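(* Let $Q$ be a Dynkin quiver, let $P$ be a projective and $I$ an injective finite-dimensional representation of $Q$ over $\mathbb{C}$, and let $\mathbf{f}\in\mathbb{Z}_{\ge 0}Q_0$ be a dimension vector. Let $\pi:P\oplus I\to P$ be the projection and set $$\mathcal{S}_{\mathbf{f}}=\{N\in \mathrm{Gr}_{\mathbf{dim}\,P}(P\oplus I):\ \mathbf{dim}(N\cap I)=\mathbf{f},\ \mathbf{dim}\,\pi(N)=\mathbf{dim}\,P-\mathbf{f}\}.$$ Then the natural surjective map $$\zeta_{\mathbf{f}}:\mathcal{S}_{\mathbf{f}}\to \mathrm{Gr}_{\mathbf{f}}(I)\times\mathrm{Gr}_{\mathbf{dim}\,P-\mathbf{f}}(P),\qquad N\mapsto (N_I,N_P):=(N\cap I,\pi(N)),$$ is a vector bundle. The fiber over the point given by $N_P$ and $N_I$ is isomorphic to $\mathrm{Hom}_Q(N_P,I/N_I)$, which has dimension $\langle \mathbf{dim}\,P-\mathbf{f},\mathbf{dim}\,I-\mathbf{f}\rangle$.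
   Context: A Dynkin quiver is a quiver whose underlying graph is a simply laced Dynkin diagram (type $A$, $D$ or $E$). $Q_0$, $Q_1$ are the sets of vertices and arrows. A representation $M$ of $Q$ consists of finite-dimensional complex vector spaces $M_i$ and linear maps $M_\alpha:M_i\to M_j$ for arrows $\alpha:i\to j$; $\mathbf{dim}\,M=(\dim M_i)_{i\in Q_0}$. The Euler form is $\langle \mathbf{d},\mathbf{e}\rangle=\sum_{i\in Q_0}d_ie_i-\sum_{(\alpha:i\to j)\in Q_1}d_ie_j$. The quiver Grassmannian $\mathrm{Gr}_{\mathbf{e}}(M)\subset\prod_i\mathrm{Gr}_{e_i}(M_i)$ parametrizes subrepresentations of $M$ of dimension vector $\mathbf{e}$ (collections $V_i\subset M_i$, $\dim V_i=e_i$, with $M_\alpha V_i\subset V_j$ for all $\alpha:i\to j$). *)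

theory Defs
  imports "HOL-Algebra.AbelCoset" "Jordan_Normal_Form.VS_Connect" "Graph_Theory.Digraph"
begin

abbreviation CC :: "complex ring" where
  "CC \<equiv> class_ring"

section \<open>Dynkin quivers\<close>

text \<open>Edge sets of the Dynkin diagrams on the vertices \<open>0, \<dots>, n - 1\<close>. Types D and E are a path
  on \<open>0, \<dots>, n - 2\<close> together with the vertex \<open>n - 1\<close> attached to the vertex \<open>n - 3\<close>,
  respectively to the vertex \<open>2\<close>.\<close>

definition path_edges :: "nat \<Rightarrow> nat set set" where
  "path_edges n = {{k, Suc k} | k. Suc k < n}"

definition dynkin_diagram :: "nat \<Rightarrow> nat set set \<Rightarrow> bool" where
  "dynkin_diagram n E \<longleftrightarrow>
     (n \<ge> 1 \<and> E = path_edges n) \<or>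
     (n \<ge> 4 \<and> E = insert {n - 3, n - 1} (path_edges (n - 1))) \<or>
     (n \<in> {6, 7, 8} \<and> E = insert {2, n - 1} (path_edges (n - 1)))"

definition dynkin_quiver :: "('i, 'a) pre_digraph \<Rightarrow> bool" where
  "dynkin_quiver Q \<longleftrightarrow> wf_digraph Q \<and>
     (\<exists>n E g. dynkin_diagram n E \<and> bij_betw g (verts Q) {..<n} \<and>
        bij_betw (\<lambda>a. {g (tail Q a), g (head Q a)}) (arcs Q) E)"

definition euler_form :: "('i, 'a) pre_digraph \<Rightarrow> ('i \<Rightarrow> int) \<Rightarrow> ('i \<Rightarrow> int) \<Rightarrow> int" where
  "euler_form Q d e = (\<Sum>i\<in>verts Q. d i * e i) - (\<Sum>a\<in>arcs Q. d (tail Q a) * e (head Q a))"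

section \<open>Representations\<close>

record ('i, 'a, 'v) rep =
  space :: "'i \<Rightarrow> (complex, 'v) module"
  act :: "'a \<Rightarrow> 'v \<Rightarrow> 'v"

definition representation :: "('i, 'a) pre_digraph \<Rightarrow> ('i, 'a, 'v) rep \<Rightarrow> bool" where
  "representation Q M \<longleftrightarrow>
     (\<forall>i\<in>verts Q. vectorspace CC (space M i) \<and> vectorspace.fin_dim CC (space M i)) \<and>
     (\<forall>a\<in>arcs Q. linear_map CC (space M (tail Q a)) (space M (head Q a)) (act M a))"

definition dimvec :: "('i, 'a, 'v) rep \<Rightarrow> 'i \<Rightarrow> int" where
  "dimvec M i = int (vectorspace.dim CC (space M i))"

definition direct_sum_rep :: "('i, 'a, 'v) rep \<Rightarrow> ('i, 'a, 'w) rep \<Rightarrow> ('i, 'a, 'v \<times> 'w) rep" where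
  "direct_sum_rep M N =
     \<lparr>space = (\<lambda>i. direct_sum (space M i) (space N i)), act = (\<lambda>a. map_prod (act M a) (act N a))\<rparr>"

text \<open>Families indexed by the vertices are kept extensional, so that equality of such families
  is equality at the vertices.\<close>

definition subreps :: "('i, 'a) pre_digraph \<Rightarrow> ('i, 'a, 'v) rep \<Rightarrow> ('i \<Rightarrow> 'v set) set" where
  "subreps Q M = {N \<in> extensional (verts Q).
     (\<forall>i\<in>verts Q. VectorSpace.subspace CC (N i) (space M i)) \<and>
     (\<forall>a\<in>arcs Q. act M a ` N (tail Q a) \<subseteq> N (head Q a))}"

definition sub_rep :: "('i, 'a, 'v) rep \<Rightarrow> ('i \<Rightarrow> 'v set) \<Rightarrow> ('i, 'a, 'v) rep" where
  "sub_rep M N = M\<lparr>space := (\<lambda>i. (space M i)\<lparr>carrier := N i\<rparr>)\<rparr>"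

text \<open>Elements of a quotient are cosets. The union over all representatives makes the operations
  manifestly independent of a choice; on a coset all its members are equal.\<close>

definition quotient_space :: "(complex, 'v) module \<Rightarrow> 'v set \<Rightarrow> (complex, 'v set) module" where
  "quotient_space V W =
     \<lparr>carrier = A_RCOSETS V W, mult = undefined, one = undefined, zero = W,
      add = set_add V, smult = (\<lambda>c X. \<Union>x\<in>X. a_r_coset V W (c \<odot>\<^bsub>V\<^esub> x))\<rparr>"

definition quotient_rep ::
  "('i, 'a) pre_digraph \<Rightarrow> ('i, 'a, 'v) rep \<Rightarrow> ('i \<Rightarrow> 'v set) \<Rightarrow> ('i, 'a, 'v set) rep" where
  "quotient_rep Q M N =
     \<lparr>space = (\<lambda>i. quotient_space (space M i) (N i)),
      act = (\<lambda>a X. \<Union>x\<in>X. a_r_coset (space M (head Q a)) (N (head Q a)) (act M a x))\<rparr>"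

definition rep_hom ::
  "('i, 'a) pre_digraph \<Rightarrow> ('i, 'a, 'v) rep \<Rightarrow> ('i, 'a, 'w) rep \<Rightarrow> ('i \<Rightarrow> 'v \<Rightarrow> 'w) set" where
  "rep_hom Q M N = {\<phi> \<in> extensional (verts Q).
     (\<forall>i\<in>verts Q. \<phi> i \<in> extensional (carrier (space M i)) \<and>
        linear_map CC (space M i) (space N i) (\<phi> i)) \<and>
     (\<forall>a\<in>arcs Q. \<forall>x\<in>carrier (space M (tail Q a)).
        \<phi> (head Q a) (act M a x) = act N a (\<phi> (tail Q a) x))}"

definition Hom_Q ::
  "('i, 'a) pre_digraph \<Rightarrow> ('i, 'a, 'v) rep \<Rightarrow> ('i, 'a, 'w) rep \<Rightarrow> (complex, 'i \<Rightarrow> 'v \<Rightarrow> 'w) module"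
  where
  "Hom_Q Q M N =
     \<lparr>carrier = rep_hom Q M N, mult = undefined, one = undefined,
      zero = (\<lambda>i\<in>verts Q. \<lambda>x\<in>carrier (space M i). \<zero>\<^bsub>space N i\<^esub>),
      add = (\<lambda>\<phi> \<psi>. \<lambda>i\<in>verts Q. \<lambda>x\<in>carrier (space M i). \<phi> i x \<oplus>\<^bsub>space N i\<^esub> \<psi> i x),
      smult = (\<lambda>c \<phi>. \<lambda>i\<in>verts Q. \<lambda>x\<in>carrier (space M i). c \<odot>\<^bsub>space N i\<^esub> \<phi> i x)\<rparr>"

definition linear_iso ::
  "(complex, 'v) module \<Rightarrow> (complex, 'w) module \<Rightarrow> ('v \<Rightarrow> 'w) \<Rightarrow> bool" where
  "linear_iso V W T \<longleftrightarrow> linear_map CC V W T \<and> bij_betw T (carrier V) (carrier W)"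

text \<open>Lifting and extension properties in the category of finite-dimensional representations.
  The test objects have spaces with elements in the type \<^typ>\<open>complex vec\<close>; since every
  finite-dimensional complex vector space is isomorphic to some \<^term>\<open>module_vec TYPE(complex) n\<close>,
  every finite-dimensional representation is isomorphic to one of these.\<close>

definition projective_rep :: "('i, 'a) pre_digraph \<Rightarrow> ('i, 'a, 'v) rep \<Rightarrow> bool" where
  "projective_rep Q P \<longleftrightarrow> representation Q P \<and>
     (\<forall>(M :: ('i, 'a, complex vec) rep) (N :: ('i, 'a, complex vec) rep).
        \<forall>g\<in>rep_hom Q M N. \<forall>h\<in>rep_hom Q P N.
          representation Q M \<and> representation Q N \<and>
          (\<forall>i\<in>verts Q. g i ` carrier (space M i) = carrier (space N i)) \<longrightarrow>
          (\<exists>k\<in>rep_hom Q P M. \<forall>i\<in>verts Q. \<forall>x\<in>carrier (space P i). g i (k i x) = h i x))"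

definition injective_rep :: "('i, 'a) pre_digraph \<Rightarrow> ('i, 'a, 'v) rep \<Rightarrow> bool" where
  "injective_rep Q I \<longleftrightarrow> representation Q I \<and>
     (\<forall>(M :: ('i, 'a, complex vec) rep) (N :: ('i, 'a, complex vec) rep).
        \<forall>g\<in>rep_hom Q M N. \<forall>h\<in>rep_hom Q M I.
          representation Q M \<and> representation Q N \<and>
          (\<forall>i\<in>verts Q. inj_on (g i) (carrier (space M i))) \<longrightarrow>
          (\<exists>k\<in>rep_hom Q N I. \<forall>i\<in>verts Q. \<forall>x\<in>carrier (space M i). k i (g i x) = h i x))"

section \<open>Spaces with functions\<close>

text \<open>Complex varieties are treated classically: a set of points with its Zariski-open sets and,
  for every open set, the regular complex-valued functions on it. Only the values on \<open>U\<close> of a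
  member of \<open>regular X U\<close> are meaningful.\<close>

record 'x fspace =
  points :: "'x set"
  opens :: "'x set set"
  regular :: "'x set \<Rightarrow> ('x \<Rightarrow> complex) set"

inductive_set alg_gen :: "('x \<Rightarrow> complex) set \<Rightarrow> ('x \<Rightarrow> complex) set"
  for G :: "('x \<Rightarrow> complex) set" where
  const: "(\<lambda>_. c) \<in> alg_gen G"
| gen: "g \<in> G \<Longrightarrow> g \<in> alg_gen G"
| add: "f \<in> alg_gen G \<Longrightarrow> g \<in> alg_gen G \<Longrightarrow> (\<lambda>x. f x + g x) \<in> alg_gen G"
| mult: "f \<in> alg_gen G \<Longrightarrow> g \<in> alg_gen G \<Longrightarrow> (\<lambda>x. f x * g x) \<in> alg_gen G"

text \<open>If \<open>A\<close> is the algebra of polynomial functions on an affine space and \<open>X\<close> a locally closed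
  subset, this is the usual structure of a quasi-affine variety on \<open>X\<close>: the open sets are unions
  of non-vanishing loci, the regular functions are locally quotients of polynomials.\<close>

definition zariski :: "'x set \<Rightarrow> ('x \<Rightarrow> complex) set \<Rightarrow> 'x fspace" where
  "zariski X A =
     \<lparr>points = X,
      opens = {U. U \<subseteq> X \<and> (\<forall>x\<in>U. \<exists>h\<in>A. h x \<noteq> 0 \<and> {y \<in> X. h y \<noteq> 0} \<subseteq> U)},
      regular = (\<lambda>U. {f. \<forall>x\<in>U. \<exists>p\<in>A. \<exists>q\<in>A. q x \<noteq> 0 \<and>
                          (\<forall>y\<in>U. q y \<noteq> 0 \<longrightarrow> f y = p y / q y)})\<rparr>"

definition affine_space :: "nat \<Rightarrow> complex vec fspace" where
  "affine_space n = zariski (carrier_vec n) (alg_gen {\<lambda>v. v $ k | k. k < n})"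

definition induced :: "'x fspace \<Rightarrow> 'x set \<Rightarrow> 'x fspace" where
  "induced X Y =
     \<lparr>points = Y,
      opens = {U \<inter> Y | U. U \<in> opens X},
      regular = (\<lambda>U. {f. \<forall>x\<in>U. \<exists>W\<in>opens X. x \<in> W \<and>
                          (\<exists>g\<in>regular X W. \<forall>y\<in>W \<inter> U. f y = g y)})\<rparr>"

definition quotient_fspace :: "'y fspace \<Rightarrow> ('y \<Rightarrow> 'x) \<Rightarrow> 'x fspace" where
  "quotient_fspace F p =
     \<lparr>points = p ` points F,
      opens = {U. U \<subseteq> p ` points F \<and> {b \<in> points F. p b \<in> U} \<in> opens F},
      regular = (\<lambda>U. {f. f \<circ> p \<in> regular F {b \<in> points F. p b \<in> U}})\<rparr>"

text \<open>On a product of open sets \<open>V \<times> W\<close>, the functions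
  \<open>(x, y) \<mapsto> f\<^sub>1 x * g\<^sub>1 y + \<dots> + f\<^sub>r x * g\<^sub>r y\<close> with all \<open>f\<^sub>k\<close>, \<open>g\<^sub>k\<close> regular play the role of the
  polynomials.  For affine \<open>V\<close> and \<open>W\<close> they form the coordinate ring of \<open>V \<times> W\<close>.\<close>

definition product_functions ::
  "'x fspace \<Rightarrow> 'y fspace \<Rightarrow> 'x set \<Rightarrow> 'y set \<Rightarrow> ('x \<times> 'y \<Rightarrow> complex) set" where
  "product_functions X Y V W =
     alg_gen ({f \<circ> fst | f. f \<in> regular X V} \<union> {g \<circ> snd | g. g \<in> regular Y W})"

definition product :: "'x fspace \<Rightarrow> 'y fspace \<Rightarrow> ('x \<times> 'y) fspace" where
  "product X Y =
     \<lparr>points = points X \<times> points Y,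
      opens = {U. U \<subseteq> points X \<times> points Y \<and>
                 (\<forall>z\<in>U. \<exists>V\<in>opens X. \<exists>W\<in>opens Y. z \<in> V \<times> W \<and>
                    U \<inter> (V \<times> W) \<in> opens (zariski (V \<times> W) (product_functions X Y V W)))},
      regular = (\<lambda>U. {f. \<forall>z\<in>U. \<exists>V\<in>opens X. \<exists>W\<in>opens Y. z \<in> V \<times> W \<and>
                    f \<in> regular (zariski (V \<times> W) (product_functions X Y V W)) (U \<inter> (V \<times> W))})\<rparr>"

definition morphism :: "'x fspace \<Rightarrow> 'y fspace \<Rightarrow> ('x \<Rightarrow> 'y) \<Rightarrow> bool" where
  "morphism X Y g \<longleftrightarrow> g ` points X \<subseteq> points Y \<and>
     (\<forall>U\<in>opens Y. {x \<in> points X. g x \<in> U} \<in> opens X \<and>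
        (\<forall>f\<in>regular Y U. f \<circ> g \<in> regular X {x \<in> points X. g x \<in> U}))"

definition isomorphism :: "'x fspace \<Rightarrow> 'y fspace \<Rightarrow> ('x \<Rightarrow> 'y) \<Rightarrow> bool" where
  "isomorphism X Y g \<longleftrightarrow> bij_betw g (points X) (points Y) \<and>
     morphism X Y g \<and> morphism Y X (inv_into (points X) g)"

text \<open>\<open>V b\<close> is the fibre of \<open>p\<close> over \<open>b\<close> with its vector space structure.  The local
  trivialisations \<open>h\<close> are over \<open>U\<close> and linear on fibres (bijectivity on fibres follows).\<close>

definition vector_bundle ::
  "'e fspace \<Rightarrow> 'b fspace \<Rightarrow> ('e \<Rightarrow> 'b) \<Rightarrow> ('b \<Rightarrow> (complex, 'e) module) \<Rightarrow> bool" where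
  "vector_bundle E B p V \<longleftrightarrow> morphism E B p \<and>
     (\<forall>b\<in>points B. vectorspace CC (V b) \<and> carrier (V b) = {x \<in> points E. p x = b}) \<and>
     (\<forall>b\<in>points B. \<exists>U\<in>opens B. b \<in> U \<and>
        (\<exists>n h. isomorphism (induced E {x \<in> points E. p x \<in> U})
                 (product (induced B U) (affine_space n)) h \<and>
           (\<forall>x\<in>points E. p x \<in> U \<longrightarrow> fst (h x) = p x) \<and>
           (\<forall>u\<in>U. linear_map CC (V u) (module_vec TYPE(complex) n) (snd \<circ> h))))"

section \<open>Quiver Grassmannians\<close>

definition lin_functional :: "(complex, 'v) module \<Rightarrow> ('v \<Rightarrow> complex) \<Rightarrow> bool" where
  "lin_functional V \<xi> \<longleftrightarrow>
     (\<forall>x\<in>carrier V. \<forall>y\<in>carrier V. \<xi> (x \<oplus>\<^bsub>V\<^esub> y) = \<xi> x + \<xi> y) \<and>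
     (\<forall>c. \<forall>x\<in>carrier V. \<xi> (c \<odot>\<^bsub>V\<^esub> x) = c * \<xi> x)"

text \<open>A frame is a family of linearly independent tuples in \<open>V i\<close> of length \<open>e i\<close>. All frames form
  an open subset of the affine space \<open>\<Prod>i\<in>J. (V i)^(e i)\<close>, whose coordinates are linear
  functionals of the individual vectors, and the product of the Grassmannians
  \<open>Gr (e i) (V i)\<close> is its quotient by \<open>\<Prod>i\<in>J. GL (e i)\<close>.\<close>

definition frames :: "'i set \<Rightarrow> ('i \<Rightarrow> (complex, 'v) module) \<Rightarrow> ('i \<Rightarrow> int) \<Rightarrow> ('i \<Rightarrow> nat \<Rightarrow> 'v) set" where
  "frames J V e = {b \<in> \<Pi>\<^sub>E i\<in>J. {..<nat (e i)} \<rightarrow>\<^sub>E carrier (V i).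
     \<forall>i\<in>J. inj_on (b i) {..<nat (e i)} \<and> \<not> LinearCombinations.module.lin_dep CC (V i) (b i ` {..<nat (e i)})}"

definition frame_functions ::
  "'i set \<Rightarrow> ('i \<Rightarrow> (complex, 'v) module) \<Rightarrow> ('i \<Rightarrow> int) \<Rightarrow> (('i \<Rightarrow> nat \<Rightarrow> 'v) \<Rightarrow> complex) set" where
  "frame_functions J V e =
     alg_gen {\<lambda>b. \<xi> (b i k) | i k \<xi>. i \<in> J \<and> k < nat (e i) \<and> lin_functional (V i) \<xi>}"

definition grassmannian_product ::
  "'i set \<Rightarrow> ('i \<Rightarrow> (complex, 'v) module) \<Rightarrow> ('i \<Rightarrow> int) \<Rightarrow> ('i \<Rightarrow> 'v set) fspace" where
  "grassmannian_product J V e =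
     quotient_fspace (zariski (frames J V e) (frame_functions J V e))
       (\<lambda>b. \<lambda>i\<in>J. LinearCombinations.module.span CC (V i) (b i ` {..<nat (e i)}))"

text \<open>Dimension vectors are integer valued: for \<open>e\<close> with a negative entry there are no points.\<close>

definition quiver_Gr_points ::
  "('i, 'a) pre_digraph \<Rightarrow> ('i \<Rightarrow> int) \<Rightarrow> ('i, 'a, 'v) rep \<Rightarrow> ('i \<Rightarrow> 'v set) set" where
  "quiver_Gr_points Q e M = {N \<in> subreps Q M. \<forall>i\<in>verts Q. dimvec (sub_rep M N) i = e i}"

definition quiver_Gr ::
  "('i, 'a) pre_digraph \<Rightarrow> ('i \<Rightarrow> int) \<Rightarrow> ('i, 'a, 'v) rep \<Rightarrow> ('i \<Rightarrow> 'v set) fspace" where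
  "quiver_Gr Q e M =
     induced (grassmannian_product (verts Q) (space M) e) (quiver_Gr_points Q e M)"

section \<open>The strata and the map to the product of quiver Grassmannians\<close>

text \<open>\<open>N \<inter> I\<close> is regarded as a family of subspaces of \<open>I\<close>, i.e. it is the preimage of \<open>N\<close> under
  the inclusion of \<open>I\<close> into \<open>P \<oplus> I\<close>. The strata are locally closed and carry the reduced
  structure induced from the quiver Grassmannian.\<close>

definition inter_I ::
  "('i, 'a) pre_digraph \<Rightarrow> ('i, 'a, 'p) rep \<Rightarrow> ('i, 'a, 'q) rep \<Rightarrow> ('i \<Rightarrow> ('p \<times> 'q) set) \<Rightarrow> 'i \<Rightarrow> 'q set"
  where
  "inter_I Q P I N =
     (\<lambda>i\<in>verts Q. {y \<in> carrier (space I i). inj2 (space P i) (space I i) y \<in> N i})"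

definition proj_P :: "('i, 'a) pre_digraph \<Rightarrow> ('i \<Rightarrow> ('p \<times> 'q) set) \<Rightarrow> 'i \<Rightarrow> 'p set" where
  "proj_P Q N = (\<lambda>i\<in>verts Q. fst ` N i)"

definition zeta ::
  "('i, 'a) pre_digraph \<Rightarrow> ('i, 'a, 'p) rep \<Rightarrow> ('i, 'a, 'q) rep \<Rightarrow>
   ('i \<Rightarrow> ('p \<times> 'q) set) \<Rightarrow> ('i \<Rightarrow> 'q set) \<times> ('i \<Rightarrow> 'p set)" where
  "zeta Q P I N = (inter_I Q P I N, proj_P Q N)"

definition stratum_points ::
  "('i, 'a) pre_digraph \<Rightarrow> ('i, 'a, 'p) rep \<Rightarrow> ('i, 'a, 'q) rep \<Rightarrow> ('i \<Rightarrow> int) \<Rightarrow>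
   ('i \<Rightarrow> ('p \<times> 'q) set) set" where
  "stratum_points Q P I f =
     {N \<in> quiver_Gr_points Q (dimvec P) (direct_sum_rep P I).
        (\<forall>i\<in>verts Q. dimvec (sub_rep I (inter_I Q P I N)) i = f i) \<and>
        (\<forall>i\<in>verts Q. dimvec (sub_rep P (proj_P Q N)) i = dimvec P i - f i)}"

definition stratum ::
  "('i, 'a) pre_digraph \<Rightarrow> ('i, 'a, 'p) rep \<Rightarrow> ('i, 'a, 'q) rep \<Rightarrow> ('i \<Rightarrow> int) \<Rightarrow>
   ('i \<Rightarrow> ('p \<times> 'q) set) fspace" where
  "stratum Q P I f =
     induced (quiver_Gr Q (dimvec P) (direct_sum_rep P I)) (stratum_points Q P I f)"

end

theory Submission
  imports Defs
begin

text \<open>Let \<open>N\<close> be a point of the stratum, and write \<open>N\<^sub>I = N \<inter> I\<close> and \<open>N\<^sub>P = \<pi>(N)\<close>.  The relation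
\<open>(x, y) \<in> N\<close> is the graph of a homomorphism \<open>N\<^sub>P \<rightarrow> I / N\<^sub>I\<close>, and every such homomorphism has a
graph of this kind.  So the fibre of \<open>\<zeta>\<close> over \<open>(N\<^sub>I, N\<^sub>P)\<close> is the vector space
\<open>Hom\<^sub>Q(N\<^sub>P, I / N\<^sub>I)\<close> (\<open>graph_bij\<close>).

This vector space is the kernel of
\<open>\<Oplus>\<^sub>i Hom(N\<^sub>P(i), (I / N\<^sub>I)(i)) \<rightarrow> \<Oplus>\<^sub>a Hom(N\<^sub>P(t a), (I / N\<^sub>I)(h a))\<close>, the map that measures how far
a family of linear maps is from commuting with the arrows.  Its cokernel is \<open>Ext(N\<^sub>P, I / N\<^sub>I)\<close>,
which vanishes: a family of maps \<open>N\<^sub>P(t a) \<rightarrow> (I / N\<^sub>I)(h a)\<close> extends to a family of maps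
\<open>P(t a) \<rightarrow> I(h a)\<close>, the latter is in the image of \<open>\<Oplus>\<^sub>i Hom(P(i), I(i))\<close> because extensions of \<open>P\<close> by
\<open>I\<close> split (\<open>projective_extension_splits\<close>), and a preimage can be restricted to \<open>N\<^sub>P\<close> and reduced
modulo \<open>N\<^sub>I\<close> (\<open>A_surj\<close>).  Hence the map is onto at every point of the base, and counting
dimensions gives the Euler form (\<open>euler_n\<close>).

A kernel of a matrix of regular functions that is onto everywhere is a vector bundle.  Near a
given base point, frames of \<open>N\<^sub>P\<close> and of a complement of \<open>N\<^sub>I\<close> turn the map into a matrix \<open>A\<close>
whose entries are regular functions on the base (\<open>A_regular\<close>).  Some maximal minor of \<open>A\<close> is
invertible at the point (\<open>invertible_minor\<close>), and so it is on a neighbourhood, with a regular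
inverse by Cramer's rule (\<open>local_inverse\<close>).  The entries of a solution outside the columns of this
minor can be prescribed freely and determine the others.  They are the coordinates on the fibres.

What remains is that these coordinates and the resulting parametrisation are morphisms for the
structure that the stratum inherits from the Grassmannian of \<open>P \<oplus> I\<close>.  A chart of a Grassmannian
consists of the subspaces with a basis dual to given functionals; this basis is unique, and its
coordinates are regular (\<open>sec_regular\<close>).  For \<open>N\<close> in the stratum the dual basis consists of a dual
basis of \<open>N\<^sub>I\<close> and of the vectors \<open>(w, \<phi>(w))\<close> with \<open>w\<close> in a dual basis of \<open>N\<^sub>P\<close> and \<open>\<phi>\<close> the lift of
the homomorphism to a fixed complement (\<open>sec_graph\<close>), so the matrix of the homomorphism can be
read off from it, and conversely.

The first sections provide the geometry of spaces with functions that this needs: subspaces,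
products and quotients of locally quasi-affine spaces, and criteria for morphisms.  The delicate
point is that the product is defined by fractions on single boxes \<open>V \<times> W\<close>, so that functions given
on different boxes have to be compared (\<open>PF_fraction\<close>).\<close>

section \<open>Spaces with functions\<close>

text \<open>On an affine space or a subset of one, a regular function on an open set is locally a quotient of
functions that are regular on the whole space.  This property, rather than an embedding, is what
the proofs about products use.\<close>
definition quasi_affine :: "'x fspace \<Rightarrow> 'x set \<Rightarrow> bool" where
  "quasi_affine X V \<longleftrightarrow> V \<in> opens X \<and>
     (\<forall>U\<in>opens X. U \<subseteq> V \<longrightarrow> (\<forall>f\<in>regular X U. \<forall>x\<in>U.
        \<exists>p\<in>regular X V. \<exists>q\<in>regular X V. q x \<noteq> 0 \<and> {y \<in> V. q y \<noteq> 0} \<subseteq> U \<and>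
          (\<forall>y\<in>V. q y \<noteq> 0 \<longrightarrow> f y = p y / q y)))"

locale space_with_functions =
  fixes X :: "'x fspace"
  assumes opens_subset: "U \<in> opens X \<Longrightarrow> U \<subseteq> points X"
    and opens_points: "points X \<in> opens X"
    and opens_Int: "U \<in> opens X \<Longrightarrow> V \<in> opens X \<Longrightarrow> U \<inter> V \<in> opens X"
    and opens_local: "(\<And>x. x \<in> U \<Longrightarrow> \<exists>V\<in>opens X. x \<in> V \<and> V \<subseteq> U) \<Longrightarrow> U \<in> opens X"
    and regular_const: "U \<in> opens X \<Longrightarrow> (\<lambda>_. c) \<in> regular X U"
    and regular_add: "U \<in> opens X \<Longrightarrow> f \<in> regular X U \<Longrightarrow> g \<in> regular X U \<Longrightarrow>
      (\<lambda>x. f x + g x) \<in> regular X U"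
    and regular_mult: "U \<in> opens X \<Longrightarrow> f \<in> regular X U \<Longrightarrow> g \<in> regular X U \<Longrightarrow>
      (\<lambda>x. f x * g x) \<in> regular X U"
    and regular_local: "U \<in> opens X \<Longrightarrow>
      (\<And>x. x \<in> U \<Longrightarrow> \<exists>V\<in>opens X. x \<in> V \<and> (\<exists>g\<in>regular X V. \<forall>y\<in>V \<inter> U. f y = g y)) \<Longrightarrow>
      f \<in> regular X U"
    and nonvanishing_open: "U \<in> opens X \<Longrightarrow> f \<in> regular X U \<Longrightarrow> {x \<in> U. f x \<noteq> 0} \<in> opens X"
    and regular_inverse: "U \<in> opens X \<Longrightarrow> f \<in> regular X U \<Longrightarrow>
      (\<lambda>x. 1 / f x) \<in> regular X {x \<in> U. f x \<noteq> 0}"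
begin

lemma regular_restrict:
  assumes "f \<in> regular X U" "U \<in> opens X" "V \<in> opens X" "V \<subseteq> U"
  shows "f \<in> regular X V"
  by (rule regular_local[OF assms(3)]) (use assms in blast)

lemma regular_cong:
  assumes "f \<in> regular X U" "U \<in> opens X" "\<And>y. y \<in> U \<Longrightarrow> g y = f y"
  shows "g \<in> regular X U"
  by (rule regular_local[OF assms(2)]) (use assms in blast)

lemma regular_uminus: "U \<in> opens X \<Longrightarrow> f \<in> regular X U \<Longrightarrow> (\<lambda>x. - f x) \<in> regular X U"
  using regular_mult[OF _ regular_const[of U "-1"], of f] by simp

lemma regular_diff:
  "U \<in> opens X \<Longrightarrow> f \<in> regular X U \<Longrightarrow> g \<in> regular X U \<Longrightarrow> (\<lambda>x. f x - g x) \<in> regular X U"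
  using regular_add[of U f "\<lambda>x. - g x"] regular_uminus by simp

lemma regular_sum:
  assumes "U \<in> opens X" "\<And>a. a \<in> A \<Longrightarrow> f a \<in> regular X U"
  shows "(\<lambda>x. \<Sum>a\<in>A. f a x) \<in> regular X U"
  using assms(2)
proof (induction A rule: infinite_finite_induct)
  case (insert a A)
  then show ?case using regular_add[OF assms(1), of "f a" "\<lambda>x. \<Sum>a\<in>A. f a x"] by simp
qed (use regular_const[OF assms(1)] in auto)

lemma regular_prod:
  assumes "U \<in> opens X" "\<And>a. a \<in> A \<Longrightarrow> f a \<in> regular X U"
  shows "(\<lambda>x. \<Prod>a\<in>A. f a x) \<in> regular X U"
  using assms(2)
proof (induction A rule: infinite_finite_induct)
  case (insert a A)
  then show ?case using regular_mult[OF assms(1), of "f a" "\<lambda>x. \<Prod>a\<in>A. f a x"] by simp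
qed (use regular_const[OF assms(1)] in auto)

lemma regular_divide:
  assumes U: "U \<in> opens X" and fg: "f \<in> regular X U" "g \<in> regular X U"
    and nz: "\<And>x. x \<in> U \<Longrightarrow> g x \<noteq> 0"
  shows "(\<lambda>x. f x / g x) \<in> regular X U"
proof -
  have "{x \<in> U. g x \<noteq> 0} = U" using nz by auto
  then have "(\<lambda>x. 1 / g x) \<in> regular X U" using regular_inverse[OF U fg(2)] by simp
  from regular_mult[OF U fg(1) this] show ?thesis by simp
qed

lemma opens_finite_INT:
  assumes "finite A" "\<And>a. a \<in> A \<Longrightarrow> W a \<in> opens X"
  shows "{x \<in> points X. \<forall>a\<in>A. x \<in> W a} \<in> opens X"
  using assms
proof (induction A)
  case (insert a A)
  have "{x \<in> points X. \<forall>b\<in>insert a A. x \<in> W b} = W a \<inter> {x \<in> points X. \<forall>b\<in>A. x \<in> W b}"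
    using opens_subset[of "W a"] insert.prems by auto
  then show ?case using opens_Int insert by simp
qed (use opens_points in simp)

lemma regular_alg_gen:
  assumes "h \<in> alg_gen G" "U \<in> opens X" "\<And>g. g \<in> G \<Longrightarrow> g \<circ> s \<in> regular X U"
  shows "h \<circ> s \<in> regular X U"
  using assms(1)
proof induction
  case (const c) then show ?case using regular_const[OF assms(2), of c] by (simp add: comp_def)
next
  case (add f g) then show ?case using regular_add[OF assms(2), of "f \<circ> s" "g \<circ> s"]
    by (simp add: comp_def)
next
  case (mult f g) then show ?case using regular_mult[OF assms(2), of "f \<circ> s" "g \<circ> s"]
    by (simp add: comp_def)
next
  case (gen g) then show ?case by (rule assms(3))
qed

end

text \<open>Every space with functions of the theorem is covered by quasi-affine open sets; for the
Grassmannians these are the usual charts.\<close>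
locale variety = space_with_functions +
  assumes quasi_affine_cover: "x \<in> points X \<Longrightarrow> \<exists>V. quasi_affine X V \<and> x \<in> V"

lemma quasi_affineD:
  assumes "quasi_affine X V" "U \<in> opens X" "U \<subseteq> V" "f \<in> regular X U" "x \<in> U"
  obtains p q where "p \<in> regular X V" "q \<in> regular X V" "q x \<noteq> 0" "{y \<in> V. q y \<noteq> 0} \<subseteq> U"
    "\<And>y. y \<in> V \<Longrightarrow> q y \<noteq> 0 \<Longrightarrow> f y = p y / q y"
proof -
  have "\<exists>p\<in>regular X V. \<exists>q\<in>regular X V. q x \<noteq> 0 \<and> {y \<in> V. q y \<noteq> 0} \<subseteq> U \<and>
          (\<forall>y\<in>V. q y \<noteq> 0 \<longrightarrow> f y = p y / q y)"
    using assms unfolding quasi_affine_def by simp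
  then show thesis using that by blast
qed

section \<open>Zariski spaces\<close>

lemma points_zariski[simp]: "points (zariski S A) = S" by (simp add: zariski_def)

lemma opens_zariski_iff:
  "U \<in> opens (zariski S A) \<longleftrightarrow> U \<subseteq> S \<and> (\<forall>x\<in>U. \<exists>h\<in>A. h x \<noteq> 0 \<and> {y \<in> S. h y \<noteq> 0} \<subseteq> U)"
  by (simp add: zariski_def)

lemma regular_zariski_iff:
  "f \<in> regular (zariski S A) U \<longleftrightarrow> (\<forall>x\<in>U. \<exists>p\<in>A. \<exists>q\<in>A. q x \<noteq> 0 \<and>
      (\<forall>y\<in>U. q y \<noteq> 0 \<longrightarrow> f y = p y / q y))"
  by (simp add: zariski_def)

lemma alg_gen_regular_zariski:
  "h \<in> alg_gen G \<Longrightarrow> h \<in> regular (zariski S (alg_gen G)) U"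
  unfolding regular_zariski_iff
  by (intro ballI bexI[of _ h] bexI[of _ "\<lambda>_. 1"]) (auto intro: alg_gen.const)

lemma zariski_openE:
  assumes "U \<in> opens (zariski S A)" "x \<in> U"
  obtains h where "h \<in> A" "h x \<noteq> 0" "\<And>y. y \<in> S \<Longrightarrow> h y \<noteq> 0 \<Longrightarrow> y \<in> U"
  using assms unfolding opens_zariski_iff by blast

lemma zariski_regularE:
  assumes "f \<in> regular (zariski S A) U" "x \<in> U"
  obtains p q where "p \<in> A" "q \<in> A" "q x \<noteq> 0" "\<And>y. y \<in> U \<Longrightarrow> q y \<noteq> 0 \<Longrightarrow> f y = p y / q y"
  using assms unfolding regular_zariski_iff by blast

lemma zariski_openI:
  assumes "U \<subseteq> S" "\<And>x. x \<in> U \<Longrightarrow> \<exists>h\<in>A. h x \<noteq> 0 \<and> (\<forall>y\<in>S. h y \<noteq> 0 \<longrightarrow> y \<in> U)"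
  shows "U \<in> opens (zariski S A)"
  using assms unfolding opens_zariski_iff by blast

lemma zariski_regularI:
  assumes "\<And>x. x \<in> U \<Longrightarrow> \<exists>p\<in>A. \<exists>q\<in>A. q x \<noteq> 0 \<and> (\<forall>y\<in>U. q y \<noteq> 0 \<longrightarrow> f y = p y / q y)"
  shows "f \<in> regular (zariski S A) U"
  using assms unfolding regular_zariski_iff by blast

text \<open>Near \<open>x \<in> U\<close> a regular function is a quotient \<open>p / q\<close>, valid on \<open>U\<close> only.  If \<open>h\<close> vanishes outside
\<open>U\<close> but not at \<open>x\<close>, then \<open>(p h) / (q h)\<close> is a quotient that is valid wherever \<open>q h\<close> is non-zero in
the whole space.  This trick proves locality and quasi-affinity.\<close>
lemma variety_zariski: "variety (zariski S (alg_gen G))" (is "variety ?X")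
proof unfold_locales
  let ?A = "alg_gen G"
  note m = alg_gen.mult
  show open_pts: "points ?X \<in> opens ?X"
    by (rule zariski_openI) (auto intro!: bexI[of _ "\<lambda>_. 1"] alg_gen.const)
  show "U \<subseteq> points ?X" if "U \<in> opens ?X" for U
    using that by (simp add: opens_zariski_iff)
  show "U \<inter> V \<in> opens ?X" if U: "U \<in> opens ?X" and V: "V \<in> opens ?X" for U V
  proof (rule zariski_openI)
    show "U \<inter> V \<subseteq> S" using U by (auto simp: opens_zariski_iff)
    fix x assume x: "x \<in> U \<inter> V"
    obtain h where h: "h \<in> ?A" "h x \<noteq> 0" "\<And>y. y \<in> S \<Longrightarrow> h y \<noteq> 0 \<Longrightarrow> y \<in> U"
      using zariski_openE[OF U] x by blast
    obtain k where k: "k \<in> ?A" "k x \<noteq> 0" "\<And>y. y \<in> S \<Longrightarrow> k y \<noteq> 0 \<Longrightarrow> y \<in> V"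
      using zariski_openE[OF V] x by blast
    show "\<exists>h\<in>?A. h x \<noteq> 0 \<and> (\<forall>y\<in>S. h y \<noteq> 0 \<longrightarrow> y \<in> U \<inter> V)"
      by (rule bexI[OF _ m[OF h(1) k(1)]]) (use h k in auto)
  qed
  show "U \<in> opens ?X" if loc: "\<And>x. x \<in> U \<Longrightarrow> \<exists>V\<in>opens ?X. x \<in> V \<and> V \<subseteq> U" for U
  proof (rule zariski_openI)
    show "U \<subseteq> S" using loc by (fastforce simp: opens_zariski_iff)
    fix x assume "x \<in> U"
    then obtain V where V: "V \<in> opens ?X" "x \<in> V" "V \<subseteq> U" using loc by blast
    then obtain h where "h \<in> ?A" "h x \<noteq> 0" "\<And>y. y \<in> S \<Longrightarrow> h y \<noteq> 0 \<Longrightarrow> y \<in> V"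
      using zariski_openE by metis
    then show "\<exists>h\<in>?A. h x \<noteq> 0 \<and> (\<forall>y\<in>S. h y \<noteq> 0 \<longrightarrow> y \<in> U)" using V by blast
  qed
  show "(\<lambda>_. c) \<in> regular ?X U" for U c
    by (rule alg_gen_regular_zariski) (rule alg_gen.const)
  show "(\<lambda>x. f x + g x) \<in> regular ?X U" if f: "f \<in> regular ?X U" and g: "g \<in> regular ?X U" for f g U
  proof (rule zariski_regularI)
    fix x assume x: "x \<in> U"
    obtain p q where p: "p \<in> ?A" "q \<in> ?A" "q x \<noteq> 0" "\<And>y. y \<in> U \<Longrightarrow> q y \<noteq> 0 \<Longrightarrow> f y = p y / q y"
      using zariski_regularE[OF f x] by metis
    obtain p' q' where p': "p' \<in> ?A" "q' \<in> ?A" "q' x \<noteq> 0"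
      "\<And>y. y \<in> U \<Longrightarrow> q' y \<noteq> 0 \<Longrightarrow> g y = p' y / q' y"
      using zariski_regularE[OF g x] by metis
    show "\<exists>p\<in>?A. \<exists>q\<in>?A. q x \<noteq> 0 \<and> (\<forall>y\<in>U. q y \<noteq> 0 \<longrightarrow> f y + g y = p y / q y)"
      by (rule bexI[OF _ alg_gen.add[OF m[OF p(1) p'(2)] m[OF p'(1) p(2)]]],
          rule bexI[OF _ m[OF p(2) p'(2)]]) (use p p' in \<open>auto simp: add_frac_eq\<close>)
  qed
  show "(\<lambda>x. f x * g x) \<in> regular ?X U" if f: "f \<in> regular ?X U" and g: "g \<in> regular ?X U" for f g U
  proof (rule zariski_regularI)
    fix x assume x: "x \<in> U"
    obtain p q where p: "p \<in> ?A" "q \<in> ?A" "q x \<noteq> 0" "\<And>y. y \<in> U \<Longrightarrow> q y \<noteq> 0 \<Longrightarrow> f y = p y / q y"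
      using zariski_regularE[OF f x] by metis
    obtain p' q' where p': "p' \<in> ?A" "q' \<in> ?A" "q' x \<noteq> 0"
      "\<And>y. y \<in> U \<Longrightarrow> q' y \<noteq> 0 \<Longrightarrow> g y = p' y / q' y"
      using zariski_regularE[OF g x] by metis
    show "\<exists>p\<in>?A. \<exists>q\<in>?A. q x \<noteq> 0 \<and> (\<forall>y\<in>U. q y \<noteq> 0 \<longrightarrow> f y * g y = p y / q y)"
      by (rule bexI[OF _ m[OF p(1) p'(1)]], rule bexI[OF _ m[OF p(2) p'(2)]])
        (use p p' in \<open>auto simp: add_frac_eq\<close>)
  qed
  show loc: "f \<in> regular ?X U"
    if loc: "\<And>x. x \<in> U \<Longrightarrow> \<exists>V\<in>opens ?X. x \<in> V \<and> (\<exists>g\<in>regular ?X V. \<forall>y\<in>V \<inter> U. f y = g y)"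
      and U: "U \<in> opens ?X" for f U
  proof (rule zariski_regularI)
    fix x assume x: "x \<in> U"
    then obtain V g where V: "V \<in> opens ?X" "x \<in> V" "g \<in> regular ?X V" "\<And>y. y \<in> V \<inter> U \<Longrightarrow> f y = g y"
      using loc by blast
    obtain p q where p: "p \<in> ?A" "q \<in> ?A" "q x \<noteq> 0" "\<And>y. y \<in> V \<Longrightarrow> q y \<noteq> 0 \<Longrightarrow> g y = p y / q y"
      using zariski_regularE[OF V(3,2)] by metis
    obtain h where h: "h \<in> ?A" "h x \<noteq> 0" "\<And>y. y \<in> S \<Longrightarrow> h y \<noteq> 0 \<Longrightarrow> y \<in> V"
      using zariski_openE[OF V(1,2)] by metis
    have US: "U \<subseteq> S" using U by (simp add: opens_zariski_iff)
    show "\<exists>p\<in>?A. \<exists>q\<in>?A. q x \<noteq> 0 \<and> (\<forall>y\<in>U. q y \<noteq> 0 \<longrightarrow> f y = p y / q y)"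
      by (rule bexI[OF _ m[OF p(1) h(1)]], rule bexI[OF _ m[OF p(2) h(1)]])
        (use p h V US in auto)
  qed
  show nv: "{x \<in> U. f x \<noteq> 0} \<in> opens ?X" if U: "U \<in> opens ?X" and f: "f \<in> regular ?X U" for f U
  proof (rule zariski_openI)
    show "{x \<in> U. f x \<noteq> 0} \<subseteq> S" using U by (auto simp: opens_zariski_iff)
    fix x assume x: "x \<in> {x \<in> U. f x \<noteq> 0}"
    obtain p q where p: "p \<in> ?A" "q \<in> ?A" "q x \<noteq> 0" "\<And>y. y \<in> U \<Longrightarrow> q y \<noteq> 0 \<Longrightarrow> f y = p y / q y"
      using zariski_regularE[OF f] x by blast
    obtain h where h: "h \<in> ?A" "h x \<noteq> 0" "\<And>y. y \<in> S \<Longrightarrow> h y \<noteq> 0 \<Longrightarrow> y \<in> U"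
      using zariski_openE[OF U] x by blast
    show "\<exists>h\<in>?A. h x \<noteq> 0 \<and> (\<forall>y\<in>S. h y \<noteq> 0 \<longrightarrow> y \<in> {x \<in> U. f x \<noteq> 0})"
      by (rule bexI[OF _ m[OF m[OF p(1,2)] h(1)]]) (use p h x in auto)
  qed
  show "(\<lambda>x. 1 / f x) \<in> regular ?X {x \<in> U. f x \<noteq> 0}"
    if U: "U \<in> opens ?X" and f: "f \<in> regular ?X U" for f U
  proof (rule zariski_regularI)
    fix x assume x: "x \<in> {x \<in> U. f x \<noteq> 0}"
    obtain p q where p: "p \<in> ?A" "q \<in> ?A" "q x \<noteq> 0" "\<And>y. y \<in> U \<Longrightarrow> q y \<noteq> 0 \<Longrightarrow> f y = p y / q y"
      using zariski_regularE[OF f] x by blast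
    show "\<exists>p\<in>?A. \<exists>q\<in>?A. q x \<noteq> 0 \<and> (\<forall>y\<in>{x \<in> U. f x \<noteq> 0}. q y \<noteq> 0 \<longrightarrow> 1 / f y = p y / q y)"
      by (rule bexI[OF _ m[OF p(2,2)]], rule bexI[OF _ m[OF p(1,2)]]) (use p x in auto)
  qed
  have qa: "quasi_affine ?X S" unfolding quasi_affine_def
  proof (intro conjI ballI impI)
    show "S \<in> opens ?X" using open_pts by simp
    fix U f x assume U: "U \<in> opens ?X" and f: "f \<in> regular ?X U" and x: "x \<in> U"
    obtain p q where p: "p \<in> ?A" "q \<in> ?A" "q x \<noteq> 0" "\<And>y. y \<in> U \<Longrightarrow> q y \<noteq> 0 \<Longrightarrow> f y = p y / q y"
      using zariski_regularE[OF f x] by metis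
    obtain h where h: "h \<in> ?A" "h x \<noteq> 0" "\<And>y. y \<in> S \<Longrightarrow> h y \<noteq> 0 \<Longrightarrow> y \<in> U"
      using zariski_openE[OF U x] by metis
    note r = alg_gen_regular_zariski
    show "\<exists>p\<in>regular ?X S. \<exists>q\<in>regular ?X S. q x \<noteq> 0 \<and> {y \<in> S. q y \<noteq> 0} \<subseteq> U \<and>
          (\<forall>y\<in>S. q y \<noteq> 0 \<longrightarrow> f y = p y / q y)"
      by (rule bexI[OF _ r[OF m[OF p(1) h(1)]]], rule bexI[OF _ r[OF m[OF p(2) h(1)]]])
        (use p h in auto)
  qed
  show "\<exists>V. quasi_affine ?X V \<and> x \<in> V" if "x \<in> points ?X" for x
    using qa that by auto
qed

section \<open>Induced structures\<close>

lemma points_induced[simp]: "points (induced X S) = S" by (simp add: induced_def)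

lemma opens_induced_iff: "U \<in> opens (induced X S) \<longleftrightarrow> (\<exists>W\<in>opens X. U = W \<inter> S)"
  by (auto simp: induced_def)

lemma regular_induced_iff:
  "f \<in> regular (induced X S) U \<longleftrightarrow>
     (\<forall>x\<in>U. \<exists>W\<in>opens X. x \<in> W \<and> (\<exists>g\<in>regular X W. \<forall>y\<in>W \<inter> U. f y = g y))"
  by (simp add: induced_def)

lemma (in space_with_functions) opens_Union:
  assumes "\<And>U. U \<in> K \<Longrightarrow> U \<in> opens X"
  shows "\<Union>K \<in> opens X"
  by (rule opens_local) (use assms in blast)

lemma (in space_with_functions) space_with_functions_induced:
  assumes "S \<subseteq> points X"
  shows "space_with_functions (induced X S)" (is "space_with_functions ?Y")
proof
  show "points ?Y \<in> opens ?Y" unfolding opens_induced_iff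
    using assms opens_points by (auto simp: Int_absorb1 intro!: bexI[of _ "points X"])
  show "U \<subseteq> points ?Y" if "U \<in> opens ?Y" for U
    using that by (auto simp: opens_induced_iff)
  show "U \<inter> V \<in> opens ?Y" if U: "U \<in> opens ?Y" and V: "V \<in> opens ?Y" for U V
  proof -
    obtain U' V' where "U' \<in> opens X" "U = U' \<inter> S" "V' \<in> opens X" "V = V' \<inter> S"
      using U V unfolding opens_induced_iff by blast
    then show ?thesis unfolding opens_induced_iff by (intro bexI[of _ "U' \<inter> V'"] opens_Int) auto
  qed
  show loc: "U \<in> opens ?Y" if loc: "\<And>x. x \<in> U \<Longrightarrow> \<exists>V\<in>opens ?Y. x \<in> V \<and> V \<subseteq> U" for U
  proof -
    let ?W = "\<Union>{V\<in>opens X. V \<inter> S \<subseteq> U}"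
    have "U = ?W \<inter> S"
    proof
      show "U \<subseteq> ?W \<inter> S"
      proof
        fix x assume "x \<in> U"
        then obtain V where "V \<in> opens ?Y" "x \<in> V" "V \<subseteq> U" using loc by blast
        then show "x \<in> ?W \<inter> S" unfolding opens_induced_iff by blast
      qed
    qed blast
    moreover have "?W \<in> opens X" by (rule opens_Union) blast
    ultimately show ?thesis unfolding opens_induced_iff by blast
  qed
  have regE: "\<exists>W\<in>opens X. x \<in> W \<and> (\<exists>g\<in>regular X W. \<forall>y\<in>W \<inter> U. f y = g y)"
    if "f \<in> regular ?Y U" "x \<in> U" for f x U using that unfolding regular_induced_iff by blast
  show "(\<lambda>_. c) \<in> regular ?Y U" if U: "U \<in> opens ?Y" for U c
    unfolding regular_induced_iff
  proof
    fix x assume "x \<in> U"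
    then have "x \<in> points X" using U assms unfolding opens_induced_iff by blast
    then show "\<exists>W\<in>opens X. x \<in> W \<and> (\<exists>g\<in>regular X W. \<forall>y\<in>W \<inter> U. c = g y)"
      by (intro bexI[OF _ opens_points] conjI bexI[OF _ regular_const[OF opens_points, of c]]) auto
  qed
  have two: "\<exists>W\<in>opens X. x \<in> W \<and> (\<exists>k\<in>regular X W. \<exists>l\<in>regular X W. \<forall>y\<in>W \<inter> U. f y = k y \<and> g y = l y)"
    if f: "f \<in> regular ?Y U" and g: "g \<in> regular ?Y U" and x: "x \<in> U" for f g U x
  proof -
    obtain W k where W: "W \<in> opens X" "x \<in> W" "k \<in> regular X W" "\<forall>y\<in>W \<inter> U. f y = k y"
      using regE[OF f x] by blast
    obtain W' l where W': "W' \<in> opens X" "x \<in> W'" "l \<in> regular X W'" "\<forall>y\<in>W' \<inter> U. g y = l y"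
      using regE[OF g x] by blast
    have o: "W \<inter> W' \<in> opens X" using W W' opens_Int by blast
    have "k \<in> regular X (W \<inter> W')" "l \<in> regular X (W \<inter> W')"
      using regular_restrict W W' o by blast+
    then show ?thesis using W W' o by blast
  qed
  show "(\<lambda>x. f x + g x) \<in> regular ?Y U" if f: "f \<in> regular ?Y U" and g: "g \<in> regular ?Y U" for f g U
    unfolding regular_induced_iff
  proof
    fix x assume "x \<in> U"
    then obtain W k l where "W\<in>opens X" "x \<in> W" "k\<in>regular X W" "l\<in>regular X W"
      "\<forall>y\<in>W \<inter> U. f y = k y \<and> g y = l y" using two[OF f g] by blast
    then show "\<exists>W\<in>opens X. x \<in> W \<and> (\<exists>h\<in>regular X W. \<forall>y\<in>W \<inter> U. f y + g y = h y)"
      by (intro bexI[of _ W] conjI bexI[OF _ regular_add[of W k l]]) auto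
  qed
  show "(\<lambda>x. f x * g x) \<in> regular ?Y U" if f: "f \<in> regular ?Y U" and g: "g \<in> regular ?Y U" for f g U
    unfolding regular_induced_iff
  proof
    fix x assume "x \<in> U"
    then obtain W k l where "W\<in>opens X" "x \<in> W" "k\<in>regular X W" "l\<in>regular X W"
      "\<forall>y\<in>W \<inter> U. f y = k y \<and> g y = l y" using two[OF f g] by blast
    then show "\<exists>W\<in>opens X. x \<in> W \<and> (\<exists>h\<in>regular X W. \<forall>y\<in>W \<inter> U. f y * g y = h y)"
      by (intro bexI[of _ W] conjI bexI[OF _ regular_mult[of W k l]]) auto
  qed
  show "f \<in> regular ?Y U"
    if loc: "\<And>x. x \<in> U \<Longrightarrow> \<exists>V\<in>opens ?Y. x \<in> V \<and> (\<exists>g\<in>regular ?Y V. \<forall>y\<in>V \<inter> U. f y = g y)"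
      and U: "U \<in> opens ?Y" for f U
    unfolding regular_induced_iff
  proof
    fix x assume x: "x \<in> U"
    then obtain V g where V: "V \<in> opens ?Y" "x \<in> V" "g \<in> regular ?Y V" "\<And>y. y \<in> V \<inter> U \<Longrightarrow> f y = g y"
      using loc by blast
    obtain V' where V': "V' \<in> opens X" "V = V' \<inter> S" using V(1) opens_induced_iff by metis
    obtain W k where W: "W \<in> opens X" "x \<in> W" "k \<in> regular X W" "\<forall>y\<in>W \<inter> V. g y = k y"
      using regE[OF V(3,2)] by blast
    have US: "U \<subseteq> S" using U unfolding opens_induced_iff by blast
    have o: "W \<inter> V' \<in> opens X" using W V' opens_Int by blast
    have "k \<in> regular X (W \<inter> V')" using regular_restrict W o by blast
    moreover have "\<forall>y\<in>W \<inter> V' \<inter> U. f y = k y" using W V V' US by auto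
    moreover have "x \<in> W \<inter> V'" using W V V' by blast
    ultimately show "\<exists>W\<in>opens X. x \<in> W \<and> (\<exists>g\<in>regular X W. \<forall>y\<in>W \<inter> U. f y = g y)"
      using o by blast
  qed
  show "{x \<in> U. f x \<noteq> 0} \<in> opens ?Y" if U: "U \<in> opens ?Y" and f: "f \<in> regular ?Y U" for f U
  proof (rule loc)
    fix x assume x: "x \<in> {x \<in> U. f x \<noteq> 0}"
    obtain W k where W: "W \<in> opens X" "x \<in> W" "k \<in> regular X W" "\<forall>y\<in>W \<inter> U. f y = k y"
      using regE[OF f] x by blast
    obtain U' where U': "U' \<in> opens X" "U = U' \<inter> S" using U opens_induced_iff by metis
    have "{y \<in> W. k y \<noteq> 0} \<inter> U' \<in> opens X" using nonvanishing_open opens_Int W U' by blast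
    then have "{y \<in> W. k y \<noteq> 0} \<inter> U' \<inter> S \<in> opens ?Y" unfolding opens_induced_iff by blast
    moreover have "x \<in> {y \<in> W. k y \<noteq> 0} \<inter> U' \<inter> S" using x W U' by auto
    moreover have "{y \<in> W. k y \<noteq> 0} \<inter> U' \<inter> S \<subseteq> {x \<in> U. f x \<noteq> 0}" using W U' by auto
    ultimately show "\<exists>V\<in>opens ?Y. x \<in> V \<and> V \<subseteq> {x \<in> U. f x \<noteq> 0}"
      by (intro bexI[of _ "{y \<in> W. k y \<noteq> 0} \<inter> U' \<inter> S"] conjI)
  qed
  show "(\<lambda>x. 1 / f x) \<in> regular ?Y {x \<in> U. f x \<noteq> 0}"
    if U: "U \<in> opens ?Y" and f: "f \<in> regular ?Y U" for f U
    unfolding regular_induced_iff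
  proof
    fix x assume x: "x \<in> {x \<in> U. f x \<noteq> 0}"
    obtain W k where W: "W \<in> opens X" "x \<in> W" "k \<in> regular X W" "\<forall>y\<in>W \<inter> U. f y = k y"
      using regE[OF f] x by blast
    show "\<exists>W\<in>opens X. x \<in> W \<and> (\<exists>g\<in>regular X W. \<forall>y\<in>W \<inter> {x \<in> U. f x \<noteq> 0}. 1 / f y = g y)"
      by (rule bexI[OF _ nonvanishing_open[OF W(1,3)]], rule conjI,
          use x W in force, rule bexI[OF _ regular_inverse[OF W(1,3)]]) (use W in auto)
  qed
qed

lemma (in space_with_functions) regular_induced:
  assumes "W \<in> opens X" "f \<in> regular X W"
  shows "f \<in> regular (induced X S) (W \<inter> S)"
  unfolding regular_induced_iff using assms by blast

text \<open>A regular function on a subspace extends, near each point, to the ambient space, where it is a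
quotient of functions on the quasi-affine open set.\<close>
lemma (in variety) variety_induced:
  assumes S: "S \<subseteq> points X"
  shows "variety (induced X S)"
proof -
  let ?Y = "induced X S"
  interpret Y: space_with_functions ?Y by (rule space_with_functions_induced[OF S])
  show ?thesis
  proof
    fix x assume "x \<in> points ?Y"
    then have "x \<in> S" by simp
    then obtain V where V: "quasi_affine X V" "x \<in> V" using quasi_affine_cover S by blast
    have Vo: "V \<in> opens X" using V unfolding quasi_affine_def by blast
    have "quasi_affine ?Y (V \<inter> S)" unfolding quasi_affine_def
    proof (intro conjI ballI impI)
      show "V \<inter> S \<in> opens ?Y" using Vo opens_induced_iff by blast
      fix U f x assume U: "U \<in> opens ?Y" "U \<subseteq> V \<inter> S" and f: "f \<in> regular ?Y U" and x: "x \<in> U"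
      obtain W g where W: "W \<in> opens X" "x \<in> W" "g \<in> regular X W" "\<forall>y\<in>W \<inter> U. f y = g y"
        using f x unfolding regular_induced_iff by blast
      obtain U' where U': "U' \<in> opens X" "U = U' \<inter> S" using U opens_induced_iff by metis
      let ?W = "W \<inter> U' \<inter> V"
      have o: "?W \<in> opens X" using W U' Vo opens_Int by blast
      have g: "g \<in> regular X ?W" using regular_restrict[OF W(3,1) o] by blast
      have xW: "x \<in> ?W" using W U U' x by blast
      obtain p q where p: "p \<in> regular X V" "q \<in> regular X V" "q x \<noteq> 0" "{y \<in> V. q y \<noteq> 0} \<subseteq> ?W"
        "\<And>y. y \<in> V \<Longrightarrow> q y \<noteq> 0 \<Longrightarrow> g y = p y / q y"
        by (rule quasi_affineD[OF V(1) o _ g xW]) auto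
      have s: "{y \<in> V \<inter> S. q y \<noteq> 0} \<subseteq> U" using p(4) U' by auto
      moreover have "\<forall>y\<in>V \<inter> S. q y \<noteq> 0 \<longrightarrow> f y = p y / q y" using s p W by fastforce
      ultimately show "\<exists>p\<in>regular ?Y (V \<inter> S). \<exists>q\<in>regular ?Y (V \<inter> S). q x \<noteq> 0 \<and>
          {y \<in> V \<inter> S. q y \<noteq> 0} \<subseteq> U \<and> (\<forall>y\<in>V \<inter> S. q y \<noteq> 0 \<longrightarrow> f y = p y / q y)"
        using regular_induced[OF Vo p(1)] regular_induced[OF Vo p(2)] p(3) by blast
    qed
    then show "\<exists>V. quasi_affine ?Y V \<and> x \<in> V" using V \<open>x \<in> S\<close> by blast
  qed
qed

section \<open>Products\<close>

lemma points_product[simp]: "points (product X Y) = points X \<times> points Y" by (simp add: product_def)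

lemma product_functions_regular:
  assumes "space_with_functions Z" "U \<in> opens Z" "h \<in> product_functions X Y V W"
    and "\<And>f. f \<in> regular X V \<Longrightarrow> (\<lambda>z. f (a z)) \<in> regular Z U"
    and "\<And>g. g \<in> regular Y W \<Longrightarrow> (\<lambda>z. g (b z)) \<in> regular Z U"
  shows "(\<lambda>z. h (a z, b z)) \<in> regular Z U"
proof -
  interpret Z: space_with_functions Z by fact
  have "h \<circ> (\<lambda>z. (a z, b z)) \<in> regular Z U"
    by (rule Z.regular_alg_gen[OF assms(3)[unfolded product_functions_def] assms(2)])
      (use assms(4,5) in \<open>auto simp: comp_def\<close>)
  then show ?thesis by (simp add: comp_def)
qed

locale two_varieties = X: variety X + Y: variety Y for X :: "'x fspace" and Y :: "'y fspace"
begin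

abbreviation "PF \<equiv> product_functions X Y"

lemma PF_const: "(\<lambda>_. c) \<in> PF V W" unfolding product_functions_def by (rule alg_gen.const)
lemma PF_add: "f \<in> PF V W \<Longrightarrow> g \<in> PF V W \<Longrightarrow> (\<lambda>x. f x + g x) \<in> PF V W"
  unfolding product_functions_def by (rule alg_gen.add)
lemma PF_mult: "f \<in> PF V W \<Longrightarrow> g \<in> PF V W \<Longrightarrow> (\<lambda>x. f x * g x) \<in> PF V W"
  unfolding product_functions_def by (rule alg_gen.mult)
lemma PF_fst: "f \<in> regular X V \<Longrightarrow> f \<circ> fst \<in> PF V W"
  unfolding product_functions_def by (rule alg_gen.gen) blast
lemma PF_snd: "f \<in> regular Y W \<Longrightarrow> f \<circ> snd \<in> PF V W"
  unfolding product_functions_def by (rule alg_gen.gen) blast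

lemma PF_restrict:
  assumes "h \<in> PF V W" "V \<in> opens X" "W \<in> opens Y" "V' \<in> opens X" "W' \<in> opens Y" "V' \<subseteq> V" "W' \<subseteq> W"
  shows "h \<in> PF V' W'"
  using assms(1) unfolding product_functions_def
proof induction
  case (gen g)
  then show ?case
    using X.regular_restrict[OF _ assms(2,4,6)] Y.regular_restrict[OF _ assms(3,5,7)]
    by (intro alg_gen.gen) blast
next
  case (const c) show ?case by (rule alg_gen.const)
next
  case (add f g) show ?case by (rule alg_gen.add[OF add.IH])
next
  case (mult f g) show ?case by (rule alg_gen.mult[OF mult.IH])
qed

text \<open>A function generated on a small box \<open>V2 \<times> W2\<close> is, near \<open>z\<close>, a quotient of functions generated on
any given quasi-affine box.  For the generators this is quasi-affinity of the factors, and
quotients are closed under sums and products.  The extra factors \<open>qV\<close> and \<open>qW\<close> in the denominator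
confine its non-vanishing locus to the small box.\<close>
lemma PF_fraction:
  assumes V: "quasi_affine X V" and W: "quasi_affine Y W"
    and V2: "V2 \<in> opens X" and W2: "W2 \<in> opens Y"
    and z: "z \<in> V \<times> W" "z \<in> V2 \<times> W2" and h: "h \<in> PF V2 W2"
  shows "\<exists>p\<in>PF V W. \<exists>q\<in>PF V W. q z \<noteq> 0 \<and>
    (\<forall>y\<in>V \<times> W. q y \<noteq> 0 \<longrightarrow> y \<in> V2 \<times> W2 \<and> h y = p y / q y)"
proof -
  have oV1: "V \<in> opens X" and oW1: "W \<in> opens Y" using V W unfolding quasi_affine_def by auto
  have oV: "V \<in> opens X" "V \<inter> V2 \<in> opens X" and oW: "W \<in> opens Y" "W \<inter> W2 \<in> opens Y"
    using oV1 oW1 X.opens_Int[OF _ V2] Y.opens_Int[OF _ W2] by auto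
  have fV: "\<exists>p\<in>PF V W. \<exists>q\<in>PF V W. q z \<noteq> 0 \<and>
      (\<forall>y\<in>V \<times> W. q y \<noteq> 0 \<longrightarrow> y \<in> V2 \<times> UNIV \<and> f (fst y) = p y / q y)"
    if f: "f \<in> regular X V2" for f
  proof -
    have f': "f \<in> regular X (V \<inter> V2)" using X.regular_restrict[OF f V2 oV(2)] by simp
    have zz: "fst z \<in> V \<inter> V2" using z by auto
    obtain p q where p: "p \<in> regular X V" "q \<in> regular X V" "q (fst z) \<noteq> 0"
      "{y \<in> V. q y \<noteq> 0} \<subseteq> V \<inter> V2" "\<And>y. y \<in> V \<Longrightarrow> q y \<noteq> 0 \<Longrightarrow> f y = p y / q y"
      by (rule quasi_affineD[OF V oV(2) _ f' zz]) auto
    show ?thesis by (rule bexI[OF _ PF_fst[OF p(1)]], rule bexI[OF _ PF_fst[OF p(2)]]) (use p in auto)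
  qed
  have fW: "\<exists>p\<in>PF V W. \<exists>q\<in>PF V W. q z \<noteq> 0 \<and>
      (\<forall>y\<in>V \<times> W. q y \<noteq> 0 \<longrightarrow> y \<in> UNIV \<times> W2 \<and> f (snd y) = p y / q y)"
    if f: "f \<in> regular Y W2" for f
  proof -
    have f': "f \<in> regular Y (W \<inter> W2)" using Y.regular_restrict[OF f W2 oW(2)] by simp
    have zz: "snd z \<in> W \<inter> W2" using z by auto
    obtain p q where p: "p \<in> regular Y W" "q \<in> regular Y W" "q (snd z) \<noteq> 0"
      "{y \<in> W. q y \<noteq> 0} \<subseteq> W \<inter> W2" "\<And>y. y \<in> W \<Longrightarrow> q y \<noteq> 0 \<Longrightarrow> f y = p y / q y"
      by (rule quasi_affineD[OF W oW(2) _ f' zz]) auto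
    show ?thesis by (rule bexI[OF _ PF_snd[OF p(1)]], rule bexI[OF _ PF_snd[OF p(2)]]) (use p in auto)
  qed
  obtain pV qV where qV: "pV \<in> PF V W" "qV \<in> PF V W" "qV z \<noteq> 0"
      "\<forall>y\<in>V \<times> W. qV y \<noteq> 0 \<longrightarrow> y \<in> V2 \<times> UNIV"
    using fV[OF X.regular_const[OF V2, of 0]] by (elim bexE conjE) (rule that, assumption+, auto)
  obtain pW qW where qW: "pW \<in> PF V W" "qW \<in> PF V W" "qW z \<noteq> 0"
      "\<forall>y\<in>V \<times> W. qW y \<noteq> 0 \<longrightarrow> y \<in> UNIV \<times> W2"
    using fW[OF Y.regular_const[OF W2, of 0]] by (elim bexE conjE) (rule that, assumption+, auto)
  have "\<exists>p\<in>PF V W. \<exists>q\<in>PF V W. q z \<noteq> 0 \<and> (\<forall>y\<in>V \<times> W. q y \<noteq> 0 \<longrightarrow> h y = p y / q y)"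
    using h unfolding product_functions_def[of X Y V2 W2]
  proof induction
    case (const c)
    show ?case by (rule bexI[OF _ PF_const[of c]], rule bexI[OF _ PF_const[of 1]]) auto
  next
    case (gen g)
    then consider f where "f \<in> regular X V2" "g = f \<circ> fst" | f where "f \<in> regular Y W2" "g = f \<circ> snd"
      by blast
    then show ?case
    proof cases
      case 1 then show ?thesis using fV[OF 1(1)] by (simp add: comp_def) blast
    next
      case 2 then show ?thesis using fW[OF 2(1)] by (simp add: comp_def) blast
    qed
  next
    case (add f g)
    then obtain p q p' q' where p: "p \<in> PF V W" "q \<in> PF V W" "p' \<in> PF V W" "q' \<in> PF V W"
      "q z \<noteq> 0" "q' z \<noteq> 0" "\<And>y. y \<in> V \<times> W \<Longrightarrow> q y \<noteq> 0 \<Longrightarrow> f y = p y / q y"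
      "\<And>y. y \<in> V \<times> W \<Longrightarrow> q' y \<noteq> 0 \<Longrightarrow> g y = p' y / q' y" by blast
    show ?case
      by (rule bexI[OF _ PF_add[OF PF_mult[OF p(1) p(4)] PF_mult[OF p(3) p(2)]]],
          rule bexI[OF _ PF_mult[OF p(2) p(4)]]) (use p in \<open>auto simp: add_frac_eq\<close>)
  next
    case (mult f g)
    then obtain p q p' q' where p: "p \<in> PF V W" "q \<in> PF V W" "p' \<in> PF V W" "q' \<in> PF V W"
      "q z \<noteq> 0" "q' z \<noteq> 0" "\<And>y. y \<in> V \<times> W \<Longrightarrow> q y \<noteq> 0 \<Longrightarrow> f y = p y / q y"
      "\<And>y. y \<in> V \<times> W \<Longrightarrow> q' y \<noteq> 0 \<Longrightarrow> g y = p' y / q' y" by blast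
    show ?case
      by (rule bexI[OF _ PF_mult[OF p(1) p(3)]], rule bexI[OF _ PF_mult[OF p(2) p(4)]])
        (use p in \<open>auto simp: add_frac_eq\<close>)
  qed
  then obtain p q where p: "p \<in> PF V W" "q \<in> PF V W" "q z \<noteq> 0"
      "\<And>y. y \<in> V \<times> W \<Longrightarrow> q y \<noteq> 0 \<Longrightarrow> h y = p y / q y" by blast
  show ?thesis
    by (rule bexI[OF _ PF_mult[OF p(1) PF_mult[OF qV(2) qW(2)]]],
        rule bexI[OF _ PF_mult[OF p(2) PF_mult[OF qV(2) qW(2)]]])
      (use p qV qW in auto)
qed

text \<open>In the definition one box has to serve for all points of \<open>U\<close> that it contains.  By
\<open>PF_fraction\<close> it is enough to have, at each point, some box and one function on it.\<close>
lemma open_product_iff: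
  "U \<in> opens (product X Y) \<longleftrightarrow> U \<subseteq> points X \<times> points Y \<and>
     (\<forall>z\<in>U. \<exists>V\<in>opens X. \<exists>W\<in>opens Y. z \<in> V \<times> W \<and>
        (\<exists>h\<in>PF V W. h z \<noteq> 0 \<and> (\<forall>y\<in>V \<times> W. h y \<noteq> 0 \<longrightarrow> y \<in> U)))" (is "?L \<longleftrightarrow> ?R")
proof
  assume ?L
  then have U: "U \<subseteq> points X \<times> points Y" "\<And>z. z \<in> U \<Longrightarrow> \<exists>V\<in>opens X. \<exists>W\<in>opens Y. z \<in> V \<times> W \<and>
                    U \<inter> (V \<times> W) \<in> opens (zariski (V \<times> W) (PF V W))" by (auto simp: product_def)
  show ?R
  proof (intro conjI ballI)
    fix z assume z: "z \<in> U"
    then obtain V W where V: "V \<in> opens X" "W \<in> opens Y" "z \<in> V \<times> W"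
      "U \<inter> (V \<times> W) \<in> opens (zariski (V \<times> W) (PF V W))" using U(2) by blast
    obtain h where "h \<in> PF V W" "h z \<noteq> 0" "\<And>y. y \<in> V \<times> W \<Longrightarrow> h y \<noteq> 0 \<Longrightarrow> y \<in> U \<inter> (V \<times> W)"
      using zariski_openE[OF V(4), of z] V z by blast
    then show "\<exists>V\<in>opens X. \<exists>W\<in>opens Y. z \<in> V \<times> W \<and>
        (\<exists>h\<in>PF V W. h z \<noteq> 0 \<and> (\<forall>y\<in>V \<times> W. h y \<noteq> 0 \<longrightarrow> y \<in> U))" using V by blast
  qed (rule U(1))
next
  assume R: ?R
  have "\<exists>V\<in>opens X. \<exists>W\<in>opens Y. z \<in> V \<times> W \<and>
                    U \<inter> (V \<times> W) \<in> opens (zariski (V \<times> W) (PF V W))" if z: "z \<in> U" for z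
  proof -
    obtain V where V: "quasi_affine X V" "fst z \<in> V" using X.quasi_affine_cover z R by fastforce
    obtain W where W: "quasi_affine Y W" "snd z \<in> W" using Y.quasi_affine_cover z R by fastforce
    have "U \<inter> (V \<times> W) \<in> opens (zariski (V \<times> W) (PF V W))"
    proof (rule zariski_openI)
      fix x assume x: "x \<in> U \<inter> (V \<times> W)"
      have xU: "x \<in> U" using x by blast
      obtain V2 W2 h where h: "V2 \<in> opens X" "W2 \<in> opens Y" "x \<in> V2 \<times> W2" "h \<in> PF V2 W2" "h x \<noteq> 0"
        "\<forall>y\<in>V2 \<times> W2. h y \<noteq> 0 \<longrightarrow> y \<in> U"
        using bspec[OF conjunct2[OF R] xU] by (elim bexE conjE) (rule that; assumption)
      have xx: "x \<in> V \<times> W" using x by blast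
      obtain p q where p: "p \<in> PF V W" "q \<in> PF V W" "q x \<noteq> 0"
        "\<And>y. y \<in> V \<times> W \<Longrightarrow> q y \<noteq> 0 \<Longrightarrow> y \<in> V2 \<times> W2 \<and> h y = p y / q y"
        using PF_fraction[OF V(1) W(1) h(1,2) xx h(3,4)] by blast
      have "p x \<noteq> 0" using h(5) p(3) p(4)[OF xx] by auto
      then show "\<exists>h\<in>PF V W. h x \<noteq> 0 \<and> (\<forall>y\<in>V \<times> W. h y \<noteq> 0 \<longrightarrow> y \<in> U \<inter> V \<times> W)"
        by (intro bexI[OF _ PF_mult[OF p(1,2)]] conjI ballI impI) (use p h in auto)
    qed blast
    moreover have "V \<in> opens X" "W \<in> opens Y" using V W unfolding quasi_affine_def by blast+
    moreover have "z \<in> V \<times> W" using V W by (cases z) auto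
    ultimately show ?thesis by blast
  qed
  then show ?L using R by (auto simp: product_def)
qed

lemma regular_product_iff:
  assumes U: "U \<subseteq> points X \<times> points Y"
  shows "f \<in> regular (product X Y) U \<longleftrightarrow>
     (\<forall>z\<in>U. \<exists>V\<in>opens X. \<exists>W\<in>opens Y. z \<in> V \<times> W \<and>
        (\<exists>p\<in>PF V W. \<exists>q\<in>PF V W. q z \<noteq> 0 \<and> (\<forall>y\<in>U \<inter> (V \<times> W). q y \<noteq> 0 \<longrightarrow> f y = p y / q y)))"
    (is "?L \<longleftrightarrow> ?R")
proof
  assume ?L
  then have L: "\<And>z. z \<in> U \<Longrightarrow> \<exists>V\<in>opens X. \<exists>W\<in>opens Y. z \<in> V \<times> W \<and>
                    f \<in> regular (zariski (V \<times> W) (PF V W)) (U \<inter> (V \<times> W))" by (auto simp: product_def)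
  show ?R
  proof (intro ballI)
    fix z assume z: "z \<in> U"
    then obtain V W where V: "V \<in> opens X" "W \<in> opens Y" "z \<in> V \<times> W"
      "f \<in> regular (zariski (V \<times> W) (PF V W)) (U \<inter> (V \<times> W))" using L by blast
    obtain p q where "p \<in> PF V W" "q \<in> PF V W" "q z \<noteq> 0"
       "\<And>y. y \<in> U \<inter> V \<times> W \<Longrightarrow> q y \<noteq> 0 \<Longrightarrow> f y = p y / q y"
      using zariski_regularE[OF V(4), of z] V z by blast
    then show "\<exists>V\<in>opens X. \<exists>W\<in>opens Y. z \<in> V \<times> W \<and>
        (\<exists>p\<in>PF V W. \<exists>q\<in>PF V W. q z \<noteq> 0 \<and> (\<forall>y\<in>U \<inter> (V \<times> W). q y \<noteq> 0 \<longrightarrow> f y = p y / q y))"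
      using V by blast
  qed
next
  assume R: ?R
  have "\<exists>V\<in>opens X. \<exists>W\<in>opens Y. z \<in> V \<times> W \<and>
                    f \<in> regular (zariski (V \<times> W) (PF V W)) (U \<inter> (V \<times> W))" if z: "z \<in> U" for z
  proof -
    obtain V where V: "quasi_affine X V" "fst z \<in> V" using X.quasi_affine_cover z U by fastforce
    obtain W where W: "quasi_affine Y W" "snd z \<in> W" using Y.quasi_affine_cover z U by fastforce
    have "f \<in> regular (zariski (V \<times> W) (PF V W)) (U \<inter> (V \<times> W))"
    proof (rule zariski_regularI)
      fix x assume x: "x \<in> U \<inter> (V \<times> W)"
      have xU: "x \<in> U" using x by blast
      obtain V2 W2 p q where h: "V2 \<in> opens X" "W2 \<in> opens Y" "x \<in> V2 \<times> W2" "p \<in> PF V2 W2" "q \<in> PF V2 W2" "q x \<noteq> 0"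
        "\<forall>y\<in>U \<inter> V2 \<times> W2. q y \<noteq> 0 \<longrightarrow> f y = p y / q y"
        using bspec[OF R xU] by (elim bexE conjE) (rule that; assumption)
      have xx: "x \<in> V \<times> W" using x by blast
      obtain a b where a: "a \<in> PF V W" "b \<in> PF V W" "b x \<noteq> 0"
        "\<And>y. y \<in> V \<times> W \<Longrightarrow> b y \<noteq> 0 \<Longrightarrow> y \<in> V2 \<times> W2 \<and> p y = a y / b y"
        using PF_fraction[OF V(1) W(1) h(1,2) xx h(3,4)] by blast
      obtain c d where c: "c \<in> PF V W" "d \<in> PF V W" "d x \<noteq> 0"
        "\<And>y. y \<in> V \<times> W \<Longrightarrow> d y \<noteq> 0 \<Longrightarrow> y \<in> V2 \<times> W2 \<and> q y = c y / d y"
        using PF_fraction[OF V(1) W(1) h(1,2) xx h(3,5)] by blast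
      have cx: "c x \<noteq> 0" using h(6) c(3) c(4)[OF xx] by auto
      have "f y = (a y * (d y * d y)) / (b y * (c y * d y))"
        if y: "y \<in> U \<inter> V \<times> W" "b y * (c y * d y) \<noteq> 0" for y
      proof -
        have yy: "y \<in> V \<times> W" "b y \<noteq> 0" "c y \<noteq> 0" "d y \<noteq> 0" using y by auto
        have e: "p y = a y / b y" "q y = c y / d y" "y \<in> V2 \<times> W2" using a(4) c(4) yy by blast+
        have "f y = p y / q y" using e yy y by (intro h(7)[rule_format]) auto
        then show ?thesis using yy by (simp add: e field_simps)
      qed
      then show "\<exists>p\<in>PF V W. \<exists>q\<in>PF V W. q x \<noteq> 0 \<and> (\<forall>y\<in>U \<inter> V \<times> W. q y \<noteq> 0 \<longrightarrow> f y = p y / q y)"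
        using a(3) c(3) cx
        by (intro bexI[OF _ PF_mult[OF a(1) PF_mult[OF c(2,2)]]]
            bexI[OF _ PF_mult[OF a(2) PF_mult[OF c(1,2)]]] conjI ballI impI) auto
    qed
    moreover have "V \<in> opens X" "W \<in> opens Y" using V W unfolding quasi_affine_def by blast+
    moreover have "z \<in> V \<times> W" using V W by (cases z) auto
    ultimately show ?thesis by blast
  qed
  then show ?L by (auto simp: product_def)
qed

lemma open_productE:
  assumes "U \<in> opens (product X Y)" "z \<in> U"
  obtains V W h where "V \<in> opens X" "W \<in> opens Y" "z \<in> V \<times> W" "h \<in> PF V W" "h z \<noteq> 0"
    "\<And>y. y \<in> V \<times> W \<Longrightarrow> h y \<noteq> 0 \<Longrightarrow> y \<in> U"
proof -
  from assms(1) have "\<forall>z\<in>U. \<exists>V\<in>opens X. \<exists>W\<in>opens Y. z \<in> V \<times> W \<and>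
        (\<exists>h\<in>PF V W. h z \<noteq> 0 \<and> (\<forall>y\<in>V \<times> W. h y \<noteq> 0 \<longrightarrow> y \<in> U))"
    unfolding open_product_iff by (rule conjunct2)
  from bspec[OF this assms(2)] show thesis
    by (elim bexE conjE) (rule that, assumption+, auto)
qed

lemma regular_productE:
  assumes "f \<in> regular (product X Y) U" "U \<in> opens (product X Y)" "z \<in> U"
  obtains V W p q where "V \<in> opens X" "W \<in> opens Y" "z \<in> V \<times> W" "p \<in> PF V W" "q \<in> PF V W" "q z \<noteq> 0"
    "\<And>y. y \<in> V \<times> W \<Longrightarrow> y \<in> U \<Longrightarrow> q y \<noteq> 0 \<Longrightarrow> f y = p y / q y"
proof -
  have U: "U \<subseteq> points X \<times> points Y" using assms(2) unfolding open_product_iff by (rule conjunct1)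
  show thesis using bspec[OF assms(1)[unfolded regular_product_iff[OF U]] assms(3)]
    by (elim bexE conjE) (rule that, assumption+, auto)
qed

lemma open_productI:
  assumes "U \<subseteq> points X \<times> points Y"
    "\<And>z. z \<in> U \<Longrightarrow> \<exists>V W h. V \<in> opens X \<and> W \<in> opens Y \<and> z \<in> V \<times> W \<and>
        h \<in> PF V W \<and> h z \<noteq> 0 \<and> (\<forall>y\<in>V \<times> W. h y \<noteq> 0 \<longrightarrow> y \<in> U)"
  shows "U \<in> opens (product X Y)"
  unfolding open_product_iff
proof (intro conjI ballI assms(1))
  fix z assume "z \<in> U"
  from assms(2)[OF this] show "\<exists>V\<in>opens X. \<exists>W\<in>opens Y. z \<in> V \<times> W \<and>
        (\<exists>h\<in>PF V W. h z \<noteq> 0 \<and> (\<forall>y\<in>V \<times> W. h y \<noteq> 0 \<longrightarrow> y \<in> U))"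
    by (elim exE conjE) (intro bexI conjI; assumption)
qed

lemma regular_productI:
  assumes "U \<in> opens (product X Y)"
    "\<And>z. z \<in> U \<Longrightarrow> \<exists>V W p q. V \<in> opens X \<and> W \<in> opens Y \<and> z \<in> V \<times> W \<and>
        p \<in> PF V W \<and> q \<in> PF V W \<and> q z \<noteq> 0 \<and> (\<forall>y\<in>V \<times> W. y \<in> U \<longrightarrow> q y \<noteq> 0 \<longrightarrow> f y = p y / q y)"
  shows "f \<in> regular (product X Y) U"
proof -
  have U: "U \<subseteq> points X \<times> points Y" using assms(1) unfolding open_product_iff by (rule conjunct1)
  show ?thesis unfolding regular_product_iff[OF U]
  proof
    fix z assume "z \<in> U"
    from assms(2)[OF this] show "\<exists>V\<in>opens X. \<exists>W\<in>opens Y. z \<in> V \<times> W \<and>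
        (\<exists>p\<in>PF V W. \<exists>q\<in>PF V W. q z \<noteq> 0 \<and> (\<forall>y\<in>U \<inter> (V \<times> W). q y \<noteq> 0 \<longrightarrow> f y = p y / q y))"
      by (elim exE conjE) (rule rev_bexI, assumption, rule rev_bexI, assumption, rule conjI, assumption,
          rule rev_bexI, assumption, rule rev_bexI, assumption, auto)
  qed
qed

lemma PF_common:
  assumes "V \<in> opens X" "W \<in> opens Y" "V2 \<in> opens X" "W2 \<in> opens Y"
  shows "V \<inter> V2 \<in> opens X" "W \<inter> W2 \<in> opens Y"
    "h \<in> PF V W \<Longrightarrow> h \<in> PF (V \<inter> V2) (W \<inter> W2)" "h \<in> PF V2 W2 \<Longrightarrow> h \<in> PF (V \<inter> V2) (W \<inter> W2)"
proof -
  show o: "V \<inter> V2 \<in> opens X" "W \<inter> W2 \<in> opens Y" using assms X.opens_Int Y.opens_Int by blast+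
  show "h \<in> PF V W \<Longrightarrow> h \<in> PF (V \<inter> V2) (W \<inter> W2)"
    by (rule PF_restrict[OF _ assms(1,2) o]) auto
  show "h \<in> PF V2 W2 \<Longrightarrow> h \<in> PF (V \<inter> V2) (W \<inter> W2)"
    by (rule PF_restrict[OF _ assms(3,4) o]) auto
qed

lemma open_Times:
  assumes "V \<in> opens X" "W \<in> opens Y" shows "V \<times> W \<in> opens (product X Y)"
proof (rule open_productI)
  show "V \<times> W \<subseteq> points X \<times> points Y" using assms X.opens_subset Y.opens_subset by blast
  fix z assume "z \<in> V \<times> W"
  then show "\<exists>V' W' h. V' \<in> opens X \<and> W' \<in> opens Y \<and> z \<in> V' \<times> W' \<and>
        h \<in> PF V' W' \<and> h z \<noteq> 0 \<and> (\<forall>y\<in>V' \<times> W'. h y \<noteq> 0 \<longrightarrow> y \<in> V \<times> W)"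
    by (intro exI[of _ V] exI[of _ W] exI[of _ "\<lambda>_. 1"]) (use assms PF_const in auto)
qed

lemma PF_regular:
  assumes "V \<in> opens X" "W \<in> opens Y" "h \<in> PF V W" shows "h \<in> regular (product X Y) (V \<times> W)"
proof (rule regular_productI[OF open_Times[OF assms(1,2)]])
  fix z assume z: "z \<in> V \<times> W"
  show "\<exists>V' W' p q. V' \<in> opens X \<and> W' \<in> opens Y \<and> z \<in> V' \<times> W' \<and>
        p \<in> PF V' W' \<and> q \<in> PF V' W' \<and> q z \<noteq> 0 \<and> (\<forall>y\<in>V' \<times> W'. y \<in> V \<times> W \<longrightarrow> q y \<noteq> 0 \<longrightarrow> h y = p y / q y)"
    by (rule exI[of _ V], rule exI[of _ W], rule exI[of _ h], rule exI[of _ "\<lambda>_. 1"])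
      (use z assms PF_const in auto)
qed

text \<open>A box of quasi-affine open sets is quasi-affine.  A regular function near \<open>x\<close> is a quotient of
functions on some box, each of which \<open>PF_fraction\<close> rewrites as a quotient on the given box.\<close>
lemma variety_product: "variety (product X Y)" (is "variety ?Z")
proof
  show open_pts: "points ?Z \<in> opens ?Z"
    using open_Times[OF X.opens_points Y.opens_points] by simp
  show "U \<subseteq> points ?Z" if "U \<in> opens ?Z" for U using that unfolding open_product_iff by simp
  show "U \<inter> U' \<in> opens ?Z" if U: "U \<in> opens ?Z" and U': "U' \<in> opens ?Z" for U U'
  proof (rule open_productI)
    show "U \<inter> U' \<subseteq> points X \<times> points Y" using U unfolding open_product_iff by auto
    fix z assume "z \<in> U \<inter> U'"
    then have z: "z \<in> U" "z \<in> U'" by auto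
    obtain V W h where h: "V \<in> opens X" "W \<in> opens Y" "z \<in> V \<times> W" "h \<in> PF V W" "h z \<noteq> 0"
      "\<And>y. y \<in> V \<times> W \<Longrightarrow> h y \<noteq> 0 \<Longrightarrow> y \<in> U" by (elim open_productE[OF U z(1)])
    obtain V2 W2 k where k: "V2 \<in> opens X" "W2 \<in> opens Y" "z \<in> V2 \<times> W2" "k \<in> PF V2 W2" "k z \<noteq> 0"
      "\<And>y. y \<in> V2 \<times> W2 \<Longrightarrow> k y \<noteq> 0 \<Longrightarrow> y \<in> U'" by (elim open_productE[OF U' z(2)])
    note c = PF_common[OF h(1,2) k(1,2)]
    show "\<exists>V W h. V \<in> opens X \<and> W \<in> opens Y \<and> z \<in> V \<times> W \<and>
        h \<in> PF V W \<and> h z \<noteq> 0 \<and> (\<forall>y\<in>V \<times> W. h y \<noteq> 0 \<longrightarrow> y \<in> U \<inter> U')"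
      by (intro exI[of _ "V \<inter> V2"] exI[of _ "W \<inter> W2"] exI[of _ "\<lambda>x. h x * k x"] conjI c(1,2)
          PF_mult[OF c(3)[OF h(4)] c(4)[OF k(4)]]) (use h k in auto)
  qed
  show "U \<in> opens ?Z" if loc: "\<And>x. x \<in> U \<Longrightarrow> \<exists>V\<in>opens ?Z. x \<in> V \<and> V \<subseteq> U" for U
  proof (rule open_productI)
    show "U \<subseteq> points X \<times> points Y"
    proof
      fix x assume "x \<in> U"
      from loc[OF this] obtain V where "V \<in> opens ?Z" "x \<in> V" by blast
      then show "x \<in> points X \<times> points Y" unfolding open_product_iff by (elim conjE) (rule subsetD)
    qed
    fix z assume z: "z \<in> U"
    then obtain O' where O': "O' \<in> opens ?Z" "z \<in> O'" "O' \<subseteq> U" using loc by blast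
    obtain V W h where h: "V \<in> opens X" "W \<in> opens Y" "z \<in> V \<times> W" "h \<in> PF V W" "h z \<noteq> 0"
      "\<And>y. y \<in> V \<times> W \<Longrightarrow> h y \<noteq> 0 \<Longrightarrow> y \<in> O'" by (elim open_productE[OF O'(1,2)])
    then show "\<exists>V W h. V \<in> opens X \<and> W \<in> opens Y \<and> z \<in> V \<times> W \<and>
        h \<in> PF V W \<and> h z \<noteq> 0 \<and> (\<forall>y\<in>V \<times> W. h y \<noteq> 0 \<longrightarrow> y \<in> U)" using O' by blast
  qed
  show "(\<lambda>_. c) \<in> regular ?Z U" if U: "U \<in> opens ?Z" for U c
  proof (rule regular_productI[OF U])
    fix z assume z: "z \<in> U"
    obtain V W h where h: "V \<in> opens X" "W \<in> opens Y" "z \<in> V \<times> W" "h \<in> PF V W" "h z \<noteq> 0"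
      "\<And>y. y \<in> V \<times> W \<Longrightarrow> h y \<noteq> 0 \<Longrightarrow> y \<in> U" by (elim open_productE[OF U z])
    show "\<exists>V W p q. V \<in> opens X \<and> W \<in> opens Y \<and> z \<in> V \<times> W \<and>
        p \<in> PF V W \<and> q \<in> PF V W \<and> q z \<noteq> 0 \<and> (\<forall>y\<in>V \<times> W. y \<in> U \<longrightarrow> q y \<noteq> 0 \<longrightarrow> c = p y / q y)"
      by (intro exI[of _ V] exI[of _ W] exI[of _ "\<lambda>_. c"] exI[of _ "\<lambda>_. 1"] conjI h(1,2,3) PF_const) auto
  qed
  have two: "\<exists>V W p q p' q'. V \<in> opens X \<and> W \<in> opens Y \<and> z \<in> V \<times> W \<and> p \<in> PF V W \<and> q \<in> PF V W \<and>
     p' \<in> PF V W \<and> q' \<in> PF V W \<and> q z \<noteq> 0 \<and> q' z \<noteq> 0 \<and>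
     (\<forall>y\<in>V \<times> W. y \<in> U \<longrightarrow> q y \<noteq> 0 \<longrightarrow> q' y \<noteq> 0 \<longrightarrow> f y = p y / q y \<and> g y = p' y / q' y)"
    if U: "U \<in> opens ?Z" and f: "f \<in> regular ?Z U" and g: "g \<in> regular ?Z U" and z: "z \<in> U" for U f g z
  proof -
    obtain V W p q where h: "V \<in> opens X" "W \<in> opens Y" "z \<in> V \<times> W" "p \<in> PF V W" "q \<in> PF V W" "q z \<noteq> 0"
      "\<And>y. y \<in> V \<times> W \<Longrightarrow> y \<in> U \<Longrightarrow> q y \<noteq> 0 \<Longrightarrow> f y = p y / q y" by (elim regular_productE[OF f U z])
    obtain V2 W2 p' q' where k: "V2 \<in> opens X" "W2 \<in> opens Y" "z \<in> V2 \<times> W2" "p' \<in> PF V2 W2" "q' \<in> PF V2 W2" "q' z \<noteq> 0"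
      "\<And>y. y \<in> V2 \<times> W2 \<Longrightarrow> y \<in> U \<Longrightarrow> q' y \<noteq> 0 \<Longrightarrow> g y = p' y / q' y" by (elim regular_productE[OF g U z])
    note c = PF_common[OF h(1,2) k(1,2)]
    show ?thesis
      by (rule exI[of _ "V \<inter> V2"], rule exI[of _ "W \<inter> W2"], rule exI[of _ p], rule exI[of _ q],
          rule exI[of _ p'], rule exI[of _ q'])
        (use h k c(1,2) c(3)[OF h(4)] c(3)[OF h(5)] c(4)[OF k(4)] c(4)[OF k(5)] in auto)
  qed
  show "(\<lambda>x. f x + g x) \<in> regular ?Z U"
    if U: "U \<in> opens ?Z" and f: "f \<in> regular ?Z U" and g: "g \<in> regular ?Z U" for f g U
  proof (rule regular_productI[OF U])
    fix z assume z: "z \<in> U"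
    from two[OF U f g z] obtain V W p q p' q' where h: "V \<in> opens X" "W \<in> opens Y" "z \<in> V \<times> W" "p \<in> PF V W" "q \<in> PF V W"
     "p' \<in> PF V W" "q' \<in> PF V W" "q z \<noteq> 0" "q' z \<noteq> 0" and
     eq: "\<forall>y\<in>V \<times> W. y \<in> U \<longrightarrow> q y \<noteq> 0 \<longrightarrow> q' y \<noteq> 0 \<longrightarrow> f y = p y / q y \<and> g y = p' y / q' y"
      by (elim exE conjE) (rule that; assumption)
    show "\<exists>V W a b. V \<in> opens X \<and> W \<in> opens Y \<and> z \<in> V \<times> W \<and>
        a \<in> PF V W \<and> b \<in> PF V W \<and> b z \<noteq> 0 \<and> (\<forall>y\<in>V \<times> W. y \<in> U \<longrightarrow> b y \<noteq> 0 \<longrightarrow> f y + g y = a y / b y)"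
      by (rule exI[of _ V], rule exI[of _ W], rule exI[of _ "\<lambda>x. p x * q' x + p' x * q x"],
          rule exI[of _ "\<lambda>x. q x * q' x"])
        (use h eq PF_add[OF PF_mult[OF h(4,7)] PF_mult[OF h(6,5)]] PF_mult[OF h(5,7)]
          in \<open>auto simp: add_frac_eq\<close>)
  qed
  show "(\<lambda>x. f x * g x) \<in> regular ?Z U"
    if U: "U \<in> opens ?Z" and f: "f \<in> regular ?Z U" and g: "g \<in> regular ?Z U" for f g U
  proof (rule regular_productI[OF U])
    fix z assume z: "z \<in> U"
    from two[OF U f g z] obtain V W p q p' q' where h: "V \<in> opens X" "W \<in> opens Y" "z \<in> V \<times> W" "p \<in> PF V W" "q \<in> PF V W"
     "p' \<in> PF V W" "q' \<in> PF V W" "q z \<noteq> 0" "q' z \<noteq> 0" and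
     eq: "\<forall>y\<in>V \<times> W. y \<in> U \<longrightarrow> q y \<noteq> 0 \<longrightarrow> q' y \<noteq> 0 \<longrightarrow> f y = p y / q y \<and> g y = p' y / q' y"
      by (elim exE conjE) (rule that; assumption)
    show "\<exists>V W a b. V \<in> opens X \<and> W \<in> opens Y \<and> z \<in> V \<times> W \<and>
        a \<in> PF V W \<and> b \<in> PF V W \<and> b z \<noteq> 0 \<and> (\<forall>y\<in>V \<times> W. y \<in> U \<longrightarrow> b y \<noteq> 0 \<longrightarrow> f y * g y = a y / b y)"
      by (rule exI[of _ V], rule exI[of _ W], rule exI[of _ "\<lambda>x. p x * p' x"],
          rule exI[of _ "\<lambda>x. q x * q' x"])
        (use h eq PF_mult[OF h(4,6)] PF_mult[OF h(5,7)] in auto)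
  qed
  show "f \<in> regular ?Z U"
    if loc: "\<And>x. x \<in> U \<Longrightarrow> \<exists>V\<in>opens ?Z. x \<in> V \<and> (\<exists>g\<in>regular ?Z V. \<forall>y\<in>V \<inter> U. f y = g y)"
      and U: "U \<in> opens ?Z" for f U
  proof (rule regular_productI[OF U])
    fix z assume z: "z \<in> U"
    then obtain O' g where O': "O' \<in> opens ?Z" "z \<in> O'" "g \<in> regular ?Z O'" "\<And>y. y \<in> O' \<inter> U \<Longrightarrow> f y = g y"
      using loc by blast
    obtain V W h where h: "V \<in> opens X" "W \<in> opens Y" "z \<in> V \<times> W" "h \<in> PF V W" "h z \<noteq> 0"
      "\<And>y. y \<in> V \<times> W \<Longrightarrow> h y \<noteq> 0 \<Longrightarrow> y \<in> O'" by (elim open_productE[OF O'(1,2)])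
    obtain V2 W2 p q where k: "V2 \<in> opens X" "W2 \<in> opens Y" "z \<in> V2 \<times> W2" "p \<in> PF V2 W2" "q \<in> PF V2 W2" "q z \<noteq> 0"
      "\<And>y. y \<in> V2 \<times> W2 \<Longrightarrow> y \<in> O' \<Longrightarrow> q y \<noteq> 0 \<Longrightarrow> g y = p y / q y"
      by (elim regular_productE[OF O'(3,1,2)])
    note c = PF_common[OF h(1,2) k(1,2)]
    show "\<exists>V W p q. V \<in> opens X \<and> W \<in> opens Y \<and> z \<in> V \<times> W \<and>
        p \<in> PF V W \<and> q \<in> PF V W \<and> q z \<noteq> 0 \<and> (\<forall>y\<in>V \<times> W. y \<in> U \<longrightarrow> q y \<noteq> 0 \<longrightarrow> f y = p y / q y)"
      by (rule exI[of _ "V \<inter> V2"], rule exI[of _ "W \<inter> W2"], rule exI[of _ "\<lambda>x. h x * p x"],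
          rule exI[of _ "\<lambda>x. h x * q x"])
        (use h k O' c(1,2) PF_mult[OF c(3)[OF h(4)] c(4)[OF k(4)]] PF_mult[OF c(3)[OF h(4)] c(4)[OF k(5)]] in auto)
  qed
  show "{x \<in> U. f x \<noteq> 0} \<in> opens ?Z" if U: "U \<in> opens ?Z" and f: "f \<in> regular ?Z U" for f U
  proof (rule open_productI)
    show "{x \<in> U. f x \<noteq> 0} \<subseteq> points X \<times> points Y" using U unfolding open_product_iff by auto
    fix z assume z: "z \<in> {x \<in> U. f x \<noteq> 0}"
    then have zU: "z \<in> U" by simp
    obtain V W h where h: "V \<in> opens X" "W \<in> opens Y" "z \<in> V \<times> W" "h \<in> PF V W" "h z \<noteq> 0"
      "\<And>y. y \<in> V \<times> W \<Longrightarrow> h y \<noteq> 0 \<Longrightarrow> y \<in> U" by (elim open_productE[OF U zU])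
    obtain V2 W2 p q where k: "V2 \<in> opens X" "W2 \<in> opens Y" "z \<in> V2 \<times> W2" "p \<in> PF V2 W2" "q \<in> PF V2 W2" "q z \<noteq> 0"
      "\<And>y. y \<in> V2 \<times> W2 \<Longrightarrow> y \<in> U \<Longrightarrow> q y \<noteq> 0 \<Longrightarrow> f y = p y / q y"
      by (elim regular_productE[OF f U zU])
    note c = PF_common[OF h(1,2) k(1,2)]
    have pz: "p z \<noteq> 0" using z k by auto
    show "\<exists>V W h. V \<in> opens X \<and> W \<in> opens Y \<and> z \<in> V \<times> W \<and>
        h \<in> PF V W \<and> h z \<noteq> 0 \<and> (\<forall>y\<in>V \<times> W. h y \<noteq> 0 \<longrightarrow> y \<in> {x \<in> U. f x \<noteq> 0})"
      by (rule exI[of _ "V \<inter> V2"], rule exI[of _ "W \<inter> W2"], rule exI[of _ "\<lambda>x. h x * (p x * q x)"])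
        (use h k pz c(1,2) PF_mult[OF c(3)[OF h(4)] PF_mult[OF c(4)[OF k(4)] c(4)[OF k(5)]]] in auto)
  qed
  show "(\<lambda>x. 1 / f x) \<in> regular ?Z {x \<in> U. f x \<noteq> 0}"
    if U: "U \<in> opens ?Z" and f: "f \<in> regular ?Z U" for f U
  proof (rule regular_productI[OF \<open>\<And>f U. U \<in> opens ?Z \<Longrightarrow> f \<in> regular ?Z U \<Longrightarrow> {x \<in> U. f x \<noteq> 0} \<in> opens ?Z\<close>[OF U f]])
    fix z assume z: "z \<in> {x \<in> U. f x \<noteq> 0}"
    then have zU: "z \<in> U" by simp
    obtain V2 W2 p q where k: "V2 \<in> opens X" "W2 \<in> opens Y" "z \<in> V2 \<times> W2" "p \<in> PF V2 W2" "q \<in> PF V2 W2" "q z \<noteq> 0"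
      "\<And>y. y \<in> V2 \<times> W2 \<Longrightarrow> y \<in> U \<Longrightarrow> q y \<noteq> 0 \<Longrightarrow> f y = p y / q y"
      by (elim regular_productE[OF f U zU])
    have pz: "p z \<noteq> 0" using z k by auto
    show "\<exists>V W p q. V \<in> opens X \<and> W \<in> opens Y \<and> z \<in> V \<times> W \<and>
        p \<in> PF V W \<and> q \<in> PF V W \<and> q z \<noteq> 0 \<and>
        (\<forall>y\<in>V \<times> W. y \<in> {x \<in> U. f x \<noteq> 0} \<longrightarrow> q y \<noteq> 0 \<longrightarrow> 1 / f y = p y / q y)"
      by (rule exI[of _ V2], rule exI[of _ W2], rule exI[of _ "\<lambda>x. q x * q x"],
          rule exI[of _ "\<lambda>x. p x * q x"])
        (use k pz PF_mult[OF k(5,5)] PF_mult[OF k(4,5)] in auto)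
  qed
  fix z assume "z \<in> points ?Z"
  then have zz: "fst z \<in> points X" "snd z \<in> points Y" by auto
  obtain V where V: "quasi_affine X V" "fst z \<in> V" using X.quasi_affine_cover zz by blast
  obtain W where W: "quasi_affine Y W" "snd z \<in> W" using Y.quasi_affine_cover zz by blast
  have oV: "V \<in> opens X" "W \<in> opens Y" using V W unfolding quasi_affine_def by auto
  have "quasi_affine ?Z (V \<times> W)" unfolding quasi_affine_def
  proof (intro conjI ballI impI)
    show "V \<times> W \<in> opens ?Z" by (rule open_Times[OF oV])
    fix U f x assume U: "U \<in> opens ?Z" "U \<subseteq> V \<times> W" and f: "f \<in> regular ?Z U" and x: "x \<in> U"
    have xx: "x \<in> V \<times> W" using U x by blast
    obtain V1 W1 h where h: "V1 \<in> opens X" "W1 \<in> opens Y" "x \<in> V1 \<times> W1" "h \<in> PF V1 W1" "h x \<noteq> 0"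
      "\<And>y. y \<in> V1 \<times> W1 \<Longrightarrow> h y \<noteq> 0 \<Longrightarrow> y \<in> U" by (elim open_productE[OF U(1) x])
    obtain V2 W2 p q where k: "V2 \<in> opens X" "W2 \<in> opens Y" "x \<in> V2 \<times> W2" "p \<in> PF V2 W2" "q \<in> PF V2 W2" "q x \<noteq> 0"
      "\<And>y. y \<in> V2 \<times> W2 \<Longrightarrow> y \<in> U \<Longrightarrow> q y \<noteq> 0 \<Longrightarrow> f y = p y / q y"
      by (elim regular_productE[OF f U(1) x])
    obtain a b where a: "a \<in> PF V W" "b \<in> PF V W" "b x \<noteq> 0"
      "\<And>y. y \<in> V \<times> W \<Longrightarrow> b y \<noteq> 0 \<Longrightarrow> y \<in> V1 \<times> W1 \<and> h y = a y / b y"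
      using PF_fraction[OF V(1) W(1) h(1,2) xx h(3,4)] by blast
    obtain c d where c: "c \<in> PF V W" "d \<in> PF V W" "d x \<noteq> 0"
      "\<And>y. y \<in> V \<times> W \<Longrightarrow> d y \<noteq> 0 \<Longrightarrow> y \<in> V2 \<times> W2 \<and> p y = c y / d y"
      using PF_fraction[OF V(1) W(1) k(1,2) xx k(3,4)] by blast
    obtain m l where m: "m \<in> PF V W" "l \<in> PF V W" "l x \<noteq> 0"
      "\<And>y. y \<in> V \<times> W \<Longrightarrow> l y \<noteq> 0 \<Longrightarrow> y \<in> V2 \<times> W2 \<and> q y = m y / l y"
      using PF_fraction[OF V(1) W(1) k(1,2) xx k(3,5)] by blast
    let ?ab = "\<lambda>y. a y * b y"
    have ab: "?ab \<in> PF V W" using PF_mult a by blast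
    let ?Q = "\<lambda>y. (a y * b y) * (d y * (m y * l y))" and ?P = "\<lambda>y. (a y * b y) * (c y * (l y * l y))"
    have Q: "?Q \<in> PF V W" and P: "?P \<in> PF V W" by (intro PF_mult ab a c m)+
    have ax: "a x \<noteq> 0" using h(5) a(3) a(4)[OF xx] by auto
    have mx: "m x \<noteq> 0" using k(6) m(3) m(4)[OF xx] by auto
    have i: "y \<in> U" if y: "y \<in> V \<times> W" "?Q y \<noteq> 0" for y
      using y a(4)[of y] by (intro h(6)) auto
    have ii: "f y = ?P y / ?Q y" if y: "y \<in> V \<times> W" "?Q y \<noteq> 0" for y
    proof -
      have yy: "d y \<noteq> 0" "m y \<noteq> 0" "l y \<noteq> 0" "a y \<noteq> 0" "b y \<noteq> 0" using y by auto
      have e: "p y = c y / d y" "q y = m y / l y" "y \<in> V2 \<times> W2" using c(4) m(4) y(1) yy by blast+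
      have "f y = p y / q y" using e yy i[OF y] by (intro k(7)) auto
      then show ?thesis using yy by (simp add: e field_simps)
    qed
    show "\<exists>p\<in>regular ?Z (V \<times> W). \<exists>q\<in>regular ?Z (V \<times> W). q x \<noteq> 0 \<and> {y \<in> V \<times> W. q y \<noteq> 0} \<subseteq> U \<and>
          (\<forall>y\<in>V \<times> W. q y \<noteq> 0 \<longrightarrow> f y = p y / q y)"
      by (rule bexI[OF _ PF_regular[OF oV P]], rule bexI[OF _ PF_regular[OF oV Q]])
        (use i ii ax mx a c m in auto)
  qed
  then show "\<exists>V. quasi_affine ?Z V \<and> z \<in> V" using V W by (metis mem_Times_iff)
qed

end

section \<open>Quotients\<close>

lemma points_quotient[simp]: "points (quotient_fspace F p) = p ` points F"
  by (simp add: quotient_fspace_def)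

lemma open_quotient_iff:
  "U \<in> opens (quotient_fspace F p) \<longleftrightarrow> U \<subseteq> p ` points F \<and> {b \<in> points F. p b \<in> U} \<in> opens F"
  by (simp add: quotient_fspace_def)

lemma regular_quotient_iff:
  "f \<in> regular (quotient_fspace F p) U \<longleftrightarrow> (\<lambda>b. f (p b)) \<in> regular F {b \<in> points F. p b \<in> U}"
  by (simp add: quotient_fspace_def comp_def)

lemma (in space_with_functions) space_with_functions_quotient:
  "space_with_functions (quotient_fspace X p)" (is "space_with_functions ?Y")
proof
  note oi = open_quotient_iff and ri = regular_quotient_iff
  show "points ?Y \<in> opens ?Y"
  proof -
    have "{b \<in> points X. p b \<in> p ` points X} = points X" by auto
    then show ?thesis unfolding oi using opens_points by simp
  qed
  show "U \<subseteq> points ?Y" if "U \<in> opens ?Y" for U using that unfolding oi by simp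
  show "U \<inter> V \<in> opens ?Y" if "U \<in> opens ?Y" "V \<in> opens ?Y" for U V
  proof -
    have "{b \<in> points X. p b \<in> U \<inter> V} = {b \<in> points X. p b \<in> U} \<inter> {b \<in> points X. p b \<in> V}" by auto
    then show ?thesis using that opens_Int unfolding oi by auto
  qed
  show "U \<in> opens ?Y" if loc: "\<And>x. x \<in> U \<Longrightarrow> \<exists>V\<in>opens ?Y. x \<in> V \<and> V \<subseteq> U" for U
    unfolding oi
  proof (rule conjI)
    show "U \<subseteq> p ` points X"
    proof
      fix x assume "x \<in> U"
      from loc[OF this] obtain V where "V \<in> opens ?Y" "x \<in> V" by blast
      then show "x \<in> p ` points X" unfolding oi by (elim conjE) (rule subsetD)
    qed
    show "{b \<in> points X. p b \<in> U} \<in> opens X"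
    proof (rule opens_local)
      fix x assume x: "x \<in> {b \<in> points X. p b \<in> U}"
      then obtain V where V: "V \<in> opens ?Y" "p x \<in> V" "V \<subseteq> U" using loc by blast
      then show "\<exists>V\<in>opens X. x \<in> V \<and> V \<subseteq> {b \<in> points X. p b \<in> U}" unfolding oi
        using x by (intro bexI[of _ "{b \<in> points X. p b \<in> V}"]) auto
    qed
  qed
  show "(\<lambda>_. c) \<in> regular ?Y U" if "U \<in> opens ?Y" for U c
    using that regular_const unfolding oi ri by blast
  show "(\<lambda>x. f x + g x) \<in> regular ?Y U" if "U \<in> opens ?Y" "f \<in> regular ?Y U" "g \<in> regular ?Y U" for U f g
    using that regular_add unfolding oi ri by blast
  show "(\<lambda>x. f x * g x) \<in> regular ?Y U" if "U \<in> opens ?Y" "f \<in> regular ?Y U" "g \<in> regular ?Y U" for U f g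
    using that regular_mult unfolding oi ri by blast
  show "f \<in> regular ?Y U"
    if loc: "\<And>x. x \<in> U \<Longrightarrow> \<exists>V\<in>opens ?Y. x \<in> V \<and> (\<exists>g\<in>regular ?Y V. \<forall>y\<in>V \<inter> U. f y = g y)"
      and U: "U \<in> opens ?Y" for f U
    unfolding ri
  proof (rule regular_local)
    show "{b \<in> points X. p b \<in> U} \<in> opens X" using U unfolding oi by blast
    fix x assume x: "x \<in> {b \<in> points X. p b \<in> U}"
    then obtain V g where V: "V \<in> opens ?Y" "p x \<in> V" "g \<in> regular ?Y V" "\<forall>y\<in>V \<inter> U. f y = g y"
      using loc by blast
    show "\<exists>V\<in>opens X. x \<in> V \<and> (\<exists>g\<in>regular X V. \<forall>y\<in>V \<inter> {b \<in> points X. p b \<in> U}. f (p y) = g y)"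
      by (rule bexI[of _ "{b \<in> points X. p b \<in> V}"], rule conjI, use x V in blast,
          rule bexI[of _ "\<lambda>b. g (p b)"]) (use V in \<open>auto simp: oi ri\<close>)
  qed
  have eq: "{b \<in> points X. p b \<in> {x \<in> U. f x \<noteq> 0}} = {b \<in> {b \<in> points X. p b \<in> U}. f (p b) \<noteq> 0}" for f :: "_ \<Rightarrow> complex" and U
    by auto
  show "{x \<in> U. f x \<noteq> 0} \<in> opens ?Y" if "U \<in> opens ?Y" "f \<in> regular ?Y U" for f U
    using that nonvanishing_open[of "{b \<in> points X. p b \<in> U}" "\<lambda>b. f (p b)"] unfolding oi ri eq by blast
  show "(\<lambda>x. 1 / f x) \<in> regular ?Y {x \<in> U. f x \<noteq> 0}" if "U \<in> opens ?Y" "f \<in> regular ?Y U" for f U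
    using that regular_inverse[of "{b \<in> points X. p b \<in> U}" "\<lambda>b. f (p b)"] unfolding oi ri eq by blast
qed

text \<open>If \<open>s\<close> is a local section of \<open>p\<close> with regular coordinates, then \<open>f = (f \<circ> p) \<circ> s\<close>.  Now \<open>f \<circ> p\<close> is
locally a quotient of polynomials, and \<open>s\<close> pulls polynomials back to regular functions.\<close>
lemma variety_quotient_zariski:
  assumes loc: "\<And>x. x \<in> p ` S \<Longrightarrow> \<exists>V s. V \<in> opens (quotient_fspace (zariski S (alg_gen G)) p) \<and> x \<in> V \<and>
     (\<forall>y\<in>V. s y \<in> S \<and> p (s y) = y) \<and>
     (\<forall>g\<in>G. g \<circ> s \<in> regular (quotient_fspace (zariski S (alg_gen G)) p) V)"
  shows "variety (quotient_fspace (zariski S (alg_gen G)) p)" (is "variety ?Y")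
proof -
  interpret F: variety "zariski S (alg_gen G)" by (rule variety_zariski)
  interpret Y: space_with_functions ?Y by (rule F.space_with_functions_quotient)
  show ?thesis
  proof
    fix x assume "x \<in> points ?Y"
    then have "x \<in> p ` S" by simp
    from loc[OF this] obtain V s where V: "V \<in> opens ?Y" "x \<in> V" "\<forall>y\<in>V. s y \<in> S \<and> p (s y) = y"
       "\<forall>g\<in>G. g \<circ> s \<in> regular ?Y V" by (elim exE conjE) (rule that; assumption)
    note V = V(1,2) V(3)[rule_format] V(4)[rule_format]
    have R: "h \<circ> s \<in> regular ?Y V" if "h \<in> alg_gen G" for h
      using Y.regular_alg_gen[OF that V(1,4)] .
    have "quasi_affine ?Y V" unfolding quasi_affine_def
    proof (intro conjI ballI impI)
      fix U f x assume U: "U \<in> opens ?Y" "U \<subseteq> V" and f: "f \<in> regular ?Y U" and x: "x \<in> U"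
      let ?U = "{b \<in> S. p b \<in> U}"
      have oU: "?U \<in> opens (zariski S (alg_gen G))" using U(1) by (simp add: open_quotient_iff)
      have fU: "(\<lambda>b. f (p b)) \<in> regular (zariski S (alg_gen G)) ?U"
        using f by (simp add: regular_quotient_iff)
      have sx: "s x \<in> ?U" using V(3) x U by auto
      obtain a b where a: "a \<in> alg_gen G" "b \<in> alg_gen G" "b (s x) \<noteq> 0"
        "\<And>y. y \<in> ?U \<Longrightarrow> b y \<noteq> 0 \<Longrightarrow> f (p y) = a y / b y" by (elim zariski_regularE[OF fU sx])
      obtain h where h: "h \<in> alg_gen G" "h (s x) \<noteq> 0" "\<And>y. y \<in> S \<Longrightarrow> h y \<noteq> 0 \<Longrightarrow> y \<in> ?U"
        by (elim zariski_openE[OF oU sx])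
      show "\<exists>p\<in>regular ?Y V. \<exists>q\<in>regular ?Y V. q x \<noteq> 0 \<and> {y \<in> V. q y \<noteq> 0} \<subseteq> U \<and>
          (\<forall>y\<in>V. q y \<noteq> 0 \<longrightarrow> f y = p y / q y)"
      proof (rule bexI[OF _ R[OF alg_gen.mult[OF a(1) h(1)]]],
          rule bexI[OF _ R[OF alg_gen.mult[OF a(2) h(1)]]], intro conjI ballI impI)
        show "((\<lambda>x. b x * h x) \<circ> s) x \<noteq> 0" using a h by simp
        show "{y \<in> V. ((\<lambda>x. b x * h x) \<circ> s) y \<noteq> 0} \<subseteq> U" using V(3) h(3) by fastforce
        fix y assume y: "y \<in> V" "((\<lambda>x. b x * h x) \<circ> s) y \<noteq> 0"
        then have "s y \<in> ?U" using h(3)[of "s y"] V(3) by auto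
        then show "f y = ((\<lambda>x. a x * h x) \<circ> s) y / ((\<lambda>x. b x * h x) \<circ> s) y"
          using a(4)[of "s y"] V(3)[OF y(1)] y(2) by auto
      qed
    qed (rule V(1))
    then show "\<exists>V. quasi_affine ?Y V \<and> x \<in> V" using V(2) by blast
  qed
qed

section \<open>Morphisms\<close>

lemma morphismD:
  assumes "morphism X Y g"
  shows "x \<in> points X \<Longrightarrow> g x \<in> points Y"
    "U \<in> opens Y \<Longrightarrow> {x \<in> points X. g x \<in> U} \<in> opens X"
    "U \<in> opens Y \<Longrightarrow> f \<in> regular Y U \<Longrightarrow> (\<lambda>x. f (g x)) \<in> regular X {x \<in> points X. g x \<in> U}"
  using assms unfolding morphism_def comp_def by auto

lemma morphismI:
  assumes "\<And>x. x \<in> points X \<Longrightarrow> g x \<in> points Y"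
    "\<And>U. U \<in> opens Y \<Longrightarrow> {x \<in> points X. g x \<in> U} \<in> opens X"
    "\<And>U f. U \<in> opens Y \<Longrightarrow> f \<in> regular Y U \<Longrightarrow> (\<lambda>x. f (g x)) \<in> regular X {x \<in> points X. g x \<in> U}"
  shows "morphism X Y g"
  using assms unfolding morphism_def comp_def by auto

lemma morphism_compose:
  assumes g: "morphism X Y g" and h: "morphism Y Z h"
  shows "morphism X Z (\<lambda>x. h (g x))"
proof (rule morphismI)
  have eq: "{x \<in> points X. g x \<in> {y \<in> points Y. h y \<in> U}} = {x \<in> points X. h (g x) \<in> U}" for U
    using morphismD(1)[OF g] by auto
  show "h (g x) \<in> points Z" if "x \<in> points X" for x
    using morphismD(1)[OF g that] morphismD(1)[OF h] by blast
  fix U assume U: "U \<in> opens Z"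
  show "{x \<in> points X. h (g x) \<in> U} \<in> opens X"
    using morphismD(2)[OF g morphismD(2)[OF h U]] unfolding eq .
  show "(\<lambda>x. f (h (g x))) \<in> regular X {x \<in> points X. h (g x) \<in> U}" if "f \<in> regular Z U" for f
    using morphismD(3)[OF g morphismD(2)[OF h U] morphismD(3)[OF h U that]] unfolding eq .
qed

context space_with_functions
begin

lemma morphism_cong:
  assumes g: "morphism X Y g" and eq: "\<And>x. x \<in> points X \<Longrightarrow> g' x = g x"
  shows "morphism X Y g'"
proof (rule morphismI)
  have e: "{x \<in> points X. g' x \<in> U} = {x \<in> points X. g x \<in> U}" for U using eq by auto
  show "g' x \<in> points Y" if "x \<in> points X" for x using morphismD(1)[OF g that] eq[OF that] by simp
  fix U assume U: "U \<in> opens Y"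
  show "{x \<in> points X. g' x \<in> U} \<in> opens X" using morphismD(2)[OF g U] unfolding e .
  show "(\<lambda>x. f (g' x)) \<in> regular X {x \<in> points X. g' x \<in> U}" if "f \<in> regular Y U" for f
    unfolding e by (rule regular_cong[OF morphismD(3)[OF g U that] morphismD(2)[OF g U]]) (simp add: eq)
qed

lemma morphism_local:
  assumes maps: "\<And>x. x \<in> points X \<Longrightarrow> g x \<in> points Y"
    and loc: "\<And>x. x \<in> points X \<Longrightarrow> \<exists>W\<in>opens X. x \<in> W \<and> morphism (induced X W) Y g"
  shows "morphism X Y g"
proof (rule morphismI)
  show "g x \<in> points Y" if "x \<in> points X" for x by (rule maps[OF that])
  fix U assume U: "U \<in> opens Y"
  show o: "{x \<in> points X. g x \<in> U} \<in> opens X"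
  proof (rule opens_local)
    fix x assume x: "x \<in> {x \<in> points X. g x \<in> U}"
    then obtain W where W: "W \<in> opens X" "x \<in> W" "morphism (induced X W) Y g" using loc by blast
    from morphismD(2)[OF W(3) U] obtain W' where W': "W' \<in> opens X" "{x \<in> W. g x \<in> U} = W' \<inter> W"
      unfolding opens_induced_iff by auto
    have "W' \<inter> W \<in> opens X" using W' W opens_Int by blast
    moreover have "x \<in> W' \<inter> W" "W' \<inter> W \<subseteq> {x \<in> points X. g x \<in> U}"
      using W'(2)[symmetric] W x opens_subset[OF W(1)] by auto
    ultimately show "\<exists>V\<in>opens X. x \<in> V \<and> V \<subseteq> {x \<in> points X. g x \<in> U}"
      by (intro bexI[of _ "W' \<inter> W"] conjI)
  qed
  show "(\<lambda>x. f (g x)) \<in> regular X {x \<in> points X. g x \<in> U}" if f: "f \<in> regular Y U" for f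
  proof (rule regular_local[OF o])
    fix x assume x: "x \<in> {x \<in> points X. g x \<in> U}"
    then obtain W where W: "W \<in> opens X" "x \<in> W" "morphism (induced X W) Y g" using loc by blast
    from morphismD(3)[OF W(3) U f]
    have "(\<lambda>x. f (g x)) \<in> regular (induced X W) {x \<in> W. g x \<in> U}" by simp
    with x W obtain V k where V: "V \<in> opens X" "x \<in> V" "k \<in> regular X V"
      "\<forall>y\<in>V \<inter> {x \<in> W. g x \<in> U}. f (g y) = k y"
      unfolding regular_induced_iff by blast
    have o: "V \<inter> W \<in> opens X" using V W opens_Int by blast
    show "\<exists>V\<in>opens X. x \<in> V \<and> (\<exists>k\<in>regular X V. \<forall>y\<in>V \<inter> {x \<in> points X. g x \<in> U}. f (g y) = k y)"
      by (rule bexI[OF _ o], rule conjI, use V W in blast,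
          rule bexI[OF _ regular_restrict[OF V(3,1) o]]) (use V in auto)
  qed
qed

lemma morphism_inclusion:
  assumes "S \<subseteq> points X" shows "morphism (induced X S) X (\<lambda>x. x)"
proof (rule morphismI)
  show "x \<in> points X" if "x \<in> points (induced X S)" for x using that assms by auto
  fix U assume U: "U \<in> opens X"
  show "{x \<in> points (induced X S). x \<in> U} \<in> opens (induced X S)"
    unfolding opens_induced_iff by (rule bexI[OF _ U]) auto
  have e: "{x \<in> points (induced X S). x \<in> U} = U \<inter> S" by auto
  show "(\<lambda>x. f x) \<in> regular (induced X S) {x \<in> points (induced X S). x \<in> U}"
    if "f \<in> regular X U" for f
    unfolding e using regular_induced[OF U that] by simp
qed

lemma morphism_into_induced:
  assumes g: "morphism X Y g" and S: "\<And>x. x \<in> points X \<Longrightarrow> g x \<in> S"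
  shows "morphism X (induced Y S) g"
proof (rule morphismI)
  show "g x \<in> points (induced Y S)" if "x \<in> points X" for x using S[OF that] by simp
  fix U assume "U \<in> opens (induced Y S)"
  then obtain W where W: "W \<in> opens Y" "U = W \<inter> S" unfolding opens_induced_iff by blast
  have e: "{x \<in> points X. g x \<in> U} = {x \<in> points X. g x \<in> W}" using W S by auto
  show o: "{x \<in> points X. g x \<in> U} \<in> opens X" unfolding e by (rule morphismD(2)[OF g W(1)])
  show "(\<lambda>x. f (g x)) \<in> regular X {x \<in> points X. g x \<in> U}" if f: "f \<in> regular (induced Y S) U" for f
  proof (rule regular_local[OF o])
    fix x assume x: "x \<in> {x \<in> points X. g x \<in> U}"
    then obtain V k where V: "V \<in> opens Y" "g x \<in> V" "k \<in> regular Y V" "\<forall>y\<in>V \<inter> U. f y = k y"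
      using f unfolding regular_induced_iff by blast
    show "\<exists>V\<in>opens X. x \<in> V \<and> (\<exists>k\<in>regular X V. \<forall>y\<in>V \<inter> {x \<in> points X. g x \<in> U}. f (g y) = k y)"
      by (rule bexI[OF _ morphismD(2)[OF g V(1)]], rule conjI, use x V in blast,
          rule bexI[OF _ morphismD(3)[OF g V(1,3)]]) (use V in auto)
  qed
qed

text \<open>Open sets and regular functions of the target are given locally by polynomials in the generators,
so only the pullbacks of the generators have to be checked.\<close>
lemma morphism_into_zariski:
  assumes maps: "\<And>x. x \<in> points X \<Longrightarrow> g x \<in> S"
    and reg: "\<And>h. h \<in> G \<Longrightarrow> (\<lambda>x. h (g x)) \<in> regular X (points X)"
  shows "morphism X (zariski S (alg_gen G)) g"
proof (rule morphismI)
  have R: "(\<lambda>x. h (g x)) \<in> regular X (points X)" if "h \<in> alg_gen G" for h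
    using regular_alg_gen[OF that opens_points, of g] reg by (simp add: comp_def)
  have nv: "{x \<in> points X. h (g x) \<noteq> 0} \<in> opens X" if "h \<in> alg_gen G" for h
    using nonvanishing_open[OF opens_points R[OF that]] .
  show "g x \<in> points (zariski S (alg_gen G))" if "x \<in> points X" for x using maps[OF that] by simp
  fix U assume U: "U \<in> opens (zariski S (alg_gen G))"
  show o: "{x \<in> points X. g x \<in> U} \<in> opens X"
  proof (rule opens_local)
    fix x assume x: "x \<in> {x \<in> points X. g x \<in> U}"
    then have gx: "g x \<in> U" by simp
    obtain h where h: "h \<in> alg_gen G" "h (g x) \<noteq> 0" "\<And>y. y \<in> S \<Longrightarrow> h y \<noteq> 0 \<Longrightarrow> y \<in> U"
      by (elim zariski_openE[OF U gx])
    show "\<exists>V\<in>opens X. x \<in> V \<and> V \<subseteq> {x \<in> points X. g x \<in> U}"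
      by (rule bexI[OF _ nv[OF h(1)]]) (use x h maps in auto)
  qed
  show "(\<lambda>x. f (g x)) \<in> regular X {x \<in> points X. g x \<in> U}" if f: "f \<in> regular (zariski S (alg_gen G)) U" for f
  proof (rule regular_local[OF o])
    fix x assume x: "x \<in> {x \<in> points X. g x \<in> U}"
    then have gx: "g x \<in> U" by simp
    obtain p q where p: "p \<in> alg_gen G" "q \<in> alg_gen G" "q (g x) \<noteq> 0"
      "\<And>y. y \<in> U \<Longrightarrow> q y \<noteq> 0 \<Longrightarrow> f y = p y / q y"
      by (elim zariski_regularE[OF f gx])
    let ?V = "{x \<in> points X. q (g x) \<noteq> 0}"
    have V: "?V \<in> opens X" by (rule nv[OF p(2)])
    have "(\<lambda>x. p (g x) / q (g x)) \<in> regular X ?V"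
      by (rule regular_divide[OF V regular_restrict[OF R[OF p(1)] opens_points V] regular_restrict[OF R[OF p(2)] opens_points V]]) auto
    then show "\<exists>V\<in>opens X. x \<in> V \<and> (\<exists>k\<in>regular X V. \<forall>y\<in>V \<inter> {x \<in> points X. g x \<in> U}. f (g y) = k y)"
      by (intro bexI[OF _ V] conjI, use x p in force) (rule bexI, use p in auto)
  qed
qed

end

lemma morphism_into_quotient:
  assumes "space_with_functions X" and s: "morphism X F s" and eq: "\<And>x. x \<in> points X \<Longrightarrow> g x = p (s x)"
  shows "morphism X (quotient_fspace F p) g"
proof -
  interpret space_with_functions X by fact
  have "morphism F (quotient_fspace F p) p"
    by (rule morphismI) (auto simp: open_quotient_iff regular_quotient_iff)
  from morphism_compose[OF s this] show ?thesis by (rule morphism_cong) (rule eq)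
qed

lemma morphism_into_affine:
  assumes "space_with_functions X" and "\<And>x. x \<in> points X \<Longrightarrow> g x \<in> carrier_vec n"
    and "\<And>k. k < n \<Longrightarrow> (\<lambda>x. g x $ k) \<in> regular X (points X)"
  shows "morphism X (affine_space n) g"
  unfolding affine_space_def
  by (rule space_with_functions.morphism_into_zariski[OF assms(1,2)]) (use assms(3) in auto)

lemma affine_space_coordinate:
  "k < n \<Longrightarrow> (\<lambda>v. v $ k) \<in> regular (affine_space n) (carrier_vec n)"
  unfolding affine_space_def by (rule alg_gen_regular_zariski) (rule alg_gen.gen, blast)

lemma points_affine_space[simp]: "points (affine_space n) = carrier_vec n"
  by (simp add: affine_space_def)

lemma variety_affine_space: "variety (affine_space n)"
  unfolding affine_space_def by (rule variety_zariski)

lemma (in two_varieties) morphism_fst: "morphism (product X Y) X fst"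
proof (rule morphismI)
  show "fst x \<in> points X" if "x \<in> points (product X Y)" for x using that by auto
  fix U assume U: "U \<in> opens X"
  have e: "{x \<in> points (product X Y). fst x \<in> U} = U \<times> points Y" using X.opens_subset[OF U] by auto
  show "{x \<in> points (product X Y). fst x \<in> U} \<in> opens (product X Y)"
    unfolding e by (rule open_Times[OF U Y.opens_points])
  show "(\<lambda>x. f (fst x)) \<in> regular (product X Y) {x \<in> points (product X Y). fst x \<in> U}" if "f \<in> regular X U" for f
    unfolding e using PF_regular[OF U Y.opens_points PF_fst[OF that]] by (simp add: comp_def)
qed

lemma (in two_varieties) morphism_snd: "morphism (product X Y) Y snd"
proof (rule morphismI)
  show "snd x \<in> points Y" if "x \<in> points (product X Y)" for x using that by auto
  fix U assume U: "U \<in> opens Y"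
  have e: "{x \<in> points (product X Y). snd x \<in> U} = points X \<times> U" using Y.opens_subset[OF U] by auto
  show "{x \<in> points (product X Y). snd x \<in> U} \<in> opens (product X Y)"
    unfolding e by (rule open_Times[OF X.opens_points U])
  show "(\<lambda>x. f (snd x)) \<in> regular (product X Y) {x \<in> points (product X Y). snd x \<in> U}" if "f \<in> regular Y U" for f
    unfolding e using PF_regular[OF X.opens_points U PF_snd[OF that]] by (simp add: comp_def)
qed

text \<open>The universal property of the product: by \<open>open_productE\<close> and \<open>regular_productE\<close>, everything on the
product is expressed near a point by functions generated by the two factors.\<close>
lemma morphism_into_product:
  assumes Z: "space_with_functions Z" and XY: "variety X" "variety Y"
    and a: "morphism Z X a" and b: "morphism Z Y b"
  shows "morphism Z (product X Y) (\<lambda>z. (a z, b z))"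
proof -
  interpret Z: space_with_functions Z by fact
  interpret X: variety X by fact
  interpret Y: variety Y by fact
  interpret two_varieties X Y ..
  have oVW: "{z \<in> points Z. (a z, b z) \<in> V \<times> W} \<in> opens Z" if "V \<in> opens X" "W \<in> opens Y" for V W
  proof -
    have "{z \<in> points Z. (a z, b z) \<in> V \<times> W} = {z \<in> points Z. a z \<in> V} \<inter> {z \<in> points Z. b z \<in> W}" by auto
    then show ?thesis using Z.opens_Int[OF morphismD(2)[OF a that(1)] morphismD(2)[OF b that(2)]] by simp
  qed
  have R: "(\<lambda>z. h (a z, b z)) \<in> regular Z {z \<in> points Z. (a z, b z) \<in> V \<times> W}"
    if VW: "V \<in> opens X" "W \<in> opens Y" and h: "h \<in> PF V W" for V W h
  proof (rule product_functions_regular[OF Z oVW[OF VW] h])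
    show "(\<lambda>z. f (a z)) \<in> regular Z {z \<in> points Z. (a z, b z) \<in> V \<times> W}" if "f \<in> regular X V" for f
      by (rule Z.regular_restrict[OF morphismD(3)[OF a VW(1) that] morphismD(2)[OF a VW(1)] oVW[OF VW]]) auto
    show "(\<lambda>z. f (b z)) \<in> regular Z {z \<in> points Z. (a z, b z) \<in> V \<times> W}" if "f \<in> regular Y W" for f
      by (rule Z.regular_restrict[OF morphismD(3)[OF b VW(2) that] morphismD(2)[OF b VW(2)] oVW[OF VW]]) auto
  qed
  show ?thesis
  proof (rule morphismI)
    show "(a z, b z) \<in> points (product X Y)" if "z \<in> points Z" for z
      using morphismD(1)[OF a that] morphismD(1)[OF b that] by simp
    fix U assume U: "U \<in> opens (product X Y)"
    show o: "{z \<in> points Z. (a z, b z) \<in> U} \<in> opens Z"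
    proof (rule Z.opens_local)
      fix z assume z: "z \<in> {z \<in> points Z. (a z, b z) \<in> U}"
      then have zU: "(a z, b z) \<in> U" by simp
      obtain V W h where h: "V \<in> opens X" "W \<in> opens Y" "(a z, b z) \<in> V \<times> W" "h \<in> PF V W" "h (a z, b z) \<noteq> 0"
        "\<And>y. y \<in> V \<times> W \<Longrightarrow> h y \<noteq> 0 \<Longrightarrow> y \<in> U" by (elim open_productE[OF U zU])
      show "\<exists>V\<in>opens Z. z \<in> V \<and> V \<subseteq> {z \<in> points Z. (a z, b z) \<in> U}"
        by (rule bexI[OF _ Z.nonvanishing_open[OF oVW[OF h(1,2)] R[OF h(1,2,4)]]]) (use z h in auto)
    qed
    show "(\<lambda>z. f (a z, b z)) \<in> regular Z {z \<in> points Z. (a z, b z) \<in> U}"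
      if f: "f \<in> regular (product X Y) U" for f
    proof (rule Z.regular_local[OF o])
      fix z assume z: "z \<in> {z \<in> points Z. (a z, b z) \<in> U}"
      then have zU: "(a z, b z) \<in> U" by simp
      obtain V W p q where h: "V \<in> opens X" "W \<in> opens Y" "(a z, b z) \<in> V \<times> W" "p \<in> PF V W" "q \<in> PF V W"
        "q (a z, b z) \<noteq> 0" "\<And>y. y \<in> V \<times> W \<Longrightarrow> y \<in> U \<Longrightarrow> q y \<noteq> 0 \<Longrightarrow> f y = p y / q y"
        by (elim regular_productE[OF f U zU])
      let ?T = "{z \<in> points Z. (a z, b z) \<in> V \<times> W}"
      let ?N = "{z \<in> ?T. q (a z, b z) \<noteq> 0}"
      note RR = R[OF h(1,2)] and oT = oVW[OF h(1,2)]
      have N: "?N \<in> opens Z" by (rule Z.nonvanishing_open[OF oT RR[OF h(5)]])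
      have r: "(\<lambda>z. p (a z, b z) / q (a z, b z)) \<in> regular Z ?N"
        by (rule Z.regular_divide[OF N Z.regular_restrict[OF RR[OF h(4)] oT N] Z.regular_restrict[OF RR[OF h(5)] oT N]]) auto
      show "\<exists>V\<in>opens Z. z \<in> V \<and> (\<exists>k\<in>regular Z V. \<forall>y\<in>V \<inter> {z \<in> points Z. (a z, b z) \<in> U}. f (a y, b y) = k y)"
        by (rule bexI[OF _ N], rule conjI, use z h in force, rule bexI[OF _ r]) (use h in auto)
    qed
  qed
qed

lemma isomorphismI:
  assumes Y: "space_with_functions Y" and g: "morphism X Y g" and h: "morphism Y X h"
    and hg: "\<And>x. x \<in> points X \<Longrightarrow> h (g x) = x" and gh: "\<And>y. y \<in> points Y \<Longrightarrow> g (h y) = y"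
  shows "isomorphism X Y g"
proof -
  interpret Y: space_with_functions Y by fact
  have b: "bij_betw g (points X) (points Y)"
    by (rule bij_betw_byWitness[of _ h]) (use hg gh morphismD(1)[OF g] morphismD(1)[OF h] in auto)
  have "inv_into (points X) g y = h y" if "y \<in> points Y" for y
    using b gh[OF that] morphismD(1)[OF h that] by (metis bij_betw_imp_inj_on inv_into_f_f)
  then show ?thesis unfolding isomorphism_def using b g Y.morphism_cong[OF h] by blast
qed

section \<open>Tuples in complex vector spaces\<close>

text \<open>Linear combinations of tuples.  Frames and coordinates are indexed families, and for these a
recursion over the index is easier to handle than linear combinations over sets of vectors, where
repeated entries would collapse.\<close>
primrec lc :: "(complex, 'v) module \<Rightarrow> (nat \<Rightarrow> complex) \<Rightarrow> (nat \<Rightarrow> 'v) \<Rightarrow> nat \<Rightarrow> 'v" where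
  "lc V c b 0 = \<zero>\<^bsub>V\<^esub>"
| "lc V c b (Suc n) = lc V c b n \<oplus>\<^bsub>V\<^esub> c n \<odot>\<^bsub>V\<^esub> b n"

definition indep :: "(complex, 'v) module \<Rightarrow> nat \<Rightarrow> (nat \<Rightarrow> 'v) \<Rightarrow> bool" where
  "indep V n b \<longleftrightarrow> (\<forall>c. lc V c b n = \<zero>\<^bsub>V\<^esub> \<longrightarrow> (\<forall>k<n. c k = 0))"

lemma lc_carrier_update[simp]: "lc (V\<lparr>carrier := W\<rparr>) c b n = lc V c b n"
  by (induction n) simp_all

lemma lc_cong: "(\<And>k. k < n \<Longrightarrow> c k = c' k) \<Longrightarrow> (\<And>k. k < n \<Longrightarrow> b k = b' k) \<Longrightarrow> lc V c b n = lc V c' b' n"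
  by (induction n) simp_all

text \<open>Over \<^const>\<open>class_ring\<close> the ring operations are those of the type; the rules below state the
vector space laws directly in terms of them.\<close>
locale cvs = vectorspace CC V for V :: "(complex, 'v) module"

context cvs
begin

lemma smult_mem[simp, intro]: "x \<in> carrier V \<Longrightarrow> a \<odot>\<^bsub>V\<^esub> x \<in> carrier V"
  using smult_closed[of a x] by simp
lemma add_mem[simp, intro]: "x \<in> carrier V \<Longrightarrow> y \<in> carrier V \<Longrightarrow> x \<oplus>\<^bsub>V\<^esub> y \<in> carrier V"
  by (rule M.a_closed)
lemma zero_mem[simp, intro]: "\<zero>\<^bsub>V\<^esub> \<in> carrier V"
  by (rule M.zero_closed)
lemma smult_add_left: "x \<in> carrier V \<Longrightarrow> (a + b) \<odot>\<^bsub>V\<^esub> x = a \<odot>\<^bsub>V\<^esub> x \<oplus>\<^bsub>V\<^esub> b \<odot>\<^bsub>V\<^esub> x"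
  using smult_l_distr[of a b x] by simp
lemma smult_add_right: "x \<in> carrier V \<Longrightarrow> y \<in> carrier V \<Longrightarrow> a \<odot>\<^bsub>V\<^esub> (x \<oplus>\<^bsub>V\<^esub> y) = a \<odot>\<^bsub>V\<^esub> x \<oplus>\<^bsub>V\<^esub> a \<odot>\<^bsub>V\<^esub> y"
  using smult_r_distr[of a x y] by simp
lemma smult_smult: "x \<in> carrier V \<Longrightarrow> a \<odot>\<^bsub>V\<^esub> (b \<odot>\<^bsub>V\<^esub> x) = (a * b) \<odot>\<^bsub>V\<^esub> x"
  using smult_assoc1[of a b x] by simp
lemma one_smult[simp]: "x \<in> carrier V \<Longrightarrow> 1 \<odot>\<^bsub>V\<^esub> x = x"
  using smult_one[of x] by simp
lemma zero_smult[simp]: "x \<in> carrier V \<Longrightarrow> 0 \<odot>\<^bsub>V\<^esub> x = \<zero>\<^bsub>V\<^esub>"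
  using lmult_0[of x] by simp
lemma smult_zero[simp]: "a \<odot>\<^bsub>V\<^esub> \<zero>\<^bsub>V\<^esub> = \<zero>\<^bsub>V\<^esub>"
  using rmult_0[of a] by simp

lemma add_eq_zero_iff:
  assumes "x \<in> carrier V" "y \<in> carrier V"
  shows "x \<oplus>\<^bsub>V\<^esub> (-1) \<odot>\<^bsub>V\<^esub> y = \<zero>\<^bsub>V\<^esub> \<longleftrightarrow> x = y"
proof
  have y0: "(-1) \<odot>\<^bsub>V\<^esub> y \<oplus>\<^bsub>V\<^esub> y = \<zero>\<^bsub>V\<^esub>" using smult_add_left[of y "-1" 1] assms by simp
  assume e: "x \<oplus>\<^bsub>V\<^esub> (-1) \<odot>\<^bsub>V\<^esub> y = \<zero>\<^bsub>V\<^esub>"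
  have "x = x \<oplus>\<^bsub>V\<^esub> ((-1) \<odot>\<^bsub>V\<^esub> y \<oplus>\<^bsub>V\<^esub> y)" using assms y0 by simp
  also have "\<dots> = (x \<oplus>\<^bsub>V\<^esub> (-1) \<odot>\<^bsub>V\<^esub> y) \<oplus>\<^bsub>V\<^esub> y" using assms M.a_assoc by simp
  finally show "x = y" using e assms by simp
next
  assume "x = y"
  then show "x \<oplus>\<^bsub>V\<^esub> (-1) \<odot>\<^bsub>V\<^esub> y = \<zero>\<^bsub>V\<^esub>" using smult_add_left[of y 1 "-1"] assms by simp
qed

lemma subspace_iff:
  "VectorSpace.subspace CC W V \<longleftrightarrow> W \<subseteq> carrier V \<and> \<zero>\<^bsub>V\<^esub> \<in> W \<and>
     (\<forall>x\<in>W. \<forall>y\<in>W. x \<oplus>\<^bsub>V\<^esub> y \<in> W) \<and> (\<forall>c. \<forall>x\<in>W. c \<odot>\<^bsub>V\<^esub> x \<in> W)"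
  unfolding VectorSpace.subspace_def submodule_def
  using module_axioms vectorspace_axioms by auto

lemma subspace_cvs: "VectorSpace.subspace CC W V \<Longrightarrow> cvs (V\<lparr>carrier := W\<rparr>)"
  unfolding cvs_def by (rule subspace_is_vs)

lemma lc_mem[simp]: "(\<forall>k<n. b k \<in> carrier V) \<Longrightarrow> lc V c b n \<in> carrier V"
  by (induction n) (auto simp: All_less_Suc)

lemma lc_mem_subspace:
  assumes "VectorSpace.subspace CC W V" "\<forall>k<n. b k \<in> W"
  shows "lc V c b n \<in> W"
  using assms(2) by (induction n) (use assms(1) in \<open>auto simp: subspace_iff All_less_Suc\<close>)

lemma lc_add: "(\<forall>k<n. b k \<in> carrier V) \<Longrightarrow>
   lc V c b n \<oplus>\<^bsub>V\<^esub> lc V d b n = lc V (\<lambda>k. c k + d k) b n"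
proof (induction n)
  case (Suc n)
  then have b: "\<forall>k<n. b k \<in> carrier V" "b n \<in> carrier V" by auto
  have "lc V c b (Suc n) \<oplus>\<^bsub>V\<^esub> lc V d b (Suc n)
     = (lc V c b n \<oplus>\<^bsub>V\<^esub> lc V d b n) \<oplus>\<^bsub>V\<^esub> (c n \<odot>\<^bsub>V\<^esub> b n \<oplus>\<^bsub>V\<^esub> d n \<odot>\<^bsub>V\<^esub> b n)"
    using b by (simp add: M.a_ac)
  also have "\<dots> = lc V (\<lambda>k. c k + d k) b (Suc n)" using Suc.IH b by (simp add: smult_add_left)
  finally show ?case .
qed simp

lemma lc_smult: "(\<forall>k<n. b k \<in> carrier V) \<Longrightarrow> a \<odot>\<^bsub>V\<^esub> lc V c b n = lc V (\<lambda>k. a * c k) b n"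
  by (induction n) (simp_all add: smult_add_right smult_smult All_less_Suc)

lemma lc_zero_coeff: "(\<forall>k<n. b k \<in> carrier V) \<Longrightarrow> (\<And>k. k < n \<Longrightarrow> c k = 0) \<Longrightarrow> lc V c b n = \<zero>\<^bsub>V\<^esub>"
  by (induction n) (auto simp: All_less_Suc)

lemma lc_delta:
  "(\<forall>k<n. b k \<in> carrier V) \<Longrightarrow> j < n \<Longrightarrow> lc V (\<lambda>k. if k = j then a else 0) b n = a \<odot>\<^bsub>V\<^esub> b j"
proof (induction n)
  case (Suc n)
  show ?case
  proof (cases "j = n")
    case True
    have "lc V (\<lambda>k. if k = n then a else 0) b n = \<zero>\<^bsub>V\<^esub>" by (rule lc_zero_coeff) (use Suc in auto)
    then show ?thesis using True Suc by simp
  next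
    case False
    then show ?thesis using Suc by simp
  qed
qed simp

lemma lc_lc:
  assumes "\<forall>k<m. b k \<in> carrier V"
  shows "lc V c (\<lambda>k. lc V (a k) b m) n = lc V (\<lambda>j. \<Sum>k<n. c k * a k j) b m"
proof (induction n)
  case 0 then show ?case using lc_zero_coeff[of m b "\<lambda>_. 0"] assms by simp
next
  case (Suc n)
  then show ?case using assms by (simp add: lc_smult lc_add)
qed

lemma lc_functional:
  assumes "lin_functional V \<xi>" "\<forall>k<n. b k \<in> carrier V"
  shows "\<xi> (lc V c b n) = (\<Sum>k<n. c k * \<xi> (b k))"
  using assms(2)
proof (induction n)
  case 0
  have "\<xi> (0 \<odot>\<^bsub>V\<^esub> \<zero>\<^bsub>V\<^esub>) = 0 * \<xi> \<zero>\<^bsub>V\<^esub>" using assms(1) zero_mem unfolding lin_functional_def by blast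
  then show ?case by simp
next
  case (Suc n)
  then show ?case using assms(1) unfolding lin_functional_def by simp
qed

lemma lc_finsum:
  assumes "\<forall>k<n. b k \<in> carrier V"
  shows "lc V c b n = finsum V (\<lambda>k. c k \<odot>\<^bsub>V\<^esub> b k) {..<n}"
  using assms
proof (induction n)
  case (Suc n)
  have "finsum V (\<lambda>k. c k \<odot>\<^bsub>V\<^esub> b k) (insert n {..<n}) = c n \<odot>\<^bsub>V\<^esub> b n \<oplus>\<^bsub>V\<^esub> finsum V (\<lambda>k. c k \<odot>\<^bsub>V\<^esub> b k) {..<n}"
    by (rule M.finsum_insert) (use Suc.prems in auto)
  then show ?case using Suc by (simp add: lessThan_Suc M.a_comm M.finsum_closed Pi_def)
qed simp

lemma span_tuple:
  assumes b: "\<forall>k<n. b k \<in> carrier V"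
  shows "span (b ` {..<n}) = range (\<lambda>c. lc V c b n)"
proof
  have S: "VectorSpace.subspace CC (range (\<lambda>c. lc V c b n)) V"
    unfolding subspace_iff
  proof (intro conjI ballI allI)
    show "\<zero>\<^bsub>V\<^esub> \<in> range (\<lambda>c. lc V c b n)" using lc_zero_coeff[of n b "\<lambda>_. 0"] b by (metis rangeI)
  qed (use b in \<open>auto simp: lc_add lc_smult\<close>)
  have "b ` {..<n} \<subseteq> range (\<lambda>c. lc V c b n)"
  proof
    fix x assume "x \<in> b ` {..<n}"
    then obtain j where j: "j < n" "x = b j" by auto
    then have "x = lc V (\<lambda>k. if k = j then 1 else 0) b n" using lc_delta[of n b j 1] b by simp
    then show "x \<in> range (\<lambda>c. lc V c b n)" by blast
  qed
  then show "span (b ` {..<n}) \<subseteq> range (\<lambda>c. lc V c b n)"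
    by (rule span_is_subset) (use S in \<open>simp add: VectorSpace.subspace_def\<close>)
  have T: "VectorSpace.subspace CC (span (b ` {..<n})) V"
    by (rule span_is_subspace) (use b in auto)
  have "b k \<in> span (b ` {..<n})" if "k < n" for k
    using in_own_span[of "b ` {..<n}"] b that by blast
  then show "range (\<lambda>c. lc V c b n) \<subseteq> span (b ` {..<n})"
    using lc_mem_subspace[OF T] by blast
qed

lemma lc_lincomb:
  assumes b: "\<forall>k<n. b k \<in> carrier V" and inj: "inj_on b {..<n}"
  shows "lc V (\<lambda>k. a (b k)) b n = lincomb a (b ` {..<n})"
proof -
  have "lincomb a (b ` {..<n}) = finsum V (\<lambda>k. a (b k) \<odot>\<^bsub>V\<^esub> b k) {..<n}"
    unfolding lincomb_def by (rule M.finsum_reindex) (use b inj in auto)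
  then show ?thesis using lc_finsum[OF b] by simp
qed

lemma frame_iff_indep:
  assumes b: "\<forall>k<n. b k \<in> carrier V"
  shows "inj_on b {..<n} \<and> \<not> lin_dep (b ` {..<n}) \<longleftrightarrow> indep V n b"
proof
  assume A: "inj_on b {..<n} \<and> \<not> lin_dep (b ` {..<n})"
  show "indep V n b" unfolding indep_def
  proof (intro allI impI)
    fix c k assume c: "lc V c b n = \<zero>\<^bsub>V\<^esub>" and k: "k < n"
    let ?a = "\<lambda>v. c (inv_into {..<n} b v)"
    have "lc V (\<lambda>k. ?a (b k)) b n = lc V c b n" using A by (intro lc_cong) auto
    then have z: "lincomb ?a (b ` {..<n}) = \<zero>\<^bsub>V\<^esub>" using lc_lincomb[OF b, of ?a] A c by simp
    show "c k = 0"
    proof (rule ccontr)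
      assume "c k \<noteq> 0"
      then have "?a (b k) \<noteq> 0" using A k by simp
      then have "lin_dep (b ` {..<n})"
        using k by (intro lin_dep_crit[OF _ _ _ _ _ z, of _ "b k"]) auto
      then show False using A by simp
    qed
  qed
next
  assume A: "indep V n b"
  have inj: "inj_on b {..<n}"
  proof (rule inj_onI, rule ccontr)
    fix i j assume ij: "i \<in> {..<n}" "j \<in> {..<n}" "b i = b j" "i \<noteq> j"
    let ?c = "\<lambda>k. (if k = i then 1 else 0) + (if k = j then -1 else (0::complex))"
    have "lc V ?c b n = b i \<oplus>\<^bsub>V\<^esub> (-1) \<odot>\<^bsub>V\<^esub> b j"
      using lc_add[OF b, of "\<lambda>k. if k = i then 1 else 0" "\<lambda>k. if k = j then -1 else 0"]
        lc_delta[OF b, of i 1] lc_delta[OF b, of j "-1"] ij b by simp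
    also have "\<dots> = \<zero>\<^bsub>V\<^esub>" using ij b by (simp add: add_eq_zero_iff)
    finally have "?c i = 0" using A ij unfolding indep_def by blast
    then show False using ij by simp
  qed
  have "\<not> lin_dep (b ` {..<n})"
  proof
    assume "lin_dep (b ` {..<n})"
    then obtain a v where a: "lincomb a (b ` {..<n}) = \<zero>\<^bsub>V\<^esub>" "v \<in> b ` {..<n}" "a v \<noteq> 0"
      using finite_lin_dep[of "b ` {..<n}"] b by auto
    then have "lc V (\<lambda>k. a (b k)) b n = \<zero>\<^bsub>V\<^esub>" using lc_lincomb[OF b inj] by simp
    then show False using A a unfolding indep_def by auto
  qed
  then show "inj_on b {..<n} \<and> \<not> lin_dep (b ` {..<n})" using inj by simp
qed

lemma indep_unique:
  assumes "indep V n b" "\<forall>k<n. b k \<in> carrier V" "lc V c b n = lc V d b n" "k < n"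
  shows "c k = d k"
proof -
  have "lc V c b n \<oplus>\<^bsub>V\<^esub> (-1) \<odot>\<^bsub>V\<^esub> lc V d b n = \<zero>\<^bsub>V\<^esub>" using assms(2,3) add_eq_zero_iff by simp
  then have "lc V (\<lambda>k. c k + (-1) * d k) b n = \<zero>\<^bsub>V\<^esub>"
    by (simp only: lc_smult[OF assms(2)] lc_add[OF assms(2)])
  then have "c k + (-1) * d k = 0" using assms(1,4) unfolding indep_def by blast
  then show ?thesis by simp
qed

text \<open>Independence, and the values of coefficients in \<open>dual_coefficient\<close>, are obtained throughout by
applying functionals that are dual to the tuple.\<close>
lemma dual_indep:
  assumes "\<forall>k<n. b k \<in> carrier V" "\<And>k. k < n \<Longrightarrow> lin_functional V (\<rho> k)"
    "\<And>k j. k < n \<Longrightarrow> j < n \<Longrightarrow> \<rho> k (b j) = (if j = k then 1 else 0)"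
  shows "indep V n b"
  unfolding indep_def
proof (intro allI impI)
  fix c k assume c: "lc V c b n = \<zero>\<^bsub>V\<^esub>" and k: "k < n"
  have "\<rho> k (lc V c b n) = (\<Sum>j<n. c j * \<rho> k (b j))" by (rule lc_functional) (use assms k in auto)
  also have "\<dots> = (\<Sum>j<n. if j = k then c j else 0)" by (rule sum.cong) (use assms k in auto)
  also have "\<dots> = c k" using k by simp
  finally have 1: "\<rho> k \<zero>\<^bsub>V\<^esub> = c k" using c by simp
  have "\<rho> k (lc V c b 0) = 0" by (subst lc_functional[OF assms(2)[OF k]]) auto
  then show "c k = 0" using 1 by simp
qed

lemma functional_zero: "lin_functional V \<xi> \<Longrightarrow> \<xi> \<zero>\<^bsub>V\<^esub> = 0"
  using lc_functional[of \<xi> 0] by simp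

lemma dual_coefficient:
  assumes "\<forall>k<n. b k \<in> carrier V" "lin_functional V (\<rho> k)" "k < n"
    "\<And>j. j < n \<Longrightarrow> \<rho> k (b j) = (if j = k then 1 else 0)"
  shows "\<rho> k (lc V c b n) = c k"
proof -
  have "\<rho> k (lc V c b n) = (\<Sum>j<n. c j * \<rho> k (b j))" by (rule lc_functional) (use assms in auto)
  also have "\<dots> = (\<Sum>j<n. if j = k then c j else 0)" by (rule sum.cong) (use assms in auto)
  also have "\<dots> = c k" using assms by simp
  finally show ?thesis .
qed

lemma dim_tuple:
  assumes b: "\<forall>k<n. b k \<in> carrier V" and i: "indep V n b"
    and s: "\<forall>x\<in>carrier V. \<exists>c. x = lc V c b n"
  shows "fin_dim" "dim = n"
proof -
  have inj: "inj_on b {..<n}" "\<not> lin_dep (b ` {..<n})" using frame_iff_indep[OF b] i by auto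
  have g: "span (b ` {..<n}) = carrier V"
    unfolding span_tuple[OF b]
  proof (intro equalityI subsetI)
    fix x assume "x \<in> carrier V"
    then obtain c where "x = lc V c b n" using s by blast
    then show "x \<in> range (\<lambda>c. lc V c b n)" by (intro image_eqI[where x = c]) simp_all
  next
    fix x assume "x \<in> range (\<lambda>c. lc V c b n)"
    then show "x \<in> carrier V" using lc_mem[OF b] by (elim rangeE) simp
  qed
  have ba: "b ` {..<n} \<subseteq> carrier V" using b by auto
  show "fin_dim" unfolding fin_dim_def using g ba by blast
  have "basis (b ` {..<n})" unfolding basis_def using inj g ba by auto
  then show "dim = n" using dim_basis[of "b ` {..<n}"] inj by (simp add: card_image)
qed

lemma indep_le_dim:
  assumes fin_dim "\<forall>k<n. b k \<in> carrier V" "indep V n b"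
  shows "n \<le> dim"
proof -
  have inj: "inj_on b {..<n}" "\<not> lin_dep (b ` {..<n})" using frame_iff_indep[OF assms(2)] assms(3) by auto
  have "card (b ` {..<n}) \<le> dim" by (rule li_le_dim(2)) (use assms inj in auto)
  then show ?thesis using inj by (simp add: card_image)
qed

lemma extend_indep:
  assumes fd: fin_dim and W: "VectorSpace.subspace CC W V"
    and b: "\<forall>k<n. b k \<in> W" and i: "indep V n b"
  shows "\<exists>m b'. n \<le> m \<and> (\<forall>k<n. b' k = b k) \<and> (\<forall>k<m. b' k \<in> W) \<and> indep V m b' \<and>
     (\<forall>x\<in>W. \<exists>c. x = lc V c b' m)"
proof -
  have WV: "W \<subseteq> carrier V" using W subspace_iff by simp
  let ?P = "\<lambda>m. \<exists>b'. n \<le> m \<and> (\<forall>k<n. b' k = b k) \<and> (\<forall>k<m. b' k \<in> W) \<and> indep V m b'"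
  have P: "?P n" using b i by blast
  have bd: "\<forall>m. ?P m \<longrightarrow> m \<le> dim" using indep_le_dim[OF fd] WV by blast
  obtain m where m: "?P m" "\<And>m'. ?P m' \<Longrightarrow> m' \<le> m"
  proof (rule that[of "Greatest ?P"])
    show "?P (Greatest ?P)" by (rule GreatestI_nat[of ?P n dim, OF P]) (use bd in blast)
    show "m' \<le> Greatest ?P" if "?P m'" for m'
      by (rule Greatest_le_nat[of ?P _ dim, OF that]) (use bd in blast)
  qed
  then obtain b' where b': "n \<le> m" "\<forall>k<n. b' k = b k" "\<forall>k<m. b' k \<in> W" "indep V m b'" by blast
  have b'V: "k < m \<Longrightarrow> b' k \<in> carrier V" for k using b' WV by blast
  have "\<exists>c. x = lc V c b' m" if x: "x \<in> W" for x
  proof (rule ccontr)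
    assume no: "\<nexists>c. x = lc V c b' m"
    let ?b = "b'(m := x)"
    have xV: "x \<in> carrier V" using x WV by blast
    have e: "lc V c ?b m = lc V c b' m" for c by (rule lc_cong) auto
    have "indep V (Suc m) ?b" unfolding indep_def
    proof (intro allI impI)
      fix c k assume c: "lc V c ?b (Suc m) = \<zero>\<^bsub>V\<^esub>" and k: "k < Suc m"
      have 1: "lc V c b' m \<oplus>\<^bsub>V\<^esub> c m \<odot>\<^bsub>V\<^esub> x = \<zero>\<^bsub>V\<^esub>" using c by (simp add: e)
      have cm: "c m = 0"
      proof (rule ccontr)
        assume nz: "c m \<noteq> 0"
        have "lc V (\<lambda>k. (- 1 / c m) * c k) b' m \<oplus>\<^bsub>V\<^esub> (-1) \<odot>\<^bsub>V\<^esub> x = (- 1 / c m) \<odot>\<^bsub>V\<^esub> (lc V c b' m \<oplus>\<^bsub>V\<^esub> c m \<odot>\<^bsub>V\<^esub> x)"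
          using nz xV b'V by (simp add: smult_add_right smult_smult lc_smult)
        then have "lc V (\<lambda>k. (- 1 / c m) * c k) b' m = x" using 1 xV b'V by (simp add: add_eq_zero_iff)
        then show False using no by metis
      qed
      then have "lc V c b' m = \<zero>\<^bsub>V\<^esub>" using 1 xV b'V by simp
      then show "c k = 0" using b'(4) k cm unfolding indep_def by (metis less_Suc_eq)
    qed
    then have "?P (Suc m)" using b' x by (intro exI[of _ ?b]) auto
    from m(2)[OF this] show False by simp
  qed
  then show ?thesis using b' by blast
qed

lemma indep_0: "indep V 0 b" unfolding indep_def by simp

lemma subspace_dim_iff:
  assumes fd: fin_dim and W: "VectorSpace.subspace CC W V"
  shows "vectorspace.dim CC (V\<lparr>carrier := W\<rparr>) = n \<longleftrightarrow>
     (\<exists>b. (\<forall>k<n. b k \<in> W) \<and> indep V n b \<and> W = range (\<lambda>c. lc V c b n))"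
    and "vectorspace.fin_dim CC (V\<lparr>carrier := W\<rparr>)"
proof -
  interpret W: cvs "V\<lparr>carrier := W\<rparr>" by (rule subspace_cvs[OF W])
  have ind: "indep (V\<lparr>carrier := W\<rparr>) n b \<longleftrightarrow> indep V n b" for n b unfolding indep_def by simp
  obtain m b where b: "\<forall>k<m. b k \<in> W" "indep V m b" "\<forall>x\<in>W. \<exists>c. x = lc V c b m"
    using extend_indep[OF fd W, of 0 undefined] indep_0 by auto
  have d: "W.fin_dim" "W.dim = m" by (rule W.dim_tuple[of m b]; use b ind in auto)+
  show "W.fin_dim" by (rule d(1))
  show "W.dim = n \<longleftrightarrow> (\<exists>b. (\<forall>k<n. b k \<in> W) \<and> indep V n b \<and> W = range (\<lambda>c. lc V c b n))"
  proof
    assume "W.dim = n"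
    then show "\<exists>b. (\<forall>k<n. b k \<in> W) \<and> indep V n b \<and> W = range (\<lambda>c. lc V c b n)"
      using b d lc_mem_subspace[OF W] by (intro exI[of _ b]) auto
  next
    assume "\<exists>b. (\<forall>k<n. b k \<in> W) \<and> indep V n b \<and> W = range (\<lambda>c. lc V c b n)"
    then obtain b' where b': "\<forall>k<n. b' k \<in> W" "indep V n b'" "W = range (\<lambda>c. lc V c b' n)" by blast
    show "W.dim = n" by (rule W.dim_tuple(2)[of n b']) (use b' ind in auto)
  qed
qed

lemma coordinates:
  assumes b: "\<forall>k<n. b k \<in> carrier V" and i: "indep V n b"
    and s: "\<forall>x\<in>carrier V. \<exists>c. x = lc V c b n"
  shows "\<exists>\<xi>. (\<forall>k<n. lin_functional V (\<xi> k)) \<and> (\<forall>k<n. \<forall>j<n. \<xi> k (b j) = (if j = k then 1 else 0)) \<and>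
    (\<forall>x\<in>carrier V. x = lc V (\<lambda>k. \<xi> k x) b n)"
proof -
  define co where "co x = (SOME c. x = lc V c b n)" for x
  have co: "x = lc V (co x) b n" if "x \<in> carrier V" for x
    unfolding co_def by (rule someI_ex[OF s[rule_format, OF that]])
  have co_lc: "co (lc V c b n) k = c k" if "k < n" for c k
    by (rule indep_unique[OF i b co[symmetric] that]) (use b in auto)
  have "lin_functional V (\<lambda>x. co x k)" if k: "k < n" for k
    unfolding lin_functional_def
  proof (intro conjI ballI allI)
    fix x y assume xy: "x \<in> carrier V" "y \<in> carrier V"
    have "x \<oplus>\<^bsub>V\<^esub> y = lc V (\<lambda>k. co x k + co y k) b n" using lc_add[OF b, of "co x" "co y"] co xy by simp
    then show "co (x \<oplus>\<^bsub>V\<^esub> y) k = co x k + co y k" using co_lc[OF k] by metis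
  next
    fix c x assume x: "x \<in> carrier V"
    have "c \<odot>\<^bsub>V\<^esub> x = lc V (\<lambda>k. c * co x k) b n" using lc_smult[OF b, of c "co x"] co x by simp
    then show "co (c \<odot>\<^bsub>V\<^esub> x) k = c * co x k" using co_lc[OF k] by metis
  qed
  moreover have "co (b j) k = (if j = k then 1 else 0)" if k: "k < n" and j: "j < n" for j k
  proof -
    have "b j = lc V (\<lambda>k. if k = j then 1 else 0) b n" using lc_delta[OF b j, of 1] b j by simp
    then have "co (b j) k = co (lc V (\<lambda>k. if k = j then 1 else 0) b n) k" by (rule arg_cong)
    also have "\<dots> = (if k = j then 1 else 0)" by (rule co_lc[OF k])
    finally show ?thesis by auto
  qed
  ultimately show ?thesis using co by (intro exI[of _ "\<lambda>k x. co x k"]) auto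
qed

text \<open>A basis of a subspace is completed to a basis of the whole space; the remaining vectors span a
complement, on which the first \<open>e\<close> coordinates vanish.\<close>
lemma adapted_coordinates:
  assumes fd: fin_dim and W: "VectorSpace.subspace CC W V" and d: "vectorspace.dim CC (V\<lparr>carrier := W\<rparr>) = e"
  obtains b \<xi> where "e \<le> dim" "\<And>k. k < dim \<Longrightarrow> b k \<in> carrier V" "\<And>k. k < e \<Longrightarrow> b k \<in> W"
    "W = range (\<lambda>c. lc V c b e)" "\<And>k. k < dim \<Longrightarrow> lin_functional V (\<xi> k)"
    "\<And>k j. k < dim \<Longrightarrow> j < dim \<Longrightarrow> \<xi> k (b j) = (if j = k then 1 else 0)"
    "\<And>x. x \<in> carrier V \<Longrightarrow> x = lc V (\<lambda>k. \<xi> k x) b dim"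
proof -
  obtain b0 where b0: "\<forall>k<e. b0 k \<in> W" "indep V e b0" "W = range (\<lambda>c. lc V c b0 e)"
    using iffD1[OF subspace_dim_iff(1)[OF fd W] d] by (elim exE conjE) (rule that; assumption)
  have WV: "W \<subseteq> carrier V" using W subspace_iff by simp
  have VV: "VectorSpace.subspace CC (carrier V) V" by (simp add: subspace_iff)
  have b0V: "\<forall>k<e. b0 k \<in> carrier V" using b0(1) WV by auto
  obtain m b where b: "e \<le> m" "\<forall>k<e. b k = b0 k" "\<forall>k<m. b k \<in> carrier V" "indep V m b"
    "\<forall>x\<in>carrier V. \<exists>c. x = lc V c b m"
    using extend_indep[OF fd VV b0V b0(2)] by (elim exE conjE) (rule that; assumption)
  have m: "dim = m" by (rule dim_tuple(2)[of m b]) (use b in auto)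
  obtain \<xi> where x: "\<forall>k<m. lin_functional V (\<xi> k)" "\<forall>k<m. \<forall>j<m. \<xi> k (b j) = (if j = k then 1 else 0)"
    "\<forall>x\<in>carrier V. x = lc V (\<lambda>k. \<xi> k x) b m"
    using coordinates[OF b(3,4,5)] by (elim exE conjE) (rule that; assumption)
  have e: "lc V c b e = lc V c b0 e" for c by (rule lc_cong) (use b in auto)
  show thesis
    by (rule that[of b \<xi>]) (use b b0 x m e in auto)
qed

end

lemma lc_linear_map:
  assumes "linear_map CC V W T" "\<forall>k<n. b k \<in> carrier V"
  shows "T (lc V c b n) = lc W c (\<lambda>k. T (b k)) n"
proof -
  interpret linear_map CC V W T by fact
  interpret V: cvs V by unfold_locales
  show ?thesis using assms(2) by (induction n) auto
qed

lemma linear_mapI: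
  assumes "cvs V" "cvs W" "\<And>x. x \<in> carrier V \<Longrightarrow> T x \<in> carrier W"
    "\<And>x y. x \<in> carrier V \<Longrightarrow> y \<in> carrier V \<Longrightarrow> T (x \<oplus>\<^bsub>V\<^esub> y) = T x \<oplus>\<^bsub>W\<^esub> T y"
    "\<And>c x. x \<in> carrier V \<Longrightarrow> T (c \<odot>\<^bsub>V\<^esub> x) = c \<odot>\<^bsub>W\<^esub> T x"
  shows "linear_map CC V W T"
proof -
  interpret V: cvs V by fact
  interpret W: cvs W by fact
  show ?thesis
    unfolding linear_map_def mod_hom_def mod_hom_axioms_def LinearCombinations.module_hom_def
    using assms(3-5) V.vectorspace_axioms W.vectorspace_axioms V.module_axioms W.module_axioms
    by (simp add: Pi_def)
qed

lemma linear_mapD: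
  assumes "linear_map CC V W T"
  shows "x \<in> carrier V \<Longrightarrow> T x \<in> carrier W"
    "x \<in> carrier V \<Longrightarrow> y \<in> carrier V \<Longrightarrow> T (x \<oplus>\<^bsub>V\<^esub> y) = T x \<oplus>\<^bsub>W\<^esub> T y"
    "x \<in> carrier V \<Longrightarrow> T (c \<odot>\<^bsub>V\<^esub> x) = c \<odot>\<^bsub>W\<^esub> T x"
    "cvs V" "cvs W"
proof -
  interpret linear_map CC V W T by fact
  show "x \<in> carrier V \<Longrightarrow> T x \<in> carrier W" by auto
  show "x \<in> carrier V \<Longrightarrow> y \<in> carrier V \<Longrightarrow> T (x \<oplus>\<^bsub>V\<^esub> y) = T x \<oplus>\<^bsub>W\<^esub> T y" by auto
  show "x \<in> carrier V \<Longrightarrow> T (c \<odot>\<^bsub>V\<^esub> x) = c \<odot>\<^bsub>W\<^esub> T x" by auto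
  show "cvs V" "cvs W" by unfold_locales
qed

lemma functional_compose:
  "linear_map CC V W T \<Longrightarrow> lin_functional W \<xi> \<Longrightarrow> lin_functional V (\<lambda>x. \<xi> (T x))"
  unfolding lin_functional_def using linear_mapD[of V W T] by simp

lemma functional_sum:
  "(\<And>a. a \<in> A \<Longrightarrow> lin_functional V (\<xi> a)) \<Longrightarrow> lin_functional V (\<lambda>x. \<Sum>a\<in>A. c a * \<xi> a x)"
  unfolding lin_functional_def by (simp add: sum.distrib distrib_left sum_distrib_left mult.left_commute)

lemma functional_diff:
  "lin_functional V \<xi> \<Longrightarrow> lin_functional V \<eta> \<Longrightarrow> lin_functional V (\<lambda>x. \<xi> x - \<eta> x)"
  unfolding lin_functional_def by (simp add: right_diff_distrib)

section \<open>Matrices of regular functions\<close>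

context space_with_functions
begin

lemma regular_det:
  assumes U: "U \<in> opens X" and M: "\<And>x. M x \<in> carrier_mat n n"
    and r: "\<And>i j. i < n \<Longrightarrow> j < n \<Longrightarrow> (\<lambda>x. M x $$ (i, j)) \<in> regular X U"
  shows "(\<lambda>x. det (M x)) \<in> regular X U"
proof -
  have "(\<lambda>x. \<Sum>p\<in>{p. p permutes {0..<n}}. signof p * (\<Prod>i\<in>{0..<n}. M x $$ (i, p i))) \<in> regular X U"
  proof (intro regular_sum[OF U] regular_mult[OF U] regular_const[OF U] regular_prod[OF U] r)
    show "p i < n" if "p \<in> {p. p permutes {0..<n}}" "i \<in> {0..<n}" for p i
      using that permutes_in_image[of p "{0..<n}" i] by simp
  qed auto
  then show ?thesis using det_def'[OF M] by simp
qed

text \<open>Cramer's rule: the determinant and the cofactors are polynomials in the entries, hence regular, and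
the inverse exists where the determinant does not vanish.\<close>
lemma local_inverse_nat:
  fixes A :: "nat \<Rightarrow> nat \<Rightarrow> 'x \<Rightarrow> complex"
  assumes U: "U \<in> opens X" and x0: "x0 \<in> U"
    and A: "\<And>i j. i < n \<Longrightarrow> j < n \<Longrightarrow> A i j \<in> regular X U"
    and B0: "\<And>i k. i < n \<Longrightarrow> k < n \<Longrightarrow> (\<Sum>j<n. A i j x0 * B0 j k) = (if i = k then 1 else 0)"
  shows "\<exists>W B. W \<in> opens X \<and> x0 \<in> W \<and> W \<subseteq> U \<and> (\<forall>j<n. \<forall>k<n. B j k \<in> regular X W) \<and>
    (\<forall>x\<in>W. \<forall>i<n. \<forall>k<n. (\<Sum>j<n. A i j x * B j k x) = (if i = k then 1 else 0) \<and>
       (\<Sum>j<n. B i j x * A j k x) = (if i = k then 1 else 0))"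
proof -
  define M where "M x = mat n n (\<lambda>(i, j). A i j x)" for x
  have M: "M x \<in> carrier_mat n n" for x unfolding M_def by simp
  have Mr: "(\<lambda>x. M x $$ (i, j)) \<in> regular X U" if "i < n" "j < n" for i j
    using A[OF that] that unfolding M_def by simp
  have detr: "(\<lambda>x. det (M x)) \<in> regular X U" by (rule regular_det[OF U M Mr])
  define B0m where "B0m = mat n n (\<lambda>(j, k). B0 j k)"
  have "M x0 * B0m = 1\<^sub>m n"
    by (rule eq_matI) (use B0 in \<open>auto simp: M_def B0m_def scalar_prod_def lessThan_atLeast0\<close>)
  then have "det (M x0) * det B0m = 1"
    using det_mult[OF M, of B0m x0] by (simp add: B0m_def)
  then have d0: "det (M x0) \<noteq> 0" by auto
  define W where "W = {x \<in> U. det (M x) \<noteq> 0}"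
  have W: "W \<in> opens X" unfolding W_def by (rule nonvanishing_open[OF U detr])
  have WU: "W \<subseteq> U" unfolding W_def by auto
  define B where "B j k x = adj_mat (M x) $$ (j, k) / det (M x)" for j k x
  have cof: "(\<lambda>x. cofactor (M x) k j) \<in> regular X W" if "j < n" "k < n" for j k
  proof -
    have dm: "mat_delete (M x) k j \<in> carrier_mat (n - 1) (n - 1)" for x
      by (rule mat_delete_carrier[OF M])
    have "(\<lambda>x. mat_delete (M x) k j $$ (i', j')) \<in> regular X U" if ij: "i' < n - 1" "j' < n - 1" for i' j'
    proof -
      have e: "(\<lambda>x. mat_delete (M x) k j $$ (i', j')) =
          (\<lambda>x. M x $$ (if i' < k then i' else Suc i', if j' < j then j' else Suc j'))"
      proof
        show "mat_delete (M x) k j $$ (i', j') = M x $$ (if i' < k then i' else Suc i', if j' < j then j' else Suc j')" for x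
          using ij M[of x] unfolding mat_delete_def by auto
      qed
      show ?thesis unfolding e by (rule Mr) (use ij in auto)
    qed
    then have "(\<lambda>x. det (mat_delete (M x) k j)) \<in> regular X U" by (rule regular_det[OF U dm])
    then have "(\<lambda>x. det (mat_delete (M x) k j)) \<in> regular X W" by (rule regular_restrict[OF _ U W WU])
    then show ?thesis unfolding cofactor_def by (rule regular_mult[OF W regular_const[OF W]])
  qed
  have Breg: "B j k \<in> regular X W" if jk: "j < n" "k < n" for j k
  proof -
    have e: "B j k = (\<lambda>x. cofactor (M x) k j / det (M x))"
      using jk M unfolding B_def adj_mat_def by (auto simp: fun_eq_iff M_def)
    show ?thesis unfolding e
      by (rule regular_divide[OF W cof[OF jk] regular_restrict[OF detr U W WU]]) (auto simp: W_def)
  qed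
  have inv: "(\<Sum>j<n. A i j x * B j k x) = (if i = k then 1 else 0) \<and>
       (\<Sum>j<n. B i j x * A j k x) = (if i = k then 1 else 0)" if x: "x \<in> W" and ik: "i < n" "k < n" for x i k
  proof -
    have d: "det (M x) \<noteq> 0" using x unfolding W_def by simp
    note adj = adj_mat[OF M[of x]]
    have "(M x * adj_mat (M x)) $$ (i, k) = (\<Sum>j<n. A i j x * adj_mat (M x) $$ (j, k))"
      using ik adj(1) by (simp add: M_def scalar_prod_def lessThan_atLeast0)
    then have 1: "(\<Sum>j<n. A i j x * adj_mat (M x) $$ (j, k)) = det (M x) * (if i = k then 1 else 0)"
      using adj(2) ik by simp
    have "(adj_mat (M x) * M x) $$ (i, k) = (\<Sum>j<n. adj_mat (M x) $$ (i, j) * A j k x)"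
      using ik adj(1) by (simp add: M_def scalar_prod_def lessThan_atLeast0)
    then have 2: "(\<Sum>j<n. adj_mat (M x) $$ (i, j) * A j k x) = det (M x) * (if i = k then 1 else 0)"
      using adj(3) ik by simp
    have "(\<Sum>j<n. A i j x * B j k x) = (\<Sum>j<n. A i j x * adj_mat (M x) $$ (j, k)) / det (M x)"
      unfolding B_def by (simp add: sum_divide_distrib)
    moreover have "(\<Sum>j<n. B i j x * A j k x) = (\<Sum>j<n. adj_mat (M x) $$ (i, j) * A j k x) / det (M x)"
      unfolding B_def by (simp add: sum_divide_distrib)
    ultimately show ?thesis using 1 2 d by simp
  qed
  have "x0 \<in> W" using x0 d0 unfolding W_def by simp
  then show ?thesis using W WU Breg inv by blast
qed

text \<open>The same for rows and columns indexed by arbitrary finite sets.  That there are as many rows as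
columns is a consequence: both numbers are the trace of the identity, computed from \<open>A B\<close> and
\<open>B A\<close>.\<close>
lemma local_inverse:
  fixes A :: "'r \<Rightarrow> 'k \<Rightarrow> 'x \<Rightarrow> complex"
  assumes fin: "finite R" "finite K" and U: "U \<in> opens X" and x0: "x0 \<in> U"
    and A: "\<And>r k. r \<in> R \<Longrightarrow> k \<in> K \<Longrightarrow> A r k \<in> regular X U"
    and B0: "\<And>r r'. r \<in> R \<Longrightarrow> r' \<in> R \<Longrightarrow> (\<Sum>k\<in>K. A r k x0 * B0 k r') = (if r = r' then 1 else 0)"
    and B0': "\<And>k k'. k \<in> K \<Longrightarrow> k' \<in> K \<Longrightarrow> (\<Sum>r\<in>R. B0 k r * A r k' x0) = (if k = k' then 1 else 0)"
  shows "card R = card K \<and> (\<exists>W B. W \<in> opens X \<and> x0 \<in> W \<and> W \<subseteq> U \<and> (\<forall>k\<in>K. \<forall>r\<in>R. B k r \<in> regular X W) \<and>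
    (\<forall>x\<in>W. (\<forall>r\<in>R. \<forall>r'\<in>R. (\<Sum>k\<in>K. A r k x * B k r' x) = (if r = r' then 1 else 0)) \<and>
       (\<forall>k\<in>K. \<forall>k'\<in>K. (\<Sum>r\<in>R. B k r x * A r k' x) = (if k = k' then 1 else 0))))"
proof -
  have "of_nat (card R) = (\<Sum>r\<in>R. \<Sum>k\<in>K. A r k x0 * B0 k r)" by (simp add: B0)
  also have "\<dots> = (\<Sum>k\<in>K. \<Sum>r\<in>R. B0 k r * A r k x0)" by (subst sum.swap) (simp add: mult.commute)
  also have "\<dots> = of_nat (card K)" by (simp add: B0')
  finally have c: "card R = card K" by simp
  define n where "n = card R"
  obtain \<alpha> where \<alpha>: "bij_betw \<alpha> {..<n} R" using ex_bij_betw_nat_finite[OF fin(1)] unfolding n_def atLeast0LessThan by blast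
  obtain \<beta> where \<beta>: "bij_betw \<beta> {..<n} K" using ex_bij_betw_nat_finite[OF fin(2)] unfolding n_def c atLeast0LessThan by blast
  have \<alpha>R: "\<alpha> i \<in> R" if "i < n" for i using \<alpha> that by (auto simp: bij_betw_def)
  have \<beta>K: "\<beta> i \<in> K" if "i < n" for i using \<beta> that by (auto simp: bij_betw_def)
  have \<alpha>i: "\<alpha> i = \<alpha> j \<longleftrightarrow> i = j" if "i < n" "j < n" for i j using \<alpha> that by (auto simp: bij_betw_def inj_on_def)
  have \<beta>i: "\<beta> i = \<beta> j \<longleftrightarrow> i = j" if "i < n" "j < n" for i j using \<beta> that by (auto simp: bij_betw_def inj_on_def)
  have sK: "(\<Sum>j<n. g (\<beta> j)) = (\<Sum>k\<in>K. g k)" for g :: "'k \<Rightarrow> complex"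
    by (rule sum.reindex_bij_betw[OF \<beta>])
  have sR: "(\<Sum>j<n. g (\<alpha> j)) = (\<Sum>k\<in>R. g k)" for g :: "'r \<Rightarrow> complex"
    by (rule sum.reindex_bij_betw[OF \<alpha>])
  have "\<exists>W B. W \<in> opens X \<and> x0 \<in> W \<and> W \<subseteq> U \<and> (\<forall>j<n. \<forall>k<n. B j k \<in> regular X W) \<and>
    (\<forall>x\<in>W. \<forall>i<n. \<forall>k<n. (\<Sum>j<n. A (\<alpha> i) (\<beta> j) x * B j k x) = (if i = k then 1 else 0) \<and>
       (\<Sum>j<n. B i j x * A (\<alpha> j) (\<beta> k) x) = (if i = k then 1 else 0))"
  proof (rule local_inverse_nat[OF U x0])
    show "A (\<alpha> i) (\<beta> j) \<in> regular X U" if "i < n" "j < n" for i j using A \<alpha>R \<beta>K that by blast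
    show "(\<Sum>j<n. A (\<alpha> i) (\<beta> j) x0 * B0 (\<beta> j) (\<alpha> k)) = (if i = k then 1 else 0)" if "i < n" "k < n" for i k
      using sK[of "\<lambda>l. A (\<alpha> i) l x0 * B0 l (\<alpha> k)"] B0[OF \<alpha>R[OF that(1)] \<alpha>R[OF that(2)]] \<alpha>i[OF that] by simp
  qed
  then obtain W B where W: "W \<in> opens X" "x0 \<in> W" "W \<subseteq> U" and B: "\<forall>j<n. \<forall>k<n. B j k \<in> regular X W"
    and inv: "\<forall>x\<in>W. \<forall>i<n. \<forall>k<n. (\<Sum>j<n. A (\<alpha> i) (\<beta> j) x * B j k x) = (if i = k then 1 else 0) \<and>
       (\<Sum>j<n. B i j x * A (\<alpha> j) (\<beta> k) x) = (if i = k then 1 else 0)" 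
    by (elim exE conjE) (rule that; assumption)
  let ?a = "inv_into {..<n} \<alpha>" and ?b = "inv_into {..<n} \<beta>"
  have aR: "?a r < n" "\<alpha> (?a r) = r" if "r \<in> R" for r
    using \<alpha> that bij_betw_inv_into_right[OF \<alpha> that] inv_into_into[of r \<alpha> "{..<n}"] by (auto simp: bij_betw_def)
  have bK: "?b k < n" "\<beta> (?b k) = k" if "k \<in> K" for k
    using \<beta> that bij_betw_inv_into_right[OF \<beta> that] inv_into_into[of k \<beta> "{..<n}"] by (auto simp: bij_betw_def)
  have ai: "?a (\<alpha> i) = i" if "i < n" for i using \<alpha> that by (simp add: bij_betw_def)
  have bi: "?b (\<beta> i) = i" if "i < n" for i using \<beta> that by (simp add: bij_betw_def)
  have aeq: "?a r = ?a r' \<longleftrightarrow> r = r'" if "r \<in> R" "r' \<in> R" for r r' using aR that by metis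
  have beq: "?b r = ?b r' \<longleftrightarrow> r = r'" if "r \<in> K" "r' \<in> K" for r r' using bK that by metis
  define B' where "B' k r = B (?b k) (?a r)" for k r
  have 1: "B' k r \<in> regular X W" if "k \<in> K" "r \<in> R" for k r
    unfolding B'_def using B bK aR that by blast
  have 2: "(\<Sum>k\<in>K. A r k x * B' k r' x) = (if r = r' then 1 else 0)" if x: "x \<in> W" and r: "r \<in> R" "r' \<in> R" for x r r'
  proof -
    have "(\<Sum>k\<in>K. A r k x * B' k r' x) = (\<Sum>j<n. A r (\<beta> j) x * B' (\<beta> j) r' x)"
      using sK[of "\<lambda>l. A r l x * B' l r' x"] by simp
    also have "\<dots> = (\<Sum>j<n. A (\<alpha> (?a r)) (\<beta> j) x * B j (?a r') x)"
      by (rule sum.cong) (use aR r bi in \<open>auto simp: B'_def\<close>)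
    also have "\<dots> = (if r = r' then 1 else 0)"
      by (simp only: inv[rule_format, OF x aR(1)[OF r(1)] aR(1)[OF r(2)], THEN conjunct1] aeq[OF r])
    finally show ?thesis .
  qed
  have 3: "(\<Sum>r\<in>R. B' k r x * A r k' x) = (if k = k' then 1 else 0)" if x: "x \<in> W" and k: "k \<in> K" "k' \<in> K" for x k k'
  proof -
    have "(\<Sum>r\<in>R. B' k r x * A r k' x) = (\<Sum>j<n. B' k (\<alpha> j) x * A (\<alpha> j) k' x)"
      using sR[of "\<lambda>r. B' k r x * A r k' x"] by simp
    also have "\<dots> = (\<Sum>j<n. B (?b k) j x * A (\<alpha> j) (\<beta> (?b k')) x)"
      by (rule sum.cong) (use bK k ai in \<open>auto simp: B'_def\<close>)
    also have "\<dots> = (if k = k' then 1 else 0)"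
      by (simp only: inv[rule_format, OF x bK(1)[OF k(1)] bK(1)[OF k(2)], THEN conjunct2] beq[OF k])
    finally show ?thesis .
  qed
  show ?thesis
    by (intro conjI c exI[of _ W] exI[of _ B'] W ballI) (use 1 2 3 in auto)
qed

end

text \<open>Choose a set of columns that is minimal among those for which the matrix is still onto.  Its columns
are independent, since a column that occurs in a relation could be dropped.  So a right inverse on
these columns is a two-sided one.\<close>
lemma invertible_minor:
  fixes A :: "'r \<Rightarrow> 'k \<Rightarrow> complex"
  assumes fin: "finite R" "finite L"
    and surj: "\<And>t. \<exists>z. \<forall>r\<in>R. (\<Sum>l\<in>L. A r l * z l) = t r"
  shows "\<exists>K B. K \<subseteq> L \<and>
    (\<forall>r\<in>R. \<forall>r'\<in>R. (\<Sum>k\<in>K. A r k * B k r') = (if r = r' then 1 else 0)) \<and>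
    (\<forall>k\<in>K. \<forall>k'\<in>K. (\<Sum>r\<in>R. B k r * A r k') = (if k = k' then 1 else 0))"
proof -
  define S where "S K \<longleftrightarrow> K \<subseteq> L \<and> (\<forall>t. \<exists>z. \<forall>r\<in>R. (\<Sum>l\<in>K. A r l * z l) = t r)" for K
  have "S L" unfolding S_def using surj by blast
  then obtain K where K: "S K" "\<And>K'. S K' \<Longrightarrow> card K \<le> card K'"
    using ex_has_least_nat[of S L card] by blast
  have finK: "finite K" using K(1) fin finite_subset unfolding S_def by blast
  have sK: "\<exists>z. \<forall>r\<in>R. (\<Sum>l\<in>K. A r l * z l) = t r" for t using K(1) unfolding S_def by blast
  define B where "B k r' = (SOME z. \<forall>r\<in>R. (\<Sum>l\<in>K. A r l * z l) = (if r = r' then 1 else 0)) k" for k r'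
  have B: "(\<Sum>k\<in>K. A r k * B k r') = (if r = r' then 1 else 0)" if "r \<in> R" for r r'
    using someI_ex[OF sK[of "\<lambda>r. if r = r' then 1 else 0"]] that unfolding B_def by blast
  have ker: "z k0 = 0" if z: "\<And>r. r \<in> R \<Longrightarrow> (\<Sum>k\<in>K. A r k * z k) = 0" and k0: "k0 \<in> K" for z k0
  proof (rule ccontr)
    assume nz: "z k0 \<noteq> 0"
    have "S (K - {k0})" unfolding S_def
    proof (intro conjI allI)
      show "K - {k0} \<subseteq> L" using K(1) unfolding S_def by blast
      fix t
      obtain w where w: "\<forall>r\<in>R. (\<Sum>l\<in>K. A r l * w l) = t r" using sK by blast
      let ?w = "\<lambda>k. w k - (w k0 / z k0) * z k"
      have "(\<Sum>l\<in>K - {k0}. A r l * ?w l) = t r" if r: "r \<in> R" for r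
      proof -
        have "(\<Sum>l\<in>K. A r l * ?w l) = A r k0 * ?w k0 + (\<Sum>l\<in>K - {k0}. A r l * ?w l)"
          by (rule sum.remove[OF finK k0])
        moreover have "?w k0 = 0" using nz by simp
        moreover have "(\<Sum>l\<in>K. A r l * ?w l) = (\<Sum>l\<in>K. A r l * w l) - (w k0 / z k0) * (\<Sum>l\<in>K. A r l * z l)"
          by (simp add: sum_subtractf right_diff_distrib sum_distrib_left mult.left_commute)
        ultimately show ?thesis using w z r by simp
      qed
      then show "\<exists>z. \<forall>r\<in>R. (\<Sum>l\<in>K - {k0}. A r l * z l) = t r" by (intro exI[of _ ?w]) blast
    qed
    then have "card K \<le> card (K - {k0})" by (rule K(2))
    then show False using finK k0 by (metis card_Diff1_less not_le)
  qed
  have B': "(\<Sum>r\<in>R. B k r * A r k') = (if k = k' then 1 else 0)" if k: "k \<in> K" "k' \<in> K" for k k'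
  proof -
    have "(\<Sum>k\<in>K. A r k * ((\<Sum>r'\<in>R. B k r' * A r' k') - (if k = k' then 1 else 0))) = 0" if r: "r \<in> R" for r
    proof -
      have "(\<Sum>k\<in>K. A r k * (\<Sum>r'\<in>R. B k r' * A r' k')) = (\<Sum>k\<in>K. \<Sum>r'\<in>R. A r k * B k r' * A r' k')"
        by (simp add: sum_distrib_left mult.assoc)
      also have "\<dots> = (\<Sum>r'\<in>R. (\<Sum>k\<in>K. A r k * B k r') * A r' k')"
        by (subst sum.swap) (simp add: sum_distrib_right)
      also have "\<dots> = (\<Sum>r'\<in>R. if r' = r then A r' k' else 0)"
        by (rule sum.cong) (use B r in auto)
      also have "\<dots> = A r k'" using r fin by simp
      finally have 1: "(\<Sum>k\<in>K. A r k * (\<Sum>r'\<in>R. B k r' * A r' k')) = A r k'" .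
      have "(\<Sum>k\<in>K. A r k * (if k = k' then 1 else 0)) = (\<Sum>k\<in>K. if k = k' then A r k' else 0)"
        by (rule sum.cong) auto
      then have 2: "(\<Sum>k\<in>K. A r k * (if k = k' then 1 else 0)) = A r k'" using k finK by simp
      show ?thesis using 1 2 by (simp add: right_diff_distrib sum_subtractf)
    qed
    from ker[OF this k(1)] show ?thesis by simp
  qed
  have "K \<subseteq> L" using K(1) unfolding S_def by blast
  then show ?thesis using B B' by blast
qed

section \<open>Charts of Grassmannians\<close>

locale frame_bundle =
  fixes J :: "'i set" and V :: "'i \<Rightarrow> (complex, 'v) module" and e :: "'i \<Rightarrow> int"
  assumes finJ: "finite J" and vs: "i \<in> J \<Longrightarrow> cvs (V i)"
    and fd: "i \<in> J \<Longrightarrow> vectorspace.fin_dim CC (V i)"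
begin

abbreviation "n i \<equiv> nat (e i)"
abbreviation "Fr \<equiv> frames J V e"
abbreviation "F \<equiv> zariski Fr (frame_functions J V e)"
abbreviation "G \<equiv> grassmannian_product J V e"

definition sp :: "('i \<Rightarrow> nat \<Rightarrow> 'v) \<Rightarrow> 'i \<Rightarrow> 'v set" where
  "sp b = (\<lambda>i\<in>J. LinearCombinations.module.span CC (V i) (b i ` {..<n i}))"

lemma G_eq: "G = quotient_fspace F sp"
  unfolding grassmannian_product_def sp_def ..

lemma frames_iff:
  "b \<in> Fr \<longleftrightarrow> b \<in> (\<Pi>\<^sub>E i\<in>J. {..<n i} \<rightarrow>\<^sub>E carrier (V i)) \<and> (\<forall>i\<in>J. indep (V i) (n i) (b i))"
proof -
  have "(inj_on (b i) {..<n i} \<and> \<not> LinearCombinations.module.lin_dep CC (V i) (b i ` {..<n i})) \<longleftrightarrow>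
      indep (V i) (n i) (b i)" if b: "b \<in> (\<Pi>\<^sub>E i\<in>J. {..<n i} \<rightarrow>\<^sub>E carrier (V i))" and i: "i \<in> J" for i
  proof -
    interpret cvs "V i" by (rule vs[OF i])
    have "b i \<in> {..<n i} \<rightarrow>\<^sub>E carrier (V i)" using b i by (rule PiE_mem)
    then have "\<forall>k<n i. b i k \<in> carrier (V i)" by auto
    then show ?thesis by (rule frame_iff_indep)
  qed
  then show ?thesis unfolding frames_def by blast
qed

lemma frame_mem: "b \<in> Fr \<Longrightarrow> i \<in> J \<Longrightarrow> \<forall>k<n i. b i k \<in> carrier (V i)"
  unfolding frames_iff by (auto dest!: PiE_mem)

lemma frame_indep: "b \<in> Fr \<Longrightarrow> i \<in> J \<Longrightarrow> indep (V i) (n i) (b i)"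
  unfolding frames_iff by blast

lemma frameI:
  assumes "\<And>i k. i \<in> J \<Longrightarrow> k < n i \<Longrightarrow> b i k \<in> carrier (V i)" "\<And>i. i \<in> J \<Longrightarrow> indep (V i) (n i) (b i)"
  shows "(\<lambda>i\<in>J. \<lambda>k\<in>{..<n i}. b i k) \<in> Fr"
  unfolding frames_iff
proof (intro conjI ballI)
  show "(\<lambda>i\<in>J. \<lambda>k\<in>{..<n i}. b i k) \<in> (\<Pi>\<^sub>E i\<in>J. {..<n i} \<rightarrow>\<^sub>E carrier (V i))"
    using assms(1) by auto
  fix i assume i: "i \<in> J"
  have "lc (V i) c (\<lambda>k\<in>{..<n i}. b i k) (n i) = lc (V i) c (b i) (n i)" for c by (rule lc_cong) auto
  then show "indep (V i) (n i) ((\<lambda>i\<in>J. \<lambda>k\<in>{..<n i}. b i k) i)"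
    using assms(2)[OF i] i unfolding indep_def by simp
qed

lemma sp_eq: "b \<in> Fr \<Longrightarrow> i \<in> J \<Longrightarrow> sp b i = range (\<lambda>c. lc (V i) c (b i) (n i))"
  unfolding sp_def using cvs.span_tuple[OF vs frame_mem] by simp

lemma sp_ext: "sp b \<in> extensional J" unfolding sp_def by simp

lemma frame_in_sp: "b \<in> Fr \<Longrightarrow> i \<in> J \<Longrightarrow> k < n i \<Longrightarrow> b i k \<in> sp b i"
proof -
  assume b: "b \<in> Fr" and i: "i \<in> J" and k: "k < n i"
  interpret cvs "V i" by (rule vs[OF i])
  have "b i k = lc (V i) (\<lambda>j. if j = k then 1 else 0) (b i) (n i)"
    using lc_delta[OF frame_mem[OF b i] k, of 1] frame_mem[OF b i] k by simp
  then show "b i k \<in> sp b i" unfolding sp_eq[OF b i] by (rule image_eqI[where x = "\<lambda>j. if j = k then 1 else 0"]) simp_all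
qed

definition functionals :: "('i \<Rightarrow> nat \<Rightarrow> 'v \<Rightarrow> complex) \<Rightarrow> bool" where
  "functionals \<rho> \<longleftrightarrow> (\<forall>i\<in>J. \<forall>k<n i. lin_functional (V i) (\<rho> i k))"

definition dual :: "('i \<Rightarrow> nat \<Rightarrow> 'v \<Rightarrow> complex) \<Rightarrow> ('i \<Rightarrow> nat \<Rightarrow> 'v) \<Rightarrow> bool" where
  "dual \<rho> b \<longleftrightarrow> (\<forall>i\<in>J. \<forall>k<n i. \<forall>l<n i. \<rho> i k (b i l) = (if l = k then 1 else 0))"

text \<open>The usual affine charts: given functionals \<open>\<rho>\<close> on \<open>V i\<close>, as many as the prescribed dimension, the chart
consists of the subspaces on which they form a basis of the dual space.  Such a subspace has
exactly one basis dual to them, and \<open>sec \<rho>\<close> chooses it.  It is a section of the frame bundle.\<close>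
definition chart :: "('i \<Rightarrow> nat \<Rightarrow> 'v \<Rightarrow> complex) \<Rightarrow> ('i \<Rightarrow> 'v set) set" where
  "chart \<rho> = {N. \<exists>b\<in>Fr. sp b = N \<and> dual \<rho> b}"

definition sec :: "('i \<Rightarrow> nat \<Rightarrow> 'v \<Rightarrow> complex) \<Rightarrow> ('i \<Rightarrow> 'v set) \<Rightarrow> 'i \<Rightarrow> nat \<Rightarrow> 'v" where
  "sec \<rho> N = (SOME b. b \<in> Fr \<and> sp b = N \<and> dual \<rho> b)"

lemma sec:
  assumes "N \<in> chart \<rho>"
  shows "sec \<rho> N \<in> Fr" "sp (sec \<rho> N) = N" "dual \<rho> (sec \<rho> N)"
proof -
  have "\<exists>b. b \<in> Fr \<and> sp b = N \<and> dual \<rho> b" using assms unfolding chart_def by blast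
  from someI_ex[OF this] show "sec \<rho> N \<in> Fr" "sp (sec \<rho> N) = N" "dual \<rho> (sec \<rho> N)"
    unfolding sec_def by blast+
qed

lemma dual_expand:
  assumes "functionals \<rho>" "b \<in> Fr" "dual \<rho> b" "i \<in> J" "x \<in> sp b i"
  shows "x = lc (V i) (\<lambda>k. \<rho> i k x) (b i) (n i)"
proof -
  interpret cvs "V i" by (rule vs[OF assms(4)])
  obtain c where c: "x = lc (V i) c (b i) (n i)" using assms(5) sp_eq[OF assms(2,4)] by auto
  have "\<rho> i k x = c k" if "k < n i" for k
    unfolding c by (rule dual_coefficient[where \<rho> = "\<rho> i"])
      (use assms that frame_mem[OF assms(2,4)] in \<open>auto simp: functionals_def dual_def\<close>)
  then show ?thesis by (subst c, intro lc_cong) auto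
qed

lemma dual_unique:
  assumes \<rho>: "functionals \<rho>" and b: "b \<in> Fr" "dual \<rho> b" and b': "b' \<in> Fr" "dual \<rho> b'" and eq: "sp b = sp b'"
  shows "b = b'"
proof (rule PiE_ext)
  show P: "b \<in> (\<Pi>\<^sub>E i\<in>J. {..<n i} \<rightarrow>\<^sub>E carrier (V i))" "b' \<in> (\<Pi>\<^sub>E i\<in>J. {..<n i} \<rightarrow>\<^sub>E carrier (V i))"
    using b b' unfolding frames_iff by auto
  have E: "b i \<in> {..<n i} \<rightarrow>\<^sub>E carrier (V i)" "b' i \<in> {..<n i} \<rightarrow>\<^sub>E carrier (V i)" if "i \<in> J" for i
    by (rule PiE_mem[OF P(1) that], rule PiE_mem[OF P(2) that])
  fix i assume i: "i \<in> J"
  interpret cvs "V i" by (rule vs[OF i])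
  show "b i = b' i"
  proof (rule PiE_ext[OF E[OF i]])
    fix l assume l: "l \<in> {..<n i}"
    have "b' i l \<in> sp b i" unfolding eq using frame_in_sp[OF b'(1) i] l by simp
    then have "b' i l = lc (V i) (\<lambda>k. \<rho> i k (b' i l)) (b i) (n i)"
      by (rule dual_expand[OF \<rho> b i])
    also have "\<dots> = lc (V i) (\<lambda>k. if k = l then 1 else 0) (b i) (n i)"
      by (rule lc_cong) (use b'(2) i l in \<open>auto simp: dual_def\<close>)
    also have "\<dots> = b i l" using lc_delta[OF frame_mem[OF b(1) i], of l 1] frame_mem[OF b(1) i] l by simp
    finally show "b i l = b' i l" by simp
  qed
qed

lemma sec_unique: "functionals \<rho> \<Longrightarrow> b \<in> Fr \<Longrightarrow> dual \<rho> b \<Longrightarrow> sec \<rho> (sp b) = b"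
proof -
  assume a: "functionals \<rho>" "b \<in> Fr" "dual \<rho> b"
  then have "sp b \<in> chart \<rho>" unfolding chart_def by blast
  from dual_unique[OF a(1) sec(1)[OF this] sec(3)[OF this] a(2,3) sec(2)[OF this]]
  show "sec \<rho> (sp b) = b" .
qed

interpretation F: variety F unfolding frame_functions_def by (rule variety_zariski)
interpretation G: space_with_functions G unfolding G_eq by (rule F.space_with_functions_quotient)

lemma space_with_functions_G: "space_with_functions G" ..

lemma frame_coordinate_regular:
  "i \<in> J \<Longrightarrow> k < n i \<Longrightarrow> lin_functional (V i) \<xi> \<Longrightarrow> (\<lambda>b. \<xi> (b i k)) \<in> regular F U"
  unfolding frame_functions_def by (intro alg_gen_regular_zariski alg_gen.gen) blast

lemma points_G: "points G = sp ` Fr" unfolding G_eq by simp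

lemma chart_subset: "chart \<rho> \<subseteq> points G" unfolding points_G chart_def by blast

text \<open>The dual frame is obtained from a frame \<open>b\<close> by the inverse of the matrix \<open>\<rho> i j (b i l)\<close>.  The
matrix is invertible at \<open>b0\<close>, since there the dual frame exists, and \<open>local_inverse_nat\<close> gives a
regular inverse nearby.\<close>
lemma chart_local:
  assumes \<rho>: "functionals \<rho>" and b0: "b0 \<in> Fr" and c0: "sp b0 \<in> chart \<rho>"
  shows "\<exists>W\<in>opens F. b0 \<in> W \<and> (\<forall>b\<in>W. sp b \<in> chart \<rho>) \<and>
    (\<forall>i\<in>J. \<forall>l<n i. \<forall>\<xi>. lin_functional (V i) \<xi> \<longrightarrow> (\<lambda>b. \<xi> (sec \<rho> (sp b) i l)) \<in> regular F W)"
proof -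
  note s0 = sec[OF c0]
  have ex: "\<exists>W B. W \<in> opens F \<and> b0 \<in> W \<and> W \<subseteq> Fr \<and> (\<forall>j<n i. \<forall>k<n i. B j k \<in> regular F W) \<and>
    (\<forall>x\<in>W. \<forall>j<n i. \<forall>k<n i. (\<Sum>l<n i. \<rho> i j (x i l) * B l k x) = (if j = k then 1 else 0) \<and>
       (\<Sum>l<n i. B j l x * \<rho> i l (x i k)) = (if j = k then 1 else 0))" if i: "i \<in> J" for i
  proof -
    interpret cvs "V i" by (rule vs[OF i])
    have "\<exists>c. sec \<rho> (sp b0) i l = lc (V i) c (b0 i) (n i)" if "l < n i" for l
      using frame_in_sp[OF s0(1) i that] unfolding s0(2) sp_eq[OF b0 i] by blast
    then obtain C where C: "\<And>l. l < n i \<Longrightarrow> sec \<rho> (sp b0) i l = lc (V i) (C l) (b0 i) (n i)" by metis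
    show ?thesis
    proof (rule F.local_inverse_nat[of _ _ _ "\<lambda>j l x. \<rho> i j (x i l)" "\<lambda>l k. C k l"])
      show "Fr \<in> opens F" using F.opens_points by simp
      show "(\<lambda>x. \<rho> i j (x i l)) \<in> regular F Fr" if "j < n i" "l < n i" for j l
        by (rule frame_coordinate_regular[OF i that(2)]) (use \<rho> i that in \<open>simp add: functionals_def\<close>)
      show "(\<Sum>l<n i. \<rho> i j (b0 i l) * C k l) = (if j = k then 1 else 0)" if jk: "j < n i" "k < n i" for j k
      proof -
        have "\<rho> i j (sec \<rho> (sp b0) i k) = (\<Sum>l<n i. C k l * \<rho> i j (b0 i l))"
          unfolding C[OF jk(2)] by (rule lc_functional) (use \<rho> i jk frame_mem[OF b0 i] in \<open>auto simp: functionals_def\<close>)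
        moreover have "\<rho> i j (sec \<rho> (sp b0) i k) = (if k = j then 1 else 0)"
          using s0(3) i jk unfolding dual_def by blast
        ultimately show ?thesis by (auto simp: mult.commute)
      qed
    qed (rule b0)
  qed
  then have "\<forall>i\<in>J. \<exists>W B. W \<in> opens F \<and> b0 \<in> W \<and> W \<subseteq> Fr \<and> (\<forall>j<n i. \<forall>k<n i. B j k \<in> regular F W) \<and>
    (\<forall>x\<in>W. \<forall>j<n i. \<forall>k<n i. (\<Sum>l<n i. \<rho> i j (x i l) * B l k x) = (if j = k then 1 else 0) \<and>
       (\<Sum>l<n i. B j l x * \<rho> i l (x i k)) = (if j = k then 1 else 0))" by (intro ballI)
  from bchoice[OF this] obtain W where "\<forall>i\<in>J. \<exists>B. W i \<in> opens F \<and> b0 \<in> W i \<and> W i \<subseteq> Fr \<and> (\<forall>j<n i. \<forall>k<n i. B j k \<in> regular F (W i)) \<and>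
    (\<forall>x\<in>W i. \<forall>j<n i. \<forall>k<n i. (\<Sum>l<n i. \<rho> i j (x i l) * B l k x) = (if j = k then 1 else 0) \<and>
       (\<Sum>l<n i. B j l x * \<rho> i l (x i k)) = (if j = k then 1 else 0))" by (elim exE) (rule that)
  from bchoice[OF this] obtain B where WB: "\<forall>i\<in>J. W i \<in> opens F \<and> b0 \<in> W i \<and> W i \<subseteq> Fr \<and> (\<forall>j<n i. \<forall>k<n i. B i j k \<in> regular F (W i)) \<and>
    (\<forall>x\<in>W i. \<forall>j<n i. \<forall>k<n i. (\<Sum>l<n i. \<rho> i j (x i l) * B i l k x) = (if j = k then 1 else 0) \<and>
       (\<Sum>l<n i. B i j l x * \<rho> i l (x i k)) = (if j = k then 1 else 0))" by (elim exE) (rule that)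
  define W' where "W' = {b \<in> Fr. \<forall>i\<in>J. b \<in> W i}"
  have W': "W' \<in> opens F" unfolding W'_def
    using F.opens_finite_INT[OF finJ, of W] WB by simp
  have Wi: "W i \<in> opens F" "W' \<subseteq> W i" if "i \<in> J" for i using WB that unfolding W'_def by auto
  have Br: "B i j k \<in> regular F W'" if "i \<in> J" "j < n i" "k < n i" for i j k
    by (rule F.regular_restrict[OF _ Wi(1)[OF that(1)] W' Wi(2)[OF that(1)]]) (use WB that in blast)
  have inv1: "(\<Sum>l<n i. \<rho> i j (b i l) * B i l k b) = (if j = k then 1 else 0)"
    if "b \<in> W'" "i \<in> J" "j < n i" "k < n i" for b i j k using WB that Wi(2)[OF that(2)] by blast
  have inv2: "(\<Sum>l<n i. B i j l b * \<rho> i l (b i k)) = (if j = k then 1 else 0)"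
    if "b \<in> W'" "i \<in> J" "j < n i" "k < n i" for b i j k using WB that Wi(2)[OF that(2)] by blast
  define b' where "b' b = (\<lambda>i\<in>J. \<lambda>l\<in>{..<n i}. lc (V i) (\<lambda>k. B i k l b) (b i) (n i))" for b
  have b': "b' b \<in> Fr \<and> dual \<rho> (b' b) \<and> sp (b' b) = sp b" if b: "b \<in> W'" for b
  proof (intro conjI)
    have bF: "b \<in> Fr" using b unfolding W'_def by blast
    have b'm: "b' b i l = lc (V i) (\<lambda>k. B i k l b) (b i) (n i)" if "i \<in> J" "l < n i" for i l
      using that unfolding b'_def by simp
    have du: "\<rho> i k (lc (V i) (\<lambda>k. B i k l b) (b i) (n i)) = (if l = k then 1 else 0)"
      if i: "i \<in> J" and k: "k < n i" "l < n i" for i k l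
    proof -
      interpret cvs "V i" by (rule vs[OF i])
      have "\<rho> i k (lc (V i) (\<lambda>k. B i k l b) (b i) (n i)) = (\<Sum>j<n i. B i j l b * \<rho> i k (b i j))"
        by (rule lc_functional) (use \<rho> i k frame_mem[OF bF i] in \<open>auto simp: functionals_def\<close>)
      also have "\<dots> = (if k = l then 1 else 0)" using inv1[OF b i k] by (simp add: mult.commute)
      finally show ?thesis by auto
    qed
    show "dual \<rho> (b' b)" unfolding dual_def using du b'm by simp
    have mem: "lc (V i) (\<lambda>k. B i k l b) (b i) (n i) \<in> carrier (V i)" if "i \<in> J" for i l
      by (rule cvs.lc_mem[OF vs[OF that] frame_mem[OF bF that]])
    show b'F: "b' b \<in> Fr" unfolding b'_def
    proof (rule frameI)
      show "lc (V i) (\<lambda>k. B i k l b) (b i) (n i) \<in> carrier (V i)" if "i \<in> J" for i l by (rule mem[OF that])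
      show "indep (V i) (n i) (\<lambda>l. lc (V i) (\<lambda>k. B i k l b) (b i) (n i))" if i: "i \<in> J" for i
        by (rule cvs.dual_indep[OF vs[OF i], of _ _ "\<rho> i"])
          (use mem[OF i] \<rho> du[OF i] i in \<open>auto simp: functionals_def\<close>)
    qed
    show "sp (b' b) = sp b"
    proof (rule extensionalityI[OF sp_ext sp_ext])
      fix i assume i: "i \<in> J"
      interpret cvs "V i" by (rule vs[OF i])
      have e1: "lc (V i) c (b' b i) (n i) = lc (V i) (\<lambda>j. \<Sum>l<n i. c l * B i j l b) (b i) (n i)" for c
      proof -
        have "lc (V i) c (b' b i) (n i) = lc (V i) c (\<lambda>l. lc (V i) (\<lambda>k. B i k l b) (b i) (n i)) (n i)"
          by (rule lc_cong) (use b'm[OF i] in auto)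
        then show ?thesis using lc_lc[OF frame_mem[OF bF i]] by simp
      qed
      have e2: "lc (V i) c (b i) (n i) = lc (V i) (\<lambda>l. \<Sum>k<n i. c k * \<rho> i l (b i k)) (b' b i) (n i)" for c
        unfolding e1
      proof (rule lc_cong)
        fix j assume j: "j < n i"
        have "(\<Sum>l<n i. (\<Sum>k<n i. c k * \<rho> i l (b i k)) * B i j l b)
            = (\<Sum>l<n i. \<Sum>k<n i. c k * (B i j l b * \<rho> i l (b i k)))"
          unfolding sum_distrib_right by (intro sum.cong refl) (simp add: mult_ac)
        also have "\<dots> = (\<Sum>k<n i. c k * (\<Sum>l<n i. B i j l b * \<rho> i l (b i k)))"
          by (subst sum.swap) (simp add: sum_distrib_left)
        also have "\<dots> = (\<Sum>k<n i. if k = j then c k else 0)"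
          by (rule sum.cong) (use inv2[OF b i j] in auto)
        also have "\<dots> = c j" using j by simp
        finally show "c j = (\<Sum>l<n i. (\<Sum>k<n i. c k * \<rho> i l (b i k)) * B i j l b)" by simp
      qed simp
      show "sp (b' b) i = sp b i" unfolding sp_eq[OF b'F i] sp_eq[OF bF i]
      proof (intro equalityI image_subsetI)
        show "lc (V i) c (b' b i) (n i) \<in> range (\<lambda>c. lc (V i) c (b i) (n i))" for c
          by (rule image_eqI[where x = "\<lambda>j. \<Sum>l<n i. c l * B i j l b"]) (rule e1, rule UNIV_I)
        show "lc (V i) c (b i) (n i) \<in> range (\<lambda>c. lc (V i) c (b' b i) (n i))" for c
          by (rule image_eqI[where x = "\<lambda>l. \<Sum>k<n i. c k * \<rho> i l (b i k)"]) (rule e2, rule UNIV_I)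
      qed
    qed
  qed
  have b0W: "b0 \<in> W'" unfolding W'_def using b0 WB by blast
  have inchart: "sp b \<in> chart \<rho>" if "b \<in> W'" for b using b'[OF that] unfolding chart_def by blast
  have secb: "sec \<rho> (sp b) = b' b" if "b \<in> W'" for b
    using sec_unique[OF \<rho>, of "b' b"] b'[OF that] by simp
  have reg: "(\<lambda>b. \<xi> (sec \<rho> (sp b) i l)) \<in> regular F W'"
    if i: "i \<in> J" and l: "l < n i" and \<xi>: "lin_functional (V i) \<xi>" for i l \<xi>
  proof (rule F.regular_cong[OF _ W'])
    show "(\<lambda>b. \<Sum>k<n i. B i k l b * \<xi> (b i k)) \<in> regular F W'"
      by (intro F.regular_sum[OF W'] F.regular_mult[OF W'] Br frame_coordinate_regular) (use i l \<xi> in auto)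
    fix b assume b: "b \<in> W'"
    then have bF: "b \<in> Fr" unfolding W'_def by blast
    interpret cvs "V i" by (rule vs[OF i])
    have "\<xi> (sec \<rho> (sp b) i l) = \<xi> (lc (V i) (\<lambda>k. B i k l b) (b i) (n i))"
      unfolding secb[OF b] b'_def using i l by simp
    also have "\<dots> = (\<Sum>k<n i. B i k l b * \<xi> (b i k))"
      by (rule lc_functional[OF \<xi> frame_mem[OF bF i]])
    finally show "\<xi> (sec \<rho> (sp b) i l) = (\<Sum>k<n i. B i k l b * \<xi> (b i k))" .
  qed
  show ?thesis
    by (rule bexI[OF _ W']) (use b0W inchart reg in blast)
qed

lemma preimage_chart_open:
  assumes "functionals \<rho>" shows "{b \<in> Fr. sp b \<in> chart \<rho>} \<in> opens F"
proof (rule F.opens_local)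
  fix b assume b: "b \<in> {b \<in> Fr. sp b \<in> chart \<rho>}"
  then obtain W where W: "W \<in> opens F" "b \<in> W" "\<forall>b\<in>W. sp b \<in> chart \<rho>"
    using chart_local[OF assms, of b] by blast
  then show "\<exists>W\<in>opens F. b \<in> W \<and> W \<subseteq> {b \<in> Fr. sp b \<in> chart \<rho>}"
    using F.opens_subset[OF W(1)] by (intro bexI[OF _ W(1)]) auto
qed

lemma chart_open:
  assumes "functionals \<rho>" shows "chart \<rho> \<in> opens G"
  unfolding G_eq open_quotient_iff
  using chart_subset[of \<rho>] preimage_chart_open[OF assms] by (simp add: points_G)

lemma sec_regular:
  assumes \<rho>: "functionals \<rho>" and i: "i \<in> J" and l: "l < n i" and \<xi>: "lin_functional (V i) \<xi>"
  shows "(\<lambda>N. \<xi> (sec \<rho> N i l)) \<in> regular G (chart \<rho>)"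
  unfolding G_eq regular_quotient_iff points_zariski
proof (rule F.regular_local[OF preimage_chart_open[OF \<rho>]])
  fix b assume b: "b \<in> {b \<in> Fr. sp b \<in> chart \<rho>}"
  then obtain W where W: "W \<in> opens F" "b \<in> W" "\<forall>b\<in>W. sp b \<in> chart \<rho>"
    "(\<lambda>b. \<xi> (sec \<rho> (sp b) i l)) \<in> regular F W"
    using chart_local[OF \<rho>, of b] i l \<xi> by blast
  show "\<exists>V\<in>opens F. b \<in> V \<and> (\<exists>g\<in>regular F V. \<forall>y\<in>V \<inter> {b \<in> Fr. sp b \<in> chart \<rho>}. \<xi> (sec \<rho> (sp y) i l) = g y)"
    by (rule bexI[OF _ W(1)], rule conjI[OF W(2)], rule bexI[OF _ W(4)]) simp
qed

text \<open>The first coordinates with respect to any completion of the frame to a basis will do.\<close>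
lemma in_some_chart:
  assumes b: "b \<in> Fr"
  shows "\<exists>\<rho>. functionals \<rho> \<and> sp b \<in> chart \<rho>"
proof -
  have "\<exists>r. (\<forall>k<n i. lin_functional (V i) (r k)) \<and> (\<forall>k<n i. \<forall>l<n i. r k (b i l) = (if l = k then 1 else 0))"
    if i: "i \<in> J" for i
  proof -
    interpret cvs "V i" by (rule vs[OF i])
    have VV: "VectorSpace.subspace CC (carrier (V i)) (V i)" by (simp add: subspace_iff)
    obtain m b' where b': "n i \<le> m" "\<forall>k<n i. b' k = b i k" "\<forall>k<m. b' k \<in> carrier (V i)" "indep (V i) m b'"
      "\<forall>x\<in>carrier (V i). \<exists>c. x = lc (V i) c b' m"
      using extend_indep[OF fd[OF i] VV frame_mem[OF b i] frame_indep[OF b i]]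
      by (elim exE conjE) (rule that; assumption)
    from coordinates[OF b'(3,4,5)] obtain \<xi> where x: "\<forall>k<m. lin_functional (V i) (\<xi> k)"
      "\<forall>k<m. \<forall>j<m. \<xi> k (b' j) = (if j = k then 1 else 0)" by (elim exE conjE) (rule that; assumption)
    have "\<xi> k (b i l) = (if l = k then 1 else 0)" if "k < n i" "l < n i" for k l
      using that b'(1) b'(2)[rule_format, OF that(2)] x(2)[rule_format, of k l] by simp
    then show ?thesis using b'(1) x(1) by (intro exI[of _ \<xi>]) auto
  qed
  then have "\<forall>i\<in>J. \<exists>r. (\<forall>k<n i. lin_functional (V i) (r k)) \<and> (\<forall>k<n i. \<forall>l<n i. r k (b i l) = (if l = k then 1 else 0))"
    by (intro ballI)
  from bchoice[OF this] obtain \<rho> where \<rho>: "\<forall>i\<in>J. (\<forall>k<n i. lin_functional (V i) (\<rho> i k)) \<and>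
     (\<forall>k<n i. \<forall>l<n i. \<rho> i k (b i l) = (if l = k then 1 else 0))" by (elim exE) (rule that)
  then have "functionals \<rho>" "dual \<rho> b" unfolding functionals_def dual_def by simp_all
  then show ?thesis using b unfolding chart_def by blast
qed

lemma variety_G: "variety G"
  unfolding G_eq frame_functions_def
proof (rule variety_quotient_zariski)
  fix x assume "x \<in> sp ` Fr"
  then obtain \<rho> where \<rho>: "functionals \<rho>" "x \<in> chart \<rho>" using in_some_chart by blast
  note c = chart_open[OF \<rho>(1), unfolded G_eq frame_functions_def]
  note r = sec_regular[OF \<rho>(1), unfolded G_eq frame_functions_def]
  show "\<exists>U s. U \<in> opens (quotient_fspace (zariski Fr (alg_gen {\<lambda>b. \<xi> (b i k) | i k \<xi>. i \<in> J \<and> k < n i \<and> lin_functional (V i) \<xi>})) sp) \<and> x \<in> U \<and>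
     (\<forall>y\<in>U. s y \<in> Fr \<and> sp (s y) = y) \<and>
     (\<forall>g\<in>{\<lambda>b. \<xi> (b i k) | i k \<xi>. i \<in> J \<and> k < n i \<and> lin_functional (V i) \<xi>}.
         g \<circ> s \<in> regular (quotient_fspace (zariski Fr (alg_gen {\<lambda>b. \<xi> (b i k) | i k \<xi>. i \<in> J \<and> k < n i \<and> lin_functional (V i) \<xi>})) sp) U)"
    by (rule exI[of _ "chart \<rho>"], rule exI[of _ "sec \<rho>"]) (use c r \<rho> sec in \<open>auto simp: comp_def\<close>)
qed

text \<open>A map into the Grassmannian is a morphism as soon as it lifts to a map into frames with regular
coordinates.\<close>
lemma morphism_into_G:
  assumes X: "space_with_functions X"
    and s: "\<And>x. x \<in> points X \<Longrightarrow> s x \<in> Fr" "\<And>x. x \<in> points X \<Longrightarrow> g x = sp (s x)"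
    and r: "\<And>i k \<xi>. i \<in> J \<Longrightarrow> k < n i \<Longrightarrow> lin_functional (V i) \<xi> \<Longrightarrow> (\<lambda>x. \<xi> (s x i k)) \<in> regular X (points X)"
  shows "morphism X G g"
  unfolding G_eq
proof (rule morphism_into_quotient[OF X])
  show "morphism X F s" unfolding frame_functions_def
    by (rule space_with_functions.morphism_into_zariski[OF X]) (use s r in auto)
qed (rule s(2))

end

lemma subreps_subspace:
  "N \<in> subreps Q M \<Longrightarrow> i \<in> verts Q \<Longrightarrow> VectorSpace.subspace CC (N i) (space M i)"
  unfolding subreps_def by blast

lemma subreps_act:
  "N \<in> subreps Q M \<Longrightarrow> a \<in> arcs Q \<Longrightarrow> x \<in> N (tail Q a) \<Longrightarrow> act M a x \<in> N (head Q a)"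
  unfolding subreps_def by blast

locale rep_bundle =
  fixes Q :: "('i, 'a) pre_digraph" and M :: "('i, 'a, 'v) rep" and e :: "'i \<Rightarrow> int"
  assumes finQ: "finite (verts Q)" and M: "representation Q M"
begin

sublocale frame_bundle "verts Q" "space M" e
proof (rule frame_bundle.intro)
  show "cvs (space M i)" if "i \<in> verts Q" for i using M that unfolding representation_def cvs_def by blast
  show "vectorspace.fin_dim CC (space M i)" if "i \<in> verts Q" for i using M that unfolding representation_def by blast
qed (rule finQ)

abbreviation "Gp \<equiv> quiver_Gr_points Q e M"

lemma quiver_Gr_frame:
  assumes N: "N \<in> Gp"
  shows "\<exists>b\<in>Fr. sp b = N"
proof -
  have "\<forall>i\<in>verts Q. \<exists>b. (\<forall>k<n i. b k \<in> N i) \<and> indep (space M i) (n i) b \<and> N i = range (\<lambda>c. lc (space M i) c b (n i))"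
  proof
    fix i assume i: "i \<in> verts Q"
    interpret cvs "space M i" by (rule vs[OF i])
    have W: "VectorSpace.subspace CC (N i) (space M i)" using N i unfolding quiver_Gr_points_def subreps_def by blast
    have "vectorspace.dim CC (space M i\<lparr>carrier := N i\<rparr>) = n i"
      using N i unfolding quiver_Gr_points_def by (auto simp: dimvec_def sub_rep_def)
    then show "\<exists>b. (\<forall>k<n i. b k \<in> N i) \<and> indep (space M i) (n i) b \<and> N i = range (\<lambda>c. lc (space M i) c b (n i))"
      by (rule iffD1[OF subspace_dim_iff(1)[OF fd[OF i] W]])
  qed
  from bchoice[OF this] obtain b where b: "\<forall>i\<in>verts Q. (\<forall>k<n i. b i k \<in> N i) \<and> indep (space M i) (n i) (b i) \<and>
     N i = range (\<lambda>c. lc (space M i) c (b i) (n i))" by (elim exE) (rule that)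
  let ?b = "\<lambda>i\<in>verts Q. \<lambda>k\<in>{..<n i}. b i k"
  have NV: "N i \<subseteq> carrier (space M i)" if "i \<in> verts Q" for i
  proof -
    have "N \<in> subreps Q M" using N unfolding quiver_Gr_points_def by blast
    from subreps_subspace[OF this that] show ?thesis unfolding cvs.subspace_iff[OF vs[OF that]] by (rule conjunct1)
  qed
  have bi: "\<forall>k<n i. b i k \<in> N i" "indep (space M i) (n i) (b i)" if "i \<in> verts Q" for i
    by (rule conjunct1[OF bspec[OF b that]], rule conjunct1[OF conjunct2[OF bspec[OF b that]]])
  have F: "?b \<in> Fr"
  proof (rule frameI)
    show "b i k \<in> carrier (space M i)" if "i \<in> verts Q" "k < n i" for i k
      using bi(1)[OF that(1)] NV[OF that(1)] that(2) by auto
  qed (rule bi(2))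
  have "sp ?b = N"
  proof (rule extensionalityI[OF sp_ext])
    show "N \<in> extensional (verts Q)" using N unfolding quiver_Gr_points_def subreps_def by blast
    fix i assume i: "i \<in> verts Q"
    have "lc (space M i) c (?b i) (n i) = lc (space M i) c (b i) (n i)" for c
      by (rule lc_cong) (use i in auto)
    then show "sp ?b i = N i" unfolding sp_eq[OF F i] using b i by simp
  qed
  then show ?thesis using F by blast
qed

lemma quiver_Gr_pointsI:
  assumes b: "b \<in> Fr" and e: "\<And>i. i \<in> verts Q \<Longrightarrow> 0 \<le> e i"
    and act: "\<And>a k. a \<in> arcs Q \<Longrightarrow> tail Q a \<in> verts Q \<Longrightarrow> head Q a \<in> verts Q \<Longrightarrow> k < n (tail Q a) \<Longrightarrow> act M a (b (tail Q a) k) \<in> sp b (head Q a)"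
    and Q: "wf_digraph Q"
  shows "sp b \<in> Gp"
proof -
  have W: "VectorSpace.subspace CC (sp b i) (space M i)" if i: "i \<in> verts Q" for i
    using cvs.span_tuple[OF vs[OF i] frame_mem[OF b i]] sp_eq[OF b i]
      vectorspace.span_is_subspace[of CC "space M i" "b i ` {..<n i}"] vs[OF i] frame_mem[OF b i]
    unfolding cvs_def by auto
  have "vectorspace.dim CC (space M i\<lparr>carrier := sp b i\<rparr>) = n i" if i: "i \<in> verts Q" for i
    by (rule iffD2[OF cvs.subspace_dim_iff(1)[OF vs[OF i] fd[OF i] W[OF i]]])
      (intro exI[of _ "b i"] conjI allI impI frame_in_sp[OF b i] frame_indep[OF b i] sp_eq[OF b i])
  then have d: "dimvec (sub_rep M (sp b)) i = e i" if i: "i \<in> verts Q" for i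
    using e[OF i] i by (simp add: dimvec_def sub_rep_def)
  have "act M a ` sp b (tail Q a) \<subseteq> sp b (head Q a)" if a: "a \<in> arcs Q" for a
  proof
    have ends: "tail Q a \<in> verts Q" "head Q a \<in> verts Q"
      using Q a by (auto simp: wf_digraph.tail_in_verts wf_digraph.head_in_verts)
    have lin: "linear_map CC (space M (tail Q a)) (space M (head Q a)) (act M a)"
      using M a unfolding representation_def by blast
    fix y assume "y \<in> act M a ` sp b (tail Q a)"
    then obtain c where y: "y = act M a (lc (space M (tail Q a)) c (b (tail Q a)) (n (tail Q a)))"
      unfolding sp_eq[OF b ends(1)] by blast
    have "y = lc (space M (head Q a)) c (\<lambda>k. act M a (b (tail Q a) k)) (n (tail Q a))"
      unfolding y by (rule lc_linear_map[OF lin]) (use frame_mem[OF b ends(1)] in blast)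
    also have "\<dots> \<in> sp b (head Q a)"
      by (rule cvs.lc_mem_subspace[OF vs[OF ends(2)] W[OF ends(2)]]) (use act[OF a ends] in blast)
    finally show "y \<in> sp b (head Q a)" .
  qed
  then show ?thesis unfolding quiver_Gr_points_def subreps_def using W d sp_ext by blast
qed

lemma Gp_subset: "Gp \<subseteq> points G"
  using quiver_Gr_frame unfolding points_G by blast

lemma variety_quiver_Gr: "variety (quiver_Gr Q e M)"
  unfolding quiver_Gr_def by (rule variety.variety_induced[OF variety_G Gp_subset])

lemma points_quiver_Gr: "points (quiver_Gr Q e M) = Gp" unfolding quiver_Gr_def by simp

lemma chart_open_quiver_Gr: "functionals \<rho> \<Longrightarrow> chart \<rho> \<inter> Gp \<in> opens (quiver_Gr Q e M)"
  unfolding quiver_Gr_def opens_induced_iff using chart_open by blast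

lemma sec_regular_quiver_Gr:
  assumes "functionals \<rho>" "i \<in> verts Q" "l < n i" "lin_functional (space M i) \<xi>"
  shows "(\<lambda>N. \<xi> (sec \<rho> N i l)) \<in> regular (quiver_Gr Q e M) (chart \<rho> \<inter> Gp)"
  unfolding quiver_Gr_def
  by (rule space_with_functions.regular_induced[OF space_with_functions_G chart_open[OF assms(1)] sec_regular[OF assms]])

lemma morphism_into_quiver_Gr:
  assumes "space_with_functions X" "\<And>x. x \<in> points X \<Longrightarrow> s x \<in> Fr" "\<And>x. x \<in> points X \<Longrightarrow> g x = sp (s x)"
    "\<And>i k \<xi>. i \<in> verts Q \<Longrightarrow> k < n i \<Longrightarrow> lin_functional (space M i) \<xi> \<Longrightarrow> (\<lambda>x. \<xi> (s x i k)) \<in> regular X (points X)"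
    "\<And>x. x \<in> points X \<Longrightarrow> g x \<in> Gp"
  shows "morphism X (quiver_Gr Q e M) g"
  unfolding quiver_Gr_def
proof (rule space_with_functions.morphism_into_induced[OF assms(1)])
  show "morphism X G g"
  proof (rule morphism_into_G[where s = s])
    show "space_with_functions X" by (rule assms(1))
    show "s x \<in> Fr" "g x = sp (s x)" if "x \<in> points X" for x by (rule assms(2)[OF that], rule assms(3)[OF that])
    show "(\<lambda>x. \<xi> (s x i k)) \<in> regular X (points X)"
      if "i \<in> verts Q" "k < n i" "lin_functional (space M i) \<xi>" for i k \<xi> by (rule assms(4)[OF that])
  qed
qed (rule assms(5))

end

section \<open>Quotient spaces\<close>

locale quotient_cvs = cvs V for V :: "(complex, 'v) module" +
  fixes W assumes W: "VectorSpace.subspace CC W V"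
begin

abbreviation q :: "'v \<Rightarrow> 'v set" where "q x \<equiv> a_r_coset V W x"

lemma WV: "w \<in> W \<Longrightarrow> w \<in> carrier V" and W0: "\<zero>\<^bsub>V\<^esub> \<in> W"
  and Wadd: "w \<in> W \<Longrightarrow> w' \<in> W \<Longrightarrow> w \<oplus>\<^bsub>V\<^esub> w' \<in> W" and Wsmult: "w \<in> W \<Longrightarrow> c \<odot>\<^bsub>V\<^esub> w \<in> W"
  using W unfolding subspace_iff by auto

lemma mem_q: "y \<in> q x \<longleftrightarrow> (\<exists>w\<in>W. y = w \<oplus>\<^bsub>V\<^esub> x)"
  unfolding a_r_coset_def' by blast

lemma q_self: "x \<in> carrier V \<Longrightarrow> x \<in> q x"
  unfolding mem_q using W0 by (intro bexI[of _ "\<zero>\<^bsub>V\<^esub>"]) auto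

lemma q_carrier: "x \<in> carrier V \<Longrightarrow> y \<in> q x \<Longrightarrow> y \<in> carrier V"
  unfolding mem_q using WV by auto

text \<open>This makes the union over representatives in \<open>quotient_space\<close> a union of equal sets.\<close>
lemma q_eq_of_mem:
  assumes x: "x \<in> carrier V" and y: "y \<in> q x" shows "q y = q x"
proof -
  obtain w where w: "w \<in> W" "y = w \<oplus>\<^bsub>V\<^esub> x" using y mem_q by blast
  have "v \<oplus>\<^bsub>V\<^esub> y = (v \<oplus>\<^bsub>V\<^esub> w) \<oplus>\<^bsub>V\<^esub> x" if "v \<in> W" for v
    using w x WV that by (simp add: M.a_assoc)
  moreover have "v \<oplus>\<^bsub>V\<^esub> x = (v \<oplus>\<^bsub>V\<^esub> (-1) \<odot>\<^bsub>V\<^esub> w) \<oplus>\<^bsub>V\<^esub> y" if v: "v \<in> W" for v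
  proof -
    have "(v \<oplus>\<^bsub>V\<^esub> (-1) \<odot>\<^bsub>V\<^esub> w) \<oplus>\<^bsub>V\<^esub> y = v \<oplus>\<^bsub>V\<^esub> (w \<oplus>\<^bsub>V\<^esub> (-1) \<odot>\<^bsub>V\<^esub> w) \<oplus>\<^bsub>V\<^esub> x"
      using w x WV v by (simp add: M.a_ac)
    also have "w \<oplus>\<^bsub>V\<^esub> (-1) \<odot>\<^bsub>V\<^esub> w = \<zero>\<^bsub>V\<^esub>" using w WV by (simp add: add_eq_zero_iff)
    finally show ?thesis using w x WV v by simp
  qed
  ultimately show ?thesis using w Wadd Wsmult unfolding set_eq_iff mem_q by metis
qed

lemma q_eq_iff:
  assumes "x \<in> carrier V" "y \<in> carrier V"
  shows "q x = q y \<longleftrightarrow> x \<oplus>\<^bsub>V\<^esub> (-1) \<odot>\<^bsub>V\<^esub> y \<in> W"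
proof
  assume "q x = q y"
  then have "x \<in> q y" using q_self[OF assms(1)] by simp
  then obtain w where w: "w \<in> W" "x = w \<oplus>\<^bsub>V\<^esub> y" using mem_q by blast
  have "x \<oplus>\<^bsub>V\<^esub> (-1) \<odot>\<^bsub>V\<^esub> y = w \<oplus>\<^bsub>V\<^esub> (y \<oplus>\<^bsub>V\<^esub> (-1) \<odot>\<^bsub>V\<^esub> y)"
    unfolding w(2) using WV[OF w(1)] assms by (simp add: M.a_assoc)
  also have "y \<oplus>\<^bsub>V\<^esub> (-1) \<odot>\<^bsub>V\<^esub> y = \<zero>\<^bsub>V\<^esub>" using assms by (simp add: add_eq_zero_iff)
  finally show "x \<oplus>\<^bsub>V\<^esub> (-1) \<odot>\<^bsub>V\<^esub> y \<in> W" using w WV by simp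
next
  assume w: "x \<oplus>\<^bsub>V\<^esub> (-1) \<odot>\<^bsub>V\<^esub> y \<in> W"
  have "(x \<oplus>\<^bsub>V\<^esub> (-1) \<odot>\<^bsub>V\<^esub> y) \<oplus>\<^bsub>V\<^esub> y = x \<oplus>\<^bsub>V\<^esub> (y \<oplus>\<^bsub>V\<^esub> (-1) \<odot>\<^bsub>V\<^esub> y)"
    using assms by (simp add: M.a_ac)
  also have "y \<oplus>\<^bsub>V\<^esub> (-1) \<odot>\<^bsub>V\<^esub> y = \<zero>\<^bsub>V\<^esub>" using assms by (simp add: add_eq_zero_iff)
  finally have "x \<in> q y" unfolding mem_q using w assms by (intro bexI[OF _ w]) simp
  then show "q x = q y" by (rule q_eq_of_mem[OF assms(2)])
qed

lemma carrier_quotient: "carrier (quotient_space V W) = q ` carrier V"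
  unfolding quotient_space_def A_RCOSETS_def' by auto

lemma add_quotient:
  assumes "x \<in> carrier V" "y \<in> carrier V"
  shows "q x \<oplus>\<^bsub>quotient_space V W\<^esub> q y = q (x \<oplus>\<^bsub>V\<^esub> y)"
proof -
  have "(w \<oplus>\<^bsub>V\<^esub> x) \<oplus>\<^bsub>V\<^esub> (w' \<oplus>\<^bsub>V\<^esub> y) = (w \<oplus>\<^bsub>V\<^esub> w') \<oplus>\<^bsub>V\<^esub> (x \<oplus>\<^bsub>V\<^esub> y)" if "w \<in> W" "w' \<in> W" for w w'
    using that WV assms by (simp add: M.a_ac)
  then have "set_add V (q x) (q y) \<subseteq> q (x \<oplus>\<^bsub>V\<^esub> y)"
    unfolding set_add_def' by (auto simp: mem_q intro!: bexI Wadd)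
  moreover have "z \<in> set_add V (q x) (q y)" if z: "z \<in> q (x \<oplus>\<^bsub>V\<^esub> y)" for z
  proof -
    obtain w where w: "w \<in> W" "z = w \<oplus>\<^bsub>V\<^esub> (x \<oplus>\<^bsub>V\<^esub> y)" using z unfolding mem_q by (elim bexE) (rule that)
    then have "z = (w \<oplus>\<^bsub>V\<^esub> x) \<oplus>\<^bsub>V\<^esub> y" using WV assms by (simp add: M.a_ac)
    moreover have "w \<oplus>\<^bsub>V\<^esub> x \<in> q x" unfolding mem_q using w(1) by (intro bexI[of _ w]) simp_all
    ultimately show ?thesis unfolding set_add_def'
      by (intro UN_I[of "w \<oplus>\<^bsub>V\<^esub> x"] UN_I[of y] q_self[OF assms(2)]) simp_all
  qed
  ultimately have "set_add V (q x) (q y) = q (x \<oplus>\<^bsub>V\<^esub> y)" by (intro equalityI subsetI) auto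
  then show ?thesis unfolding quotient_space_def by simp
qed

lemma smult_mem_W: "x \<in> carrier V \<Longrightarrow> y \<in> q x \<Longrightarrow> c \<odot>\<^bsub>V\<^esub> y \<in> q (c \<odot>\<^bsub>V\<^esub> x)"
  unfolding mem_q using Wsmult WV smult_add_right by blast

lemma smult_quotient:
  assumes x: "x \<in> carrier V"
  shows "c \<odot>\<^bsub>quotient_space V W\<^esub> q x = q (c \<odot>\<^bsub>V\<^esub> x)"
proof -
  have "q (c \<odot>\<^bsub>V\<^esub> y) = q (c \<odot>\<^bsub>V\<^esub> x)" if "y \<in> q x" for y
    by (rule q_eq_of_mem[OF smult_mem[OF x] smult_mem_W[OF x that]])
  then have "(\<Union>y\<in>q x. q (c \<odot>\<^bsub>V\<^esub> y)) = q (c \<odot>\<^bsub>V\<^esub> x)" using q_self[OF x] by blast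
  then show ?thesis unfolding quotient_space_def by simp
qed

lemma zero_quotient: "\<zero>\<^bsub>quotient_space V W\<^esub> = q \<zero>\<^bsub>V\<^esub>"
proof -
  have "q \<zero>\<^bsub>V\<^esub> = W" unfolding set_eq_iff mem_q using WV W0 by auto
  then show ?thesis unfolding quotient_space_def by simp
qed

lemma cvs_quotient: "cvs (quotient_space V W)" (is "cvs ?Q")
  unfolding cvs_def
proof (rule vs_criteria)
  note s = carrier_quotient add_quotient smult_quotient zero_quotient
  show "field CC" by (rule class_field)
  show "\<zero>\<^bsub>?Q\<^esub> \<in> carrier ?Q" by (auto simp: s)
  show "\<forall>v w. v \<in> carrier ?Q \<and> w \<in> carrier ?Q \<longrightarrow> v \<oplus>\<^bsub>?Q\<^esub> w \<in> carrier ?Q" by (auto simp: s)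
  show "\<forall>v\<in>carrier ?Q. \<exists>nv\<in>carrier ?Q. v \<oplus>\<^bsub>?Q\<^esub> nv = \<zero>\<^bsub>?Q\<^esub>"
  proof
    fix v assume "v \<in> carrier ?Q"
    then obtain x where x: "x \<in> carrier V" "v = q x" by (auto simp: s)
    then have "v \<oplus>\<^bsub>?Q\<^esub> q ((-1) \<odot>\<^bsub>V\<^esub> x) = \<zero>\<^bsub>?Q\<^esub>"
      using iffD2[OF add_eq_zero_iff refl, OF x(1) x(1)] by (simp add: s)
    then show "\<exists>nv\<in>carrier ?Q. v \<oplus>\<^bsub>?Q\<^esub> nv = \<zero>\<^bsub>?Q\<^esub>"
      using x by (intro bexI[of _ "q ((-1) \<odot>\<^bsub>V\<^esub> x)"]) (auto simp: s)
  qed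
  show "\<forall>c v. c \<in> carrier CC \<and> v \<in> carrier ?Q \<longrightarrow> c \<odot>\<^bsub>?Q\<^esub> v \<in> carrier ?Q" by (auto simp: s)
  show "\<forall>v w. v \<in> carrier ?Q \<and> w \<in> carrier ?Q \<longrightarrow> v \<oplus>\<^bsub>?Q\<^esub> w = w \<oplus>\<^bsub>?Q\<^esub> v"
    by (auto simp: s M.a_comm)
  show "\<forall>v w x. v \<in> carrier ?Q \<and> w \<in> carrier ?Q \<and> x \<in> carrier ?Q \<longrightarrow>
      v \<oplus>\<^bsub>?Q\<^esub> w \<oplus>\<^bsub>?Q\<^esub> x = v \<oplus>\<^bsub>?Q\<^esub> (w \<oplus>\<^bsub>?Q\<^esub> x)" by (auto simp: s M.a_assoc)
  show "\<forall>v\<in>carrier ?Q. v \<oplus>\<^bsub>?Q\<^esub> \<zero>\<^bsub>?Q\<^esub> = v" by (auto simp: s)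
  show "\<forall>a b v. a \<in> carrier CC \<and> b \<in> carrier CC \<and> v \<in> carrier ?Q \<longrightarrow>
      (a \<otimes>\<^bsub>CC\<^esub> b) \<odot>\<^bsub>?Q\<^esub> v = a \<odot>\<^bsub>?Q\<^esub> (b \<odot>\<^bsub>?Q\<^esub> v)" by (auto simp: s smult_smult)
  show "\<forall>v\<in>carrier ?Q. \<one>\<^bsub>CC\<^esub> \<odot>\<^bsub>?Q\<^esub> v = v" by (auto simp: s)
  show "\<forall>a b v. a \<in> carrier CC \<and> b \<in> carrier CC \<and> v \<in> carrier ?Q \<longrightarrow>
      (a \<oplus>\<^bsub>CC\<^esub> b) \<odot>\<^bsub>?Q\<^esub> v = a \<odot>\<^bsub>?Q\<^esub> v \<oplus>\<^bsub>?Q\<^esub> b \<odot>\<^bsub>?Q\<^esub> v" by (auto simp: s smult_add_left)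
  show "\<forall>a v w. a \<in> carrier CC \<and> v \<in> carrier ?Q \<and> w \<in> carrier ?Q \<longrightarrow>
      a \<odot>\<^bsub>?Q\<^esub> (v \<oplus>\<^bsub>?Q\<^esub> w) = a \<odot>\<^bsub>?Q\<^esub> v \<oplus>\<^bsub>?Q\<^esub> a \<odot>\<^bsub>?Q\<^esub> w" by (auto simp: s smult_add_right)
qed

lemma q_linear: "linear_map CC V (quotient_space V W) q"
  by (rule linear_mapI[OF cvs_axioms cvs_quotient]) (auto simp: carrier_quotient add_quotient smult_quotient)

end

lemma linear_map_compose:
  fixes U :: "(complex, 'u) module" and V :: "(complex, 'v) module" and W :: "(complex, 'w) module"
  assumes "linear_map CC U V S" "linear_map CC V W T"
  shows "linear_map CC U W (\<lambda>x. T (S x))"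
  by (rule linear_mapI) (use linear_mapD[OF assms(1)] linear_mapD[OF assms(2)] in auto)

lemma linear_map_cong:
  fixes V :: "(complex, 'v) module" and W :: "(complex, 'w) module"
  assumes "linear_map CC V W T" "\<And>x. x \<in> carrier V \<Longrightarrow> S x = T x"
  shows "linear_map CC V W S"
proof -
  interpret V: cvs V by (rule linear_mapD(4)[OF assms(1)])
  show ?thesis
    by (rule linear_mapI) (use linear_mapD[OF assms(1)] assms(2) V.add_mem V.smult_mem in auto)
qed

lemma linear_map_add:
  fixes V :: "(complex, 'v) module" and W :: "(complex, 'w) module"
  assumes S: "linear_map CC V W S" and T: "linear_map CC V W T"
  shows "linear_map CC V W (\<lambda>x. S x \<oplus>\<^bsub>W\<^esub> T x)"
proof -
  interpret W: cvs W by (rule linear_mapD(5)[OF S])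
  show ?thesis
    by (rule linear_mapI) (use linear_mapD[OF S] linear_mapD[OF T] in \<open>auto simp: W.M.a_ac W.smult_add_right\<close>)
qed

lemma cvs_module_vec: "cvs (module_vec TYPE(complex) n)"
  unfolding cvs_def by (rule vec_vs)

lemma linear_map_vec:
  assumes "cvs V" "\<And>k. k < n \<Longrightarrow> lin_functional V (\<xi> k)"
  shows "linear_map CC V (module_vec TYPE(complex) n) (\<lambda>x. vec n (\<lambda>k. \<xi> k x))"
  by (rule linear_mapI[OF assms(1) cvs_module_vec])
    (use assms(2) in \<open>auto simp: module_vec_simps lin_functional_def intro!: eq_vecI\<close>)

lemma vec_coordinate: "k < n \<Longrightarrow> lin_functional (module_vec TYPE(complex) n) (\<lambda>v. v $ k)"
  unfolding lin_functional_def module_vec_simps by auto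

lemma linear_map_lc:
  assumes "cvs V" "cvs W" "\<forall>k<n. b k \<in> carrier V" "\<And>k. k < n \<Longrightarrow> lin_functional W (\<xi> k)"
  shows "linear_map CC W V (\<lambda>x. lc V (\<lambda>k. \<xi> k x) b n)"
proof -
  interpret cvs V by fact
  show ?thesis
  proof (rule linear_mapI[OF assms(2,1)])
    fix x y assume "x \<in> carrier W" "y \<in> carrier W"
    then have "lc V (\<lambda>k. \<xi> k (x \<oplus>\<^bsub>W\<^esub> y)) b n = lc V (\<lambda>k. \<xi> k x + \<xi> k y) b n"
      using assms(4) by (intro lc_cong) (auto simp: lin_functional_def)
    then show "lc V (\<lambda>k. \<xi> k (x \<oplus>\<^bsub>W\<^esub> y)) b n = lc V (\<lambda>k. \<xi> k x) b n \<oplus>\<^bsub>V\<^esub> lc V (\<lambda>k. \<xi> k y) b n"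
      by (simp add: lc_add[OF assms(3)])
  next
    fix c x assume "x \<in> carrier W"
    then have "lc V (\<lambda>k. \<xi> k (c \<odot>\<^bsub>W\<^esub> x)) b n = lc V (\<lambda>k. c * \<xi> k x) b n"
      using assms(4) by (intro lc_cong) (auto simp: lin_functional_def)
    then show "lc V (\<lambda>k. \<xi> k (c \<odot>\<^bsub>W\<^esub> x)) b n = c \<odot>\<^bsub>V\<^esub> lc V (\<lambda>k. \<xi> k x) b n"
      by (simp add: lc_smult[OF assms(3)])
  qed (use lc_mem[OF assms(3)] in auto)
qed

lemma fin_dim_module_vec: "vectorspace.fin_dim CC (module_vec TYPE(complex) n)"
  and dim_module_vec: "vectorspace.dim CC (module_vec TYPE(complex) n) = n"
proof -
  interpret vec_space "TYPE(complex)" n .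
  show "vectorspace.fin_dim CC (module_vec TYPE(complex) n)" by (rule fin_dim)
  show "vectorspace.dim CC (module_vec TYPE(complex) n) = n" by (rule dim_is_n)
qed

lemma (in cvs) basis_coordinates:
  assumes fin_dim
  obtains b \<xi> where "\<forall>k<dim. b k \<in> carrier V" "\<And>k. k < dim \<Longrightarrow> lin_functional V (\<xi> k)"
    "\<And>k j. k < dim \<Longrightarrow> j < dim \<Longrightarrow> \<xi> k (b j) = (if j = k then 1 else 0)"
    "\<And>x. x \<in> carrier V \<Longrightarrow> x = lc V (\<lambda>k. \<xi> k x) b dim"
proof -
  have VV: "VectorSpace.subspace CC (carrier V) V" by (simp add: subspace_iff)
  have V': "V\<lparr>carrier := carrier V\<rparr> = V" by simp
  obtain b \<xi> where b: "\<And>k. k < dim \<Longrightarrow> b k \<in> carrier V" "\<And>k. k < dim \<Longrightarrow> lin_functional V (\<xi> k)"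
    "\<And>k j. k < dim \<Longrightarrow> j < dim \<Longrightarrow> \<xi> k (b j) = (if j = k then 1 else 0)"
    "\<And>x. x \<in> carrier V \<Longrightarrow> x = lc V (\<lambda>k. \<xi> k x) b dim"
    by (rule adapted_coordinates[OF assms VV refl, unfolded V']) (rule that; assumption)
  show thesis by (rule that[OF _ b(2,3,4)]) (use b(1) in auto)
qed

section \<open>Extensions of a projective representation split\<close>

text \<open>The family \<open>\<psi>\<close> twists the action on \<open>P \<oplus> I\<close>: an arrow \<open>a\<close> acts by
\<open>(x, y) \<mapsto> (P\<^sub>a x, I\<^sub>a y + \<psi>\<^sub>a x)\<close>.  This is an extension of \<open>P\<close> by \<open>I\<close>.  A lift of the identity of \<open>P\<close>
to it has the form \<open>x \<mapsto> (x, \<phi> x)\<close>, and its compatibility with the arrows is the equation for \<open>\<phi>\<close>.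
In other words, \<open>Ext(P, I) = 0\<close>.\<close>
lemma projective_extension_splits:
  assumes wf: "wf_digraph Q" and P: "projective_rep Q P" and I: "representation Q I"
    and \<psi>: "\<And>a. a \<in> arcs Q \<Longrightarrow> linear_map CC (space P (tail Q a)) (space I (head Q a)) (\<psi> a)"
  shows "\<exists>\<phi>. (\<forall>i\<in>verts Q. linear_map CC (space P i) (space I i) (\<phi> i)) \<and>
    (\<forall>a\<in>arcs Q. \<forall>x\<in>carrier (space P (tail Q a)).
       \<phi> (head Q a) (act P a x) = act I a (\<phi> (tail Q a) x) \<oplus>\<^bsub>space I (head Q a)\<^esub> \<psi> a x)"
proof -
  have Pr: "representation Q P" using P unfolding projective_rep_def by blast
  have vP: "cvs (space P i)" "vectorspace.fin_dim CC (space P i)" if "i \<in> verts Q" for i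
    using Pr that unfolding representation_def cvs_def by auto
  have vI: "cvs (space I i)" "vectorspace.fin_dim CC (space I i)" if "i \<in> verts Q" for i
    using I that unfolding representation_def cvs_def by auto
  have ends: "tail Q a \<in> verts Q" "head Q a \<in> verts Q" if "a \<in> arcs Q" for a
    using wf that by (auto simp: wf_digraph.tail_in_verts wf_digraph.head_in_verts)
  have aP: "linear_map CC (space P (tail Q a)) (space P (head Q a)) (act P a)" if "a \<in> arcs Q" for a
    using Pr that unfolding representation_def by blast
  have aI: "linear_map CC (space I (tail Q a)) (space I (head Q a)) (act I a)" if "a \<in> arcs Q" for a
    using I that unfolding representation_def by blast
  define dP where "dP i = vectorspace.dim CC (space P i)" for i
  define dI where "dI i = vectorspace.dim CC (space I i)" for i
  have "\<forall>i\<in>verts Q. \<exists>bx. (\<forall>k<dP i. fst bx k \<in> carrier (space P i)) \<and>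
      (\<forall>k<dP i. lin_functional (space P i) (snd bx k)) \<and>
      (\<forall>k<dP i. \<forall>j<dP i. snd bx k (fst bx j) = (if j = k then 1 else 0)) \<and>
      (\<forall>x\<in>carrier (space P i). x = lc (space P i) (\<lambda>k. snd bx k x) (fst bx) (dP i))"
  proof
    fix i assume i: "i \<in> verts Q"
    obtain b \<xi> where "\<forall>k<dP i. b k \<in> carrier (space P i)" "\<And>k. k < dP i \<Longrightarrow> lin_functional (space P i) (\<xi> k)"
      "\<And>k j. k < dP i \<Longrightarrow> j < dP i \<Longrightarrow> \<xi> k (b j) = (if j = k then 1 else 0)"
      "\<And>x. x \<in> carrier (space P i) \<Longrightarrow> x = lc (space P i) (\<lambda>k. \<xi> k x) b (dP i)"
      by (rule cvs.basis_coordinates[OF vP[OF i]]) (rule that, auto simp: dP_def)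
    then show "\<exists>bx. (\<forall>k<dP i. fst bx k \<in> carrier (space P i)) \<and>
      (\<forall>k<dP i. lin_functional (space P i) (snd bx k)) \<and>
      (\<forall>k<dP i. \<forall>j<dP i. snd bx k (fst bx j) = (if j = k then 1 else 0)) \<and>
      (\<forall>x\<in>carrier (space P i). x = lc (space P i) (\<lambda>k. snd bx k x) (fst bx) (dP i))"
      by (intro exI[of _ "(b, \<xi>)"]) simp
  qed
  from bchoice[OF this] obtain BP where BP: "\<forall>i\<in>verts Q. (\<forall>k<dP i. fst (BP i) k \<in> carrier (space P i)) \<and>
      (\<forall>k<dP i. lin_functional (space P i) (snd (BP i) k)) \<and>
      (\<forall>k<dP i. \<forall>j<dP i. snd (BP i) k (fst (BP i) j) = (if j = k then 1 else 0)) \<and>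
      (\<forall>x\<in>carrier (space P i). x = lc (space P i) (\<lambda>k. snd (BP i) k x) (fst (BP i)) (dP i))"
    by (elim exE) (rule that)
  define bP where "bP i = fst (BP i)" for i
  define \<xi>P where "\<xi>P i = snd (BP i)" for i
  have bP: "\<forall>k<dP i. bP i k \<in> carrier (space P i)" and \<xi>P: "\<And>k. k < dP i \<Longrightarrow> lin_functional (space P i) (\<xi>P i k)"
    and \<xi>bP: "\<And>k j. k < dP i \<Longrightarrow> j < dP i \<Longrightarrow> \<xi>P i k (bP i j) = (if j = k then 1 else 0)"
    and eP: "\<And>x. x \<in> carrier (space P i) \<Longrightarrow> lc (space P i) (\<lambda>k. \<xi>P i k x) (bP i) (dP i) = x"
    if "i \<in> verts Q" for i
    using bspec[OF BP that] unfolding bP_def \<xi>P_def by simp_all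
  have "\<forall>i\<in>verts Q. \<exists>bx. (\<forall>k<dI i. fst bx k \<in> carrier (space I i)) \<and>
      (\<forall>k<dI i. lin_functional (space I i) (snd bx k)) \<and>
      (\<forall>x\<in>carrier (space I i). x = lc (space I i) (\<lambda>k. snd bx k x) (fst bx) (dI i))"
  proof
    fix i assume i: "i \<in> verts Q"
    obtain b \<xi> where "\<forall>k<dI i. b k \<in> carrier (space I i)" "\<And>k. k < dI i \<Longrightarrow> lin_functional (space I i) (\<xi> k)"
      "\<And>k j. k < dI i \<Longrightarrow> j < dI i \<Longrightarrow> \<xi> k (b j) = (if j = k then 1 else 0)"
      "\<And>x. x \<in> carrier (space I i) \<Longrightarrow> x = lc (space I i) (\<lambda>k. \<xi> k x) b (dI i)"
      by (rule cvs.basis_coordinates[OF vI[OF i]]) (rule that, auto simp: dI_def)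
    then show "\<exists>bx. (\<forall>k<dI i. fst bx k \<in> carrier (space I i)) \<and>
      (\<forall>k<dI i. lin_functional (space I i) (snd bx k)) \<and>
      (\<forall>x\<in>carrier (space I i). x = lc (space I i) (\<lambda>k. snd bx k x) (fst bx) (dI i))"
      by (intro exI[of _ "(b, \<xi>)"]) simp
  qed
  from bchoice[OF this] obtain BI where BI: "\<forall>i\<in>verts Q. (\<forall>k<dI i. fst (BI i) k \<in> carrier (space I i)) \<and>
      (\<forall>k<dI i. lin_functional (space I i) (snd (BI i) k)) \<and>
      (\<forall>x\<in>carrier (space I i). x = lc (space I i) (\<lambda>k. snd (BI i) k x) (fst (BI i)) (dI i))"
    by (elim exE) (rule that)
  define bI where "bI i = fst (BI i)" for i
  define \<xi>I where "\<xi>I i = snd (BI i)" for i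
  have bI: "\<forall>k<dI i. bI i k \<in> carrier (space I i)" and \<xi>I: "\<And>k. k < dI i \<Longrightarrow> lin_functional (space I i) (\<xi>I i k)"
    and eI: "\<And>x. x \<in> carrier (space I i) \<Longrightarrow> lc (space I i) (\<lambda>k. \<xi>I i k x) (bI i) (dI i) = x"
    if "i \<in> verts Q" for i
    using bspec[OF BI that] unfolding bI_def \<xi>I_def by simp_all
  \<comment> \<open>The test objects of projectivity have spaces of complex vectors.  So the extension is written
    in coordinates: the first \<open>dP i\<close> entries of a vector are coordinates on \<open>P\<close>, the others on \<open>I\<close>.\<close>
  define VM where "VM i = module_vec TYPE(complex) (dP i + dI i)" for i
  define VN where "VN i = module_vec TYPE(complex) (dP i)" for i
  define pP where "pP i v = lc (space P i) (\<lambda>k. v $ k) (bP i) (dP i)" for i v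
  define pI where "pI i v = lc (space I i) (\<lambda>k. v $ (dP i + k)) (bI i) (dI i)" for i v
  have lpP: "linear_map CC (VM i) (space P i) (pP i)" if "i \<in> verts Q" for i
    unfolding pP_def VM_def by (rule linear_map_lc[OF vP(1)[OF that] cvs_module_vec bP[OF that]]) (simp add: vec_coordinate)
  have lpN: "linear_map CC (VN i) (space P i) (pP i)" if "i \<in> verts Q" for i
    unfolding pP_def VN_def by (rule linear_map_lc[OF vP(1)[OF that] cvs_module_vec bP[OF that]]) (simp add: vec_coordinate)
  have lpI: "linear_map CC (VM i) (space I i) (pI i)" if "i \<in> verts Q" for i
    unfolding pI_def VM_def by (rule linear_map_lc[OF vI(1)[OF that] cvs_module_vec bI[OF that]]) (simp add: vec_coordinate)
  define eact where "eact a v = act I a (pI (tail Q a) v) \<oplus>\<^bsub>space I (head Q a)\<^esub> \<psi> a (pP (tail Q a) v)" for a v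
  have leact: "linear_map CC (VM (tail Q a)) (space I (head Q a)) (eact a)" if a: "a \<in> arcs Q" for a
    unfolding eact_def
    by (rule linear_map_add[OF linear_map_compose[OF lpI[OF ends(1)[OF a]] aI[OF a]] linear_map_compose[OF lpP[OF ends(1)[OF a]] \<psi>[OF a]]])
  define MM :: "('a, 'b, complex vec) rep" where "MM = \<lparr>space = VM, act = (\<lambda>a v. vec (dP (head Q a) + dI (head Q a))
     (\<lambda>k. if k < dP (head Q a) then \<xi>P (head Q a) k (act P a (pP (tail Q a) v))
          else \<xi>I (head Q a) (k - dP (head Q a)) (eact a v)))\<rparr>"
  define NN :: "('a, 'b, complex vec) rep" where "NN = \<lparr>space = VN, act = (\<lambda>a v. vec (dP (head Q a))
     (\<lambda>k. \<xi>P (head Q a) k (act P a (pP (tail Q a) v))))\<rparr>"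
  have lact: "linear_map CC (VM (tail Q a)) (VM (head Q a)) (act MM a)" if a: "a \<in> arcs Q" for a
  proof -
    note h = ends[OF a]
    have "lin_functional (VM (tail Q a)) (\<lambda>v. if k < dP (head Q a) then \<xi>P (head Q a) k (act P a (pP (tail Q a) v))
          else \<xi>I (head Q a) (k - dP (head Q a)) (eact a v))" if "k < dP (head Q a) + dI (head Q a)" for k
    proof (cases "k < dP (head Q a)")
      case True
      have "lin_functional (VM (tail Q a)) (\<lambda>v. \<xi>P (head Q a) k (act P a (pP (tail Q a) v)))"
        by (rule functional_compose[OF linear_map_compose[OF lpP[OF h(1)] aP[OF a]] \<xi>P[OF h(2) True]])
      then show ?thesis using True by simp
    next
      case False
      then have "k - dP (head Q a) < dI (head Q a)" using that by simp
      from functional_compose[OF leact[OF a] \<xi>I[OF h(2) this]] show ?thesis using False by simp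
    qed
    then show ?thesis unfolding MM_def VM_def by (simp, intro linear_map_vec[OF cvs_module_vec]) 
  qed
  have lactN: "linear_map CC (VN (tail Q a)) (VN (head Q a)) (act NN a)" if a: "a \<in> arcs Q" for a
  proof -
    note h = ends[OF a]
    have "lin_functional (VN (tail Q a)) (\<lambda>v. \<xi>P (head Q a) k (act P a (pP (tail Q a) v)))" if "k < dP (head Q a)" for k
      by (rule functional_compose[OF linear_map_compose[OF lpN[OF h(1)] aP[OF a]] \<xi>P[OF h(2) that]])
    then show ?thesis unfolding NN_def VN_def by (simp, intro linear_map_vec[OF cvs_module_vec]) 
  qed
  have repM: "representation Q MM"
    unfolding representation_def using lact cvs_module_vec fin_dim_module_vec by (auto simp: MM_def VM_def cvs_def)
  have repN: "representation Q NN"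
    unfolding representation_def using lactN cvs_module_vec fin_dim_module_vec by (auto simp: NN_def VN_def cvs_def)
  define g where "g = (\<lambda>i\<in>verts Q. \<lambda>v\<in>carrier (VM i). vec (dP i) (\<lambda>k. v $ k))"
  define h where "h = (\<lambda>i\<in>verts Q. \<lambda>x\<in>carrier (space P i). vec (dP i) (\<lambda>k. \<xi>P i k x))"
  have pPg: "pP i (vec (dP i) (\<lambda>k. v $ k)) = pP i v" for i v
    unfolding pP_def by (rule lc_cong) auto
  have gm: "g \<in> rep_hom Q MM NN"
    unfolding rep_hom_def
  proof (intro CollectI conjI ballI)
    show "g \<in> extensional (verts Q)" unfolding g_def by simp
    show "g i \<in> extensional (carrier (space MM i))" if "i \<in> verts Q" for i
      using that unfolding g_def MM_def by simp
    show "linear_map CC (space MM i) (space NN i) (g i)" if i: "i \<in> verts Q" for i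
    proof (rule linear_map_cong)
      show "linear_map CC (space MM i) (space NN i) (\<lambda>v. vec (dP i) (\<lambda>k. v $ k))"
        unfolding MM_def NN_def VN_def VM_def
        by (simp, intro linear_map_vec[OF cvs_module_vec] vec_coordinate) simp
    qed (use i in \<open>simp add: g_def MM_def\<close>)
    show "g (head Q a) (act MM a x) = act NN a (g (tail Q a) x)"
      if a: "a \<in> arcs Q" and x: "x \<in> carrier (space MM (tail Q a))" for a x
    proof -
      have x': "x \<in> carrier (VM (tail Q a))" using x by (simp add: MM_def)
      have "g (head Q a) (act MM a x) = vec (dP (head Q a)) (\<lambda>k. act MM a x $ k)"
        using linear_mapD(1)[OF lact[OF a] x'] ends[OF a] by (simp add: g_def)
      also have "\<dots> = vec (dP (head Q a)) (\<lambda>k. \<xi>P (head Q a) k (act P a (pP (tail Q a) x)))"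
        by (rule eq_vecI) (auto simp: MM_def)
      also have "\<dots> = act NN a (g (tail Q a) x)" using x' ends[OF a] by (simp add: NN_def g_def pPg)
      finally show ?thesis .
    qed
  qed
  have hm: "h \<in> rep_hom Q P NN"
    unfolding rep_hom_def
  proof (intro CollectI conjI ballI)
    show "h \<in> extensional (verts Q)" unfolding h_def by simp
    show "h i \<in> extensional (carrier (space P i))" if "i \<in> verts Q" for i
      using that unfolding h_def by simp
    show "linear_map CC (space P i) (space NN i) (h i)" if i: "i \<in> verts Q" for i
    proof (rule linear_map_cong)
      show "linear_map CC (space P i) (space NN i) (\<lambda>x. vec (dP i) (\<lambda>k. \<xi>P i k x))"
        unfolding NN_def VN_def by (simp, intro linear_map_vec[OF vP(1)[OF i]] \<xi>P[OF i])
    qed (use i in \<open>simp add: h_def\<close>)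
    show "h (head Q a) (act P a x) = act NN a (h (tail Q a) x)"
      if a: "a \<in> arcs Q" and x: "x \<in> carrier (space P (tail Q a))" for a x
    proof -
      have "pP (tail Q a) (vec (dP (tail Q a)) (\<lambda>k. \<xi>P (tail Q a) k x)) = lc (space P (tail Q a)) (\<lambda>k. \<xi>P (tail Q a) k x) (bP (tail Q a)) (dP (tail Q a))"
        unfolding pP_def by (rule lc_cong) auto
      also have "\<dots> = x" by (rule eP[OF ends(1)[OF a] x])
      finally show ?thesis using x ends[OF a] linear_mapD(1)[OF aP[OF a] x] by (simp add: h_def NN_def)
    qed
  qed
  have surj: "g i ` carrier (space MM i) = carrier (space NN i)" if i: "i \<in> verts Q" for i
  proof (intro equalityI subsetI)
    fix v assume "v \<in> g i ` carrier (space MM i)"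
    then show "v \<in> carrier (space NN i)" using i by (auto simp: g_def MM_def NN_def VN_def module_vec_simps)
  next
    fix v assume v: "v \<in> carrier (space NN i)"
    then have dv: "dim_vec v = dP i" by (simp add: NN_def VN_def module_vec_simps)
    let ?w = "vec (dP i + dI i) (\<lambda>k. if k < dP i then v $ k else 0)"
    have w: "?w \<in> carrier (space MM i)" by (simp add: MM_def VM_def module_vec_simps)
    have "v = g i ?w" using i w dv by (intro eq_vecI) (auto simp: g_def MM_def)
    then show "v \<in> g i ` carrier (space MM i)" using w by blast
  qed
  have "\<exists>k\<in>rep_hom Q P MM. \<forall>i\<in>verts Q. \<forall>x\<in>carrier (space P i). g i (k i x) = h i x"
    using P gm hm repM repN surj unfolding projective_rep_def by blast
  then obtain k where k: "k \<in> rep_hom Q P MM" "\<forall>i\<in>verts Q. \<forall>x\<in>carrier (space P i). g i (k i x) = h i x"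
    by blast
  have kl: "linear_map CC (space P i) (VM i) (k i)" if "i \<in> verts Q" for i
    using k(1) that unfolding rep_hom_def by (auto simp: MM_def)
  have kc: "k (head Q a) (act P a x) = act MM a (k (tail Q a) x)"
    if "a \<in> arcs Q" "x \<in> carrier (space P (tail Q a))" for a x
    using k(1) that unfolding rep_hom_def by blast
  have pPk: "pP i (k i x) = x" if i: "i \<in> verts Q" and x: "x \<in> carrier (space P i)" for i x
  proof -
    have m: "k i x \<in> carrier (VM i)" by (rule linear_mapD(1)[OF kl[OF i] x])
    have e: "vec (dP i) (\<lambda>j. k i x $ j) = vec (dP i) (\<lambda>j. \<xi>P i j x)"
      using bspec[OF bspec[OF k(2) i] x] i x m by (simp add: g_def h_def)
    have "k i x $ j = \<xi>P i j x" if "j < dP i" for j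
      using arg_cong[OF e, of "\<lambda>v. v $ j"] that by simp
    then have "pP i (k i x) = lc (space P i) (\<lambda>k. \<xi>P i k x) (bP i) (dP i)"
      unfolding pP_def by (intro lc_cong) auto
    then show ?thesis using eP[OF i x] by simp
  qed
  show ?thesis
  proof (intro exI[of _ "\<lambda>i x. pI i (k i x)"] conjI ballI)
    show "linear_map CC (space P i) (space I i) (\<lambda>x. pI i (k i x))" if i: "i \<in> verts Q" for i
      by (rule linear_map_compose[OF kl[OF i] lpI[OF i]])
    fix a x assume a: "a \<in> arcs Q" and x: "x \<in> carrier (space P (tail Q a))"
    note hh = ends[OF a]
    have m: "k (tail Q a) x \<in> carrier (VM (tail Q a))" by (rule linear_mapD(1)[OF kl[OF hh(1)] x])
    have "pI (head Q a) (k (head Q a) (act P a x)) = lc (space I (head Q a))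
        (\<lambda>j. \<xi>I (head Q a) j (eact a (k (tail Q a) x))) (bI (head Q a)) (dI (head Q a))"
      unfolding kc[OF a x] pI_def by (rule lc_cong) (auto simp: MM_def)
    also have "\<dots> = eact a (k (tail Q a) x)"
      by (rule eI[OF hh(2) linear_mapD(1)[OF leact[OF a] m]])
    also have "\<dots> = act I a (pI (tail Q a) (k (tail Q a) x)) \<oplus>\<^bsub>space I (head Q a)\<^esub> \<psi> a x"
      unfolding eact_def pPk[OF hh(1) x] ..
    finally show "pI (head Q a) (k (head Q a) (act P a x)) =
      act I a (pI (tail Q a) (k (tail Q a) x)) \<oplus>\<^bsub>space I (head Q a)\<^esub> \<psi> a x" .
  qed
qed

section \<open>Direct sums\<close>

lemma direct_sum_simps[simp]:
  fixes V :: "(complex, 'v) module" and W :: "(complex, 'w) module"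
  shows "carrier (direct_sum V W) = carrier V \<times> carrier W"
    "\<zero>\<^bsub>direct_sum V W\<^esub> = (\<zero>\<^bsub>V\<^esub>, \<zero>\<^bsub>W\<^esub>)"
    "x \<oplus>\<^bsub>direct_sum V W\<^esub> y = (fst x \<oplus>\<^bsub>V\<^esub> fst y, snd x \<oplus>\<^bsub>W\<^esub> snd y)"
    "c \<odot>\<^bsub>direct_sum V W\<^esub> x = (c \<odot>\<^bsub>V\<^esub> fst x, c \<odot>\<^bsub>W\<^esub> snd x)"
  unfolding direct_sum_def by simp_all

lemma lc_direct_sum:
  fixes V :: "(complex, 'v) module" and W :: "(complex, 'w) module"
  shows "lc (direct_sum V W) c b n = (lc V c (\<lambda>k. fst (b k)) n, lc W c (\<lambda>k. snd (b k)) n)"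
  by (induction n) simp_all

lemma (in cvs) lc_split:
  assumes "\<forall>k<p + q. b k \<in> carrier V"
  shows "lc V c b (p + q) = lc V c b p \<oplus>\<^bsub>V\<^esub> lc V (\<lambda>k. c (p + k)) (\<lambda>k. b (p + k)) q"
  using assms
proof (induction q)
  case 0
  have "lc V c b p \<in> carrier V" using 0 by (intro lc_mem) simp
  then show ?case by simp
next
  case (Suc q)
  have "lc V c b p \<in> carrier V" "lc V (\<lambda>k. c (p + k)) (\<lambda>k. b (p + k)) q \<in> carrier V" "b (p + q) \<in> carrier V"
    using Suc.prems by (auto intro!: lc_mem)
  then show ?case using Suc by (simp add: M.a_assoc)
qed

lemma (in cvs) lc_zero_vectors: "(\<And>k. k < n \<Longrightarrow> b k = \<zero>\<^bsub>V\<^esub>) \<Longrightarrow> lc V c b n = \<zero>\<^bsub>V\<^esub>"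
  by (induction n) simp_all

lemma cvs_direct_sum:
  fixes V :: "(complex, 'v) module" and W :: "(complex, 'w) module"
  shows "cvs V \<Longrightarrow> cvs W \<Longrightarrow> cvs (direct_sum V W)"
  unfolding cvs_def by (rule direct_sum_is_vs)

lemma fin_dim_direct_sum:
  fixes V :: "(complex, 'v) module" and W :: "(complex, 'w) module"
  assumes V: "cvs V" "vectorspace.fin_dim CC V" and W: "cvs W" "vectorspace.fin_dim CC W"
  shows "vectorspace.fin_dim CC (direct_sum V W)"
proof -
  interpret V: cvs V by fact
  interpret W: cvs W by fact
  interpret D: cvs "direct_sum V W" by (rule cvs_direct_sum[OF V(1) W(1)])
  obtain b \<xi> where b: "\<forall>k<V.dim. b k \<in> carrier V" "\<And>x. x \<in> carrier V \<Longrightarrow> x = lc V (\<lambda>k. \<xi> k x) b V.dim"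
    by (rule V.basis_coordinates[OF V(2)]) (rule that; assumption)
  obtain b' \<xi>' where b': "\<forall>k<W.dim. b' k \<in> carrier W" "\<And>x. x \<in> carrier W \<Longrightarrow> x = lc W (\<lambda>k. \<xi>' k x) b' W.dim"
    by (rule W.basis_coordinates[OF W(2)]) (rule that; assumption)
  define bb where "bb k = (if k < V.dim then (b k, \<zero>\<^bsub>W\<^esub>) else (\<zero>\<^bsub>V\<^esub>, b' (k - V.dim)))" for k
  have bb: "\<forall>k<V.dim + W.dim. bb k \<in> carrier (direct_sum V W)"
    using b b' by (auto simp: bb_def)
  have "z \<in> range (\<lambda>c. lc (direct_sum V W) c bb (V.dim + W.dim))" if z: "z \<in> carrier (direct_sum V W)" for z
  proof -
    obtain x y where xy: "z = (x, y)" "x \<in> carrier V" "y \<in> carrier W" using z by auto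
    let ?c = "\<lambda>k. if k < V.dim then \<xi> k x else \<xi>' (k - V.dim) y"
    have "lc (direct_sum V W) ?c bb (V.dim + W.dim) = lc (direct_sum V W) ?c bb V.dim \<oplus>\<^bsub>direct_sum V W\<^esub>
       lc (direct_sum V W) (\<lambda>k. ?c (V.dim + k)) (\<lambda>k. bb (V.dim + k)) W.dim"
      by (rule D.lc_split[OF bb])
    also have "lc (direct_sum V W) ?c bb V.dim = (lc V (\<lambda>k. \<xi> k x) b V.dim, lc W ?c (\<lambda>k. snd (bb k)) V.dim)"
      unfolding lc_direct_sum by (auto intro!: lc_cong simp: bb_def)
    also have "lc W ?c (\<lambda>k. snd (bb k)) V.dim = \<zero>\<^bsub>W\<^esub>" by (rule W.lc_zero_vectors) (simp add: bb_def)
    also have "lc V (\<lambda>k. \<xi> k x) b V.dim = x" using b(2)[OF xy(2)] by simp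
    also have "lc (direct_sum V W) (\<lambda>k. ?c (V.dim + k)) (\<lambda>k. bb (V.dim + k)) W.dim =
        (lc V (\<lambda>k. ?c (V.dim + k)) (\<lambda>k. fst (bb (V.dim + k))) W.dim, lc W (\<lambda>k. \<xi>' k y) b' W.dim)"
      unfolding lc_direct_sum by (auto intro!: lc_cong simp: bb_def)
    also have "lc V (\<lambda>k. ?c (V.dim + k)) (\<lambda>k. fst (bb (V.dim + k))) W.dim = \<zero>\<^bsub>V\<^esub>"
      by (rule V.lc_zero_vectors) (simp add: bb_def)
    also have "lc W (\<lambda>k. \<xi>' k y) b' W.dim = y" using b'(2)[OF xy(3)] by simp
    finally have "z = lc (direct_sum V W) ?c bb (V.dim + W.dim)" using xy by simp
    then show ?thesis by (rule image_eqI[where x = ?c]) simp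
  qed
  then have "D.span (bb ` {..<V.dim + W.dim}) = carrier (direct_sum V W)"
    unfolding D.span_tuple[OF bb]
  proof (intro equalityI subsetI)
    fix z assume "z \<in> range (\<lambda>t. lc (direct_sum V W) t bb (V.dim + W.dim))"
    then show "z \<in> carrier (direct_sum V W)" using D.lc_mem[OF bb] by (elim rangeE) (simp only:)
  qed
  moreover have "bb ` {..<V.dim + W.dim} \<subseteq> carrier (direct_sum V W)" using bb by auto
  ultimately show ?thesis unfolding D.fin_dim_def by (intro exI[of _ "bb ` {..<V.dim + W.dim}"]) auto
qed

lemma linear_map_restrict:
  fixes V :: "(complex, 'v) module" and W :: "(complex, 'w) module"
  assumes T: "linear_map CC V W T" and S: "VectorSpace.subspace CC S V"
  shows "linear_map CC (V\<lparr>carrier := S\<rparr>) W T"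
proof -
  interpret V: cvs V by (rule linear_mapD(4)[OF T])
  have SV: "S \<subseteq> carrier V" using S V.subspace_iff by simp
  show ?thesis
    by (rule linear_mapI[OF V.subspace_cvs[OF S] linear_mapD(5)[OF T]])
      (use linear_mapD[OF T] SV in \<open>auto simp: subset_iff\<close>)
qed

lemma linear_map_zero:
  fixes V :: "(complex, 'v) module" and W :: "(complex, 'w) module"
  shows "linear_map CC V W T \<Longrightarrow> T \<zero>\<^bsub>V\<^esub> = \<zero>\<^bsub>W\<^esub>"
  using lc_linear_map[of V W T 0] by simp

lemma (in cvs) indep_spans:
  assumes fd: fin_dim and W: "VectorSpace.subspace CC W V" and d: "vectorspace.dim CC (V\<lparr>carrier := W\<rparr>) = n"
    and b: "\<forall>k<n. b k \<in> W" and i: "indep V n b"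
  shows "W = range (\<lambda>c. lc V c b n)"
proof -
  have WV: "W \<subseteq> carrier V" using W subspace_iff by simp
  have bV: "\<forall>k<n. b k \<in> carrier V" using b WV by auto
  obtain m b' where b': "n \<le> m" "\<forall>k<n. b' k = b k" "\<forall>k<m. b' k \<in> W" "indep V m b'" "\<forall>x\<in>W. \<exists>c. x = lc V c b' m"
    using extend_indep[OF fd W b i] by (elim exE conjE) (rule that; assumption)
  have r: "W = range (\<lambda>c. lc V c b' m)"
    using b'(5) lc_mem_subspace[OF W b'(3)] by (intro equalityI subsetI) auto
  have "vectorspace.dim CC (V\<lparr>carrier := W\<rparr>) = m"
    by (rule iffD2[OF subspace_dim_iff(1)[OF fd W]]) (use b'(3,4) r in blast)
  then have m: "m = n" using d by simp
  have "lc V c b' n = lc V c b n" for c by (rule lc_cong) (use b'(2) in auto)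
  then show ?thesis using r unfolding m by simp
qed

lemma (in cvs) range_lc_subspace:
  assumes "\<forall>k<n. b k \<in> carrier V"
  shows "VectorSpace.subspace CC (range (\<lambda>c. lc V c b n)) V"
  using span_is_subspace[of "b ` {..<n}"] span_tuple[OF assms] assms by (simp add: image_subset_iff)

section \<open>The stratum\<close>

text \<open>The last assumption says that \<open>Ext(P, I) = 0\<close>, in terms of the complex that computes it.\<close>
locale stratum_setup =
  fixes Q :: "('i, 'a) pre_digraph" and P :: "('i, 'a, 'p) rep" and I :: "('i, 'a, 'q) rep" and f :: "'i \<Rightarrow> nat"
  assumes finV: "finite (verts Q)" and finA: "finite (arcs Q)" and wf: "wf_digraph Q"
    and P: "representation Q P" and I: "representation Q I"
    and ext: "\<And>\<psi>. (\<And>a. a \<in> arcs Q \<Longrightarrow> linear_map CC (space P (tail Q a)) (space I (head Q a)) (\<psi> a)) \<Longrightarrow>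
      \<exists>\<phi>. (\<forall>i\<in>verts Q. linear_map CC (space P i) (space I i) (\<phi> i)) \<and>
        (\<forall>a\<in>arcs Q. \<forall>x\<in>carrier (space P (tail Q a)).
           \<phi> (head Q a) (act P a x) = act I a (\<phi> (tail Q a) x) \<oplus>\<^bsub>space I (head Q a)\<^esub> \<psi> a x)"

lemma representation_direct_sum:
  assumes P: "representation Q P" and I: "representation Q I"
  shows "representation Q (direct_sum_rep P I)"
  unfolding representation_def
proof (intro conjI ballI)
  fix i assume i: "i \<in> verts Q"
  have v: "cvs (space P i)" "cvs (space I i)" "vectorspace.fin_dim CC (space P i)" "vectorspace.fin_dim CC (space I i)"
    using P I i unfolding representation_def cvs_def by auto
  show "vectorspace CC (space (direct_sum_rep P I) i)"
    using cvs_direct_sum[OF v(1,2)] by (simp add: direct_sum_rep_def cvs_def)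
  show "vectorspace.fin_dim CC (space (direct_sum_rep P I) i)"
    using fin_dim_direct_sum[OF v(1,3,2,4)] by (simp add: direct_sum_rep_def)
next
  fix a assume a: "a \<in> arcs Q"
  have aP: "linear_map CC (space P (tail Q a)) (space P (head Q a)) (act P a)"
    and aI: "linear_map CC (space I (tail Q a)) (space I (head Q a)) (act I a)"
    using P I a unfolding representation_def by auto
  show "linear_map CC (space (direct_sum_rep P I) (tail Q a)) (space (direct_sum_rep P I) (head Q a)) (act (direct_sum_rep P I) a)"
    unfolding direct_sum_rep_def
    by (simp, rule linear_mapI) (use linear_mapD[OF aP] linear_mapD[OF aI] in \<open>auto intro!: cvs_direct_sum\<close>)
qed

text \<open>The prefixes \<open>PB\<close>, \<open>IB\<close> and \<open>EB\<close> refer to the three Grassmannians, of \<open>P\<close>, of \<open>I\<close> and of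
\<open>P \<oplus> I\<close>.\<close>
sublocale stratum_setup \<subseteq> PB: rep_bundle Q P "\<lambda>i. dimvec P i - int (f i)"
  by (rule rep_bundle.intro[OF finV P])

sublocale stratum_setup \<subseteq> IB: rep_bundle Q I "\<lambda>i. int (f i)"
  by (rule rep_bundle.intro[OF finV I])

sublocale stratum_setup \<subseteq> EB: rep_bundle Q "direct_sum_rep P I" "dimvec P"
  by (rule rep_bundle.intro[OF finV representation_direct_sum[OF P I]])

context stratum_setup
begin

abbreviation "nP i \<equiv> nat (dimvec P i - int (f i))"
abbreviation "S \<equiv> stratum_points Q P I (\<lambda>i. int (f i))"

lemma ends: "a \<in> arcs Q \<Longrightarrow> tail Q a \<in> verts Q" "a \<in> arcs Q \<Longrightarrow> head Q a \<in> verts Q"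
  using wf by (auto simp: wf_digraph.tail_in_verts wf_digraph.head_in_verts)

lemma actP: "a \<in> arcs Q \<Longrightarrow> linear_map CC (space P (tail Q a)) (space P (head Q a)) (act P a)"
  using P unfolding representation_def by blast
lemma actI: "a \<in> arcs Q \<Longrightarrow> linear_map CC (space I (tail Q a)) (space I (head Q a)) (act I a)"
  using I unfolding representation_def by blast

lemma space_E[simp]: "space (direct_sum_rep P I) i = direct_sum (space P i) (space I i)"
  by (simp add: direct_sum_rep_def)
lemma act_E[simp]: "act (direct_sum_rep P I) a (x, y) = (act P a x, act I a y)"
  by (simp add: direct_sum_rep_def)

lemma zeta_stratum:
  assumes N: "N \<in> S"
  shows "inter_I Q P I N \<in> IB.Gp" "proj_P Q N \<in> PB.Gp"
proof -
  have N': "N \<in> subreps Q (direct_sum_rep P I)"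
    and dI: "\<And>i. i \<in> verts Q \<Longrightarrow> dimvec (sub_rep I (inter_I Q P I N)) i = int (f i)"
    and dP: "\<And>i. i \<in> verts Q \<Longrightarrow> dimvec (sub_rep P (proj_P Q N)) i = dimvec P i - int (f i)"
    using N unfolding stratum_points_def quiver_Gr_points_def by auto
  have sub: "N i \<subseteq> carrier (space P i) \<times> carrier (space I i) \<and> (\<zero>\<^bsub>space P i\<^esub>, \<zero>\<^bsub>space I i\<^esub>) \<in> N i \<and>
     (\<forall>x\<in>N i. \<forall>y\<in>N i. (fst x \<oplus>\<^bsub>space P i\<^esub> fst y, snd x \<oplus>\<^bsub>space I i\<^esub> snd y) \<in> N i) \<and>
     (\<forall>c. \<forall>x\<in>N i. (c \<odot>\<^bsub>space P i\<^esub> fst x, c \<odot>\<^bsub>space I i\<^esub> snd x) \<in> N i)" if i: "i \<in> verts Q" for i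
    using subreps_subspace[OF N' i] cvs.subspace_iff[OF EB.vs[OF i], of "N i"] by simp
  have act: "(act P a x, act I a y) \<in> N (head Q a)" if "a \<in> arcs Q" "(x, y) \<in> N (tail Q a)" for a x y
    using subreps_act[OF N' that] by simp
  have "inter_I Q P I N \<in> subreps Q I"
    unfolding subreps_def
  proof (intro CollectI conjI ballI)
    show "inter_I Q P I N \<in> extensional (verts Q)" by (simp add: inter_I_def)
    show "VectorSpace.subspace CC (inter_I Q P I N i) (space I i)" if i: "i \<in> verts Q" for i
    proof -
      interpret VI: cvs "space I i" by (rule IB.vs[OF i])
      interpret VP: cvs "space P i" by (rule PB.vs[OF i])
      have z: "\<zero>\<^bsub>space P i\<^esub> \<oplus>\<^bsub>space P i\<^esub> \<zero>\<^bsub>space P i\<^esub> = \<zero>\<^bsub>space P i\<^esub>" by simp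
      show ?thesis unfolding VI.subspace_iff using sub[OF i] i
      proof (intro conjI ballI allI)
        fix x y assume xy: "x \<in> inter_I Q P I N i" "y \<in> inter_I Q P I N i"
        then have "(\<zero>\<^bsub>space P i\<^esub>, x) \<in> N i" "(\<zero>\<^bsub>space P i\<^esub>, y) \<in> N i" "x \<in> carrier (space I i)" "y \<in> carrier (space I i)"
          using i by (auto simp: inter_I_def inj2_def)
        then have "(\<zero>\<^bsub>space P i\<^esub> \<oplus>\<^bsub>space P i\<^esub> \<zero>\<^bsub>space P i\<^esub>, x \<oplus>\<^bsub>space I i\<^esub> y) \<in> N i"
          using sub[OF i] by force
        then show "x \<oplus>\<^bsub>space I i\<^esub> y \<in> inter_I Q P I N i"
          using i \<open>x \<in> carrier (space I i)\<close> \<open>y \<in> carrier (space I i)\<close> unfolding z by (auto simp: inter_I_def inj2_def)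
      next
        fix c x assume x: "x \<in> inter_I Q P I N i"
        then have "(\<zero>\<^bsub>space P i\<^esub>, x) \<in> N i" "x \<in> carrier (space I i)"
          using i by (auto simp: inter_I_def inj2_def)
        then have "(c \<odot>\<^bsub>space P i\<^esub> \<zero>\<^bsub>space P i\<^esub>, c \<odot>\<^bsub>space I i\<^esub> x) \<in> N i"
          using sub[OF i] by force
        then show "c \<odot>\<^bsub>space I i\<^esub> x \<in> inter_I Q P I N i"
          using i \<open>x \<in> carrier (space I i)\<close> by (auto simp: inter_I_def inj2_def)
      qed (use i sub[OF i] in \<open>auto simp: inter_I_def inj2_def\<close>)
    qed
    show "act I a ` inter_I Q P I N (tail Q a) \<subseteq> inter_I Q P I N (head Q a)" if a: "a \<in> arcs Q" for a
    proof
      fix z assume "z \<in> act I a ` inter_I Q P I N (tail Q a)"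
      then obtain y where y: "z = act I a y" "y \<in> carrier (space I (tail Q a))" "(\<zero>\<^bsub>space P (tail Q a)\<^esub>, y) \<in> N (tail Q a)"
        using ends[OF a] by (auto simp: inter_I_def inj2_def)
      have "(act P a \<zero>\<^bsub>space P (tail Q a)\<^esub>, act I a y) \<in> N (head Q a)" by (rule act[OF a y(3)])
      then show "z \<in> inter_I Q P I N (head Q a)"
        using ends[OF a] linear_map_zero[OF actP[OF a]] linear_mapD(1)[OF actI[OF a] y(2)] y(1)
        by (simp add: inter_I_def inj2_def)
    qed
  qed
  then show "inter_I Q P I N \<in> IB.Gp" using dI unfolding quiver_Gr_points_def by blast
  have "proj_P Q N \<in> subreps Q P"
    unfolding subreps_def
  proof (intro CollectI conjI ballI)
    show "proj_P Q N \<in> extensional (verts Q)" by (simp add: proj_P_def)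
    show "VectorSpace.subspace CC (proj_P Q N i) (space P i)" if i: "i \<in> verts Q" for i
      unfolding cvs.subspace_iff[OF PB.vs[OF i]]
    proof (intro conjI ballI allI)
      show "proj_P Q N i \<subseteq> carrier (space P i)" using sub[OF i] i by (auto simp: proj_P_def)
      show "\<zero>\<^bsub>space P i\<^esub> \<in> proj_P Q N i" using sub[OF i] i by (force simp: proj_P_def)
      fix x assume "x \<in> proj_P Q N i"
      then obtain x' where x': "x' \<in> N i" "x = fst x'" using i by (auto simp: proj_P_def)
      show "c \<odot>\<^bsub>space P i\<^esub> x \<in> proj_P Q N i" for c
        using sub[OF i] x' i by (simp add: proj_P_def) (metis fst_conv image_eqI)
      fix y assume "y \<in> proj_P Q N i"
      then obtain y' where y': "y' \<in> N i" "y = fst y'" using i by (auto simp: proj_P_def)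
      show "x \<oplus>\<^bsub>space P i\<^esub> y \<in> proj_P Q N i"
        using sub[OF i] x' y' i by (simp add: proj_P_def) (metis fst_conv image_eqI)
    qed
    show "act P a ` proj_P Q N (tail Q a) \<subseteq> proj_P Q N (head Q a)" if a: "a \<in> arcs Q" for a
    proof
      fix z assume "z \<in> act P a ` proj_P Q N (tail Q a)"
      then obtain x y where xy: "z = act P a x" "(x, y) \<in> N (tail Q a)" using ends[OF a] by (auto simp: proj_P_def)
      show "z \<in> proj_P Q N (head Q a)" using ends[OF a] act[OF a xy(2)] xy(1) by (force simp: proj_P_def)
    qed
  qed
  then show "proj_P Q N \<in> PB.Gp" using dP unfolding quiver_Gr_points_def by blast
qed

end

section \<open>Matrix coordinates near a point of the base\<close>

text \<open>Charts \<open>\<rho>I\<close> and \<open>\<rho>P\<close> of the two Grassmannians of the base.  The vectors \<open>c i\<close> form a basis of the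
common kernel of the functionals \<open>\<rho>I i\<close>.  This kernel is a complement to all subspaces in the
chart at once, so it represents every quotient \<open>I / N\<^sub>I\<close>.  The functionals \<open>cs i\<close> are the coordinates
on it.\<close>

locale chart_data = stratum_setup Q P I f
  for Q :: "('i, 'a) pre_digraph" and P :: "('i, 'a, 'p) rep" and I :: "('i, 'a, 'q) rep" and f :: "'i \<Rightarrow> nat" +
  fixes \<rho>I :: "'i \<Rightarrow> nat \<Rightarrow> 'q \<Rightarrow> complex" and \<rho>P :: "'i \<Rightarrow> nat \<Rightarrow> 'p \<Rightarrow> complex"
    and m :: "'i \<Rightarrow> nat" and c :: "'i \<Rightarrow> nat \<Rightarrow> 'q" and cs :: "'i \<Rightarrow> nat \<Rightarrow> 'q \<Rightarrow> complex"
  assumes le: "\<And>i. i \<in> verts Q \<Longrightarrow> int (f i) \<le> dimvec P i"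
    and dimI: "\<And>i. i \<in> verts Q \<Longrightarrow> dimvec I i = int (f i) + int (m i)"
    and \<rho>I: "IB.functionals \<rho>I" and \<rho>P: "PB.functionals \<rho>P"
    and c: "\<And>i. i \<in> verts Q \<Longrightarrow> \<forall>j<m i. c i j \<in> carrier (space I i)"
    and cs: "\<And>i j. i \<in> verts Q \<Longrightarrow> j < m i \<Longrightarrow> lin_functional (space I i) (cs i j)"
    and \<rho>Ic: "\<And>i k j. i \<in> verts Q \<Longrightarrow> k < f i \<Longrightarrow> j < m i \<Longrightarrow> \<rho>I i k (c i j) = 0"
    and csc: "\<And>i j j'. i \<in> verts Q \<Longrightarrow> j < m i \<Longrightarrow> j' < m i \<Longrightarrow> cs i j (c i j') = (if j' = j then 1 else 0)"
    and kerI: "\<And>i y. i \<in> verts Q \<Longrightarrow> y \<in> carrier (space I i) \<Longrightarrow> (\<And>k. k < f i \<Longrightarrow> \<rho>I i k y = 0) \<Longrightarrow>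
      y = lc (space I i) (\<lambda>j. cs i j y) (c i) (m i)"
begin

lemma \<rho>I': "i \<in> verts Q \<Longrightarrow> k < f i \<Longrightarrow> lin_functional (space I i) (\<rho>I i k)"
  using \<rho>I unfolding IB.functionals_def by simp
lemma \<rho>P': "i \<in> verts Q \<Longrightarrow> k < nP i \<Longrightarrow> lin_functional (space P i) (\<rho>P i k)"
  using \<rho>P unfolding PB.functionals_def by simp

lemma nE: "i \<in> verts Q \<Longrightarrow> nat (dimvec P i) = f i + nP i"
  using le[of i] by simp

text \<open>The index set \<open>L\<close> is that of the matrices of families of maps \<open>N\<^sub>P(i) \<rightarrow> (I / N\<^sub>I)(i)\<close>, and \<open>R\<close> that of
families of maps \<open>N\<^sub>P(t a) \<rightarrow> (I / N\<^sub>I)(h a)\<close>.\<close>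
definition L :: "('i \<times> nat \<times> nat) set" where "L = (SIGMA i:verts Q. {..<nP i} \<times> {..<m i})"
definition R :: "('a \<times> nat \<times> nat) set" where "R = (SIGMA a:arcs Q. {..<nP (tail Q a)} \<times> {..<m (head Q a)})"

lemma finL: "finite L" and finR: "finite R"
  unfolding L_def R_def using finV finA by auto

text \<open>The coordinates on \<open>I / N\<^sub>I\<close> with respect to the classes of the \<open>c i j\<close>: the functional \<open>cs i j\<close> is
corrected by its values on the dual frame of \<open>N\<^sub>I\<close> so that it vanishes on \<open>N\<^sub>I\<close>.\<close>
definition quot_coord :: "('i \<Rightarrow> 'q set) \<Rightarrow> 'i \<Rightarrow> nat \<Rightarrow> 'q \<Rightarrow> complex" where
  "quot_coord NI i j y = cs i j y - (\<Sum>k<f i. cs i j (IB.sec \<rho>I NI i k) * \<rho>I i k y)"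

text \<open>The matrix of the map that sends a family \<open>\<phi>\<close> to the family \<open>\<phi>(h a) \<circ> P\<^sub>a - I\<^sub>a \<circ> \<phi>(t a)\<close>, with respect to the dual
frame of \<open>N\<^sub>P\<close> and the coordinates on \<open>I / N\<^sub>I\<close>; see \<open>A_lift\<close>.\<close>
definition A :: "('i \<Rightarrow> 'q set) \<Rightarrow> ('i \<Rightarrow> 'p set) \<Rightarrow> 'a \<times> nat \<times> nat \<Rightarrow> 'i \<times> nat \<times> nat \<Rightarrow> complex" where
  "A NI NP r x = (case r of (a, l, j') \<Rightarrow> case x of (i, l', j) \<Rightarrow>
     (if i = head Q a \<and> j = j' then \<rho>P i l' (act P a (PB.sec \<rho>P NP (tail Q a) l)) else 0) -
     (if i = tail Q a \<and> l' = l then quot_coord NI (head Q a) j' (act I a (c (tail Q a) j)) else 0))"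

text \<open>The linear map on all of \<open>P i\<close> that has matrix \<open>Z\<close> with respect to any frame dual to \<open>\<rho>P\<close> and the
basis \<open>c\<close>.  It is independent of \<open>N\<^sub>P\<close> and \<open>N\<^sub>I\<close>, and it represents the map
\<open>N\<^sub>P(i) \<rightarrow> (I / N\<^sub>I)(i)\<close> with this matrix for all points of the chart.\<close>
definition lift :: "('i \<times> nat \<times> nat \<Rightarrow> complex) \<Rightarrow> 'i \<Rightarrow> 'p \<Rightarrow> 'q" where
  "lift Z i x = lc (space I i) (\<lambda>j. \<Sum>l<nP i. Z (i, l, j) * \<rho>P i l x) (c i) (m i)"

lemma sum_L: "(\<Sum>x\<in>L. g x) = (\<Sum>i\<in>verts Q. \<Sum>l<nP i. \<Sum>j<m i. g (i, l, j))" for g :: "_ \<Rightarrow> complex"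
proof -
  have "(\<Sum>x\<in>L. g x) = (\<Sum>i\<in>verts Q. \<Sum>y\<in>{..<nP i} \<times> {..<m i}. g (i, y))"
    unfolding L_def using sum.Sigma[of "verts Q" "\<lambda>i. {..<nP i} \<times> {..<m i}" "\<lambda>i y. g (i, y)"] finV by simp
  also have "\<dots> = (\<Sum>i\<in>verts Q. \<Sum>l<nP i. \<Sum>j<m i. g (i, l, j))"
    by (rule sum.cong[OF refl]) (simp add: sum.cartesian_product)
  finally show ?thesis .
qed

lemma A_sum:
  assumes r: "(a, l, j') \<in> R"
  shows "(\<Sum>x\<in>L. A NI NP (a, l, j') x * Z x) =
     (\<Sum>l'<nP (head Q a). \<rho>P (head Q a) l' (act P a (PB.sec \<rho>P NP (tail Q a) l)) * Z (head Q a, l', j')) -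
     (\<Sum>j<m (tail Q a). quot_coord NI (head Q a) j' (act I a (c (tail Q a) j)) * Z (tail Q a, l, j))"
proof -
  have a: "a \<in> arcs Q" "l < nP (tail Q a)" "j' < m (head Q a)" using r unfolding R_def by auto
  let ?b = "\<lambda>i l'. \<rho>P i l' (act P a (PB.sec \<rho>P NP (tail Q a) l))"
  let ?g = "\<lambda>j. quot_coord NI (head Q a) j' (act I a (c (tail Q a) j))"
  have "(\<Sum>x\<in>L. A NI NP (a, l, j') x * Z x) =
     (\<Sum>i\<in>verts Q. \<Sum>l'<nP i. \<Sum>j<m i. (if i = head Q a \<and> j = j' then ?b i l' * Z (i, l', j) else 0) -
        (if i = tail Q a \<and> l' = l then ?g j * Z (i, l', j) else 0))"
    unfolding sum_L A_def by (intro sum.cong refl) (auto simp: algebra_simps)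
  also have "\<dots> = (\<Sum>i\<in>verts Q. \<Sum>l'<nP i. \<Sum>j<m i. (if i = head Q a \<and> j = j' then ?b i l' * Z (i, l', j) else 0)) -
     (\<Sum>i\<in>verts Q. \<Sum>l'<nP i. \<Sum>j<m i. (if i = tail Q a \<and> l' = l then ?g j * Z (i, l', j) else 0))"
    by (simp add: sum_subtractf)
  also have "(\<Sum>i\<in>verts Q. \<Sum>l'<nP i. \<Sum>j<m i. (if i = head Q a \<and> j = j' then ?b i l' * Z (i, l', j) else 0)) =
     (\<Sum>i\<in>verts Q. if i = head Q a then (\<Sum>l'<nP i. \<Sum>j<m i. if j = j' then ?b i l' * Z (i, l', j) else 0) else 0)"
    by (intro sum.cong refl) auto
  also have "\<dots> = (\<Sum>l'<nP (head Q a). \<Sum>j<m (head Q a). if j = j' then ?b (head Q a) l' * Z (head Q a, l', j) else 0)"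
    using finV ends[OF a(1)] by simp
  also have "\<dots> = (\<Sum>l'<nP (head Q a). ?b (head Q a) l' * Z (head Q a, l', j'))"
    using a(3) by simp
  also have "(\<Sum>i\<in>verts Q. \<Sum>l'<nP i. \<Sum>j<m i. (if i = tail Q a \<and> l' = l then ?g j * Z (i, l', j) else 0)) =
     (\<Sum>i\<in>verts Q. if i = tail Q a then (\<Sum>l'<nP i. if l' = l then (\<Sum>j<m i. ?g j * Z (i, l', j)) else 0) else 0)"
  proof (rule sum.cong[OF refl])
    fix i
    have e: "(\<Sum>j<m i. if l' = l then ?g j * Z (i, l', j) else 0) = (if l' = l then (\<Sum>j<m i. ?g j * Z (i, l', j)) else 0)" for i l'
      by (cases "l' = l") simp_all
    show "(\<Sum>l'<nP i. \<Sum>j<m i. (if i = tail Q a \<and> l' = l then ?g j * Z (i, l', j) else 0)) =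
      (if i = tail Q a then (\<Sum>l'<nP i. if l' = l then (\<Sum>j<m i. ?g j * Z (i, l', j)) else 0) else 0)"
    proof (cases "i = tail Q a")
      case True
      then have "(\<Sum>j<m i. (if i = tail Q a \<and> l' = l then ?g j * Z (i, l', j) else 0)) =
          (if l' = l then (\<Sum>j<m i. ?g j * Z (i, l', j)) else 0)" for l'
        using e[of l' i] by simp
      then show ?thesis using True by simp
    qed simp
  qed
  also have "\<dots> = (\<Sum>l'<nP (tail Q a). if l' = l then (\<Sum>j<m (tail Q a). ?g j * Z (tail Q a, l', j)) else 0)"
    using finV ends[OF a(1)] by simp
  also have "\<dots> = (\<Sum>j<m (tail Q a). ?g j * Z (tail Q a, l, j))"
    using a(2) by simp
  finally show ?thesis .
qed

lemma lift_linear: "i \<in> verts Q \<Longrightarrow> linear_map CC (space P i) (space I i) (lift Z i)"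
  unfolding lift_def
  by (rule linear_map_lc[OF IB.vs PB.vs c]) (auto intro!: functional_sum \<rho>P')

lemma \<rho>I_lift: "i \<in> verts Q \<Longrightarrow> k < f i \<Longrightarrow> \<rho>I i k (lift Z i x) = 0"
  unfolding lift_def by (subst cvs.lc_functional[OF IB.vs \<rho>I' c]) (auto simp: \<rho>Ic)

lemma lift_add: "i \<in> verts Q \<Longrightarrow> lift (\<lambda>x. Z x + Z' x) i x = lift Z i x \<oplus>\<^bsub>space I i\<^esub> lift Z' i x"
  unfolding lift_def by (simp add: cvs.lc_add[OF IB.vs c] sum.distrib distrib_right)

lemma lift_smult: "i \<in> verts Q \<Longrightarrow> lift (\<lambda>x. t * Z x) i x = t \<odot>\<^bsub>space I i\<^esub> lift Z i x"
  unfolding lift_def by (simp add: cvs.lc_smult[OF IB.vs c] sum_distrib_left mult.assoc)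

end

section \<open>Homomorphisms as solutions of a linear system\<close>

locale chart_point = chart_data Q P I f \<rho>I \<rho>P m c cs
  for Q :: "('i, 'a) pre_digraph" and P :: "('i, 'a, 'p) rep" and I :: "('i, 'a, 'q) rep" and f :: "'i \<Rightarrow> nat"
    and \<rho>I :: "'i \<Rightarrow> nat \<Rightarrow> 'q \<Rightarrow> complex" and \<rho>P :: "'i \<Rightarrow> nat \<Rightarrow> 'p \<Rightarrow> complex"
    and m :: "'i \<Rightarrow> nat" and c :: "'i \<Rightarrow> nat \<Rightarrow> 'q" and cs :: "'i \<Rightarrow> nat \<Rightarrow> 'q \<Rightarrow> complex" +
  fixes NI :: "'i \<Rightarrow> 'q set" and NP :: "'i \<Rightarrow> 'p set"
  assumes NI: "NI \<in> IB.chart \<rho>I" "NI \<in> IB.Gp" and NP: "NP \<in> PB.chart \<rho>P" "NP \<in> PB.Gp"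
begin

abbreviation "u \<equiv> IB.sec \<rho>I NI"
abbreviation "w \<equiv> PB.sec \<rho>P NP"
abbreviation "coset i y \<equiv> a_r_coset (space I i) (NI i) y"
abbreviation "AA \<equiv> A NI NP"
abbreviation "ker Z \<equiv> (\<forall>r\<in>R. (\<Sum>x\<in>L. AA r x * Z x) = 0)"
abbreviation "Sub \<equiv> sub_rep P NP"
abbreviation "Quot \<equiv> quotient_rep Q I NI"

lemma NI_sub: "NI \<in> subreps Q I" and NP_sub: "NP \<in> subreps Q P"
  using NI NP unfolding quiver_Gr_points_def by auto

lemma u_car: "i \<in> verts Q \<Longrightarrow> \<forall>k<f i. u i k \<in> carrier (space I i)"
  using IB.frame_mem[OF IB.sec(1)[OF NI(1)]] by simp
lemma w_car: "i \<in> verts Q \<Longrightarrow> \<forall>k<nP i. w i k \<in> carrier (space P i)"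
  by (rule PB.frame_mem[OF PB.sec(1)[OF NP(1)]])
lemma NI_eq: "i \<in> verts Q \<Longrightarrow> NI i = range (\<lambda>t. lc (space I i) t (u i) (f i))"
  using IB.sp_eq[OF IB.sec(1)[OF NI(1)]] IB.sec(2)[OF NI(1)] by simp
lemma NP_eq: "i \<in> verts Q \<Longrightarrow> NP i = range (\<lambda>t. lc (space P i) t (w i) (nP i))"
  using PB.sp_eq[OF PB.sec(1)[OF NP(1)]] PB.sec(2)[OF NP(1)] by simp
lemma u_mem: "i \<in> verts Q \<Longrightarrow> k < f i \<Longrightarrow> u i k \<in> NI i"
  using IB.frame_in_sp[OF IB.sec(1)[OF NI(1)]] IB.sec(2)[OF NI(1)] by simp
lemma w_mem: "i \<in> verts Q \<Longrightarrow> k < nP i \<Longrightarrow> w i k \<in> NP i"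
  using PB.frame_in_sp[OF PB.sec(1)[OF NP(1)]] PB.sec(2)[OF NP(1)] by simp
lemma \<rho>u: "i \<in> verts Q \<Longrightarrow> k < f i \<Longrightarrow> l < f i \<Longrightarrow> \<rho>I i k (u i l) = (if l = k then 1 else 0)"
  using IB.sec(3)[OF NI(1)] unfolding IB.dual_def by simp
lemma \<rho>w: "i \<in> verts Q \<Longrightarrow> k < nP i \<Longrightarrow> l < nP i \<Longrightarrow> \<rho>P i k (w i l) = (if l = k then 1 else 0)"
  using PB.sec(3)[OF NP(1)] unfolding PB.dual_def by simp
lemma NI_exp: "i \<in> verts Q \<Longrightarrow> y \<in> NI i \<Longrightarrow> y = lc (space I i) (\<lambda>k. \<rho>I i k y) (u i) (f i)"
  using IB.dual_expand[OF \<rho>I IB.sec(1)[OF NI(1)] IB.sec(3)[OF NI(1)]] IB.sec(2)[OF NI(1)] by simp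
lemma NP_exp: "i \<in> verts Q \<Longrightarrow> x \<in> NP i \<Longrightarrow> x = lc (space P i) (\<lambda>k. \<rho>P i k x) (w i) (nP i)"
  using PB.dual_expand[OF \<rho>P PB.sec(1)[OF NP(1)] PB.sec(3)[OF NP(1)]] PB.sec(2)[OF NP(1)] by simp
lemma NI_subsp: "i \<in> verts Q \<Longrightarrow> VectorSpace.subspace CC (NI i) (space I i)"
  by (rule subreps_subspace[OF NI_sub])
lemma NP_subsp: "i \<in> verts Q \<Longrightarrow> VectorSpace.subspace CC (NP i) (space P i)"
  by (rule subreps_subspace[OF NP_sub])
lemma NI_car: "i \<in> verts Q \<Longrightarrow> NI i \<subseteq> carrier (space I i)"
  by (rule conjunct1[OF iffD1[OF cvs.subspace_iff[OF IB.vs] NI_subsp]])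
lemma NP_car: "i \<in> verts Q \<Longrightarrow> NP i \<subseteq> carrier (space P i)"
  by (rule conjunct1[OF iffD1[OF cvs.subspace_iff[OF PB.vs] NP_subsp]])
lemma NI_act: "a \<in> arcs Q \<Longrightarrow> x \<in> NI (tail Q a) \<Longrightarrow> act I a x \<in> NI (head Q a)"
  by (rule subreps_act[OF NI_sub])
lemma NP_act: "a \<in> arcs Q \<Longrightarrow> x \<in> NP (tail Q a) \<Longrightarrow> act P a x \<in> NP (head Q a)"
  by (rule subreps_act[OF NP_sub])

lemma qc: "i \<in> verts Q \<Longrightarrow> quotient_cvs (space I i) (NI i)"
  by (rule quotient_cvs.intro[OF IB.vs quotient_cvs_axioms.intro[OF NI_subsp]])

lemma quot_coord_functional: "i \<in> verts Q \<Longrightarrow> j < m i \<Longrightarrow> lin_functional (space I i) (quot_coord NI i j)"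
  unfolding quot_coord_def[abs_def] by (intro functional_diff cs functional_sum \<rho>I') auto

lemma quot_coord_NI: assumes i: "i \<in> verts Q" and y: "y \<in> NI i" and j: "j < m i" shows "quot_coord NI i j y = 0"
proof -
  have "cs i j y = cs i j (lc (space I i) (\<lambda>k. \<rho>I i k y) (u i) (f i))" using NI_exp[OF i y] by simp
  also have "\<dots> = (\<Sum>k<f i. \<rho>I i k y * cs i j (u i k))"
    by (rule cvs.lc_functional[OF IB.vs[OF i] cs[OF i j] u_car[OF i]])
  finally show ?thesis unfolding quot_coord_def by (simp add: mult.commute)
qed

lemma functional_sub:
  assumes "lin_functional V \<xi>" "cvs V" "x \<in> carrier V" "y \<in> carrier V"
  shows "\<xi> (x \<oplus>\<^bsub>V\<^esub> (-1) \<odot>\<^bsub>V\<^esub> y) = \<xi> x - \<xi> y"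
  using assms cvs.smult_mem[OF assms(2,4), of "-1"] unfolding lin_functional_def by simp

text \<open>Subtracting from \<open>y\<close> the element of \<open>N\<^sub>I\<close> with the same values of \<open>\<rho>I\<close> leaves a vector in the span of
the \<open>c i j\<close>, whose coordinates are then zero.\<close>
lemma quot_coord_zero:
  assumes i: "i \<in> verts Q" and y: "y \<in> carrier (space I i)" and z: "\<And>j. j < m i \<Longrightarrow> quot_coord NI i j y = 0"
  shows "y \<in> NI i"
proof -
  interpret cvs "space I i" by (rule IB.vs[OF i])
  let ?n = "lc (space I i) (\<lambda>k. \<rho>I i k y) (u i) (f i)"
  have n: "?n \<in> carrier (space I i)" "?n \<in> NI i" using lc_mem[OF u_car[OF i]] NI_eq[OF i] by auto
  let ?y = "y \<oplus>\<^bsub>space I i\<^esub> (-1) \<odot>\<^bsub>space I i\<^esub> ?n"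
  have yc: "?y \<in> carrier (space I i)" using n y by simp
  have "\<rho>I i k ?y = 0" if k: "k < f i" for k
  proof -
    have "\<rho>I i k ?n = \<rho>I i k y"
      by (rule dual_coefficient[where \<rho> = "\<rho>I i"]) (use u_car[OF i] \<rho>I'[OF i] k \<rho>u[OF i] in auto)
    then show ?thesis using functional_sub[OF \<rho>I'[OF i k] cvs_axioms y n(1)] by simp
  qed
  from kerI[OF i yc this] have "?y = lc (space I i) (\<lambda>j. cs i j ?y) (c i) (m i)" .
  also have "\<dots> = \<zero>\<^bsub>space I i\<^esub>"
  proof (rule lc_zero_coeff[OF c[OF i]])
    fix j assume j: "j < m i"
    have "cs i j ?n = (\<Sum>k<f i. \<rho>I i k y * cs i j (u i k))" by (rule lc_functional[OF cs[OF i j] u_car[OF i]])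
    then show "cs i j ?y = 0"
      using functional_sub[OF cs[OF i j] cvs_axioms y n(1)] z[OF j] unfolding quot_coord_def by (simp add: mult.commute)
  qed
  finally have "y = ?n" using add_eq_zero_iff[OF y n(1)] by simp
  then show ?thesis using n(2) by simp
qed

lemma quot_coord_c: "i \<in> verts Q \<Longrightarrow> j < m i \<Longrightarrow> j' < m i \<Longrightarrow> quot_coord NI i j (c i j') = (if j' = j then 1 else 0)"
  unfolding quot_coord_def by (simp add: \<rho>Ic csc)

lemma q_eq_quot_coord:
  assumes i: "i \<in> verts Q" and y: "y \<in> carrier (space I i)" "y' \<in> carrier (space I i)"
  shows "coset i y = coset i y' \<longleftrightarrow> (\<forall>j<m i. quot_coord NI i j y = quot_coord NI i j y')"
proof -
  interpret quotient_cvs "space I i" "NI i" by (rule qc[OF i])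
  let ?y = "y \<oplus>\<^bsub>space I i\<^esub> (-1) \<odot>\<^bsub>space I i\<^esub> y'"
  have e: "quot_coord NI i j ?y = quot_coord NI i j y - quot_coord NI i j y'" if "j < m i" for j
    by (rule functional_sub[OF quot_coord_functional[OF i that] cvs_axioms y])
  have yc: "?y \<in> carrier (space I i)" using y by simp
  show ?thesis unfolding q_eq_iff[OF y]
    using e quot_coord_NI[OF i] quot_coord_zero[OF i yc] by (metis right_minus_eq)
qed

lemma quot_coord_cong:
  assumes "i \<in> verts Q" "y \<in> carrier (space I i)" "y' \<in> carrier (space I i)" "coset i y = coset i y'" "j < m i"
  shows "quot_coord NI i j y = quot_coord NI i j y'"
  using iffD1[OF q_eq_quot_coord[OF assms(1-3)] assms(4)] assms(5) by simp

lemma quot_coord_lift: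
  assumes i: "i \<in> verts Q" and j: "j < m i"
  shows "quot_coord NI i j (lift Z i x) = (\<Sum>l<nP i. Z (i, l, j) * \<rho>P i l x)"
  unfolding lift_def
  by (rule cvs.dual_coefficient[OF IB.vs[OF i] c[OF i], where \<rho> = "quot_coord NI i"])
    (use quot_coord_functional[OF i] j quot_coord_c[OF i] in auto)

lemma lift_w:
  assumes i: "i \<in> verts Q" and l: "l < nP i"
  shows "lift Z i (w i l) = lc (space I i) (\<lambda>j. Z (i, l, j)) (c i) (m i)"
  unfolding lift_def
proof (rule lc_cong)
  fix j
  have "(\<Sum>l'<nP i. Z (i, l', j) * \<rho>P i l' (w i l)) = (\<Sum>l'<nP i. if l' = l then Z (i, l', j) else 0)"
    by (rule sum.cong) (use \<rho>w[OF i _ l] in auto)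
  then show "(\<Sum>l'<nP i. Z (i, l', j) * \<rho>P i l' (w i l)) = Z (i, l, j)" using l by simp
qed simp

lemma quot_coord_lift_w: "i \<in> verts Q \<Longrightarrow> l < nP i \<Longrightarrow> j < m i \<Longrightarrow> quot_coord NI i j (lift Z i (w i l)) = Z (i, l, j)"
  unfolding lift_w
  by (rule cvs.dual_coefficient[OF IB.vs c, where \<rho> = "quot_coord NI i"]) (use quot_coord_functional quot_coord_c in auto)

text \<open>Row \<open>(a, l, j')\<close> of the system is the coordinate \<open>j'\<close>, modulo \<open>N\<^sub>I\<close>, of the failure of the lift to
commute with \<open>a\<close> at the frame vector \<open>w l\<close>.\<close>
lemma A_lift:
  assumes r: "(a, l, j') \<in> R"
  shows "(\<Sum>x\<in>L. AA (a, l, j') x * Z x) =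
    quot_coord NI (head Q a) j' (lift Z (head Q a) (act P a (w (tail Q a) l))) -
    quot_coord NI (head Q a) j' (act I a (lift Z (tail Q a) (w (tail Q a) l)))"
proof -
  have a: "a \<in> arcs Q" "l < nP (tail Q a)" "j' < m (head Q a)" using r unfolding R_def by auto
  note t = ends[OF a(1)]
  have "quot_coord NI (head Q a) j' (act I a (lift Z (tail Q a) (w (tail Q a) l))) =
      (\<Sum>j<m (tail Q a). Z (tail Q a, l, j) * quot_coord NI (head Q a) j' (act I a (c (tail Q a) j)))"
    unfolding lift_w[OF t(1) a(2)]
    by (rule cvs.lc_functional[OF IB.vs[OF t(1)] functional_compose[OF actI[OF a(1)] quot_coord_functional[OF t(2) a(3)]] c[OF t(1)]])
  then show ?thesis unfolding A_sum[OF r] quot_coord_lift[OF t(2) a(3)] by (simp add: mult.commute)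
qed

lemma linear_agree:
  fixes W :: "(complex, 'w) module"
  assumes i: "i \<in> verts Q" and T: "linear_map CC (space P i\<lparr>carrier := NP i\<rparr>) W T"
    and T': "linear_map CC (space P i\<lparr>carrier := NP i\<rparr>) W T'"
    and eq: "\<And>l. l < nP i \<Longrightarrow> T (w i l) = T' (w i l)" and x: "x \<in> NP i"
  shows "T x = T' x"
proof -
  let ?t = "\<lambda>k. \<rho>P i k x"
  have e: "x = lc (space P i\<lparr>carrier := NP i\<rparr>) ?t (w i) (nP i)" using NP_exp[OF i x] by simp
  have "T x = lc W ?t (\<lambda>l. T (w i l)) (nP i)"
    by (subst e, rule lc_linear_map[OF T]) (use w_mem[OF i] in simp)
  also have "\<dots> = lc W ?t (\<lambda>l. T' (w i l)) (nP i)" by (rule lc_cong) (use eq in auto)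
  also have "\<dots> = T' (lc (space P i\<lparr>carrier := NP i\<rparr>) ?t (w i) (nP i))"
    by (rule lc_linear_map[OF T', symmetric]) (use w_mem[OF i] in simp)
  finally show ?thesis using e by simp
qed

lemma lift_carrier: "i \<in> verts Q \<Longrightarrow> x \<in> carrier (space P i) \<Longrightarrow> lift Z i x \<in> carrier (space I i)"
  by (rule linear_mapD(1)[OF lift_linear])

lemma act_quotient:
  assumes a: "a \<in> arcs Q" and y: "y \<in> carrier (space I (tail Q a))"
  shows "act Quot a (coset (tail Q a) y) = coset (head Q a) (act I a y)"
proof -
  note t = ends[OF a]
  interpret T: quotient_cvs "space I (tail Q a)" "NI (tail Q a)" by (rule qc[OF t(1)])
  interpret H: quotient_cvs "space I (head Q a)" "NI (head Q a)" by (rule qc[OF t(2)])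
  have cc: "coset (head Q a) (act I a x) = coset (head Q a) (act I a y)" if x: "x \<in> coset (tail Q a) y" for x
  proof -
    obtain n where n: "n \<in> NI (tail Q a)" "x = n \<oplus>\<^bsub>space I (tail Q a)\<^esub> y" using x unfolding T.mem_q by (elim bexE) (rule that)
    have "act I a x = act I a n \<oplus>\<^bsub>space I (head Q a)\<^esub> act I a y"
      unfolding n(2) by (rule linear_mapD(2)[OF actI[OF a] T.WV[OF n(1)] y])
    then have "act I a x \<in> coset (head Q a) (act I a y)" unfolding H.mem_q using NI_act[OF a n(1)] by (intro bexI[of _ "act I a n"])
    then show ?thesis by (rule H.q_eq_of_mem[OF linear_mapD(1)[OF actI[OF a] y]])
  qed
  have "(\<Union>x\<in>coset (tail Q a) y. coset (head Q a) (act I a x)) = coset (head Q a) (act I a y)"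
    by (rule UN_constant_eq[OF T.q_self[OF y]]) (use cc in simp)
  then show ?thesis by (simp add: quotient_rep_def)
qed

lemma space_Quot[simp]: "space Quot i = quotient_space (space I i) (NI i)" by (simp add: quotient_rep_def)
lemma space_Sub[simp]: "space Sub i = space P i\<lparr>carrier := NP i\<rparr>" by (simp add: sub_rep_def)
lemma act_Sub[simp]: "act Sub = act P" by (simp add: sub_rep_def)

definition hom :: "('i \<times> nat \<times> nat \<Rightarrow> complex) \<Rightarrow> 'i \<Rightarrow> 'p \<Rightarrow> 'q set" where
  "hom Z = (\<lambda>i\<in>verts Q. \<lambda>x\<in>NP i. coset i (lift Z i x))"

lemma q_lift_linear:
  assumes "i \<in> verts Q"
  shows "linear_map CC (space P i) (quotient_space (space I i) (NI i)) (\<lambda>x. coset i (lift Z i x))"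
  by (rule linear_map_compose[OF lift_linear[OF assms] quotient_cvs.q_linear[OF qc[OF assms]]])

lemma ker_iff_commute:
  "ker Z \<longleftrightarrow> (\<forall>a\<in>arcs Q. \<forall>l<nP (tail Q a).
     coset (head Q a) (lift Z (head Q a) (act P a (w (tail Q a) l))) = coset (head Q a) (act I a (lift Z (tail Q a) (w (tail Q a) l))))"
proof -
  have "coset (head Q a) (lift Z (head Q a) (act P a (w (tail Q a) l))) = coset (head Q a) (act I a (lift Z (tail Q a) (w (tail Q a) l)))
     \<longleftrightarrow> (\<forall>j'<m (head Q a). (\<Sum>x\<in>L. AA (a, l, j') x * Z x) = 0)" if a: "a \<in> arcs Q" and l: "l < nP (tail Q a)" for a l
  proof -
    note t = ends[OF a]
    have wc: "w (tail Q a) l \<in> carrier (space P (tail Q a))" using w_car[OF t(1)] l by simp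
    have "(\<Sum>x\<in>L. AA (a, l, j') x * Z x) = quot_coord NI (head Q a) j' (lift Z (head Q a) (act P a (w (tail Q a) l))) -
        quot_coord NI (head Q a) j' (act I a (lift Z (tail Q a) (w (tail Q a) l)))" if "j' < m (head Q a)" for j'
      by (rule A_lift) (use a l that in \<open>simp add: R_def\<close>)
    then show ?thesis
      by (subst q_eq_quot_coord[OF t(2) lift_carrier[OF t(2) linear_mapD(1)[OF actP[OF a] wc]] linear_mapD(1)[OF actI[OF a] lift_carrier[OF t(1) wc]]])
        simp
  qed
  note e = this
  show ?thesis
  proof
    assume k: "ker Z"
    show "\<forall>a\<in>arcs Q. \<forall>l<nP (tail Q a). coset (head Q a) (lift Z (head Q a) (act P a (w (tail Q a) l))) = coset (head Q a) (act I a (lift Z (tail Q a) (w (tail Q a) l)))"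
    proof (intro ballI allI impI)
      fix a l assume a: "a \<in> arcs Q" "l < nP (tail Q a)"
      have "(a, l, j') \<in> R" if "j' < m (head Q a)" for j' using a that by (simp add: R_def)
      then show "coset (head Q a) (lift Z (head Q a) (act P a (w (tail Q a) l))) = coset (head Q a) (act I a (lift Z (tail Q a) (w (tail Q a) l)))"
        unfolding e[OF a] using k by simp
    qed
  next
    assume C: "\<forall>a\<in>arcs Q. \<forall>l<nP (tail Q a). coset (head Q a) (lift Z (head Q a) (act P a (w (tail Q a) l))) = coset (head Q a) (act I a (lift Z (tail Q a) (w (tail Q a) l)))"
    show "ker Z"
    proof
      fix r assume "r \<in> R"
      then obtain a l j' where r: "r = (a, l, j')" "a \<in> arcs Q" "l < nP (tail Q a)" "j' < m (head Q a)" unfolding R_def by auto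
      show "(\<Sum>x\<in>L. AA r x * Z x) = 0" using C[rule_format, OF r(2,3)] r(4) unfolding r(1) e[OF r(2,3)] by simp
    qed
  qed
qed

lemma hom_commute:
  assumes k: "ker Z" and a: "a \<in> arcs Q" and x: "x \<in> NP (tail Q a)"
  shows "coset (head Q a) (lift Z (head Q a) (act P a x)) = coset (head Q a) (act I a (lift Z (tail Q a) x))"
proof (rule linear_agree[OF ends(1)[OF a] _ _ _ x])
  note t = ends[OF a]
  show "linear_map CC (space P (tail Q a)\<lparr>carrier := NP (tail Q a)\<rparr>) (quotient_space (space I (head Q a)) (NI (head Q a)))
     (\<lambda>x. coset (head Q a) (lift Z (head Q a) (act P a x)))"
    by (rule linear_map_restrict[OF linear_map_compose[OF actP[OF a] q_lift_linear[OF t(2)]] NP_subsp[OF t(1)]])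
  show "linear_map CC (space P (tail Q a)\<lparr>carrier := NP (tail Q a)\<rparr>) (quotient_space (space I (head Q a)) (NI (head Q a)))
     (\<lambda>x. coset (head Q a) (act I a (lift Z (tail Q a) x)))"
    by (rule linear_map_restrict[OF linear_map_compose[OF linear_map_compose[OF lift_linear[OF t(1)] actI[OF a]]
          quotient_cvs.q_linear[OF qc[OF t(2)]]] NP_subsp[OF t(1)]])
  show "coset (head Q a) (lift Z (head Q a) (act P a (w (tail Q a) l))) = coset (head Q a) (act I a (lift Z (tail Q a) (w (tail Q a) l)))"
    if "l < nP (tail Q a)" for l
    using k a that unfolding ker_iff_commute by blast
qed

lemma hom_mem:
  assumes k: "ker Z" shows "hom Z \<in> rep_hom Q Sub Quot"
  unfolding rep_hom_def
proof (intro CollectI conjI ballI)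
  show "hom Z \<in> extensional (verts Q)" by (simp add: hom_def)
  show "hom Z i \<in> extensional (carrier (space Sub i))" if "i \<in> verts Q" for i using that by (simp add: hom_def)
  show "linear_map CC (space Sub i) (space Quot i) (hom Z i)" if i: "i \<in> verts Q" for i
    by (rule linear_map_cong[OF linear_map_restrict[OF q_lift_linear[OF i] NP_subsp[OF i], folded space_Sub space_Quot]])
      (use i in \<open>simp add: hom_def\<close>)
  fix a x assume a: "a \<in> arcs Q" and x: "x \<in> carrier (space Sub (tail Q a))"
  have x': "x \<in> NP (tail Q a)" using x by simp
  note t = ends[OF a]
  have xc: "x \<in> carrier (space P (tail Q a))" using x' NP_car[OF t(1)] by blast
  show "hom Z (head Q a) (act Sub a x) = act Quot a (hom Z (tail Q a) x)"
    using hom_commute[OF k a x'] act_quotient[OF a lift_carrier[OF t(1) xc]] t x' NP_act[OF a x'] by (simp add: hom_def)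
qed

text \<open>All representatives of a coset have the same coordinates, so the choice is immaterial.\<close>
definition matrix_of :: "('i \<Rightarrow> 'p \<Rightarrow> 'q set) \<Rightarrow> 'i \<times> nat \<times> nat \<Rightarrow> complex" where
  "matrix_of \<phi> x = (case x of (i, l, j) \<Rightarrow> quot_coord NI i j (SOME y. y \<in> \<phi> i (w i l)))"

lemma quot_coord_some:
  assumes i: "i \<in> verts Q" and y: "y \<in> carrier (space I i)" and j: "j < m i"
  shows "quot_coord NI i j (SOME z. z \<in> coset i y) = quot_coord NI i j y"
proof -
  interpret quotient_cvs "space I i" "NI i" by (rule qc[OF i])
  have z: "(SOME z. z \<in> coset i y) \<in> coset i y" by (rule someI[of "\<lambda>z. z \<in> coset i y", OF q_self[OF y]])
  have "coset i (SOME z. z \<in> coset i y) = coset i y" by (rule q_eq_of_mem[OF y z])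
  then show ?thesis by (rule quot_coord_cong[OF i q_carrier[OF y z] y _ j])
qed

lemma matrix_of_lift:
  assumes i: "i \<in> verts Q"
    and T: "linear_map CC (space P i\<lparr>carrier := NP i\<rparr>) (quotient_space (space I i) (NI i)) (\<phi> i)"
    and x: "x \<in> NP i"
  shows "\<phi> i x = coset i (lift (matrix_of \<phi>) i x)"
proof (rule linear_agree[OF i T linear_map_restrict[OF q_lift_linear[OF i] NP_subsp[OF i]] _ x])
  fix l assume l: "l < nP i"
  interpret quotient_cvs "space I i" "NI i" by (rule qc[OF i])
  have "\<phi> i (w i l) \<in> carrier (quotient_space (space I i) (NI i))"
    by (rule linear_mapD(1)[OF T]) (use w_mem[OF i l] in simp)
  then obtain y where y: "y \<in> carrier (space I i)" "\<phi> i (w i l) = coset i y" unfolding carrier_quotient by (elim imageE) (rule that)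
  have wc: "w i l \<in> carrier (space P i)" using w_car[OF i] l by simp
  have "coset i y = coset i (lift (matrix_of \<phi>) i (w i l))"
    unfolding q_eq_quot_coord[OF i y(1) lift_carrier[OF i wc]]
    using quot_coord_lift_w[OF i l] quot_coord_some[OF i y(1)] by (simp add: matrix_of_def y(2))
  then show "\<phi> i (w i l) = coset i (lift (matrix_of \<phi>) i (w i l))" using y(2) by simp
qed

lemma matrix_of_hom:
  assumes "(i, l, j) \<in> L" shows "matrix_of (hom Z) (i, l, j) = Z (i, l, j)"
proof -
  have i: "i \<in> verts Q" "l < nP i" "j < m i" using assms unfolding L_def by auto
  have wc: "w i l \<in> carrier (space P i)" using w_car[OF i(1)] i by simp
  show ?thesis
    using quot_coord_some[OF i(1) lift_carrier[OF i(1) wc] i(3), of Z] quot_coord_lift_w[OF i] i w_mem[OF i(1,2)]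
    by (simp add: matrix_of_def hom_def)
qed

lemma hom_cong: "(\<And>x. x \<in> L \<Longrightarrow> Z x = Z' x) \<Longrightarrow> hom Z = hom Z'"
proof -
  assume e: "\<And>x. x \<in> L \<Longrightarrow> Z x = Z' x"
  have "lift Z i x = lift Z' i x" if "i \<in> verts Q" for i x
    unfolding lift_def by (intro lc_cong sum.cong) (use e that in \<open>auto simp: L_def\<close>)
  then show ?thesis unfolding hom_def by (intro restrict_ext) (auto intro!: restrict_ext)
qed

lemma hom_matrix_of:
  assumes \<phi>: "\<phi> \<in> rep_hom Q Sub Quot"
  shows "hom (matrix_of \<phi>) = \<phi>" "ker (matrix_of \<phi>)"
proof -
  have T: "linear_map CC (space P i\<lparr>carrier := NP i\<rparr>) (quotient_space (space I i) (NI i)) (\<phi> i)" if "i \<in> verts Q" for i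
    using \<phi> that unfolding rep_hom_def by auto
  have E: "\<phi> \<in> extensional (verts Q)" "\<And>i. i \<in> verts Q \<Longrightarrow> \<phi> i \<in> extensional (NP i)"
    using \<phi> unfolding rep_hom_def by auto
  have C: "\<phi> (head Q a) (act P a x) = act Quot a (\<phi> (tail Q a) x)" if "a \<in> arcs Q" "x \<in> NP (tail Q a)" for a x
    using \<phi> that unfolding rep_hom_def by simp
  show "hom (matrix_of \<phi>) = \<phi>"
  proof (rule extensionalityI[OF _ E(1)])
    show "hom (matrix_of \<phi>) \<in> extensional (verts Q)" by (simp add: hom_def)
    fix i assume i: "i \<in> verts Q"
    show "hom (matrix_of \<phi>) i = \<phi> i"
    proof (rule extensionalityI[OF _ E(2)[OF i]])
      show "hom (matrix_of \<phi>) i \<in> extensional (NP i)" using i by (simp add: hom_def)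
      show "hom (matrix_of \<phi>) i x = \<phi> i x" if "x \<in> NP i" for x
        using matrix_of_lift[of i \<phi>, OF i T[OF i] that] i that by (simp add: hom_def)
    qed
  qed
  show "ker (matrix_of \<phi>)" unfolding ker_iff_commute
  proof (intro ballI allI impI)
    fix a l assume a: "a \<in> arcs Q" and l: "l < nP (tail Q a)"
    note t = ends[OF a]
    let ?w = "w (tail Q a) l"
    have wm: "?w \<in> NP (tail Q a)" by (rule w_mem[OF t(1) l])
    have wc: "?w \<in> carrier (space P (tail Q a))" using NP_car[OF t(1)] wm by blast
    have "coset (head Q a) (lift (matrix_of \<phi>) (head Q a) (act P a ?w)) = \<phi> (head Q a) (act P a ?w)"
      by (rule matrix_of_lift[of "head Q a" \<phi>, OF t(2) T[OF t(2)] NP_act[OF a wm], symmetric])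
    also have "\<dots> = act Quot a (\<phi> (tail Q a) ?w)" by (rule C[OF a wm])
    also have "\<phi> (tail Q a) ?w = coset (tail Q a) (lift (matrix_of \<phi>) (tail Q a) ?w)"
      by (rule matrix_of_lift[of "tail Q a" \<phi>, OF t(1) T[OF t(1)] wm])
    also have "act Quot a \<dots> = coset (head Q a) (act I a (lift (matrix_of \<phi>) (tail Q a) ?w))"
      by (rule act_quotient[OF a lift_carrier[OF t(1) wc]])
    finally show "coset (head Q a) (lift (matrix_of \<phi>) (head Q a) (act P a ?w)) = coset (head Q a) (act I a (lift (matrix_of \<phi>) (tail Q a) ?w))" .
  qed
qed

text \<open>This is \<open>Ext(N\<^sub>P, I / N\<^sub>I) = 0\<close>.  The right-hand side \<open>t\<close> is the matrix of a family of maps along the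
arrows, which the functionals \<open>\<rho>P\<close> and the vectors \<open>c\<close> extend to a family \<open>\<psi>\<close> of maps from \<open>P\<close> to
\<open>I\<close>.  A family \<open>\<eta>\<close> that splits \<open>\<psi>\<close>, restricted to \<open>N\<^sub>P\<close> and reduced modulo \<open>N\<^sub>I\<close>, has a matrix that
solves the system.\<close>
lemma A_surj: "\<exists>Z. \<forall>r\<in>R. (\<Sum>x\<in>L. AA r x * Z x) = t r"
proof -
  define \<psi> where "\<psi> a x = lc (space I (head Q a)) (\<lambda>j. \<Sum>l<nP (tail Q a). t (a, l, j) * \<rho>P (tail Q a) l x) (c (head Q a)) (m (head Q a))" for a x
  have \<psi>: "linear_map CC (space P (tail Q a)) (space I (head Q a)) (\<psi> a)" if a: "a \<in> arcs Q" for a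
    unfolding \<psi>_def
    by (rule linear_map_lc[OF IB.vs[OF ends(2)[OF a]] PB.vs[OF ends(1)[OF a]] c[OF ends(2)[OF a]]])
      (auto intro!: functional_sum \<rho>P' ends(1)[OF a])
  from ext[OF \<psi>] obtain \<eta> where \<eta>: "\<And>i. i \<in> verts Q \<Longrightarrow> linear_map CC (space P i) (space I i) (\<eta> i)"
    "\<And>a x. a \<in> arcs Q \<Longrightarrow> x \<in> carrier (space P (tail Q a)) \<Longrightarrow>
       \<eta> (head Q a) (act P a x) = act I a (\<eta> (tail Q a) x) \<oplus>\<^bsub>space I (head Q a)\<^esub> \<psi> a x" by auto
  define \<phi> where "\<phi> i x = coset i (\<eta> i x)" for i x
  let ?Z = "matrix_of \<phi>"
  have T: "linear_map CC (space P i\<lparr>carrier := NP i\<rparr>) (quotient_space (space I i) (NI i)) (\<phi> i)" if "i \<in> verts Q" for i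
    unfolding \<phi>_def
    by (rule linear_map_restrict[OF linear_map_compose[OF \<eta>(1)[OF that] quotient_cvs.q_linear[OF qc[OF that]]] NP_subsp[OF that]])
  have key: "quot_coord NI i j (lift ?Z i x) = quot_coord NI i j (\<eta> i x)" if i: "i \<in> verts Q" and x: "x \<in> NP i" and j: "j < m i" for i x j
  proof -
    have xc: "x \<in> carrier (space P i)" using NP_car[OF i] x by blast
    have "coset i (\<eta> i x) = coset i (lift ?Z i x)" using matrix_of_lift[of i \<phi>, OF i T[OF i] x] unfolding \<phi>_def .
    then show ?thesis by (intro quot_coord_cong[OF i lift_carrier[OF i xc] linear_mapD(1)[OF \<eta>(1)[OF i] xc] _ j]) simp
  qed
  have "(\<Sum>x\<in>L. AA r x * ?Z x) = t r" if r: "r \<in> R" for r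
  proof -
    obtain a l j where rr: "r = (a, l, j)" "a \<in> arcs Q" "l < nP (tail Q a)" "j < m (head Q a)" using r unfolding R_def by auto
    note a = rr(2) and h = ends[OF rr(2)]
    interpret H: quotient_cvs "space I (head Q a)" "NI (head Q a)" by (rule qc[OF h(2)])
    let ?w = "w (tail Q a) l"
    have wm: "?w \<in> NP (tail Q a)" by (rule w_mem[OF h(1) rr(3)])
    have wc: "?w \<in> carrier (space P (tail Q a))" using NP_car[OF h(1)] wm by blast
    note ew = linear_mapD(1)[OF \<eta>(1)[OF h(1)] wc]
    note fj = quot_coord_functional[OF h(2) rr(4)]
    have tq: "coset (tail Q a) (\<eta> (tail Q a) ?w) = coset (tail Q a) (lift ?Z (tail Q a) ?w)"
      using matrix_of_lift[of "tail Q a" \<phi>, OF h(1) T[OF h(1)] wm] unfolding \<phi>_def .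
    have "coset (head Q a) (act I a (\<eta> (tail Q a) ?w)) = coset (head Q a) (act I a (lift ?Z (tail Q a) ?w))"
      using act_quotient[OF a ew] act_quotient[OF a lift_carrier[OF h(1) wc]] tq by simp
    then have e2: "quot_coord NI (head Q a) j (act I a (lift ?Z (tail Q a) ?w)) = quot_coord NI (head Q a) j (act I a (\<eta> (tail Q a) ?w))"
      by (intro quot_coord_cong[OF h(2) linear_mapD(1)[OF actI[OF a] lift_carrier[OF h(1) wc]] linear_mapD(1)[OF actI[OF a] ew] _ rr(4)]) simp
    have e1: "quot_coord NI (head Q a) j (lift ?Z (head Q a) (act P a ?w)) = quot_coord NI (head Q a) j (\<eta> (head Q a) (act P a ?w))"
      by (rule key[OF h(2) NP_act[OF a wm] rr(4)])
    have e3: "quot_coord NI (head Q a) j (\<eta> (head Q a) (act P a ?w)) =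
        quot_coord NI (head Q a) j (act I a (\<eta> (tail Q a) ?w)) + quot_coord NI (head Q a) j (\<psi> a ?w)"
      unfolding \<eta>(2)[OF a wc] using fj linear_mapD(1)[OF actI[OF a] ew] linear_mapD(1)[OF \<psi>[OF a] wc]
      unfolding lin_functional_def by blast
    have "quot_coord NI (head Q a) j (\<psi> a ?w) = (\<Sum>l'<nP (tail Q a). t (a, l', j) * \<rho>P (tail Q a) l' ?w)"
      unfolding \<psi>_def
      by (rule cvs.dual_coefficient[OF IB.vs[OF h(2)] c[OF h(2)], where \<rho> = "quot_coord NI (head Q a)"])
        (use quot_coord_functional[OF h(2)] rr(4) quot_coord_c[OF h(2)] in auto)
    also have "\<dots> = (\<Sum>l'<nP (tail Q a). if l' = l then t (a, l', j) else 0)"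
      by (rule sum.cong) (use \<rho>w[OF h(1) _ rr(3)] in auto)
    also have "\<dots> = t (a, l, j)" using rr(3) by simp
    finally have e4: "quot_coord NI (head Q a) j (\<psi> a ?w) = t (a, l, j)" .
    show ?thesis unfolding rr(1) using A_lift[of a l j ?Z] r e1 e2 e3 e4 unfolding rr(1) by simp
  qed
  then show ?thesis by blast
qed

lemma hom_add:
  "hom (\<lambda>x. Z x + Z' x) = hom Z \<oplus>\<^bsub>Hom_Q Q Sub Quot\<^esub> hom Z'"
proof -
  have "coset i (lift (\<lambda>x. Z x + Z' x) i x) = coset i (lift Z i x) \<oplus>\<^bsub>quotient_space (space I i) (NI i)\<^esub> coset i (lift Z' i x)"
    if i: "i \<in> verts Q" and x: "x \<in> NP i" for i x
  proof -
    have xc: "x \<in> carrier (space P i)" using NP_car[OF i] x by blast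
    show ?thesis
      unfolding lift_add[OF i] quotient_cvs.add_quotient[OF qc[OF i] lift_carrier[OF i xc] lift_carrier[OF i xc]] ..
  qed
  then show ?thesis unfolding hom_def Hom_Q_def by (auto intro!: restrict_ext)
qed

lemma hom_smult:
  "hom (\<lambda>x. t * Z x) = t \<odot>\<^bsub>Hom_Q Q Sub Quot\<^esub> hom Z"
proof -
  have "coset i (lift (\<lambda>x. t * Z x) i x) = t \<odot>\<^bsub>quotient_space (space I i) (NI i)\<^esub> coset i (lift Z i x)"
    if i: "i \<in> verts Q" and x: "x \<in> NP i" for i x
  proof -
    have xc: "x \<in> carrier (space P i)" using NP_car[OF i] x by blast
    show ?thesis unfolding lift_smult[OF i] quotient_cvs.smult_quotient[OF qc[OF i] lift_carrier[OF i xc]] ..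
  qed
  then show ?thesis unfolding hom_def Hom_Q_def by (auto intro!: restrict_ext)
qed

lemma hom_zero: "hom (\<lambda>_. 0) = \<zero>\<^bsub>Hom_Q Q Sub Quot\<^esub>"
proof -
  have "coset i (lift (\<lambda>_. 0) i x) = \<zero>\<^bsub>quotient_space (space I i) (NI i)\<^esub>" if i: "i \<in> verts Q" for i x
  proof -
    have "lift (\<lambda>_. 0) i x = \<zero>\<^bsub>space I i\<^esub>"
      unfolding lift_def by (rule cvs.lc_zero_coeff[OF IB.vs[OF i] c[OF i]]) simp
    then show ?thesis using quotient_cvs.zero_quotient[OF qc[OF i]] by simp
  qed
  then show ?thesis unfolding hom_def Hom_Q_def by (auto intro!: restrict_ext)
qed

end

section \<open>Transport of structure\<close>

lemma transport_cvs:
  fixes A :: "(complex, 'v) module" and B :: "(complex, 'w) module"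
  assumes A: "cvs A" and bij: "bij_betw T (carrier A) (carrier B)" and zero: "\<zero>\<^bsub>B\<^esub> = T \<zero>\<^bsub>A\<^esub>"
    and add: "\<And>x y. x \<in> carrier A \<Longrightarrow> y \<in> carrier A \<Longrightarrow> T x \<oplus>\<^bsub>B\<^esub> T y = T (x \<oplus>\<^bsub>A\<^esub> y)"
    and smult: "\<And>t x. x \<in> carrier A \<Longrightarrow> t \<odot>\<^bsub>B\<^esub> T x = T (t \<odot>\<^bsub>A\<^esub> x)"
  shows "cvs B" "linear_map CC A B T"
proof -
  interpret A: cvs A by fact
  have im: "carrier B = T ` carrier A" using bij by (simp add: bij_betw_def)
  show B: "cvs B" unfolding cvs_def
  proof (rule vs_criteria)
    note s = im add smult zero
    show "field CC" by (rule class_field)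
    show "\<zero>\<^bsub>B\<^esub> \<in> carrier B" by (auto simp: s)
    show "\<forall>v w. v \<in> carrier B \<and> w \<in> carrier B \<longrightarrow> v \<oplus>\<^bsub>B\<^esub> w \<in> carrier B" by (auto simp: s)
    show "\<forall>v\<in>carrier B. \<exists>nv\<in>carrier B. v \<oplus>\<^bsub>B\<^esub> nv = \<zero>\<^bsub>B\<^esub>"
    proof
      fix v assume "v \<in> carrier B"
      then obtain x where x: "x \<in> carrier A" "v = T x" by (auto simp: s)
      then have "v \<oplus>\<^bsub>B\<^esub> T ((-1) \<odot>\<^bsub>A\<^esub> x) = \<zero>\<^bsub>B\<^esub>"
        using iffD2[OF A.add_eq_zero_iff refl, OF x(1) x(1)] by (simp add: s)
      then show "\<exists>nv\<in>carrier B. v \<oplus>\<^bsub>B\<^esub> nv = \<zero>\<^bsub>B\<^esub>"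
        using x by (intro bexI[of _ "T ((-1) \<odot>\<^bsub>A\<^esub> x)"]) (auto simp: s)
    qed
    show "\<forall>c v. c \<in> carrier CC \<and> v \<in> carrier B \<longrightarrow> c \<odot>\<^bsub>B\<^esub> v \<in> carrier B" by (auto simp: s)
    show "\<forall>v w. v \<in> carrier B \<and> w \<in> carrier B \<longrightarrow> v \<oplus>\<^bsub>B\<^esub> w = w \<oplus>\<^bsub>B\<^esub> v"
      by (auto simp: s A.M.a_comm)
    show "\<forall>v w x. v \<in> carrier B \<and> w \<in> carrier B \<and> x \<in> carrier B \<longrightarrow>
        v \<oplus>\<^bsub>B\<^esub> w \<oplus>\<^bsub>B\<^esub> x = v \<oplus>\<^bsub>B\<^esub> (w \<oplus>\<^bsub>B\<^esub> x)" by (auto simp: s A.M.a_assoc)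
    show "\<forall>v\<in>carrier B. v \<oplus>\<^bsub>B\<^esub> \<zero>\<^bsub>B\<^esub> = v" by (auto simp: s)
    show "\<forall>a b v. a \<in> carrier CC \<and> b \<in> carrier CC \<and> v \<in> carrier B \<longrightarrow>
        (a \<otimes>\<^bsub>CC\<^esub> b) \<odot>\<^bsub>B\<^esub> v = a \<odot>\<^bsub>B\<^esub> (b \<odot>\<^bsub>B\<^esub> v)" by (auto simp: s A.smult_smult)
    show "\<forall>v\<in>carrier B. \<one>\<^bsub>CC\<^esub> \<odot>\<^bsub>B\<^esub> v = v" by (auto simp: s)
    show "\<forall>a b v. a \<in> carrier CC \<and> b \<in> carrier CC \<and> v \<in> carrier B \<longrightarrow>
        (a \<oplus>\<^bsub>CC\<^esub> b) \<odot>\<^bsub>B\<^esub> v = a \<odot>\<^bsub>B\<^esub> v \<oplus>\<^bsub>B\<^esub> b \<odot>\<^bsub>B\<^esub> v" by (auto simp: s A.smult_add_left)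
    show "\<forall>a v w. a \<in> carrier CC \<and> v \<in> carrier B \<and> w \<in> carrier B \<longrightarrow>
        a \<odot>\<^bsub>B\<^esub> (v \<oplus>\<^bsub>B\<^esub> w) = a \<odot>\<^bsub>B\<^esub> v \<oplus>\<^bsub>B\<^esub> a \<odot>\<^bsub>B\<^esub> w" by (auto simp: s A.smult_add_right)
  qed
  show "linear_map CC A B T" by (rule linear_mapI[OF A B]) (auto simp: im add smult)
qed

lemma linear_map_inverse:
  fixes A :: "(complex, 'v) module" and B :: "(complex, 'w) module"
  assumes T: "linear_map CC A B T" and bij: "bij_betw T (carrier A) (carrier B)"
    and S: "\<And>x. x \<in> carrier A \<Longrightarrow> S (T x) = x"
  shows "linear_map CC B A S"
proof -
  interpret A: cvs A by (rule linear_mapD(4)[OF T])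
  have im: "carrier B = T ` carrier A" using bij by (simp add: bij_betw_def)
  show ?thesis
    by (rule linear_mapI[OF linear_mapD(5)[OF T] linear_mapD(4)[OF T]])
      (auto simp: im S linear_mapD(2)[OF T, symmetric] linear_mapD(3)[OF T, symmetric])
qed

lemma dim_transport:
  fixes A :: "(complex, 'v) module" and B :: "(complex, 'w) module"
  assumes T: "linear_map CC A B T" and bij: "bij_betw T (carrier A) (carrier B)"
    and fd: "vectorspace.fin_dim CC A"
  shows "vectorspace.fin_dim CC B" "vectorspace.dim CC B = vectorspace.dim CC A"
proof -
  interpret A: cvs A by (rule linear_mapD(4)[OF T])
  interpret B: cvs B by (rule linear_mapD(5)[OF T])
  have im: "carrier B = T ` carrier A" and inj: "inj_on T (carrier A)" using bij by (simp_all add: bij_betw_def)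
  obtain b \<xi> where b: "\<forall>k<A.dim. b k \<in> carrier A" "\<And>k. k < A.dim \<Longrightarrow> lin_functional A (\<xi> k)"
    "\<And>k j. k < A.dim \<Longrightarrow> j < A.dim \<Longrightarrow> \<xi> k (b j) = (if j = k then 1 else 0)"
    "\<And>x. x \<in> carrier A \<Longrightarrow> x = lc A (\<lambda>k. \<xi> k x) b A.dim"
    by (rule A.basis_coordinates[OF fd]) (rule that; assumption)
  have ind: "indep A A.dim b" by (rule A.dual_indep[OF b(1,2,3)])
  have lcT: "lc B t (\<lambda>k. T (b k)) A.dim = T (lc A t b A.dim)" for t
    by (rule lc_linear_map[OF T, symmetric]) (use b(1) in simp)
  have 1: "\<forall>k<A.dim. T (b k) \<in> carrier B" using b(1) im by auto
  have 2: "indep B A.dim (\<lambda>k. T (b k))"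
    unfolding indep_def lcT
  proof (intro allI impI)
    fix t k assume t: "T (lc A t b A.dim) = \<zero>\<^bsub>B\<^esub>" and k: "k < A.dim"
    then have "T (lc A t b A.dim) = T \<zero>\<^bsub>A\<^esub>" using linear_map_zero[OF T] by simp
    then have "lc A t b A.dim = \<zero>\<^bsub>A\<^esub>" by (rule inj_onD[OF inj]) (use A.lc_mem[OF b(1)] in auto)
    then show "t k = 0" using ind k unfolding indep_def by blast
  qed
  have 3: "\<forall>x\<in>carrier B. \<exists>t. x = lc B t (\<lambda>k. T (b k)) A.dim"
  proof
    fix x assume "x \<in> carrier B"
    then have "x \<in> T ` carrier A" using im by simp
    then obtain y where "x = T y" "y \<in> carrier A" by (rule imageE)
    then have "x = lc B (\<lambda>k. \<xi> k y) (\<lambda>k. T (b k)) A.dim" using b(4)[of y] by (simp add: lcT)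
    then show "\<exists>t. x = lc B t (\<lambda>k. T (b k)) A.dim" by (rule exI[of _ "\<lambda>k. \<xi> k y"])
  qed
  show "B.fin_dim" by (rule B.dim_tuple(1)[OF 1 2 3])
  show "B.dim = A.dim" by (rule B.dim_tuple(2)[OF 1 2 3])
qed

section \<open>Points of the fibres\<close>

text \<open>The values of \<open>\<phi>\<close> are cosets, so this is the preimage in \<open>N\<^sub>P \<oplus> I\<close> of the graph in
\<open>N\<^sub>P \<oplus> I / N\<^sub>I\<close>.\<close>
definition graph_rep :: "('i, 'a) pre_digraph \<Rightarrow> ('i \<Rightarrow> 'p set) \<Rightarrow> ('i \<Rightarrow> 'p \<Rightarrow> 'q set) \<Rightarrow> 'i \<Rightarrow> ('p \<times> 'q) set" where
  "graph_rep Q NP \<phi> = (\<lambda>i\<in>verts Q. {(x, y). x \<in> NP i \<and> y \<in> \<phi> i x})"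

context chart_data
begin

text \<open>These functionals define the chart of the Grassmannian of \<open>P \<oplus> I\<close> that belongs to the charts \<open>\<rho>I\<close>
and \<open>\<rho>P\<close>: within the stratum it is the preimage of their product (\<open>S_chart_iff\<close>).\<close>
definition \<rho>E :: "'i \<Rightarrow> nat \<Rightarrow> 'p \<times> 'q \<Rightarrow> complex" where
  "\<rho>E i k z = (if k < f i then \<rho>I i k (snd z) else \<rho>P i (k - f i) (fst z))"

lemma functional_fst: "lin_functional V \<xi> \<Longrightarrow> lin_functional (direct_sum V W) (\<lambda>z. \<xi> (fst z))"
  for V :: "(complex, 'v) module" and W :: "(complex, 'w) module"
  unfolding lin_functional_def by simp
lemma functional_snd: "lin_functional W \<xi> \<Longrightarrow> lin_functional (direct_sum V W) (\<lambda>z. \<xi> (snd z))"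
  for V :: "(complex, 'v) module" and W :: "(complex, 'w) module"
  unfolding lin_functional_def by simp

lemma \<rho>E_functional:
  assumes i: "i \<in> verts Q" and k: "k < f i + nP i"
  shows "lin_functional (direct_sum (space P i) (space I i)) (\<rho>E i k)"
proof (cases "k < f i")
  case True
  then show ?thesis using functional_snd[OF \<rho>I'[OF i True]] by (simp add: \<rho>E_def[abs_def])
next
  case False
  then have "k - f i < nP i" using k by simp
  then show ?thesis using functional_fst[OF \<rho>P'[OF i]] False by (simp add: \<rho>E_def[abs_def])
qed

lemma \<rho>E: "EB.functionals \<rho>E"
  unfolding EB.functionals_def using \<rho>E_functional nE by simp

end

context chart_point
begin

text \<open>The frame dual to \<open>\<rho>E\<close> of the graph of the homomorphism with matrix \<open>Z\<close>: first the dual frame of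
\<open>N\<^sub>I\<close>, then the vectors \<open>(w, lift w)\<close>.  Duality holds because the lift takes values in the common kernel of
\<open>\<rho>I\<close>.\<close>
definition graph_vec :: "('i \<times> nat \<times> nat \<Rightarrow> complex) \<Rightarrow> 'i \<Rightarrow> nat \<Rightarrow> 'p \<times> 'q" where
  "graph_vec Z i k = (if k < f i then (\<zero>\<^bsub>space P i\<^esub>, u i k) else (w i (k - f i), lift Z i (w i (k - f i))))"

definition graph_frame :: "('i \<times> nat \<times> nat \<Rightarrow> complex) \<Rightarrow> 'i \<Rightarrow> nat \<Rightarrow> 'p \<times> 'q" where
  "graph_frame Z = (\<lambda>i\<in>verts Q. \<lambda>k\<in>{..<nat (dimvec P i)}. graph_vec Z i k)"

lemma graph_vec_mem: "i \<in> verts Q \<Longrightarrow> k < f i + nP i \<Longrightarrow> graph_vec Z i k \<in> carrier (direct_sum (space P i) (space I i))"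
  using u_car[of i] w_car[of i] lift_carrier[of i] cvs.zero_mem[OF PB.vs[of i]] by (auto simp: graph_vec_def)

lemma \<rho>E_graph_vec:
  assumes i: "i \<in> verts Q" and k: "k < f i + nP i" "l < f i + nP i"
  shows "\<rho>E i k (graph_vec Z i l) = (if l = k then 1 else 0)"
proof -
  consider "k < f i" "l < f i" | "k < f i" "\<not> l < f i" | "\<not> k < f i" "l < f i" | "\<not> k < f i" "\<not> l < f i" by blast
  then show ?thesis
  proof cases
    case 1 then show ?thesis using \<rho>u[OF i] by (simp add: \<rho>E_def graph_vec_def)
  next
    case 2 then show ?thesis using \<rho>I_lift[OF i] by (simp add: \<rho>E_def graph_vec_def)
  next
    case 3
    then have "\<rho>P i (k - f i) \<zero>\<^bsub>space P i\<^esub> = 0"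
      using k by (intro cvs.functional_zero[OF PB.vs[OF i] \<rho>P'[OF i]]) simp
    then show ?thesis using 3 by (auto simp: \<rho>E_def graph_vec_def)
  next
    case 4
    then show ?thesis using \<rho>w[OF i, of "k - f i" "l - f i"] k by (auto simp: \<rho>E_def graph_vec_def)
  qed
qed

lemma graph_vec_indep: "i \<in> verts Q \<Longrightarrow> indep (direct_sum (space P i) (space I i)) (f i + nP i) (graph_vec Z i)"
  by (rule cvs.dual_indep[OF cvs_direct_sum[OF PB.vs IB.vs], where \<rho> = "\<rho>E i"])
    (use graph_vec_mem \<rho>E_graph_vec \<rho>E_functional in auto)

lemma graph_frame_frame: "graph_frame Z \<in> EB.Fr"
  unfolding graph_frame_def
proof (rule EB.frameI)
  show "graph_vec Z i k \<in> carrier (space (direct_sum_rep P I) i)" if "i \<in> verts Q" "k < nat (dimvec P i)" for i k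
    using graph_vec_mem[OF that(1)] that nE[OF that(1)] by simp
  show "indep (space (direct_sum_rep P I) i) (nat (dimvec P i)) (graph_vec Z i)" if "i \<in> verts Q" for i
    using graph_vec_indep[OF that] nE[OF that] by simp
qed

lemma graph_frame_dual: "EB.dual \<rho>E (graph_frame Z)"
  unfolding EB.dual_def graph_frame_def using \<rho>E_graph_vec nE by simp

lemma lc_graph_vec:
  assumes i: "i \<in> verts Q"
  shows "lc (direct_sum (space P i) (space I i)) t (graph_vec Z i) (f i + nP i) =
    (lc (space P i) (\<lambda>l. t (f i + l)) (w i) (nP i),
     lc (space I i) t (u i) (f i) \<oplus>\<^bsub>space I i\<^esub> lift Z i (lc (space P i) (\<lambda>l. t (f i + l)) (w i) (nP i)))"
proof -
  interpret VP: cvs "space P i" by (rule PB.vs[OF i])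
  interpret VI: cvs "space I i" by (rule IB.vs[OF i])
  have c1: "\<forall>k<f i + nP i. fst (graph_vec Z i k) \<in> carrier (space P i)" and c2: "\<forall>k<f i + nP i. snd (graph_vec Z i k) \<in> carrier (space I i)"
    using graph_vec_mem[OF i] by (auto simp: mem_Times_iff)
  have wl: "lc (space P i) (\<lambda>l. t (f i + l)) (w i) (nP i) \<in> carrier (space P i)" by (rule VP.lc_mem[OF w_car[OF i]])
  have "lc (space P i) t (\<lambda>k. fst (graph_vec Z i k)) (f i + nP i) =
      lc (space P i) t (\<lambda>k. fst (graph_vec Z i k)) (f i) \<oplus>\<^bsub>space P i\<^esub> lc (space P i) (\<lambda>k. t (f i + k)) (\<lambda>k. fst (graph_vec Z i (f i + k))) (nP i)"
    by (rule VP.lc_split[OF c1])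
  also have "lc (space P i) t (\<lambda>k. fst (graph_vec Z i k)) (f i) = \<zero>\<^bsub>space P i\<^esub>"
    by (rule VP.lc_zero_vectors) (simp add: graph_vec_def)
  also have "lc (space P i) (\<lambda>k. t (f i + k)) (\<lambda>k. fst (graph_vec Z i (f i + k))) (nP i) = lc (space P i) (\<lambda>l. t (f i + l)) (w i) (nP i)"
    by (rule lc_cong) (auto simp: graph_vec_def)
  finally have 1: "lc (space P i) t (\<lambda>k. fst (graph_vec Z i k)) (f i + nP i) = lc (space P i) (\<lambda>l. t (f i + l)) (w i) (nP i)"
    using wl by simp
  have "lc (space I i) t (\<lambda>k. snd (graph_vec Z i k)) (f i + nP i) =
      lc (space I i) t (\<lambda>k. snd (graph_vec Z i k)) (f i) \<oplus>\<^bsub>space I i\<^esub> lc (space I i) (\<lambda>k. t (f i + k)) (\<lambda>k. snd (graph_vec Z i (f i + k))) (nP i)"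
    by (rule VI.lc_split[OF c2])
  also have "lc (space I i) t (\<lambda>k. snd (graph_vec Z i k)) (f i) = lc (space I i) t (u i) (f i)"
    by (rule lc_cong) (auto simp: graph_vec_def)
  also have "lc (space I i) (\<lambda>k. t (f i + k)) (\<lambda>k. snd (graph_vec Z i (f i + k))) (nP i) = lc (space I i) (\<lambda>k. t (f i + k)) (\<lambda>l. lift Z i (w i l)) (nP i)"
    by (rule lc_cong) (auto simp: graph_vec_def)
  also have "\<dots> = lift Z i (lc (space P i) (\<lambda>l. t (f i + l)) (w i) (nP i))"
    by (rule lc_linear_map[OF lift_linear[OF i], symmetric]) (use w_car[OF i] in simp)
  finally show ?thesis unfolding lc_direct_sum 1 by simp
qed

lemma sp_graph_frame: "EB.sp (graph_frame Z) = graph_rep Q NP (hom Z)"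
proof (rule extensionalityI[OF EB.sp_ext])
  show "graph_rep Q NP (hom Z) \<in> extensional (verts Q)" by (simp add: graph_rep_def)
  fix i assume i: "i \<in> verts Q"
  interpret Qu: quotient_cvs "space I i" "NI i" by (rule qc[OF i])
  interpret VP: cvs "space P i" by (rule PB.vs[OF i])
  have "EB.sp (graph_frame Z) i = range (\<lambda>t. lc (direct_sum (space P i) (space I i)) t (graph_frame Z i) (nat (dimvec P i)))"
    using EB.sp_eq[OF graph_frame_frame i] by simp
  also have "\<dots> = range (\<lambda>t. lc (direct_sum (space P i) (space I i)) t (graph_vec Z i) (f i + nP i))"
  proof -
    have "lc (direct_sum (space P i) (space I i)) t (graph_frame Z i) (nat (dimvec P i)) =
       lc (direct_sum (space P i) (space I i)) t (graph_vec Z i) (nat (dimvec P i))" for t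
      by (rule lc_cong) (use i in \<open>auto simp: graph_frame_def\<close>)
    then show ?thesis using nE[OF i] by simp
  qed
  also have "\<dots> = {(x, y). x \<in> NP i \<and> y \<in> coset i (lift Z i x)}"
  proof (intro equalityI subsetI)
    fix z assume "z \<in> range (\<lambda>t. lc (direct_sum (space P i) (space I i)) t (graph_vec Z i) (f i + nP i))"
    then obtain t where z: "z = lc (direct_sum (space P i) (space I i)) t (graph_vec Z i) (f i + nP i)" by (elim rangeE) (rule that)
    have "lc (space P i) (\<lambda>l. t (f i + l)) (w i) (nP i) \<in> NP i" unfolding NP_eq[OF i] by blast
    moreover have "lc (space I i) t (u i) (f i) \<in> NI i" unfolding NI_eq[OF i] by blast
    ultimately show "z \<in> {(x, y). x \<in> NP i \<and> y \<in> coset i (lift Z i x)}"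
      unfolding z lc_graph_vec[OF i] by (auto simp: Qu.mem_q)
  next
    fix z assume "z \<in> {(x, y). x \<in> NP i \<and> y \<in> coset i (lift Z i x)}"
    then obtain x n where x: "z = (x, n \<oplus>\<^bsub>space I i\<^esub> lift Z i x)" "x \<in> NP i" "n \<in> NI i" by (auto simp: Qu.mem_q)
    let ?t = "\<lambda>k. if k < f i then \<rho>I i k n else \<rho>P i (k - f i) x"
    have "lc (space P i) (\<lambda>l. ?t (f i + l)) (w i) (nP i) = lc (space P i) (\<lambda>l. \<rho>P i l x) (w i) (nP i)"
      by (rule lc_cong) auto
    then have 1: "lc (space P i) (\<lambda>l. ?t (f i + l)) (w i) (nP i) = x" using NP_exp[OF i x(2)] by simp
    have "lc (space I i) ?t (u i) (f i) = lc (space I i) (\<lambda>k. \<rho>I i k n) (u i) (f i)"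
      by (rule lc_cong) auto
    then have 2: "lc (space I i) ?t (u i) (f i) = n" using NI_exp[OF i x(3)] by simp
    have "z = lc (direct_sum (space P i) (space I i)) ?t (graph_vec Z i) (f i + nP i)"
      unfolding lc_graph_vec[OF i] 1 2 x(1) ..
    then show "z \<in> range (\<lambda>t. lc (direct_sum (space P i) (space I i)) t (graph_vec Z i) (f i + nP i))"
      by (rule image_eqI[where x = ?t]) simp
  qed
  also have "\<dots> = graph_rep Q NP (hom Z) i" using i by (auto simp: graph_rep_def hom_def)
  finally show "EB.sp (graph_frame Z) i = graph_rep Q NP (hom Z) i" .
qed

lemma mem_graph: "i \<in> verts Q \<Longrightarrow> (x, y) \<in> graph_rep Q NP (hom Z) i \<longleftrightarrow> x \<in> NP i \<and> y \<in> coset i (lift Z i x)"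
  by (auto simp: graph_rep_def hom_def)

lemma sec_graph: "EB.sec \<rho>E (graph_rep Q NP (hom Z)) = graph_frame Z"
  unfolding sp_graph_frame[symmetric] by (rule EB.sec_unique[OF \<rho>E graph_frame_frame graph_frame_dual])

lemma graph_in_chart: "graph_rep Q NP (hom Z) \<in> EB.chart \<rho>E"
  unfolding EB.chart_def using graph_frame_frame graph_frame_dual sp_graph_frame by blast

lemma NP_zero: "i \<in> verts Q \<Longrightarrow> \<zero>\<^bsub>space P i\<^esub> \<in> NP i"
  using iffD1[OF cvs.subspace_iff[OF PB.vs] NP_subsp] by blast

lemma zeta_graph: "zeta Q P I (graph_rep Q NP (hom Z)) = (NI, NP)"
proof -
  have "inter_I Q P I (graph_rep Q NP (hom Z)) = NI"
  proof (rule extensionalityI)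
    show "inter_I Q P I (graph_rep Q NP (hom Z)) \<in> extensional (verts Q)" by (simp add: inter_I_def)
    show "NI \<in> extensional (verts Q)" using NI_sub unfolding subreps_def by blast
    fix i assume i: "i \<in> verts Q"
    interpret Qu: quotient_cvs "space I i" "NI i" by (rule qc[OF i])
    have "lift Z i \<zero>\<^bsub>space P i\<^esub> = \<zero>\<^bsub>space I i\<^esub>" by (rule linear_map_zero[OF lift_linear[OF i]])
    moreover have "coset i \<zero>\<^bsub>space I i\<^esub> = NI i" unfolding set_eq_iff Qu.mem_q using Qu.WV by auto
    ultimately show "inter_I Q P I (graph_rep Q NP (hom Z)) i = NI i"
      using i NP_zero[OF i] NI_car[OF i] by (auto simp: inter_I_def inj2_def mem_graph)
  qed
  moreover have "proj_P Q (graph_rep Q NP (hom Z)) = NP"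
  proof (rule extensionalityI)
    show "proj_P Q (graph_rep Q NP (hom Z)) \<in> extensional (verts Q)" by (simp add: proj_P_def)
    show "NP \<in> extensional (verts Q)" using NP_sub unfolding subreps_def by blast
    fix i assume i: "i \<in> verts Q"
    interpret Qu: quotient_cvs "space I i" "NI i" by (rule qc[OF i])
    have "x \<in> fst ` graph_rep Q NP (hom Z) i" if x: "x \<in> NP i" for x
    proof -
      have "x \<in> carrier (space P i)" using NP_car[OF i] x by blast
      then have "(x, lift Z i x) \<in> graph_rep Q NP (hom Z) i"
        using x Qu.q_self[OF lift_carrier[OF i]] by (simp add: mem_graph[OF i])
      then show ?thesis by (rule image_eqI[rotated]) simp
    qed
    then show "proj_P Q (graph_rep Q NP (hom Z)) i = NP i"
      using i by (auto simp: proj_P_def mem_graph)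
  qed
  ultimately show ?thesis unfolding zeta_def by simp
qed

lemma graph_act:
  assumes k: "ker Z" and a: "a \<in> arcs Q" and z: "(x, y) \<in> graph_rep Q NP (hom Z) (tail Q a)"
  shows "(act P a x, act I a y) \<in> graph_rep Q NP (hom Z) (head Q a)"
proof -
  note t = ends[OF a]
  interpret T: quotient_cvs "space I (tail Q a)" "NI (tail Q a)" by (rule qc[OF t(1)])
  interpret H: quotient_cvs "space I (head Q a)" "NI (head Q a)" by (rule qc[OF t(2)])
  have x: "x \<in> NP (tail Q a)" and y: "y \<in> coset (tail Q a) (lift Z (tail Q a) x)" using z mem_graph[OF t(1)] by auto
  have xc: "x \<in> carrier (space P (tail Q a))" using NP_car[OF t(1)] x by blast
  obtain n where n: "n \<in> NI (tail Q a)" "y = n \<oplus>\<^bsub>space I (tail Q a)\<^esub> lift Z (tail Q a) x"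
    using y unfolding T.mem_q by (elim bexE) (rule that)
  have "act I a y = act I a n \<oplus>\<^bsub>space I (head Q a)\<^esub> act I a (lift Z (tail Q a) x)"
    unfolding n(2) by (rule linear_mapD(2)[OF actI[OF a] T.WV[OF n(1)] lift_carrier[OF t(1) xc]])
  then have "act I a y \<in> coset (head Q a) (act I a (lift Z (tail Q a) x))"
    unfolding H.mem_q using NI_act[OF a n(1)] by (intro bexI[of _ "act I a n"])
  then show ?thesis using hom_commute[OF k a x] NP_act[OF a x] by (simp add: mem_graph[OF t(2)])
qed

lemma graph_in_S:
  assumes k: "ker Z" shows "graph_rep Q NP (hom Z) \<in> S"
proof -
  let ?N = "graph_rep Q NP (hom Z)"
  have "EB.sp (graph_frame Z) \<in> EB.Gp"
  proof (rule EB.quiver_Gr_pointsI[OF graph_frame_frame])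
    show "0 \<le> dimvec P i" for i by (simp add: dimvec_def)
    fix a k' assume a: "a \<in> arcs Q" and k': "k' < nat (dimvec P (tail Q a))"
    have "graph_frame Z (tail Q a) k' \<in> ?N (tail Q a)"
      using EB.frame_in_sp[OF graph_frame_frame ends(1)[OF a] k'] unfolding sp_graph_frame .
    then have "(fst (graph_frame Z (tail Q a) k'), snd (graph_frame Z (tail Q a) k')) \<in> ?N (tail Q a)" by simp
    from graph_act[OF k a this] show "act (direct_sum_rep P I) a (graph_frame Z (tail Q a) k') \<in> EB.sp (graph_frame Z) (head Q a)"
      unfolding sp_graph_frame by (metis act_E prod.collapse)
  qed (rule wf)
  then have "?N \<in> EB.Gp" unfolding sp_graph_frame .
  moreover have "inter_I Q P I ?N = NI" "proj_P Q ?N = NP" using zeta_graph[of Z] unfolding zeta_def by auto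
  ultimately show ?thesis using NI(2) NP(2) unfolding stratum_points_def quiver_Gr_points_def by auto
qed

text \<open>Over \<open>w i l\<close> there is a point \<open>(w i l, y)\<close> of \<open>N\<close>, with \<open>y\<close> unique up to \<open>N\<^sub>I\<close>.  Correcting \<open>y\<close> by
an element of \<open>N\<^sub>I\<close>, one can take it in the span of the \<open>c i j\<close>, and its coordinates are the entries of
\<open>Z\<close>.  Then \<open>N\<close> contains the frame of the graph, and both have the same dimension.\<close>
lemma S_param:
  assumes N: "N \<in> S" and z: "zeta Q P I N = (NI, NP)"
  shows "\<exists>Z. ker Z \<and> N = graph_rep Q NP (hom Z)"
proof -
  have iN: "inter_I Q P I N = NI" and pN: "proj_P Q N = NP" using z unfolding zeta_def by auto
  have N': "N \<in> subreps Q (direct_sum_rep P I)" and dN: "\<And>i. i \<in> verts Q \<Longrightarrow> dimvec (sub_rep (direct_sum_rep P I) N) i = dimvec P i"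
    using N unfolding stratum_points_def quiver_Gr_points_def by auto
  have sub: "VectorSpace.subspace CC (N i) (direct_sum (space P i) (space I i))" if "i \<in> verts Q" for i
    using subreps_subspace[OF N' that] by simp
  have subE: "(\<forall>x\<in>N i. \<forall>y\<in>N i. x \<oplus>\<^bsub>direct_sum (space P i) (space I i)\<^esub> y \<in> N i)"
    "(\<forall>c. \<forall>x\<in>N i. c \<odot>\<^bsub>direct_sum (space P i) (space I i)\<^esub> x \<in> N i)"
    "N i \<subseteq> carrier (direct_sum (space P i) (space I i))" if i: "i \<in> verts Q" for i
    using iffD1[OF cvs.subspace_iff[OF cvs_direct_sum[OF PB.vs[OF i] IB.vs[OF i]]] sub[OF i]] by blast+
  have zN: "(\<zero>\<^bsub>space P i\<^esub>, n) \<in> N i" if "i \<in> verts Q" "n \<in> NI i" for i n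
    using that fun_cong[OF iN, of i] unfolding inter_I_def inj2_def by auto
  have "\<exists>y. (w i l, y) \<in> N i \<and> y \<in> carrier (space I i) \<and> (\<forall>k<f i. \<rho>I i k y = 0)" if i: "i \<in> verts Q" and l: "l < nP i" for i l
  proof -
    interpret VP: cvs "space P i" by (rule PB.vs[OF i])
    interpret VI: cvs "space I i" by (rule IB.vs[OF i])
    have wc: "w i l \<in> carrier (space P i)" using w_car[OF i] l by simp
    have "w i l \<in> proj_P Q N i" using w_mem[OF i l] pN by simp
    then obtain y where y: "(w i l, y) \<in> N i" using i by (auto simp: proj_P_def)
    have yc: "y \<in> carrier (space I i)" using y subE(3)[OF i] by auto
    let ?n = "lc (space I i) (\<lambda>k. \<rho>I i k y) (u i) (f i)"
    have nc: "?n \<in> carrier (space I i)" by (rule VI.lc_mem[OF u_car[OF i]])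
    have n: "?n \<in> NI i" unfolding NI_eq[OF i] by blast
    have "(-1) \<odot>\<^bsub>direct_sum (space P i) (space I i)\<^esub> (\<zero>\<^bsub>space P i\<^esub>, ?n) \<in> N i"
      using subE(2)[OF i] zN[OF i n] by blast
    then have "(w i l, y) \<oplus>\<^bsub>direct_sum (space P i) (space I i)\<^esub> ((-1) \<odot>\<^bsub>direct_sum (space P i) (space I i)\<^esub> (\<zero>\<^bsub>space P i\<^esub>, ?n)) \<in> N i"
      using subE(1)[OF i] y by blast
    then have 1: "(w i l, y \<oplus>\<^bsub>space I i\<^esub> (-1) \<odot>\<^bsub>space I i\<^esub> ?n) \<in> N i" using wc by simp
    have "\<rho>I i k (y \<oplus>\<^bsub>space I i\<^esub> (-1) \<odot>\<^bsub>space I i\<^esub> ?n) = 0" if k: "k < f i" for k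
    proof -
      have "\<rho>I i k ?n = \<rho>I i k y"
        by (rule VI.dual_coefficient[where \<rho> = "\<rho>I i"]) (use u_car[OF i] \<rho>I'[OF i] k \<rho>u[OF i] in auto)
      then show ?thesis using functional_sub[OF \<rho>I'[OF i k] VI.cvs_axioms yc nc] by simp
    qed
    then show ?thesis using 1 yc nc by (intro exI[of _ "y \<oplus>\<^bsub>space I i\<^esub> (-1) \<odot>\<^bsub>space I i\<^esub> ?n"]) auto
  qed
  note ex = this
  define Y where "Y i l = (SOME y. (w i l, y) \<in> N i \<and> y \<in> carrier (space I i) \<and> (\<forall>k<f i. \<rho>I i k y = 0))" for i l
  have YY: "(w i l, Y i l) \<in> N i \<and> Y i l \<in> carrier (space I i) \<and> (\<forall>k<f i. \<rho>I i k (Y i l) = 0)"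
    if "i \<in> verts Q" "l < nP i" for i l
    unfolding Y_def by (rule someI_ex[OF ex[OF that]])
  have Y: "\<And>i l. i \<in> verts Q \<Longrightarrow> l < nP i \<Longrightarrow> (w i l, Y i l) \<in> N i"
    "\<And>i l. i \<in> verts Q \<Longrightarrow> l < nP i \<Longrightarrow> Y i l \<in> carrier (space I i)"
    "\<And>i l k. i \<in> verts Q \<Longrightarrow> l < nP i \<Longrightarrow> k < f i \<Longrightarrow> \<rho>I i k (Y i l) = 0"
    using YY by auto
  define Z where "Z x = (case x of (i, l, j) \<Rightarrow> cs i j (Y i l))" for x
  have lw: "lift Z i (w i l) = Y i l" if "i \<in> verts Q" "l < nP i" for i l
    unfolding lift_w[OF that] Z_def using kerI[OF that(1) Y(2)[OF that] Y(3)[OF that]] by simp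
  have nuN: "graph_vec Z i k \<in> N i" if "i \<in> verts Q" "k < f i + nP i" for i k
  proof (cases "k < f i")
    case True then show ?thesis using zN[OF that(1) u_mem[OF that(1)]] by (simp add: graph_vec_def)
  next
    case False
    then have "k - f i < nP i" using that by simp
    then show ?thesis using Y(1)[OF that(1)] lw[OF that(1)] False by (simp add: graph_vec_def)
  qed
  have "N = EB.sp (graph_frame Z)"
  proof (rule extensionalityI[OF _ EB.sp_ext])
    show "N \<in> extensional (verts Q)" using N' unfolding subreps_def by blast
    fix i assume i: "i \<in> verts Q"
    interpret E: cvs "direct_sum (space P i) (space I i)" by (rule cvs_direct_sum[OF PB.vs[OF i] IB.vs[OF i]])
    have "vectorspace.fin_dim CC (direct_sum (space P i) (space I i))" using EB.fd[OF i] by simp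
    moreover have "vectorspace.dim CC (direct_sum (space P i) (space I i)\<lparr>carrier := N i\<rparr>) = f i + nP i"
      using dN[OF i] nE[OF i] by (simp add: dimvec_def sub_rep_def)
    ultimately have "N i = range (\<lambda>t. lc (direct_sum (space P i) (space I i)) t (graph_vec Z i) (f i + nP i))"
      by (rule E.indep_spans[OF _ sub[OF i]]) (use nuN[OF i] graph_vec_indep[OF i] in auto)
    also have "\<dots> = range (\<lambda>t. lc (direct_sum (space P i) (space I i)) t (graph_frame Z i) (f i + nP i))"
    proof -
      have "lc (direct_sum (space P i) (space I i)) t (graph_vec Z i) (f i + nP i) = lc (direct_sum (space P i) (space I i)) t (graph_frame Z i) (f i + nP i)" for t
        by (rule lc_cong) (use i nE[OF i] in \<open>auto simp: graph_frame_def\<close>)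
      then show ?thesis by simp
    qed
    also have "\<dots> = EB.sp (graph_frame Z) i" using EB.sp_eq[OF graph_frame_frame i] nE[OF i] by simp
    finally show "N i = EB.sp (graph_frame Z) i" .
  qed
  then have Ng: "N = graph_rep Q NP (hom Z)" by (simp add: sp_graph_frame)
  have "ker Z" unfolding ker_iff_commute
  proof (intro ballI allI impI)
    fix a l assume a: "a \<in> arcs Q" and l: "l < nP (tail Q a)"
    note t = ends[OF a]
    interpret H: quotient_cvs "space I (head Q a)" "NI (head Q a)" by (rule qc[OF t(2)])
    let ?w = "w (tail Q a) l"
    have wm: "?w \<in> NP (tail Q a)" by (rule w_mem[OF t(1) l])
    have pc: "act P a ?w \<in> carrier (space P (head Q a))" using NP_car[OF t(2)] NP_act[OF a wm] by blast
    have "(?w, lift Z (tail Q a) ?w) \<in> N (tail Q a)" using Y(1)[OF t(1) l] lw[OF t(1) l] by simp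
    then have "(act P a ?w, act I a (lift Z (tail Q a) ?w)) \<in> N (head Q a)" using subreps_act[OF N' a] by fastforce
    then have "act I a (lift Z (tail Q a) ?w) \<in> coset (head Q a) (lift Z (head Q a) (act P a ?w))"
      unfolding Ng mem_graph[OF t(2)] by simp
    from H.q_eq_of_mem[OF lift_carrier[OF t(2) pc] this]
    show "coset (head Q a) (lift Z (head Q a) (act P a ?w)) = coset (head Q a) (act I a (lift Z (tail Q a) ?w))" by simp
  qed
  then show ?thesis using Ng by blast
qed

lemma graph_inj:
  assumes "\<phi> \<in> rep_hom Q Sub Quot" "\<psi> \<in> rep_hom Q Sub Quot" "graph_rep Q NP \<phi> = graph_rep Q NP \<psi>"
  shows "\<phi> = \<psi>"
proof (rule extensionalityI)
  show "\<phi> \<in> extensional (verts Q)" "\<psi> \<in> extensional (verts Q)" using assms(1,2) unfolding rep_hom_def by auto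
  fix i assume i: "i \<in> verts Q"
  show "\<phi> i = \<psi> i"
  proof (rule extensionalityI)
    show "\<phi> i \<in> extensional (NP i)" "\<psi> i \<in> extensional (NP i)" using assms(1,2) i unfolding rep_hom_def by auto
    fix x assume x: "x \<in> NP i"
    have "graph_rep Q NP \<phi> i = graph_rep Q NP \<psi> i" using assms(3) by simp
    then have "(x, y) \<in> graph_rep Q NP \<phi> i \<longleftrightarrow> (x, y) \<in> graph_rep Q NP \<psi> i" for y by simp
    then have e: "y \<in> \<phi> i x \<longleftrightarrow> y \<in> \<psi> i x" for y using i x by (simp add: graph_rep_def)
    show "\<phi> i x = \<psi> i x" using e by blast
  qed
qed

lemma graph_bij: "bij_betw (graph_rep Q NP) (rep_hom Q Sub Quot) {N \<in> S. zeta Q P I N = (NI, NP)}"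
proof (intro bij_betwI')
  show "graph_rep Q NP \<phi> = graph_rep Q NP \<psi> \<longleftrightarrow> \<phi> = \<psi>" if "\<phi> \<in> rep_hom Q Sub Quot" "\<psi> \<in> rep_hom Q Sub Quot" for \<phi> \<psi>
    using graph_inj[OF that] by auto
  show "graph_rep Q NP \<phi> \<in> {N \<in> S. zeta Q P I N = (NI, NP)}" if "\<phi> \<in> rep_hom Q Sub Quot" for \<phi>
    using hom_matrix_of[OF that] graph_in_S[of "matrix_of \<phi>"] zeta_graph[of "matrix_of \<phi>"] by simp
  show "\<exists>\<phi>\<in>rep_hom Q Sub Quot. N = graph_rep Q NP \<phi>" if "N \<in> {N \<in> S. zeta Q P I N = (NI, NP)}" for N
    using S_param[of N] that hom_mem by blast
qed

end

context chart_data
begin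

lemma chart_point: "NI \<in> IB.chart \<rho>I \<Longrightarrow> NI \<in> IB.Gp \<Longrightarrow> NP \<in> PB.chart \<rho>P \<Longrightarrow> NP \<in> PB.Gp \<Longrightarrow>
   chart_point Q P I f \<rho>I \<rho>P m c cs NI NP"
  by (rule chart_point.intro[OF chart_data_axioms chart_point_axioms.intro])

text \<open>If both components lie in their charts, then \<open>N\<close> is a graph and has the frame of \<open>graph_vec\<close>.
Conversely, let \<open>N\<close> have a frame dual to \<open>\<rho>E\<close>.  The second components of the first \<open>f i\<close> vectors are
dual to \<open>\<rho>I\<close> and the first components of the others are dual to \<open>\<rho>P\<close>; counting dimensions, they
span \<open>N \<inter> I\<close> and \<open>\<pi>(N)\<close>.\<close>
lemma S_chart_iff:
  assumes N: "N \<in> S"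
  shows "N \<in> EB.chart \<rho>E \<longleftrightarrow> inter_I Q P I N \<in> IB.chart \<rho>I \<and> proj_P Q N \<in> PB.chart \<rho>P"
proof
  assume "inter_I Q P I N \<in> IB.chart \<rho>I \<and> proj_P Q N \<in> PB.chart \<rho>P"
  then interpret chart_point Q P I f \<rho>I \<rho>P m c cs "inter_I Q P I N" "proj_P Q N"
    using zeta_stratum[OF N] by (intro chart_point) auto
  obtain Z where "N = graph_rep Q (proj_P Q N) (hom Z)"
    using S_param[OF N zeta_def] by (elim exE conjE) (rule that)
  then show "N \<in> EB.chart \<rho>E" using graph_in_chart[of Z] by simp
next
  assume NE: "N \<in> EB.chart \<rho>E"
  define s0 where "s0 = EB.sec \<rho>E N"
  note s = EB.sec[OF NE, folded s0_def]
  have N': "N \<in> subreps Q (direct_sum_rep P I)" using N unfolding stratum_points_def quiver_Gr_points_def by auto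
  note z = zeta_stratum[OF N]
  have sm: "s0 i k \<in> carrier (space P i) \<times> carrier (space I i)" if "i \<in> verts Q" "k < f i + nP i" for i k
    using EB.frame_mem[OF s(1) that(1)] that nE[OF that(1)] by simp
  have sd: "\<rho>E i k (s0 i l) = (if l = k then 1 else 0)" if "i \<in> verts Q" "k < f i + nP i" "l < f i + nP i" for i k l
    using s(3) that nE[OF that(1)] unfolding EB.dual_def by simp
  have sN: "s0 i k \<in> N i" if "i \<in> verts Q" "k < f i + nP i" for i k
    using EB.frame_in_sp[OF s(1) that(1)] that nE[OF that(1)] s(2) by simp
  have dual1: "\<rho>I i k (snd (s0 i l)) = (if l = k then 1 else 0)" if "i \<in> verts Q" "k < f i" "l < f i" for i k l
    using sd[of i k l] that by (simp add: \<rho>E_def)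
  have dual2: "\<rho>P i k (fst (s0 i (f i + l))) = (if l = k then 1 else 0)" if "i \<in> verts Q" "k < nP i" "l < nP i" for i k l
    using sd[of i "f i + k" "f i + l"] that by (simp add: \<rho>E_def)
  have c1: "\<forall>k<f i. snd (s0 i k) \<in> carrier (space I i)" and c2: "\<forall>l<nP i. fst (s0 i (f i + l)) \<in> carrier (space P i)" if "i \<in> verts Q" for i
    using sm[OF that] by (auto simp: mem_Times_iff)
  have i1: "indep (space I i) (f i) (\<lambda>k. snd (s0 i k))" if i: "i \<in> verts Q" for i
    by (rule cvs.dual_indep[OF IB.vs[OF i] c1[OF i], where \<rho> = "\<rho>I i"]) (use dual1[OF i] \<rho>I'[OF i] in auto)
  have i2: "indep (space P i) (nP i) (\<lambda>l. fst (s0 i (f i + l)))" if i: "i \<in> verts Q" for i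
    by (rule cvs.dual_indep[OF PB.vs[OF i] c2[OF i], where \<rho> = "\<rho>P i"]) (use dual2[OF i] \<rho>P'[OF i] in auto)
  \<comment> \<open>Only the first block of the dual frame contributes to a vector of the form \<open>(0, y)\<close> in \<open>N\<close>;
    so \<open>N \<inter> I\<close> lies in the span of that block, and equality follows by counting dimensions.\<close>
  have eqI: "inter_I Q P I N i = range (\<lambda>t. lc (space I i) t (\<lambda>k. snd (s0 i k)) (f i))" if i: "i \<in> verts Q" for i
  proof -
    interpret VI: cvs "space I i" by (rule IB.vs[OF i])
    interpret VP: cvs "space P i" by (rule PB.vs[OF i])
    let ?R = "range (\<lambda>t. lc (space I i) t (\<lambda>k. snd (s0 i k)) (f i))"
    have WI: "VectorSpace.subspace CC (inter_I Q P I N i) (space I i)"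
      using subreps_subspace[OF _ i] z(1) unfolding quiver_Gr_points_def by blast
    have dI: "vectorspace.dim CC (space I i\<lparr>carrier := inter_I Q P I N i\<rparr>) = f i"
      using z(1) i unfolding quiver_Gr_points_def by (auto simp: dimvec_def sub_rep_def)
    obtain b where b: "\<forall>k<f i. b k \<in> inter_I Q P I N i" "indep (space I i) (f i) b"
      "inter_I Q P I N i = range (\<lambda>t. lc (space I i) t b (f i))"
      using iffD1[OF VI.subspace_dim_iff(1)[OF IB.fd[OF i] WI] dI] by (elim exE conjE) (rule that; assumption)
    have "y \<in> ?R" if y: "y \<in> inter_I Q P I N i" for y
    proof -
      have yN: "(\<zero>\<^bsub>space P i\<^esub>, y) \<in> N i" "y \<in> carrier (space I i)" using y i by (auto simp: inter_I_def inj2_def)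
      have "(\<zero>\<^bsub>space P i\<^esub>, y) = lc (space (direct_sum_rep P I) i) (\<lambda>k. \<rho>E i k (\<zero>\<^bsub>space P i\<^esub>, y)) (s0 i) (nat (dimvec P i))"
        by (rule EB.dual_expand[OF \<rho>E s(1) s(3) i]) (use yN s(2) in simp)
      then have "y = lc (space I i) (\<lambda>k. \<rho>E i k (\<zero>\<^bsub>space P i\<^esub>, y)) (\<lambda>k. snd (s0 i k)) (f i + nP i)"
        unfolding space_E lc_direct_sum nE[OF i] by simp
      also have "\<dots> = lc (space I i) (\<lambda>k. \<rho>E i k (\<zero>\<^bsub>space P i\<^esub>, y)) (\<lambda>k. snd (s0 i k)) (f i) \<oplus>\<^bsub>space I i\<^esub>
          lc (space I i) (\<lambda>k. \<rho>E i (f i + k) (\<zero>\<^bsub>space P i\<^esub>, y)) (\<lambda>k. snd (s0 i (f i + k))) (nP i)"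
        by (rule VI.lc_split) (use sm[OF i] in \<open>auto simp: mem_Times_iff\<close>)
      also have "lc (space I i) (\<lambda>k. \<rho>E i (f i + k) (\<zero>\<^bsub>space P i\<^esub>, y)) (\<lambda>k. snd (s0 i (f i + k))) (nP i) = \<zero>\<^bsub>space I i\<^esub>"
      proof (rule VI.lc_zero_coeff)
        show "\<forall>k<nP i. snd (s0 i (f i + k)) \<in> carrier (space I i)" using sm[OF i] by (auto simp: mem_Times_iff)
        show "\<rho>E i (f i + k) (\<zero>\<^bsub>space P i\<^esub>, y) = 0" if "k < nP i" for k
          using VP.functional_zero[OF \<rho>P'[OF i that]] by (simp add: \<rho>E_def)
      qed
      finally have "y = lc (space I i) (\<lambda>k. \<rho>E i k (\<zero>\<^bsub>space P i\<^esub>, y)) (\<lambda>k. snd (s0 i k)) (f i)"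
        using VI.lc_mem[OF c1[OF i]] by simp
      then show ?thesis by (rule image_eqI[where x = "\<lambda>k. \<rho>E i k (\<zero>\<^bsub>space P i\<^esub>, y)"]) simp
    qed
    then have sub: "inter_I Q P I N i \<subseteq> ?R" by blast
    have RS: "VectorSpace.subspace CC ?R (space I i)" by (rule VI.range_lc_subspace[OF c1[OF i]])
    have dR: "vectorspace.dim CC (space I i\<lparr>carrier := ?R\<rparr>) = f i"
    proof (rule iffD2[OF VI.subspace_dim_iff(1)[OF IB.fd[OF i] RS]], intro exI conjI allI impI)
      show "indep (space I i) (f i) (\<lambda>k. snd (s0 i k))" by (rule i1[OF i])
      show "snd (s0 i k) \<in> ?R" if "k < f i" for k
        using VI.lc_delta[OF c1[OF i] that, of 1] c1[OF i] that
        by (intro image_eqI[where x = "\<lambda>j. if j = k then 1 else 0"]) auto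
    qed (rule refl)
    have "?R = range (\<lambda>t. lc (space I i) t b (f i))"
      by (rule VI.indep_spans[OF IB.fd[OF i] RS dR _ b(2)]) (use b(1) sub in blast)
    then show ?thesis using b(3) by simp
  qed
  have eqP: "proj_P Q N i = range (\<lambda>t. lc (space P i) t (\<lambda>l. fst (s0 i (f i + l))) (nP i))" if i: "i \<in> verts Q" for i
  proof (rule cvs.indep_spans[OF PB.vs[OF i] PB.fd[OF i] _ _ _ i2[OF i]])
    show "VectorSpace.subspace CC (proj_P Q N i) (space P i)"
      using subreps_subspace[OF _ i] z(2) unfolding quiver_Gr_points_def by blast
    show "vectorspace.dim CC (space P i\<lparr>carrier := proj_P Q N i\<rparr>) = nP i"
      using z(2) i unfolding quiver_Gr_points_def by (auto simp: dimvec_def sub_rep_def)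
    show "\<forall>l<nP i. fst (s0 i (f i + l)) \<in> proj_P Q N i"
      using sN[OF i] i by (auto simp: proj_P_def)
  qed
  let ?bI = "\<lambda>i\<in>verts Q. \<lambda>k\<in>{..<nat (int (f i))}. snd (s0 i k)"
  let ?bP = "\<lambda>i\<in>verts Q. \<lambda>k\<in>{..<nP i}. fst (s0 i (f i + k))"
  have FI: "?bI \<in> IB.Fr" by (rule IB.frameI) (use c1 i1 in auto)
  have FP: "?bP \<in> PB.Fr" by (rule PB.frameI) (use c2 i2 in auto)
  have "IB.sp ?bI = inter_I Q P I N"
  proof (rule extensionalityI[OF IB.sp_ext])
    show "inter_I Q P I N \<in> extensional (verts Q)" by (simp add: inter_I_def)
    fix i assume i: "i \<in> verts Q"
    have "lc (space I i) t (?bI i) (f i) = lc (space I i) t (\<lambda>k. snd (s0 i k)) (f i)" for t by (rule lc_cong) (use i in auto)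
    then show "IB.sp ?bI i = inter_I Q P I N i" unfolding IB.sp_eq[OF FI i] eqI[OF i] by simp
  qed
  moreover have "IB.dual \<rho>I ?bI" unfolding IB.dual_def using dual1 by simp
  ultimately have 1: "inter_I Q P I N \<in> IB.chart \<rho>I" unfolding IB.chart_def using FI by blast
  have "PB.sp ?bP = proj_P Q N"
  proof (rule extensionalityI[OF PB.sp_ext])
    show "proj_P Q N \<in> extensional (verts Q)" by (simp add: proj_P_def)
    fix i assume i: "i \<in> verts Q"
    have "lc (space P i) t (?bP i) (nP i) = lc (space P i) t (\<lambda>l. fst (s0 i (f i + l))) (nP i)" for t by (rule lc_cong) (use i in auto)
    then show "PB.sp ?bP i = proj_P Q N i" unfolding PB.sp_eq[OF FP i] eqP[OF i] by simp
  qed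
  moreover have "PB.dual \<rho>P ?bP" unfolding PB.dual_def using dual2 by simp
  ultimately have 2: "proj_P Q N \<in> PB.chart \<rho>P" unfolding PB.chart_def using FP by blast
  show "inter_I Q P I N \<in> IB.chart \<rho>I \<and> proj_P Q N \<in> PB.chart \<rho>P" using 1 2 by simp
qed

end

section \<open>Coordinates on the solution space\<close>

lemma morphism_pullback:
  assumes g: "morphism X Y g" and U: "U \<in> opens Y" "f \<in> regular Y U" and gU: "\<And>x. x \<in> points X \<Longrightarrow> g x \<in> U"
  shows "(\<lambda>x. f (g x)) \<in> regular X (points X)"
proof -
  have "{x \<in> points X. g x \<in> U} = points X" using gU by auto
  then show ?thesis using morphismD(3)[OF g U] by simp
qed

context stratum_setup
begin

abbreviation "Gr_I \<equiv> quiver_Gr Q (\<lambda>i. int (f i)) I"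
abbreviation "Gr_P \<equiv> quiver_Gr Q (\<lambda>i. dimvec P i - int (f i)) P"
abbreviation "Base \<equiv> product Gr_I Gr_P"
abbreviation "Strat \<equiv> stratum Q P I (\<lambda>i. int (f i))"

lemma two_varieties_Gr: "two_varieties Gr_I Gr_P"
  by (rule two_varieties.intro[OF IB.variety_quiver_Gr PB.variety_quiver_Gr])

lemma variety_base: "variety Base" by (rule two_varieties.variety_product[OF two_varieties_Gr])
lemma swf_base: "space_with_functions Base" using variety_base by (simp add: variety_def)
lemma points_base: "points Base = IB.Gp \<times> PB.Gp" by (simp add: IB.points_quiver_Gr PB.points_quiver_Gr)
lemma S_Gp: "S \<subseteq> EB.Gp" unfolding stratum_points_def by blast
lemma points_stratum: "points Strat = S" by (simp add: stratum_def)
lemma swf_Gr_sum: "space_with_functions (quiver_Gr Q (dimvec P) (direct_sum_rep P I))"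
  using EB.variety_quiver_Gr by (simp add: variety_def)
lemma swf_stratum: "space_with_functions Strat"
  unfolding stratum_def
  by (rule space_with_functions.space_with_functions_induced[OF swf_Gr_sum]) (use S_Gp EB.points_quiver_Gr in simp)

text \<open>The vector space structure of \<open>Hom\<^sub>Q(N\<^sub>P, I / N\<^sub>I)\<close>, transported along the bijection with the fibre.\<close>
definition fibre :: "('i \<Rightarrow> 'q set) \<times> ('i \<Rightarrow> 'p set) \<Rightarrow> (complex, 'i \<Rightarrow> ('p \<times> 'q) set) module" where
  "fibre b = (let H = Hom_Q Q (sub_rep P (snd b)) (quotient_rep Q I (fst b));
      G = graph_rep Q (snd b); G' = inv_into (carrier H) G in
     \<lparr>carrier = {N \<in> S. zeta Q P I N = b}, mult = undefined, one = undefined, zero = G \<zero>\<^bsub>H\<^esub>,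
      add = (\<lambda>N N'. G (G' N \<oplus>\<^bsub>H\<^esub> G' N')), smult = (\<lambda>t N. G (t \<odot>\<^bsub>H\<^esub> G' N))\<rparr>)"

end

context chart_data
begin

abbreviation "UI \<equiv> IB.chart \<rho>I \<inter> IB.Gp"
abbreviation "UP \<equiv> PB.chart \<rho>P \<inter> PB.Gp"
abbreviation "Strat_chart \<equiv> S \<inter> EB.chart \<rho>E"

lemma UI_open: "UI \<in> opens Gr_I" by (rule IB.chart_open_quiver_Gr[OF \<rho>I])
lemma UP_open: "UP \<in> opens Gr_P" by (rule PB.chart_open_quiver_Gr[OF \<rho>P])
lemma UIP_open: "UI \<times> UP \<in> opens Base" by (rule two_varieties.open_Times[OF two_varieties_Gr UI_open UP_open])

lemma secI_regular_Base:
  assumes "i \<in> verts Q" "k < f i" "lin_functional (space I i) \<xi>"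
  shows "(\<lambda>b. \<xi> (IB.sec \<rho>I (fst b) i k)) \<in> regular Base (UI \<times> UP)"
proof -
  interpret B: space_with_functions Base by (rule swf_base)
  have r: "(\<lambda>N. \<xi> (IB.sec \<rho>I N i k)) \<in> regular Gr_I UI"
    by (rule IB.sec_regular_quiver_Gr[OF \<rho>I assms(1) _ assms(3)]) (use assms(2) in simp)
  note m = two_varieties.morphism_fst[OF two_varieties_Gr]
  show ?thesis
    by (rule B.regular_restrict[OF morphismD(3)[OF m UI_open r] morphismD(2)[OF m UI_open] UIP_open])
      (use B.opens_subset[OF UIP_open] in auto)
qed

lemma secP_regular_Base:
  assumes "i \<in> verts Q" "l < nP i" "lin_functional (space P i) \<xi>"
  shows "(\<lambda>b. \<xi> (PB.sec \<rho>P (snd b) i l)) \<in> regular Base (UI \<times> UP)"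
proof -
  interpret B: space_with_functions Base by (rule swf_base)
  have r: "(\<lambda>N. \<xi> (PB.sec \<rho>P N i l)) \<in> regular Gr_P UP"
    by (rule PB.sec_regular_quiver_Gr[OF \<rho>P assms])
  note m = two_varieties.morphism_snd[OF two_varieties_Gr]
  show ?thesis
    by (rule B.regular_restrict[OF morphismD(3)[OF m UP_open r] morphismD(2)[OF m UP_open] UIP_open])
      (use B.opens_subset[OF UIP_open] in auto)
qed

lemma A_regular:
  assumes r: "r \<in> R" and x: "x \<in> L"
  shows "(\<lambda>b. A (fst b) (snd b) r x) \<in> regular Base (UI \<times> UP)"
proof -
  interpret B: space_with_functions Base by (rule swf_base)
  obtain a l j' where rr: "r = (a, l, j')" "a \<in> arcs Q" "l < nP (tail Q a)" "j' < m (head Q a)" using r unfolding R_def by auto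
  obtain i l' j where xx: "x = (i, l', j)" "i \<in> verts Q" "l' < nP i" "j < m i" using x unfolding L_def by auto
  note t = ends[OF rr(2)]
  have 1: "(\<lambda>b. if i = head Q a \<and> j = j' then \<rho>P i l' (act P a (PB.sec \<rho>P (snd b) (tail Q a) l)) else 0) \<in> regular Base (UI \<times> UP)"
  proof (cases "i = head Q a \<and> j = j'")
    case True
    then have "lin_functional (space P (tail Q a)) (\<lambda>x. \<rho>P i l' (act P a x))"
      using functional_compose[OF actP[OF rr(2)]] \<rho>P'[OF xx(2,3)] by simp
    from secP_regular_Base[OF t(1) rr(3) this] show ?thesis using True by simp
  next
    case False
    show ?thesis unfolding if_not_P[OF False] by (rule B.regular_const[OF UIP_open])
  qed
  have 2: "(\<lambda>b. if i = tail Q a \<and> l' = l then quot_coord (fst b) (head Q a) j' (act I a (c (tail Q a) j)) else 0) \<in> regular Base (UI \<times> UP)"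
  proof (cases "i = tail Q a \<and> l' = l")
    case True
    have "(\<lambda>b. quot_coord (fst b) (head Q a) j' (act I a (c (tail Q a) j))) \<in> regular Base (UI \<times> UP)"
      unfolding quot_coord_def
      by (intro B.regular_diff B.regular_sum B.regular_mult B.regular_const UIP_open secI_regular_Base t(2) cs rr(4)) simp
    then show ?thesis using True by simp
  next
    case False
    show ?thesis unfolding if_not_P[OF False] by (rule B.regular_const[OF UIP_open])
  qed
  show ?thesis unfolding A_def rr(1) xx(1) prod.case by (rule B.regular_diff[OF UIP_open 1 2])
qed

lemma Strat_chart_open: "Strat_chart \<in> opens Strat"
  unfolding stratum_def opens_induced_iff
  by (rule bexI[OF _ EB.chart_open_quiver_Gr[OF \<rho>E]]) (use S_Gp in blast)

lemma sec_regular_Strat: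
  assumes "i \<in> verts Q" "k < f i + nP i" "lin_functional (direct_sum (space P i) (space I i)) \<xi>"
  shows "(\<lambda>N. \<xi> (EB.sec \<rho>E N i k)) \<in> regular Strat Strat_chart"
proof -
  have "(\<lambda>N. \<xi> (EB.sec \<rho>E N i k)) \<in> regular (quiver_Gr Q (dimvec P) (direct_sum_rep P I)) (EB.chart \<rho>E \<inter> EB.Gp)"
    by (rule EB.sec_regular_quiver_Gr[OF \<rho>E assms(1)]) (use assms nE[OF assms(1)] in auto)
  from space_with_functions.regular_induced[OF swf_Gr_sum EB.chart_open_quiver_Gr[OF \<rho>E] this, of S]
  have "(\<lambda>N. \<xi> (EB.sec \<rho>E N i k)) \<in> regular Strat (EB.chart \<rho>E \<inter> EB.Gp \<inter> S)" unfolding stratum_def .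
  moreover have "EB.chart \<rho>E \<inter> EB.Gp \<inter> S = Strat_chart" using S_Gp by blast
  ultimately show ?thesis by simp
qed

text \<open>The dual frame of \<open>N\<close> contains those of its two components.  So regularity of the coordinates of the
former makes \<open>\<zeta>\<close> a morphism.\<close>
lemma sec_stratum:
  assumes N: "N \<in> Strat_chart" and i: "i \<in> verts Q"
  shows "k < f i \<Longrightarrow> snd (EB.sec \<rho>E N i k) = IB.sec \<rho>I (inter_I Q P I N) i k"
    "l < nP i \<Longrightarrow> fst (EB.sec \<rho>E N i (f i + l)) = PB.sec \<rho>P (proj_P Q N) i l"
proof -
  have NS: "N \<in> S" "N \<in> EB.chart \<rho>E" using N by auto
  interpret chart_point Q P I f \<rho>I \<rho>P m c cs "inter_I Q P I N" "proj_P Q N"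
    using S_chart_iff[OF NS(1)] NS zeta_stratum[OF NS(1)] by (intro chart_point) auto
  obtain Z where Z: "N = graph_rep Q (proj_P Q N) (hom Z)"
    using S_param[OF NS(1) zeta_def] by (elim exE conjE) (rule that)
  have s: "EB.sec \<rho>E N = graph_frame Z" by (subst Z) (rule sec_graph)
  show "snd (EB.sec \<rho>E N i k) = IB.sec \<rho>I (inter_I Q P I N) i k" if "k < f i"
    unfolding s graph_frame_def using i that nE[OF i] by (simp add: graph_vec_def)
  show "fst (EB.sec \<rho>E N i (f i + l)) = PB.sec \<rho>P (proj_P Q N) i l" if "l < nP i"
    unfolding s graph_frame_def using i that nE[OF i] by (simp add: graph_vec_def)
qed

lemma zeta_morphism_chart: "morphism (induced Strat Strat_chart) Base (zeta Q P I)"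
proof -
  interpret E: space_with_functions Strat by (rule swf_stratum)
  have sub: "Strat_chart \<subseteq> points Strat" using points_stratum by auto
  interpret C: space_with_functions "induced Strat Strat_chart" by (rule E.space_with_functions_induced[OF sub])
  have reg: "(\<lambda>N. \<xi> (EB.sec \<rho>E N i k)) \<in> regular (induced Strat Strat_chart) (points (induced Strat Strat_chart))"
    if "i \<in> verts Q" "k < f i + nP i" "lin_functional (direct_sum (space P i) (space I i)) \<xi>" for i k \<xi>
    using E.regular_induced[OF Strat_chart_open sec_regular_Strat[OF that], of Strat_chart] by simp
  have ch: "inter_I Q P I N \<in> IB.chart \<rho>I" "proj_P Q N \<in> PB.chart \<rho>P" "inter_I Q P I N \<in> IB.Gp" "proj_P Q N \<in> PB.Gp" if "N \<in> Strat_chart" for N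
    using that S_chart_iff[of N] zeta_stratum[of N] by auto
  have 1: "morphism (induced Strat Strat_chart) Gr_I (inter_I Q P I)"
  proof (rule IB.morphism_into_quiver_Gr[OF C.space_with_functions_axioms, where s = "\<lambda>N. IB.sec \<rho>I (inter_I Q P I N)"])
    fix N assume "N \<in> points (induced Strat Strat_chart)"
    then have N: "N \<in> Strat_chart" by simp
    show "IB.sec \<rho>I (inter_I Q P I N) \<in> IB.Fr" by (rule IB.sec(1)[OF ch(1)[OF N]])
    show "inter_I Q P I N = IB.sp (IB.sec \<rho>I (inter_I Q P I N))" using IB.sec(2)[OF ch(1)[OF N]] by simp
    show "inter_I Q P I N \<in> IB.Gp" by (rule ch(3)[OF N])
  next
    fix i k \<xi> assume i: "i \<in> verts Q" and k: "k < nat (int (f i))" and \<xi>: "lin_functional (space I i) \<xi>"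
    show "(\<lambda>N. \<xi> (IB.sec \<rho>I (inter_I Q P I N) i k)) \<in> regular (induced Strat Strat_chart) (points (induced Strat Strat_chart))"
      by (rule C.regular_cong[OF reg[OF i _ functional_snd[OF \<xi>], of k] C.opens_points]) (use k sec_stratum(1)[OF _ i] in auto)
  qed
  have 2: "morphism (induced Strat Strat_chart) Gr_P (proj_P Q)"
  proof (rule PB.morphism_into_quiver_Gr[OF C.space_with_functions_axioms, where s = "\<lambda>N. PB.sec \<rho>P (proj_P Q N)"])
    fix N assume "N \<in> points (induced Strat Strat_chart)"
    then have N: "N \<in> Strat_chart" by simp
    show "PB.sec \<rho>P (proj_P Q N) \<in> PB.Fr" by (rule PB.sec(1)[OF ch(2)[OF N]])
    show "proj_P Q N = PB.sp (PB.sec \<rho>P (proj_P Q N))" using PB.sec(2)[OF ch(2)[OF N]] by simp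
    show "proj_P Q N \<in> PB.Gp" by (rule ch(4)[OF N])
  next
    fix i l \<xi> assume i: "i \<in> verts Q" and l: "l < nP i" and \<xi>: "lin_functional (space P i) \<xi>"
    show "(\<lambda>N. \<xi> (PB.sec \<rho>P (proj_P Q N) i l)) \<in> regular (induced Strat Strat_chart) (points (induced Strat Strat_chart))"
      by (rule C.regular_cong[OF reg[OF i _ functional_fst[OF \<xi>], of "f i + l"] C.opens_points]) (use l sec_stratum(2)[OF _ i] in auto)
  qed
  show ?thesis
    using morphism_into_product[OF C.space_with_functions_axioms IB.variety_quiver_Gr PB.variety_quiver_Gr 1 2]
    by (simp add: zeta_def[abs_def])
qed

text \<open>The frame \<open>graph_frame\<close> as a function of the base point, whose regular dependence on it is needed.\<close>
definition frame_over :: "('i \<Rightarrow> 'q set) \<times> ('i \<Rightarrow> 'p set) \<Rightarrow> ('i \<times> nat \<times> nat \<Rightarrow> complex) \<Rightarrow> 'i \<Rightarrow> nat \<Rightarrow> 'p \<times> 'q" where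
  "frame_over b Z = (\<lambda>i\<in>verts Q. \<lambda>k\<in>{..<nat (dimvec P i)}.
     if k < f i then (\<zero>\<^bsub>space P i\<^esub>, IB.sec \<rho>I (fst b) i k)
     else (PB.sec \<rho>P (snd b) i (k - f i), lift Z i (PB.sec \<rho>P (snd b) i (k - f i))))"

end

text \<open>The columns \<open>K\<close> form a maximal minor of \<open>A\<close> that is invertible at all points of \<open>W\<close>, with inverse
\<open>Inv\<close>.\<close>
locale chart_minor = chart_data Q P I f \<rho>I \<rho>P m c cs
  for Q :: "('i, 'a) pre_digraph" and P :: "('i, 'a, 'p) rep" and I :: "('i, 'a, 'q) rep" and f :: "'i \<Rightarrow> nat"
    and \<rho>I :: "'i \<Rightarrow> nat \<Rightarrow> 'q \<Rightarrow> complex" and \<rho>P :: "'i \<Rightarrow> nat \<Rightarrow> 'p \<Rightarrow> complex"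
    and m :: "'i \<Rightarrow> nat" and c :: "'i \<Rightarrow> nat \<Rightarrow> 'q" and cs :: "'i \<Rightarrow> nat \<Rightarrow> 'q \<Rightarrow> complex" +
  fixes K :: "('i \<times> nat \<times> nat) set" and W :: "(('i \<Rightarrow> 'q set) \<times> ('i \<Rightarrow> 'p set)) set"
    and Inv :: "'i \<times> nat \<times> nat \<Rightarrow> 'a \<times> nat \<times> nat \<Rightarrow> ('i \<Rightarrow> 'q set) \<times> ('i \<Rightarrow> 'p set) \<Rightarrow> complex"
  assumes KL: "K \<subseteq> L" and cardK: "card R = card K"
    and W_open: "W \<in> opens Base" and W_sub: "W \<subseteq> UI \<times> UP"
    and Inv: "\<And>x r. x \<in> K \<Longrightarrow> r \<in> R \<Longrightarrow> Inv x r \<in> regular Base W"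
    and inv1: "\<And>b r r'. b \<in> W \<Longrightarrow> r \<in> R \<Longrightarrow> r' \<in> R \<Longrightarrow>
      (\<Sum>k\<in>K. A (fst b) (snd b) r k * Inv k r' b) = (if r = r' then 1 else 0)"
    and inv2: "\<And>b k k'. b \<in> W \<Longrightarrow> k \<in> K \<Longrightarrow> k' \<in> K \<Longrightarrow>
      (\<Sum>r\<in>R. Inv k r b * A (fst b) (snd b) r k') = (if k = k' then 1 else 0)"
begin

abbreviation "n \<equiv> card (L - K)"

definition \<kappa> :: "nat \<Rightarrow> 'i \<times> nat \<times> nat" where "\<kappa> = (SOME \<kappa>. bij_betw \<kappa> {..<n} (L - K))"
definition \<iota> :: "'i \<times> nat \<times> nat \<Rightarrow> nat" where "\<iota> = inv_into {..<n} \<kappa>"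

lemma \<kappa>: "bij_betw \<kappa> {..<n} (L - K)"
  unfolding \<kappa>_def
  by (rule someI_ex[of "\<lambda>\<kappa>. bij_betw \<kappa> {..<n} (L - K)"]) (use ex_bij_betw_nat_finite[of "L - K"] finL in \<open>simp add: atLeast0LessThan\<close>)

lemma \<kappa>L: "k < n \<Longrightarrow> \<kappa> k \<in> L - K" using \<kappa> by (auto simp: bij_betw_def)
lemma \<iota>\<kappa>: "k < n \<Longrightarrow> \<iota> (\<kappa> k) = k" using \<kappa> by (simp add: \<iota>_def bij_betw_def)
lemma \<kappa>\<iota>: "x \<in> L - K \<Longrightarrow> \<kappa> (\<iota> x) = x"
  unfolding \<iota>_def by (rule bij_betw_inv_into_right[OF \<kappa>])
lemma \<iota>_less: "x \<in> L - K \<Longrightarrow> \<iota> x < n"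
  using inv_into_into[of x \<kappa> "{..<n}"] \<kappa> by (simp add: \<iota>_def bij_betw_def)

text \<open>The solution of the system with prescribed entries \<open>v\<close> in the columns outside \<open>K\<close>; the enumeration
\<open>\<kappa>\<close> of these columns, with inverse \<open>\<iota>\<close>, numbers the entries of \<open>v\<close>.\<close>
definition solution :: "('i \<Rightarrow> 'q set) \<times> ('i \<Rightarrow> 'p set) \<Rightarrow> complex vec \<Rightarrow> 'i \<times> nat \<times> nat \<Rightarrow> complex" where
  "solution b v x = (if x \<in> K then - (\<Sum>r\<in>R. Inv x r b * (\<Sum>x'\<in>L - K. A (fst b) (snd b) r x' * v $ \<iota> x')) else v $ \<iota> x)"

lemma sum_split: "(\<Sum>x\<in>L. g x) = (\<Sum>x\<in>L - K. g x) + (\<Sum>x\<in>K. g x)" for g :: "_ \<Rightarrow> complex"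
  using sum.subset_diff[OF KL finL, of g] by simp

lemma finK: "finite K" using KL finL finite_subset by blast

lemma solution_ker:
  assumes b: "b \<in> W" and r: "r \<in> R"
  shows "(\<Sum>x\<in>L. A (fst b) (snd b) r x * solution b v x) = 0"
proof -
  let ?A = "A (fst b) (snd b)" and ?s = "\<lambda>r. \<Sum>x'\<in>L - K. A (fst b) (snd b) r x' * v $ \<iota> x'"
  have "(\<Sum>x\<in>K. ?A r x * solution b v x) = (\<Sum>x\<in>K. \<Sum>r'\<in>R. - (?A r x * Inv x r' b * ?s r'))"
    by (rule sum.cong[OF refl]) (simp add: solution_def sum_distrib_left sum_negf mult.assoc)
  also have "\<dots> = (\<Sum>r'\<in>R. - ((\<Sum>x\<in>K. ?A r x * Inv x r' b) * ?s r'))"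
    by (subst sum.swap) (simp add: sum_distrib_right sum_negf)
  also have "\<dots> = (\<Sum>r'\<in>R. if r' = r then - ?s r' else 0)"
    by (rule sum.cong[OF refl]) (use inv1[OF b r] in auto)
  also have "\<dots> = - ?s r" using r finR by simp
  finally have "(\<Sum>x\<in>K. ?A r x * solution b v x) = - ?s r" .
  moreover have "(\<Sum>x\<in>L - K. ?A r x * solution b v x) = ?s r"
    by (rule sum.cong[OF refl]) (simp add: solution_def)
  ultimately show ?thesis unfolding sum_split by simp
qed

lemma solution_unique:
  assumes b: "b \<in> W" and k: "\<forall>r\<in>R. (\<Sum>x\<in>L. A (fst b) (snd b) r x * Z x) = 0"
    and v: "\<And>x. x \<in> L - K \<Longrightarrow> v $ \<iota> x = Z x" and x: "x \<in> L"
  shows "solution b v x = Z x"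
proof (cases "x \<in> K")
  case False
  then show ?thesis using v x by (simp add: solution_def)
next
  case True
  let ?A = "A (fst b) (snd b)" and ?s = "\<lambda>r. \<Sum>x'\<in>L - K. A (fst b) (snd b) r x' * v $ \<iota> x'"
  have s: "?s r = - (\<Sum>x'\<in>K. ?A r x' * Z x')" if "r \<in> R" for r
  proof -
    have "?s r = (\<Sum>x'\<in>L - K. ?A r x' * Z x')" by (rule sum.cong[OF refl]) (simp add: v)
    then show ?thesis using k that sum_split[of "\<lambda>x. ?A r x * Z x"] by (simp add: eq_neg_iff_add_eq_0)
  qed
  have "solution b v x = (\<Sum>r\<in>R. \<Sum>x'\<in>K. Inv x r b * ?A r x' * Z x')"
    using True by (simp add: solution_def s sum_distrib_left sum_negf mult.assoc)
  also have "\<dots> = (\<Sum>x'\<in>K. (\<Sum>r\<in>R. Inv x r b * ?A r x') * Z x')"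
    by (subst sum.swap) (simp add: sum_distrib_right)
  also have "\<dots> = (\<Sum>x'\<in>K. if x' = x then Z x' else 0)"
    by (rule sum.cong[OF refl]) (use inv2[OF b True] in auto)
  also have "\<dots> = Z x" using True finK by simp
  finally show ?thesis .
qed

lemma solution_add:
  assumes "v \<in> carrier_vec n" "v' \<in> carrier_vec n" "x \<in> L"
  shows "solution b (v + v') x = solution b v x + solution b v' x"
proof -
  have e: "(v + v') $ \<iota> x = v $ \<iota> x + v' $ \<iota> x" if "x \<in> L - K" for x
    using assms \<iota>_less[OF that] by simp
  have "(\<Sum>x'\<in>L - K. A (fst b) (snd b) r x' * (v + v') $ \<iota> x') =
    (\<Sum>x'\<in>L - K. A (fst b) (snd b) r x' * v $ \<iota> x') + (\<Sum>x'\<in>L - K. A (fst b) (snd b) r x' * v' $ \<iota> x')" for r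
    unfolding sum.distrib[symmetric] by (rule sum.cong[OF refl]) (simp only: e distrib_left)
  then show ?thesis using e[of x] assms(3) by (simp add: solution_def distrib_left sum.distrib)
qed

lemma solution_smult:
  assumes "v \<in> carrier_vec n" "x \<in> L"
  shows "solution b (t \<cdot>\<^sub>v v) x = t * solution b v x"
proof -
  have e: "(t \<cdot>\<^sub>v v) $ \<iota> x = t * v $ \<iota> x" if "x \<in> L - K" for x
    using assms \<iota>_less[OF that] by simp
  have "(\<Sum>x'\<in>L - K. A (fst b) (snd b) r x' * (t \<cdot>\<^sub>v v) $ \<iota> x') = t * (\<Sum>x'\<in>L - K. A (fst b) (snd b) r x' * v $ \<iota> x')" for r
    unfolding sum_distrib_left by (rule sum.cong[OF refl]) (simp only: e mult.left_commute)
  then show ?thesis using e[of x] assms(2) by (simp add: solution_def sum_distrib_left mult.left_commute)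
qed

lemma solution_zero: "x \<in> L \<Longrightarrow> solution b (0\<^sub>v n) x = 0"
proof -
  have "0 \<cdot>\<^sub>v 0\<^sub>v n = (0\<^sub>v n :: complex vec)" by (rule eq_vecI) simp_all
  then show "x \<in> L \<Longrightarrow> solution b (0\<^sub>v n) x = 0" using solution_smult[of "0\<^sub>v n" x b 0] by simp
qed

end

locale minor_point = chart_minor Q P I f \<rho>I \<rho>P m c cs K W Inv
  for Q :: "('i, 'a) pre_digraph" and P :: "('i, 'a, 'p) rep" and I :: "('i, 'a, 'q) rep" and f :: "'i \<Rightarrow> nat"
    and \<rho>I :: "'i \<Rightarrow> nat \<Rightarrow> 'q \<Rightarrow> complex" and \<rho>P :: "'i \<Rightarrow> nat \<Rightarrow> 'p \<Rightarrow> complex"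
    and m :: "'i \<Rightarrow> nat" and c :: "'i \<Rightarrow> nat \<Rightarrow> 'q" and cs :: "'i \<Rightarrow> nat \<Rightarrow> 'q \<Rightarrow> complex"
    and K :: "('i \<times> nat \<times> nat) set" and W :: "(('i \<Rightarrow> 'q set) \<times> ('i \<Rightarrow> 'p set)) set"
    and Inv :: "'i \<times> nat \<times> nat \<Rightarrow> 'a \<times> nat \<times> nat \<Rightarrow> ('i \<Rightarrow> 'q set) \<times> ('i \<Rightarrow> 'p set) \<Rightarrow> complex" +
  fixes NI :: "'i \<Rightarrow> 'q set" and NP :: "'i \<Rightarrow> 'p set"
  assumes bW: "(NI, NP) \<in> W"

sublocale minor_point \<subseteq> chart_point Q P I f \<rho>I \<rho>P m c cs NI NP
  by (rule chart_point) (use bW W_sub in auto)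

context chart_minor
begin

lemma minor_point: "b \<in> W \<Longrightarrow> minor_point Q P I f \<rho>I \<rho>P m c cs K W Inv (fst b) (snd b)"
  by (rule minor_point.intro[OF chart_minor_axioms minor_point_axioms.intro]) simp

text \<open>The inverse of the trivialisation, in terms of a frame with regular coordinates.\<close>
definition point_at :: "(('i \<Rightarrow> 'q set) \<times> ('i \<Rightarrow> 'p set)) \<times> complex vec \<Rightarrow> 'i \<Rightarrow> ('p \<times> 'q) set" where
  "point_at z = EB.sp (frame_over (fst z) (solution (fst z) (snd z)))"

text \<open>The matrix entries outside \<open>K\<close>, read off from the dual frame of \<open>N\<close>: its vector \<open>f i + l\<close> is
\<open>(w i l, lift (w i l))\<close>.\<close>
definition fibre_coords :: "('i \<Rightarrow> ('p \<times> 'q) set) \<Rightarrow> complex vec" where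
  "fibre_coords N = vec n (\<lambda>k. case \<kappa> k of (i, l, j) \<Rightarrow> cs i j (snd (EB.sec \<rho>E N i (f i + l))))"

end

context minor_point
begin

abbreviation "H \<equiv> Hom_Q Q Sub Quot"
abbreviation "\<tau> v \<equiv> hom (solution (NI, NP) v)"

lemma frame_over_graph_frame: "frame_over (NI, NP) Z = graph_frame Z"
  unfolding frame_over_def graph_frame_def graph_vec_def fst_conv snd_conv ..

lemma point_at_graph: "point_at ((NI, NP), v) = graph_rep Q NP (\<tau> v)"
  unfolding point_at_def by (simp add: frame_over_graph_frame sp_graph_frame)

lemma ker_solution: "ker (solution (NI, NP) v)"
  using solution_ker[OF bW] by simp

lemma fibre_coords_graph: "fibre_coords (graph_rep Q NP (hom Z)) = vec n (\<lambda>k. Z (\<kappa> k))"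
  unfolding fibre_coords_def sec_graph
proof (rule eq_vecI)
  fix k assume "k < dim_vec (vec n (\<lambda>k. Z (\<kappa> k)))"
  then have k: "k < n" by simp
  obtain i l j where x: "\<kappa> k = (i, l, j)" by (cases "\<kappa> k")
  then have i: "i \<in> verts Q" "l < nP i" "j < m i" using \<kappa>L[OF k] by (auto simp: L_def)
  have "snd (graph_frame Z i (f i + l)) = lift Z i (w i l)" using i nE[OF i(1)] by (simp add: graph_frame_def graph_vec_def)
  also have "cs i j \<dots> = Z (i, l, j)" unfolding lift_w[OF i(1,2)]
    by (rule cvs.dual_coefficient[OF IB.vs[OF i(1)] c[OF i(1)], where \<rho> = "cs i"]) (use cs[OF i(1)] csc[OF i(1)] i in auto)
  finally show "vec n (\<lambda>k. case \<kappa> k of (i, l, j) \<Rightarrow> cs i j (snd (graph_frame Z i (f i + l)))) $ k = vec n (\<lambda>k. Z (\<kappa> k)) $ k"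
    using k x by simp
qed simp

lemma hom_solution:
  assumes "ker Z" shows "\<tau> (vec n (\<lambda>k. Z (\<kappa> k))) = hom Z"
proof (rule hom_cong, rule solution_unique[OF bW])
  show "\<forall>r\<in>R. (\<Sum>x\<in>L. A (fst (NI, NP)) (snd (NI, NP)) r x * Z x) = 0" using assms by simp
  show "vec n (\<lambda>k. Z (\<kappa> k)) $ \<iota> x = Z x" if "x \<in> L - K" for x
    using \<iota>_less[OF that] \<kappa>\<iota>[OF that] by simp
qed

lemma fibre_coords_point_at:
  assumes v: "v \<in> carrier_vec n" shows "fibre_coords (point_at ((NI, NP), v)) = v"
  unfolding point_at_graph fibre_coords_graph
proof (rule eq_vecI)
  fix k assume "k < dim_vec v"
  then have k: "k < n" using v by simp
  show "vec n (\<lambda>k. solution (NI, NP) v (\<kappa> k)) $ k = v $ k"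
    using \<kappa>L[OF k] \<iota>\<kappa>[OF k] k by (simp add: solution_def)
qed (use v in simp)

lemma point_at_stratum: "point_at ((NI, NP), v) \<in> S" "zeta Q P I (point_at ((NI, NP), v)) = (NI, NP)"
  unfolding point_at_graph using graph_in_S[OF ker_solution] zeta_graph by auto

lemma point_at_fibre_coords:
  assumes N: "N \<in> S" "zeta Q P I N = (NI, NP)"
  shows "point_at ((NI, NP), fibre_coords N) = N"
proof -
  obtain Z where Z: "ker Z" "N = graph_rep Q NP (hom Z)" using S_param[OF N] by (elim exE conjE) (rule that)
  show ?thesis unfolding point_at_graph Z(2) fibre_coords_graph hom_solution[OF Z(1)] ..
qed

lemma \<tau>_bij: "bij_betw \<tau> (carrier_vec n) (carrier H)"
proof -
  have "carrier H = rep_hom Q Sub Quot" by (simp add: Hom_Q_def)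
  moreover have "bij_betw \<tau> (carrier_vec n) (rep_hom Q Sub Quot)"
  proof (rule bij_betw_byWitness[where f' = "\<lambda>\<phi>. vec n (\<lambda>k. matrix_of \<phi> (\<kappa> k))"])
    show "\<forall>v\<in>carrier_vec n. vec n (\<lambda>k. matrix_of (\<tau> v) (\<kappa> k)) = v"
    proof
      fix v :: "complex vec" assume v: "v \<in> carrier_vec n"
      show "vec n (\<lambda>k. matrix_of (\<tau> v) (\<kappa> k)) = v"
      proof (rule eq_vecI)
        fix k assume "k < dim_vec v"
        then have k: "k < n" using v by simp
        obtain i l j where x: "\<kappa> k = (i, l, j)" by (cases "\<kappa> k")
        have "matrix_of (\<tau> v) (\<kappa> k) = solution (NI, NP) v (\<kappa> k)" unfolding x by (rule matrix_of_hom) (use \<kappa>L[OF k] x in simp)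
        then show "vec n (\<lambda>k. matrix_of (\<tau> v) (\<kappa> k)) $ k = v $ k" using k \<kappa>L[OF k] \<iota>\<kappa>[OF k] by (simp add: solution_def)
      qed (use v in simp)
    qed
    show "\<forall>\<phi>\<in>rep_hom Q Sub Quot. \<tau> (vec n (\<lambda>k. matrix_of \<phi> (\<kappa> k))) = \<phi>"
      using hom_solution hom_matrix_of by simp
    show "\<tau> ` carrier_vec n \<subseteq> rep_hom Q Sub Quot" using hom_mem[OF ker_solution] by blast
    show "(\<lambda>\<phi>. vec n (\<lambda>k. matrix_of \<phi> (\<kappa> k))) ` rep_hom Q Sub Quot \<subseteq> carrier_vec n" by (rule image_subsetI) simp
  qed
  ultimately show ?thesis by simp
qed

lemma H_transport: "cvs H" "linear_map CC (module_vec TYPE(complex) n) H \<tau>"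
proof -
  have c: "carrier (module_vec TYPE(complex) n) = carrier_vec n" by (simp add: module_vec_def)
  have b: "bij_betw \<tau> (carrier (module_vec TYPE(complex) n)) (carrier H)" unfolding c by (rule \<tau>_bij)
  have z: "\<zero>\<^bsub>H\<^esub> = \<tau> \<zero>\<^bsub>module_vec TYPE(complex) n\<^esub>"
    using hom_cong[of "solution (NI, NP) (0\<^sub>v n)" "\<lambda>_. 0"] solution_zero hom_zero by (simp add: module_vec_def)
  have a: "\<tau> x \<oplus>\<^bsub>H\<^esub> \<tau> y = \<tau> (x \<oplus>\<^bsub>module_vec TYPE(complex) n\<^esub> y)"
    if "x \<in> carrier (module_vec TYPE(complex) n)" "y \<in> carrier (module_vec TYPE(complex) n)" for x y
    using hom_cong[of "solution (NI, NP) (x + y)" "\<lambda>z. solution (NI, NP) x z + solution (NI, NP) y z"] solution_add[of x y] that hom_add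
    by (simp add: module_vec_def)
  have s: "t \<odot>\<^bsub>H\<^esub> \<tau> x = \<tau> (t \<odot>\<^bsub>module_vec TYPE(complex) n\<^esub> x)"
    if "x \<in> carrier (module_vec TYPE(complex) n)" for x t
    using hom_cong[of "solution (NI, NP) (t \<cdot>\<^sub>v x)" "\<lambda>z. t * solution (NI, NP) x z"] solution_smult[of x] that hom_smult
    by (simp add: module_vec_def)
  show "cvs H" by (rule transport_cvs(1)[OF cvs_module_vec b z a s])
  show "linear_map CC (module_vec TYPE(complex) n) H \<tau>" by (rule transport_cvs(2)[OF cvs_module_vec b z a s])
qed

lemma H_dim: "vectorspace.fin_dim CC H" "vectorspace.dim CC H = n"
proof -
  have b: "bij_betw \<tau> (carrier (module_vec TYPE(complex) n)) (carrier H)"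
    using \<tau>_bij by (simp add: module_vec_def)
  show "vectorspace.fin_dim CC H" by (rule dim_transport(1)[OF H_transport(2) b fin_dim_module_vec])
  show "vectorspace.dim CC H = n" using dim_transport(2)[OF H_transport(2) b fin_dim_module_vec] by (simp add: dim_module_vec)
qed

text \<open>The kernel has dimension \<open>card L - card R\<close>, and the two cardinalities are the two sums in the Euler
form.\<close>
lemma euler_n: "int n = euler_form Q (\<lambda>i. dimvec P i - int (f i)) (\<lambda>i. dimvec I i - int (f i))"
proof -
  have L: "card L = (\<Sum>i\<in>verts Q. nP i * m i)" unfolding L_def using finV by simp
  have R: "card R = (\<Sum>a\<in>arcs Q. nP (tail Q a) * m (head Q a))" unfolding R_def using finA by simp
  have "n = card L - card K" by (rule card_Diff_subset[OF finK KL])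
  moreover have "card K \<le> card L" by (rule card_mono[OF finL KL])
  ultimately have "int n = int (card L) - int (card R)" using cardK by simp
  also have "int (card L) = (\<Sum>i\<in>verts Q. (dimvec P i - int (f i)) * (dimvec I i - int (f i)))"
    unfolding L by (simp, rule sum.cong[OF refl]) (use le dimI in simp)
  also have "int (card R) = (\<Sum>a\<in>arcs Q. (dimvec P (tail Q a) - int (f (tail Q a))) * (dimvec I (head Q a) - int (f (head Q a))))"
    unfolding R by (simp, rule sum.cong[OF refl]) (use le dimI ends in simp)
  finally show ?thesis unfolding euler_form_def .
qed

lemma fibre_simps:
  "carrier (fibre (NI, NP)) = {N \<in> S. zeta Q P I N = (NI, NP)}"
  "\<zero>\<^bsub>fibre (NI, NP)\<^esub> = graph_rep Q NP \<zero>\<^bsub>H\<^esub>"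
  "\<phi> \<in> carrier H \<Longrightarrow> \<psi> \<in> carrier H \<Longrightarrow> graph_rep Q NP \<phi> \<oplus>\<^bsub>fibre (NI, NP)\<^esub> graph_rep Q NP \<psi> = graph_rep Q NP (\<phi> \<oplus>\<^bsub>H\<^esub> \<psi>)"
  "\<phi> \<in> carrier H \<Longrightarrow> t \<odot>\<^bsub>fibre (NI, NP)\<^esub> graph_rep Q NP \<phi> = graph_rep Q NP (t \<odot>\<^bsub>H\<^esub> \<phi>)"
proof -
  have c: "carrier H = rep_hom Q Sub Quot" by (simp add: Hom_Q_def)
  have i: "inv_into (carrier H) (graph_rep Q NP) (graph_rep Q NP \<phi>) = \<phi>" if "\<phi> \<in> carrier H" for \<phi>
    using graph_bij that unfolding c by (simp add: bij_betw_def)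
  show "carrier (fibre (NI, NP)) = {N \<in> S. zeta Q P I N = (NI, NP)}" by (simp add: fibre_def Let_def)
  show "\<zero>\<^bsub>fibre (NI, NP)\<^esub> = graph_rep Q NP \<zero>\<^bsub>H\<^esub>" by (simp add: fibre_def Let_def)
  show "graph_rep Q NP \<phi> \<oplus>\<^bsub>fibre (NI, NP)\<^esub> graph_rep Q NP \<psi> = graph_rep Q NP (\<phi> \<oplus>\<^bsub>H\<^esub> \<psi>)"
    if "\<phi> \<in> carrier H" "\<psi> \<in> carrier H" using i[OF that(1)] i[OF that(2)] by (simp add: fibre_def Let_def)
  show "t \<odot>\<^bsub>fibre (NI, NP)\<^esub> graph_rep Q NP \<phi> = graph_rep Q NP (t \<odot>\<^bsub>H\<^esub> \<phi>)" if "\<phi> \<in> carrier H"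
    using i[OF that] by (simp add: fibre_def Let_def)
qed

lemma graph_bij_fibre: "bij_betw (graph_rep Q NP) (carrier H) (carrier (fibre (NI, NP)))"
  using graph_bij unfolding fibre_simps(1) by (simp add: Hom_Q_def)

lemma fibre_transport: "cvs (fibre (NI, NP))" "linear_map CC H (fibre (NI, NP)) (graph_rep Q NP)"
proof -
  show "cvs (fibre (NI, NP))"
    by (rule transport_cvs(1)[where T = "graph_rep Q NP", OF H_transport(1) graph_bij_fibre fibre_simps(2)]; rule fibre_simps; assumption)
  show "linear_map CC H (fibre (NI, NP)) (graph_rep Q NP)"
    by (rule transport_cvs(2)[where T = "graph_rep Q NP", OF H_transport(1) graph_bij_fibre fibre_simps(2)]; rule fibre_simps; assumption)
qed

lemma fibre_iso: "linear_iso (fibre (NI, NP)) H (inv_into (carrier H) (graph_rep Q NP))"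
  unfolding linear_iso_def
proof
  show "linear_map CC (fibre (NI, NP)) H (inv_into (carrier H) (graph_rep Q NP))"
    by (rule linear_map_inverse[OF fibre_transport(2) graph_bij_fibre])
      (use graph_bij_fibre in \<open>simp add: bij_betw_def\<close>)
  show "bij_betw (inv_into (carrier H) (graph_rep Q NP)) (carrier (fibre (NI, NP))) (carrier H)"
    by (rule bij_betw_inv_into[OF graph_bij_fibre])
qed

lemma fibre_coords_linear: "linear_map CC (fibre (NI, NP)) (module_vec TYPE(complex) n) fibre_coords"
proof (rule linear_map_inverse)
  show "linear_map CC (module_vec TYPE(complex) n) (fibre (NI, NP)) (\<lambda>v. graph_rep Q NP (\<tau> v))"
    by (rule linear_map_compose[OF H_transport(2) fibre_transport(2)])
  have "bij_betw \<tau> (carrier (module_vec TYPE(complex) n)) (carrier H)" using \<tau>_bij by (simp add: module_vec_def)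
  from bij_betw_trans[OF this graph_bij_fibre]
  show "bij_betw (\<lambda>v. graph_rep Q NP (\<tau> v)) (carrier (module_vec TYPE(complex) n)) (carrier (fibre (NI, NP)))"
    by (simp add: comp_def)
  show "fibre_coords (graph_rep Q NP (\<tau> v)) = v" if "v \<in> carrier (module_vec TYPE(complex) n)" for v
    using fibre_coords_point_at[of v] that unfolding point_at_graph by (simp add: module_vec_def)
qed

end

section \<open>Local triviality\<close>

lemma functional_direct_sum:
  fixes V :: "(complex, 'v) module" and W :: "(complex, 'w) module"
  assumes V: "cvs V" and W: "cvs W" and \<xi>: "lin_functional (direct_sum V W) \<xi>"
  shows "lin_functional V (\<lambda>x. \<xi> (x, \<zero>\<^bsub>W\<^esub>))" "lin_functional W (\<lambda>y. \<xi> (\<zero>\<^bsub>V\<^esub>, y))"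
    "x \<in> carrier V \<Longrightarrow> y \<in> carrier W \<Longrightarrow> \<xi> (x, y) = \<xi> (x, \<zero>\<^bsub>W\<^esub>) + \<xi> (\<zero>\<^bsub>V\<^esub>, y)"
proof -
  interpret V: cvs V by fact
  interpret W: cvs W by fact
  have add: "\<xi> (x \<oplus>\<^bsub>V\<^esub> x', y \<oplus>\<^bsub>W\<^esub> y') = \<xi> (x, y) + \<xi> (x', y')"
    if "x \<in> carrier V" "x' \<in> carrier V" "y \<in> carrier W" "y' \<in> carrier W" for x x' y y'
  proof -
    have "\<xi> ((x, y) \<oplus>\<^bsub>direct_sum V W\<^esub> (x', y')) = \<xi> (x, y) + \<xi> (x', y')"
      using \<xi> that unfolding lin_functional_def by (simp only: direct_sum_simps(1) mem_Sigma_iff)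
    then show ?thesis by simp
  qed
  have smult: "\<xi> (t \<odot>\<^bsub>V\<^esub> x, t \<odot>\<^bsub>W\<^esub> y) = t * \<xi> (x, y)" if "x \<in> carrier V" "y \<in> carrier W" for t x y
  proof -
    have "\<xi> (t \<odot>\<^bsub>direct_sum V W\<^esub> (x, y)) = t * \<xi> (x, y)"
      using \<xi> that unfolding lin_functional_def by (simp only: direct_sum_simps(1) mem_Sigma_iff)
    then show ?thesis by simp
  qed
  show "lin_functional V (\<lambda>x. \<xi> (x, \<zero>\<^bsub>W\<^esub>))"
    unfolding lin_functional_def using add[of _ _ "\<zero>\<^bsub>W\<^esub>" "\<zero>\<^bsub>W\<^esub>"] smult[of _ "\<zero>\<^bsub>W\<^esub>"] by simp
  show "lin_functional W (\<lambda>y. \<xi> (\<zero>\<^bsub>V\<^esub>, y))"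
    unfolding lin_functional_def using add[of "\<zero>\<^bsub>V\<^esub>" "\<zero>\<^bsub>V\<^esub>"] smult[of "\<zero>\<^bsub>V\<^esub>"] by simp
  show "\<xi> (x, y) = \<xi> (x, \<zero>\<^bsub>W\<^esub>) + \<xi> (\<zero>\<^bsub>V\<^esub>, y)" if "x \<in> carrier V" "y \<in> carrier W"
    using add[of x "\<zero>\<^bsub>V\<^esub>" "\<zero>\<^bsub>W\<^esub>" y] that by simp
qed

context minor_point
begin

lemma frame_over_frame: "frame_over (NI, NP) Z \<in> EB.Fr"
  unfolding frame_over_graph_frame by (rule graph_frame_frame)

text \<open>A functional of a frame vector is a functional of the frame of \<open>N\<^sub>P\<close> plus a linear expression in the
entries of the matrix, hence regular.\<close>
lemma frame_over_functional:
  assumes i: "i \<in> verts Q" and l: "l < nP i" and \<xi>: "lin_functional (direct_sum (space P i) (space I i)) \<xi>"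
  shows "\<xi> (frame_over (NI, NP) Z i (f i + l)) =
    \<xi> (w i l, \<zero>\<^bsub>space I i\<^esub>) + (\<Sum>j<m i. Z (i, l, j) * \<xi> (\<zero>\<^bsub>space P i\<^esub>, c i j))"
proof -
  note fd = functional_direct_sum[OF PB.vs[OF i] IB.vs[OF i] \<xi>]
  have wc: "w i l \<in> carrier (space P i)" using w_car[OF i] l by simp
  have "frame_over (NI, NP) Z i (f i + l) = (w i l, lift Z i (w i l))"
    unfolding frame_over_graph_frame using i l nE[OF i] by (simp add: graph_frame_def graph_vec_def)
  then have "\<xi> (frame_over (NI, NP) Z i (f i + l)) = \<xi> (w i l, \<zero>\<^bsub>space I i\<^esub>) + \<xi> (\<zero>\<^bsub>space P i\<^esub>, lift Z i (w i l))"
    using fd(3)[OF wc lift_carrier[OF i wc]] by simp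
  also have "\<xi> (\<zero>\<^bsub>space P i\<^esub>, lift Z i (w i l)) = (\<Sum>j<m i. Z (i, l, j) * \<xi> (\<zero>\<^bsub>space P i\<^esub>, c i j))"
    unfolding lift_w[OF i l] by (rule cvs.lc_functional[OF IB.vs[OF i] fd(2) c[OF i]])
  finally show ?thesis .
qed

end

lemma (in rep_bundle) adapted_chart:
  assumes N: "N \<in> Gp"
  shows "\<exists>b \<xi>. N \<in> chart \<xi> \<and> functionals \<xi> \<and> (\<forall>i\<in>verts Q. 0 \<le> e i \<and> n i \<le> vectorspace.dim CC (space M i) \<and>
    (\<forall>k<vectorspace.dim CC (space M i). b i k \<in> carrier (space M i) \<and> lin_functional (space M i) (\<xi> i k)) \<and>
    (\<forall>k<vectorspace.dim CC (space M i). \<forall>j<vectorspace.dim CC (space M i). \<xi> i k (b i j) = (if j = k then 1 else 0)) \<and>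
    (\<forall>x\<in>carrier (space M i). x = lc (space M i) (\<lambda>k. \<xi> i k x) (b i) (vectorspace.dim CC (space M i))))"
proof -
  let ?D = "\<lambda>i. vectorspace.dim CC (space M i)"
  let ?p = "\<lambda>i b \<xi>. n i \<le> ?D i \<and> (\<forall>k<?D i. b k \<in> carrier (space M i) \<and> lin_functional (space M i) (\<xi> k)) \<and>
    (\<forall>k<?D i. \<forall>j<?D i. \<xi> k (b j) = (if j = k then 1 else 0)) \<and>
    (\<forall>x\<in>carrier (space M i). x = lc (space M i) (\<lambda>k. \<xi> k x) b (?D i)) \<and> N i = range (\<lambda>t. lc (space M i) t b (n i))"
  have Ns: "N \<in> subreps Q M" and Nd: "\<And>i. i \<in> verts Q \<Longrightarrow> dimvec (sub_rep M N) i = e i"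
    using N unfolding quiver_Gr_points_def by auto
  have d: "vectorspace.dim CC (space M i\<lparr>carrier := N i\<rparr>) = n i" "0 \<le> e i" if "i \<in> verts Q" for i
    using Nd[OF that] by (auto simp: dimvec_def sub_rep_def)
  have "\<forall>i\<in>verts Q. \<exists>b \<xi>. ?p i b \<xi>"
  proof
    fix i assume i: "i \<in> verts Q"
    show "\<exists>b \<xi>. ?p i b \<xi>"
    proof (rule cvs.adapted_coordinates[OF vs[OF i] fd[OF i] subreps_subspace[OF Ns i] d(1)[OF i]])
      fix b :: "nat \<Rightarrow> 'v" and \<xi> :: "nat \<Rightarrow> 'v \<Rightarrow> complex"
      assume "n i \<le> ?D i" "\<And>k. k < ?D i \<Longrightarrow> b k \<in> carrier (space M i)"
        "N i = range (\<lambda>c. lc (space M i) c b (n i))" "\<And>k. k < ?D i \<Longrightarrow> lin_functional (space M i) (\<xi> k)"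
        "\<And>k j. k < ?D i \<Longrightarrow> j < ?D i \<Longrightarrow> \<xi> k (b j) = (if j = k then 1 else 0)"
        "\<And>x. x \<in> carrier (space M i) \<Longrightarrow> x = lc (space M i) (\<lambda>k. \<xi> k x) b (?D i)"
      then show "\<exists>b \<xi>. ?p i b \<xi>" by (intro exI[of _ b] exI[of _ \<xi>]) simp
    qed
  qed
  from bchoice[OF this] obtain b where "\<forall>i\<in>verts Q. \<exists>\<xi>. ?p i (b i) \<xi>" by (elim exE) (rule that)
  from bchoice[OF this] obtain \<xi> where b\<xi>: "\<forall>i\<in>verts Q. ?p i (b i) (\<xi> i)" by (elim exE) (rule that)
  have le: "k < ?D i" if "k < n i" "i \<in> verts Q" for i k using b\<xi> that by (auto intro: less_le_trans)
  have bc: "b i k \<in> carrier (space M i)" "lin_functional (space M i) (\<xi> i k)" if "i \<in> verts Q" "k < n i" for i k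
    using bspec[OF b\<xi> that(1)] le[OF that(2,1)] by simp_all
  let ?b = "\<lambda>i\<in>verts Q. \<lambda>k\<in>{..<n i}. b i k"
  have fr: "?b \<in> Fr"
  proof (rule frameI)
    show "b i k \<in> carrier (space M i)" if "i \<in> verts Q" "k < n i" for i k by (rule bc(1)[OF that])
    show "indep (space M i) (n i) (b i)" if "i \<in> verts Q" for i
      by (rule cvs.dual_indep[OF vs[OF that], where \<rho> = "\<xi> i"]) (use b\<xi> that le in auto)
  qed
  have "sp ?b = N"
  proof (rule extensionalityI[OF sp_ext])
    show "N \<in> extensional (verts Q)" using Ns unfolding subreps_def by blast
    fix i assume i: "i \<in> verts Q"
    have "lc (space M i) t (?b i) (n i) = lc (space M i) t (b i) (n i)" for t by (rule lc_cong) (use i in auto)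
    then show "sp ?b i = N i" unfolding sp_eq[OF fr i] using b\<xi> i by simp
  qed
  moreover have "dual \<xi> ?b" unfolding dual_def using b\<xi> le by simp
  ultimately have "N \<in> chart \<xi>" unfolding chart_def using fr by blast
  moreover have "functionals \<xi>" unfolding functionals_def using bc(2) by simp
  ultimately show ?thesis using b\<xi> d(2) by (intro exI[of _ b] exI[of _ \<xi>]) simp
qed

context stratum_setup
begin

lemma chart_exists:
  assumes NI: "NI \<in> IB.Gp" and NP: "NP \<in> PB.Gp"
  shows "\<exists>\<rho>I \<rho>P m c cs. chart_data Q P I f \<rho>I \<rho>P m c cs \<and> NI \<in> IB.chart \<rho>I \<and> NP \<in> PB.chart \<rho>P"
proof -
  let ?D = "\<lambda>i. vectorspace.dim CC (space I i)"
  obtain b \<xi> where ch: "NI \<in> IB.chart \<xi>" "IB.functionals \<xi>" and b\<xi>: "\<forall>i\<in>verts Q. 0 \<le> int (f i) \<and> nat (int (f i)) \<le> ?D i \<and>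
    (\<forall>k<?D i. b i k \<in> carrier (space I i) \<and> lin_functional (space I i) (\<xi> i k)) \<and>
    (\<forall>k<?D i. \<forall>j<?D i. \<xi> i k (b i j) = (if j = k then 1 else 0)) \<and>
    (\<forall>x\<in>carrier (space I i). x = lc (space I i) (\<lambda>k. \<xi> i k x) (b i) (?D i))"
    using IB.adapted_chart[OF NI] by (elim exE conjE) (rule that; assumption)
  obtain b' \<xi>' where ch': "NP \<in> PB.chart \<xi>'" "PB.functionals \<xi>'" and le: "\<forall>i\<in>verts Q. 0 \<le> dimvec P i - int (f i)"
    using PB.adapted_chart[OF NP] by (elim exE conjE) (rule that; (assumption | blast))
  let ?m = "\<lambda>i. ?D i - f i" and ?c = "\<lambda>i j. b i (f i + j)" and ?cs = "\<lambda>i j. \<xi> i (f i + j)"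
  have D: "?D i = f i + ?m i" if "i \<in> verts Q" for i using b\<xi> that by simp
  have bc: "b i k \<in> carrier (space I i)" and xl: "lin_functional (space I i) (\<xi> i k)" if "i \<in> verts Q" "k < ?D i" for i k
    using b\<xi> that by auto
  have du: "\<xi> i k (b i j) = (if j = k then 1 else 0)" if "i \<in> verts Q" "k < ?D i" "j < ?D i" for i k j
    using b\<xi> that by blast
  have "chart_data Q P I f \<xi> \<xi>' ?m ?c ?cs"
  proof (rule chart_data.intro[OF stratum_setup_axioms chart_data_axioms.intro])
    show "int (f i) \<le> dimvec P i" if "i \<in> verts Q" for i using le that by simp
    show "dimvec I i = int (f i) + int (?m i)" if "i \<in> verts Q" for i
      unfolding dimvec_def using D[OF that] by linarith
    show "IB.functionals \<xi>" by (rule ch(2))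
    show "PB.functionals \<xi>'" by (rule ch'(2))
    show "\<forall>j<?m i. ?c i j \<in> carrier (space I i)" if "i \<in> verts Q" for i using bc[OF that] by simp
    show "lin_functional (space I i) (?cs i j)" if "i \<in> verts Q" "j < ?m i" for i j using xl[OF that(1)] that by simp
    show "\<xi> i k (?c i j) = 0" if "i \<in> verts Q" "k < f i" "j < ?m i" for i k j using du[OF that(1), of k "f i + j"] that by simp
    show "?cs i j (?c i j') = (if j' = j then 1 else 0)" if "i \<in> verts Q" "j < ?m i" "j' < ?m i" for i j j'
      using du[OF that(1), of "f i + j" "f i + j'"] that by simp
    show "y = lc (space I i) (\<lambda>j. ?cs i j y) (?c i) (?m i)"
      if i: "i \<in> verts Q" and y: "y \<in> carrier (space I i)" and z: "\<And>k. k < f i \<Longrightarrow> \<xi> i k y = 0" for i y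
    proof -
      interpret VI: cvs "space I i" by (rule IB.vs[OF i])
      have b1: "\<forall>k<f i + ?m i. b i k \<in> carrier (space I i)" using bc[OF i] D[OF i] by simp
      have "y = lc (space I i) (\<lambda>k. \<xi> i k y) (b i) (f i + ?m i)" using b\<xi> i y D[OF i] by simp
      also have "\<dots> = lc (space I i) (\<lambda>k. \<xi> i k y) (b i) (f i) \<oplus>\<^bsub>space I i\<^esub> lc (space I i) (\<lambda>j. ?cs i j y) (?c i) (?m i)"
        by (rule VI.lc_split[OF b1])
      also have "lc (space I i) (\<lambda>k. \<xi> i k y) (b i) (f i) = \<zero>\<^bsub>space I i\<^esub>"
        by (rule VI.lc_zero_coeff) (use b1 z in auto)
      finally show ?thesis using VI.lc_mem[of "?m i" "?c i"] b1 by simp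
    qed
  qed
  then show ?thesis using ch(1) ch'(1)
    by - (rule exI[of _ \<xi>], rule exI[of _ \<xi>'], rule exI[of _ ?m], rule exI[of _ ?c], rule exI[of _ ?cs], intro conjI)
qed

text \<open>Surjectivity at the single point \<open>b\<close> yields an invertible minor there, and Cramer's rule a
neighbourhood on which it stays invertible.\<close>
lemma minor_exists:
  assumes b: "b \<in> points Base"
  shows "\<exists>\<rho>I \<rho>P m c cs K W Inv. chart_minor Q P I f \<rho>I \<rho>P m c cs K W Inv \<and> b \<in> W"
proof -
  have bG: "fst b \<in> IB.Gp" "snd b \<in> PB.Gp" using b unfolding points_base by auto
  obtain \<rho>I \<rho>P m c cs where cd: "chart_data Q P I f \<rho>I \<rho>P m c cs" and ch: "fst b \<in> IB.chart \<rho>I" "snd b \<in> PB.chart \<rho>P"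
    using chart_exists[OF bG] by (elim exE conjE) (rule that; assumption)
  interpret chart_data Q P I f \<rho>I \<rho>P m c cs by (rule cd)
  interpret p: chart_point Q P I f \<rho>I \<rho>P m c cs "fst b" "snd b" by (rule chart_point[OF ch(1) bG(1) ch(2) bG(2)])
  interpret B: space_with_functions Base by (rule swf_base)
  obtain K B0 where K: "K \<subseteq> L"
    and B0: "\<forall>r\<in>R. \<forall>r'\<in>R. (\<Sum>k\<in>K. A (fst b) (snd b) r k * B0 k r') = (if r = r' then 1 else 0)"
    "\<forall>k\<in>K. \<forall>k'\<in>K. (\<Sum>r\<in>R. B0 k r * A (fst b) (snd b) r k') = (if k = k' then 1 else 0)"
    using invertible_minor[OF finR finL p.A_surj] by (elim exE conjE) (rule that; assumption)
  have finK: "finite K" using K finL finite_subset by blast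
  have bU: "b \<in> UI \<times> UP" using ch bG by (simp add: mem_Times_iff)
  have "card R = card K \<and> (\<exists>W Inv. W \<in> opens Base \<and> b \<in> W \<and> W \<subseteq> UI \<times> UP \<and> (\<forall>k\<in>K. \<forall>r\<in>R. Inv k r \<in> regular Base W) \<and>
    (\<forall>x\<in>W. (\<forall>r\<in>R. \<forall>r'\<in>R. (\<Sum>k\<in>K. A (fst x) (snd x) r k * Inv k r' x) = (if r = r' then 1 else 0)) \<and>
       (\<forall>k\<in>K. \<forall>k'\<in>K. (\<Sum>r\<in>R. Inv k r x * A (fst x) (snd x) r k') = (if k = k' then 1 else 0))))"
    by (rule B.local_inverse[OF finR finK UIP_open bU, where ?B0.0 = B0]) (use A_regular K B0 in auto)
  then obtain W Inv where W: "card R = card K" "W \<in> opens Base" "b \<in> W" "W \<subseteq> UI \<times> UP" "\<forall>k\<in>K. \<forall>r\<in>R. Inv k r \<in> regular Base W"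
    "\<forall>x\<in>W. (\<forall>r\<in>R. \<forall>r'\<in>R. (\<Sum>k\<in>K. A (fst x) (snd x) r k * Inv k r' x) = (if r = r' then 1 else 0)) \<and>
       (\<forall>k\<in>K. \<forall>k'\<in>K. (\<Sum>r\<in>R. Inv k r x * A (fst x) (snd x) r k') = (if k = k' then 1 else 0))"
    by (elim exE conjE) (rule that; assumption)
  have "chart_minor Q P I f \<rho>I \<rho>P m c cs K W Inv"
    by (rule chart_minor.intro[OF cd chart_minor_axioms.intro]) (use K W in auto)
  then show ?thesis using W(3)
    by - (rule exI[of _ \<rho>I], rule exI[of _ \<rho>P], rule exI[of _ m], rule exI[of _ c], rule exI[of _ cs],
      rule exI[of _ K], rule exI[of _ W], rule exI[of _ Inv], rule conjI)
qed

lemma zeta_morphism: "morphism Strat Base (zeta Q P I)"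
proof (rule space_with_functions.morphism_local[OF swf_stratum])
  fix N assume "N \<in> points Strat"
  then have N: "N \<in> S" by (simp add: points_stratum)
  note z = zeta_stratum[OF N]
  show "zeta Q P I N \<in> points Base" unfolding points_base zeta_def using z by simp
  obtain \<rho>I \<rho>P m c cs where cd: "chart_data Q P I f \<rho>I \<rho>P m c cs"
    and ch: "inter_I Q P I N \<in> IB.chart \<rho>I" "proj_P Q N \<in> PB.chart \<rho>P"
    using chart_exists[OF z] by (elim exE conjE) (rule that; assumption)
  interpret chart_data Q P I f \<rho>I \<rho>P m c cs by (rule cd)
  show "\<exists>U\<in>opens Strat. N \<in> U \<and> morphism (induced Strat U) Base (zeta Q P I)"
    by (rule bexI[OF _ Strat_chart_open], rule conjI[OF _ zeta_morphism_chart]) (use N ch S_chart_iff[OF N] in auto)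
qed

end

context chart_minor
begin

abbreviation "Triv \<equiv> product (induced Base W) (affine_space n)"

lemma W_points: "W \<subseteq> points Base" using space_with_functions.opens_subset[OF swf_base W_open] .
lemma variety_W: "variety (induced Base W)" by (rule variety.variety_induced[OF variety_base W_points])
lemma two_Triv: "two_varieties (induced Base W) (affine_space n)"
  by (rule two_varieties.intro[OF variety_W variety_affine_space])
lemma swf_Triv: "space_with_functions Triv"
  using two_varieties.variety_product[OF two_Triv] by (simp add: variety_def)

lemma Triv_base: "morphism Triv Base fst"
  using morphism_compose[OF two_varieties.morphism_fst[OF two_Triv] space_with_functions.morphism_inclusion[OF swf_base W_points]] .

lemma solution_regular:
  assumes x: "x \<in> L"
  shows "(\<lambda>z. solution (fst z) (snd z) x) \<in> regular Triv (points Triv)"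
proof -
  interpret X: space_with_functions Triv by (rule swf_Triv)
  interpret Af: variety "affine_space n" by (rule variety_affine_space)
  have 1: "(\<lambda>z. Inv x r (fst z)) \<in> regular Triv (points Triv)" if "x \<in> K" "r \<in> R" for x r
    by (rule morphism_pullback[OF Triv_base W_open Inv[OF that]]) auto
  have 2: "(\<lambda>z. A (fst (fst z)) (snd (fst z)) r x) \<in> regular Triv (points Triv)" if "r \<in> R" "x \<in> L" for r x
    by (rule morphism_pullback[OF Triv_base UIP_open A_regular[OF that]]) (use W_sub in auto)
  have 3: "(\<lambda>z. snd z $ \<iota> x) \<in> regular Triv (points Triv)" if "x \<in> L - K" for x
  proof (rule morphism_pullback[OF two_varieties.morphism_snd[OF two_Triv] _ affine_space_coordinate[OF \<iota>_less[OF that]]])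
    show "carrier_vec n \<in> opens (affine_space n)" using Af.opens_points by simp
  qed auto
  show ?thesis
  proof (cases "x \<in> K")
    case True
    have "(\<lambda>z. - (\<Sum>r\<in>R. Inv x r (fst z) * (\<Sum>x'\<in>L - K. A (fst (fst z)) (snd (fst z)) r x' * snd z $ \<iota> x'))) \<in> regular Triv (points Triv)"
      by (intro X.regular_uminus X.regular_sum X.regular_mult X.opens_points 1 2 3 True) auto
    then show ?thesis using True by (simp add: solution_def)
  next
    case False
    then show ?thesis using 3[of x] x by (simp add: solution_def)
  qed
qed

lemma frame_over_regular:
  assumes i: "i \<in> verts Q" and k: "k < f i + nP i" and \<xi>: "lin_functional (direct_sum (space P i) (space I i)) \<xi>"
  shows "(\<lambda>z. \<xi> (frame_over (fst z) (solution (fst z) (snd z)) i k)) \<in> regular Triv (points Triv)"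
proof -
  interpret X: space_with_functions Triv by (rule swf_Triv)
  note fd = functional_direct_sum[OF PB.vs[OF i] IB.vs[OF i] \<xi>]
  show ?thesis
  proof (cases "k < f i")
    case True
    have "(\<lambda>z. \<xi> (\<zero>\<^bsub>space P i\<^esub>, IB.sec \<rho>I (fst (fst z)) i k)) \<in> regular Triv (points Triv)"
      by (rule morphism_pullback[OF Triv_base UIP_open secI_regular_Base[OF i True fd(2)]]) (use W_sub in auto)
    then show ?thesis using True i nE[OF i] by (simp add: frame_over_def)
  next
    case False
    define l where "l = k - f i"
    have l: "l < nP i" "k = f i + l" using k False unfolding l_def by auto
    have "(\<lambda>z. \<xi> (PB.sec \<rho>P (snd (fst z)) i l, \<zero>\<^bsub>space I i\<^esub>)) \<in> regular Triv (points Triv)"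
      by (rule morphism_pullback[OF Triv_base UIP_open secP_regular_Base[OF i l(1) fd(1)]]) (use W_sub in auto)
    moreover have "(\<lambda>z. \<Sum>j<m i. solution (fst z) (snd z) (i, l, j) * \<xi> (\<zero>\<^bsub>space P i\<^esub>, c i j)) \<in> regular Triv (points Triv)"
      by (intro X.regular_sum X.regular_mult X.regular_const X.opens_points solution_regular) (use i l in \<open>simp add: L_def\<close>)
    ultimately have "(\<lambda>z. \<xi> (PB.sec \<rho>P (snd (fst z)) i l, \<zero>\<^bsub>space I i\<^esub>) +
        (\<Sum>j<m i. solution (fst z) (snd z) (i, l, j) * \<xi> (\<zero>\<^bsub>space P i\<^esub>, c i j))) \<in> regular Triv (points Triv)"
      by (rule X.regular_add[OF X.opens_points])
    then show ?thesis
    proof (rule X.regular_cong[OF _ X.opens_points])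
      fix z assume "z \<in> points Triv"
      then have "fst z \<in> W" by auto
      from minor_point.frame_over_functional[OF minor_point[OF this] i l(1) \<xi>]
      show "\<xi> (frame_over (fst z) (solution (fst z) (snd z)) i k) = \<xi> (PB.sec \<rho>P (snd (fst z)) i l, \<zero>\<^bsub>space I i\<^esub>) +
        (\<Sum>j<m i. solution (fst z) (snd z) (i, l, j) * \<xi> (\<zero>\<^bsub>space P i\<^esub>, c i j))"
        unfolding prod.collapse l(2) .
    qed
  qed
qed

abbreviation "Over_W \<equiv> {N \<in> points Strat. zeta Q P I N \<in> W}"

lemma point_at_props:
  assumes "b \<in> W"
  shows "point_at (b, v) \<in> S" "zeta Q P I (point_at (b, v)) = b" "v \<in> carrier_vec n \<Longrightarrow> fibre_coords (point_at (b, v)) = v"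
    "N \<in> S \<Longrightarrow> zeta Q P I N = b \<Longrightarrow> point_at (b, fibre_coords N) = N" "frame_over b Z \<in> EB.Fr"
  using minor_point.point_at_stratum[OF minor_point[OF assms]] minor_point.fibre_coords_point_at[OF minor_point[OF assms]]
    minor_point.point_at_fibre_coords[OF minor_point[OF assms]] minor_point.frame_over_frame[OF minor_point[OF assms]]
  by auto

lemma point_at_morphism: "morphism Triv (induced Strat Over_W) point_at"
proof (rule space_with_functions.morphism_into_induced[OF swf_Triv])
  have z: "fst z \<in> W" "z = (fst z, snd z)" if "z \<in> points Triv" for z using that by auto
  have S: "point_at z \<in> S" "zeta Q P I (point_at z) \<in> W" if "z \<in> points Triv" for z
    using point_at_props(1,2)[OF z(1)[OF that], of "snd z"] z(1)[OF that] by simp_all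
  show "point_at z \<in> Over_W" if "z \<in> points Triv" for z using S[OF that] by (simp add: points_stratum)
  show "morphism Triv Strat point_at"
    unfolding stratum_def
  proof (rule space_with_functions.morphism_into_induced[OF swf_Triv])
    show "point_at z \<in> S" if "z \<in> points Triv" for z by (rule S(1)[OF that])
    show "morphism Triv (quiver_Gr Q (dimvec P) (direct_sum_rep P I)) point_at"
    proof (rule EB.morphism_into_quiver_Gr[OF swf_Triv, where s = "\<lambda>z. frame_over (fst z) (solution (fst z) (snd z))"])
      show "frame_over (fst z) (solution (fst z) (snd z)) \<in> EB.Fr" if "z \<in> points Triv" for z
        by (rule point_at_props(5)[OF z(1)[OF that]])
      show "point_at z = EB.sp (frame_over (fst z) (solution (fst z) (snd z)))" for z by (rule point_at_def)
      show "point_at z \<in> EB.Gp" if "z \<in> points Triv" for z using S(1)[OF that] S_Gp by blast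
      show "(\<lambda>z. \<xi> (frame_over (fst z) (solution (fst z) (snd z)) i k)) \<in> regular Triv (points Triv)"
        if "i \<in> verts Q" "k < nat (dimvec P i)" "lin_functional (space (direct_sum_rep P I) i) \<xi>" for i k \<xi>
        by (rule frame_over_regular[OF that(1)]) (use that nE[OF that(1)] in auto)
    qed
  qed
qed

lemma Over_W_open: "Over_W \<in> opens Strat"
  by (rule morphismD(2)[OF zeta_morphism W_open])

lemma Over_W_Strat_chart: "Over_W \<subseteq> Strat_chart"
  using W_sub S_chart_iff by (auto simp: points_stratum zeta_def)

lemma trivialisation_morphism: "morphism (induced Strat Over_W) Triv (\<lambda>N. (zeta Q P I N, fibre_coords N))"
proof -
  interpret E: space_with_functions Strat by (rule swf_stratum)
  have sub: "Over_W \<subseteq> points Strat" by blast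
  interpret C: space_with_functions "induced Strat Over_W" by (rule E.space_with_functions_induced[OF sub])
  have 1: "morphism (induced Strat Over_W) (induced Base W) (zeta Q P I)"
    by (rule C.morphism_into_induced[OF morphism_compose[OF E.morphism_inclusion[OF sub] zeta_morphism]]) simp
  have 2: "morphism (induced Strat Over_W) (affine_space n) fibre_coords"
  proof (rule morphism_into_affine[OF C.space_with_functions_axioms])
    show "fibre_coords N \<in> carrier_vec n" for N by (simp add: fibre_coords_def)
    fix k assume k: "k < n"
    obtain i l j where x: "\<kappa> k = (i, l, j)" by (cases "\<kappa> k")
    then have i: "i \<in> verts Q" "l < nP i" "j < m i" using \<kappa>L[OF k] by (auto simp: L_def)
    have "(\<lambda>N. cs i j (snd (EB.sec \<rho>E N i (f i + l)))) \<in> regular Strat Strat_chart"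
      by (rule sec_regular_Strat[OF i(1) _ functional_snd[OF cs[OF i(1,3)]]]) (use i in simp)
    from E.regular_induced[OF Over_W_open E.regular_restrict[OF this Strat_chart_open Over_W_open Over_W_Strat_chart], of Over_W]
    show "(\<lambda>N. fibre_coords N $ k) \<in> regular (induced Strat Over_W) (points (induced Strat Over_W))"
      using k x by (simp add: fibre_coords_def)
  qed
  show ?thesis by (rule morphism_into_product[OF C.space_with_functions_axioms variety_W variety_affine_space 1 2])
qed

lemma trivialisation: "isomorphism (induced Strat Over_W) Triv (\<lambda>N. (zeta Q P I N, fibre_coords N))"
proof (rule isomorphismI[OF swf_Triv trivialisation_morphism point_at_morphism])
  show "point_at (zeta Q P I N, fibre_coords N) = N" if "N \<in> points (induced Strat Over_W)" for N
    using that point_at_props(4)[of "zeta Q P I N" N] by (simp add: points_stratum)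
  show "(zeta Q P I (point_at z), fibre_coords (point_at z)) = z" if "z \<in> points Triv" for z
    using that point_at_props(2,3)[of "fst z" "snd z"] by auto
qed

end

section \<open>The vector bundle\<close>

context stratum_setup
begin

lemma zeta_surj: "zeta Q P I ` points Strat = points Base"
proof (intro equalityI subsetI)
  fix b assume "b \<in> zeta Q P I ` points Strat"
  then show "b \<in> points Base" using morphismD(1)[OF zeta_morphism] by blast
next
  fix b assume b: "b \<in> points Base"
  obtain \<rho>I \<rho>P m c cs K W Inv where cm: "chart_minor Q P I f \<rho>I \<rho>P m c cs K W Inv" and bW: "b \<in> W"
    using minor_exists[OF b] by (elim exE conjE) (rule that; assumption)
  interpret chart_minor Q P I f \<rho>I \<rho>P m c cs K W Inv by (rule cm)
  show "b \<in> zeta Q P I ` points Strat"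
    using point_at_props(1,2)[OF bW] points_stratum by (intro image_eqI[where x = "point_at (b, undefined)"]) auto
qed

lemma zeta_bundle: "vector_bundle Strat Base (zeta Q P I) fibre"
  unfolding vector_bundle_def
proof (intro conjI ballI zeta_morphism)
  fix b assume b: "b \<in> points Base"
  obtain \<rho>I \<rho>P m c cs K W Inv where cm: "chart_minor Q P I f \<rho>I \<rho>P m c cs K W Inv" and bW: "b \<in> W"
    using minor_exists[OF b] by (elim exE conjE) (rule that; assumption)
  interpret chart_minor Q P I f \<rho>I \<rho>P m c cs K W Inv by (rule cm)
  interpret mp: minor_point Q P I f \<rho>I \<rho>P m c cs K W Inv "fst b" "snd b" by (rule minor_point[OF bW])
  show "vectorspace CC (fibre b)" using mp.fibre_transport(1) by (simp add: cvs_def)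
  show "carrier (fibre b) = {N \<in> points Strat. zeta Q P I N = b}" using mp.fibre_simps(1) by (simp add: points_stratum)
  have lin: "linear_map CC (fibre u) (module_vec TYPE(complex) n) fibre_coords" if "u \<in> W" for u
    using minor_point.fibre_coords_linear[OF minor_point[OF that]] by simp
  show "\<exists>U\<in>opens Base. b \<in> U \<and> (\<exists>n h. isomorphism (induced Strat {x \<in> points Strat. zeta Q P I x \<in> U})
          (product (induced Base U) (affine_space n)) h \<and>
        (\<forall>x\<in>points Strat. zeta Q P I x \<in> U \<longrightarrow> fst (h x) = zeta Q P I x) \<and>
        (\<forall>u\<in>U. linear_map CC (fibre u) (module_vec TYPE(complex) n) (snd \<circ> h)))"
    by (rule bexI[OF _ W_open], rule conjI[OF bW], rule exI[of _ n], rule exI[of _ "\<lambda>N. (zeta Q P I N, fibre_coords N)"], intro conjI trivialisation)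
      (use lin in \<open>simp_all add: comp_def\<close>)
qed

lemma fibre_Hom:
  assumes b: "NI \<in> points Gr_I" "NP \<in> points Gr_P"
  shows "\<exists>T. linear_iso (fibre (NI, NP)) (Hom_Q Q (sub_rep P NP) (quotient_rep Q I NI)) T"
    "vectorspace.fin_dim CC (Hom_Q Q (sub_rep P NP) (quotient_rep Q I NI))"
    "int (vectorspace.dim CC (Hom_Q Q (sub_rep P NP) (quotient_rep Q I NI))) =
       euler_form Q (\<lambda>i. dimvec P i - int (f i)) (\<lambda>i. dimvec I i - int (f i))"
proof -
  have "(NI, NP) \<in> points Base" using b by simp
  from minor_exists[OF this] obtain \<rho>I \<rho>P m c cs K W Inv where cm: "chart_minor Q P I f \<rho>I \<rho>P m c cs K W Inv" and bW: "(NI, NP) \<in> W"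
    by (elim exE conjE) (rule that; assumption)
  interpret chart_minor Q P I f \<rho>I \<rho>P m c cs K W Inv by (rule cm)
  interpret mp: minor_point Q P I f \<rho>I \<rho>P m c cs K W Inv NI NP using minor_point[OF bW] by simp
  show "\<exists>T. linear_iso (fibre (NI, NP)) (Hom_Q Q (sub_rep P NP) (quotient_rep Q I NI)) T"
    using mp.fibre_iso by (rule exI[where x = "inv_into (carrier mp.H) (graph_rep Q NP)"])
  show "vectorspace.fin_dim CC (Hom_Q Q (sub_rep P NP) (quotient_rep Q I NI))" by (rule mp.H_dim(1))
  show "int (vectorspace.dim CC (Hom_Q Q (sub_rep P NP) (quotient_rep Q I NI))) =
       euler_form Q (\<lambda>i. dimvec P i - int (f i)) (\<lambda>i. dimvec I i - int (f i))"
    unfolding mp.H_dim(2) by (rule mp.euler_n)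
qed

end

lemma dynkin_finite:
  assumes "dynkin_quiver Q"
  shows "wf_digraph Q" "finite (verts Q)" "finite (arcs Q)"
proof -
  obtain n E g where E: "wf_digraph Q" "dynkin_diagram n E" "bij_betw g (verts Q) {..<n}"
    "bij_betw (\<lambda>a. {g (tail Q a), g (head Q a)}) (arcs Q) E"
    using assms unfolding dynkin_quiver_def by (elim exE conjE) (rule that; assumption)
  show "wf_digraph Q" by (rule E(1))
  show "finite (verts Q)" using bij_betw_finite[OF E(3)] by simp
  have "finite (path_edges k)" for k
  proof (rule finite_subset)
    show "path_edges k \<subseteq> (\<lambda>j. {j, Suc j}) ` {..<k}" by (auto simp: path_edges_def)
  qed simp
  then have "finite E" using E(2) by (auto simp: dynkin_diagram_def)
  then show "finite (arcs Q)" using bij_betw_finite[OF E(4)] by simp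
qed

theorem theorem1p2:
  fixes Q :: "('i, 'a) pre_digraph"
    and P :: "('i, 'a, 'p) rep" and I :: "('i, 'a, 'q) rep"
    and f :: "'i \<Rightarrow> nat"
  defines "d \<equiv> \<lambda>i. int (f i)"
  assumes "dynkin_quiver Q"
    and "projective_rep Q P"
    and "injective_rep Q I"
  shows "zeta Q P I ` points (stratum Q P I d) =
           points (quiver_Gr Q d I) \<times> points (quiver_Gr Q (\<lambda>i. dimvec P i - d i) P) \<and>
    (\<exists>V. vector_bundle (stratum Q P I d)
           (product (quiver_Gr Q d I) (quiver_Gr Q (\<lambda>i. dimvec P i - d i) P))
           (zeta Q P I) V \<and>
      (\<forall>N\<^sub>I\<in>points (quiver_Gr Q d I). \<forall>N\<^sub>P\<in>points (quiver_Gr Q (\<lambda>i. dimvec P i - d i) P).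
         (\<exists>T. linear_iso (V (N\<^sub>I, N\<^sub>P)) (Hom_Q Q (sub_rep P N\<^sub>P) (quotient_rep Q I N\<^sub>I)) T))) \<and>
    (\<forall>N\<^sub>I\<in>points (quiver_Gr Q d I). \<forall>N\<^sub>P\<in>points (quiver_Gr Q (\<lambda>i. dimvec P i - d i) P).
       vectorspace.fin_dim CC (Hom_Q Q (sub_rep P N\<^sub>P) (quotient_rep Q I N\<^sub>I)) \<and>
       int (vectorspace.dim CC (Hom_Q Q (sub_rep P N\<^sub>P) (quotient_rep Q I N\<^sub>I))) =
         euler_form Q (\<lambda>i. dimvec P i - d i) (\<lambda>i. dimvec I i - d i))"
proof -
  note Q = dynkin_finite[OF assms(2)]
  have P: "representation Q P" and I: "representation Q I"
    using assms(3,4) unfolding projective_rep_def injective_rep_def by auto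
  interpret stratum_setup Q P I f
    by (rule stratum_setup.intro[OF Q(2,3,1) P I projective_extension_splits[OF Q(1) assms(3) I]])
  show ?thesis
    unfolding d_def
    by (intro conjI exI[of _ fibre] ballI zeta_bundle fibre_Hom) (use zeta_surj in simp_all)
qed

end
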